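(* Let $q\in(-1,1)\setminus\{0\}$, let $\theta\in(0,1)$ be irrational, and let $\mathbb{G}_q^\theta=SU_q(2)\rtimes_{\rho_\theta}\mathbb{Z}$ be the crossed product compact quantum group. Then the discrete quantum group $\widehat{\mathbb{G}_q^\theta}$ is $C^*$-unique and not locally finite.
   Context: $\mathrm{Pol}(SU_q(2))$ is the unital $^*$-algebra generated by $\alpha,\gamma$ subject to $$\gamma^*\gamma=\gamma\gamma^*,\quad q\gamma^*\alpha=\alpha\gamma^*,\quad q\gamma\alpha=\alpha\gamma,\quad \alpha^*\alpha+\gamma^*\gamma=1,\quad \alpha\alpha^*+q^2\gamma\gamma^*=1,$$ with comultiplication $\Delta(\alpha)=\alpha\otimes\alpha-q\gamma^*\otimes\gamma$, $\Delta(\gamma)=\gamma\otimes\alpha+\alpha^*\otimes\gamma$. The formulas $\rho_\theta(\alpha)=\alpha$, $\rho_\theta(\gamma)=e^{2\pi i\theta}\gamma$ define a Hopf $^*$-automorphism of $\mathrm{Pol}(SU_q(2))$. $\mathrm{Pol}(\mathbb{G}_q^\theta)$ is the algebraic crossed product $\mathrm{Pol}(SU_q(2))\rtimes_{\rho_\theta}\mathbb{Z}$, i.e. the $^*$-algebra generated by $\mathrm{Pol}(SU_q(2))$ and a unitary $u_\theta$ subject to $u_\theta^*\gamma u_\theta=e^{2\pi i\theta}\gamma$ and $u_\theta^*\alpha u_\theta=\alpha$; the coproduct extends that of $\mathrm{Pol}(SU_q(2))$ by $\Delta(u_\theta)=u_\theta\otimes u_\theta$. This is the Hopf $^*$-algebra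 of a compact quantum group $\mathbb{G}_q^\theta$, and $\mathbb{C}[\widehat{\mathbb{G}_q^\theta}]=\mathrm{Pol}(\mathbb{G}_q^\theta)$. A pre-$C^*$-norm on a unital $^*$-algebra is a norm such that the completion is a $C^*$-algebra. A discrete quantum group $\mathbb{\Gamma}=\widehat{\mathbb{G}}$ (dual of a compact quantum group $\mathbb{G}$, with $\mathbb{C}[\mathbb{\Gamma}]=\mathrm{Pol}(\mathbb{G})$) is called $C^*$-unique if $\mathbb{C}[\mathbb{\Gamma}]$ has a unique pre-$C^*$-norm. It is called locally finite if each finite subset $I$ of the set $\mathrm{Irr}(\mathbb{G})$ of equivalence classes of irreducible unitary representations of $\mathbb{G}$ generates a finite fusion ring inside $\mathrm{Irr}(\mathbb{G})$, i.e. the smallest subset of $\mathrm{Irr}(\mathbb{G})$ containing $I$ and the trivial representation and closed under conjugation and under taking irreducible subrepresentations of tensor products is finite. *)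

theory Defs
  imports
    Complex_Main
    "HOL-Library.Poly_Mapping"
    "HOL-Algebra.QuotRing"
    "HOL-Algebra.Module"
    "Jordan_Normal_Form.Matrix"
begin

section \<open>Unital *-algebras over the complex numbers\<close>

record 'a star_algebra = "(complex, 'a) module" +
  star :: "'a \<Rightarrow> 'a" (\<open>_\<^sup>\<star>\<index>\<close> [1000] 999)

definition complex_ring :: "complex ring" where
  "complex_ring = \<lparr>carrier = UNIV, monoid.mult = (*), one = 1, zero = 0, add = (+)\<rparr>"

text \<open>The locale \<open>algebra\<close> of \<open>HOL-Algebra.Module\<close> is commutative, hence not usable here.\<close>

locale star_algebra = ring A + module complex_ring A for A (structure) +
  assumes smult_mult_left: "x \<in> carrier A \<Longrightarrow> y \<in> carrier A \<Longrightarrow> (c \<odot> x) \<otimes> y = c \<odot> (x \<otimes> y)"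
    and smult_mult_right: "x \<in> carrier A \<Longrightarrow> y \<in> carrier A \<Longrightarrow> x \<otimes> (c \<odot> y) = c \<odot> (x \<otimes> y)"
    and star_closed: "x \<in> carrier A \<Longrightarrow> x\<^sup>\<star> \<in> carrier A"
    and star_star: "x \<in> carrier A \<Longrightarrow> (x\<^sup>\<star>)\<^sup>\<star> = x"
    and star_add: "x \<in> carrier A \<Longrightarrow> y \<in> carrier A \<Longrightarrow> (x \<oplus> y)\<^sup>\<star> = x\<^sup>\<star> \<oplus> y\<^sup>\<star>"
    and star_smult: "x \<in> carrier A \<Longrightarrow> (c \<odot> x)\<^sup>\<star> = cnj c \<odot> x\<^sup>\<star>"
    and star_mult: "x \<in> carrier A \<Longrightarrow> y \<in> carrier A \<Longrightarrow> (x \<otimes> y)\<^sup>\<star> = y\<^sup>\<star> \<otimes> x\<^sup>\<star>"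

definition star_ideal_gen :: "('a, 'x) star_algebra_scheme \<Rightarrow> 'a set \<Rightarrow> 'a set" where
  "star_ideal_gen A R = \<Inter>{I. ideal I A \<and> (\<forall>x\<in>I. x\<^sup>\<star>\<^bsub>A\<^esub> \<in> I) \<and> R \<subseteq> I}"

definition star_quotient ::
    "('a, 'x) star_algebra_scheme \<Rightarrow> 'a set \<Rightarrow> 'a set star_algebra" where
  "star_quotient A I =
    \<lparr>carrier = carrier (A Quot I), monoid.mult = monoid.mult (A Quot I), one = one (A Quot I),
     zero = zero (A Quot I), add = add (A Quot I),
     smult = (\<lambda>c X. \<Union>x\<in>X. I +>\<^bsub>A\<^esub> (c \<odot>\<^bsub>A\<^esub> x)),
     star = (\<lambda>X. \<Union>x\<in>X. I +>\<^bsub>A\<^esub> x\<^sup>\<star>\<^bsub>A\<^esub>)\<rparr>"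

text \<open>The *-algebra of a monoid \<open>M\<close> with an involutive anti-automorphism \<open>\<iota>\<close>: finite formal
  linear combinations of elements of \<open>M\<close>.\<close>

definition monoid_algebra ::
    "('m, 'x) monoid_scheme \<Rightarrow> ('m \<Rightarrow> 'm) \<Rightarrow> ('m \<Rightarrow>\<^sub>0 complex) star_algebra" where
  "monoid_algebra M \<iota> =
    \<lparr>carrier = {p. Poly_Mapping.keys p \<subseteq> carrier M},
     monoid.mult = (\<lambda>p r. \<Sum>a\<in>Poly_Mapping.keys p. \<Sum>b\<in>Poly_Mapping.keys r.
        Poly_Mapping.single (a \<otimes>\<^bsub>M\<^esub> b) (Poly_Mapping.lookup p a * Poly_Mapping.lookup r b)),
     one = Poly_Mapping.single \<one>\<^bsub>M\<^esub> 1,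
     zero = 0,
     add = (+),
     smult = (\<lambda>c. Poly_Mapping.map ((*) c)),
     star = (\<lambda>p. \<Sum>a\<in>Poly_Mapping.keys p.
        Poly_Mapping.single (\<iota> a) (cnj (Poly_Mapping.lookup p a)))\<rparr>"

section \<open>*-algebras given by generators and relations\<close>

text \<open>The letter \<open>(g, False)\<close> stands for the generator \<open>g\<close>, the letter \<open>(g, True)\<close> for its
  adjoint.\<close>

type_synonym 'g word = "('g \<times> bool) list"

definition free_star_algebra :: "('g word \<Rightarrow>\<^sub>0 complex) star_algebra" where
  "free_star_algebra = monoid_algebra \<lparr>carrier = UNIV, monoid.mult = (@), one = []\<rparr>
     (\<lambda>w. rev (map (\<lambda>(g, s). (g, \<not> s)) w))"

definition free_gen :: "'g \<Rightarrow> ('g word \<Rightarrow>\<^sub>0 complex)" where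
  "free_gen g = Poly_Mapping.single [(g, False)] 1"

definition presented_star_algebra ::
    "('g word \<Rightarrow>\<^sub>0 complex) set \<Rightarrow> ('g word \<Rightarrow>\<^sub>0 complex) set star_algebra" where
  "presented_star_algebra R = star_quotient free_star_algebra (star_ideal_gen free_star_algebra R)"

definition presented_gen ::
    "('g word \<Rightarrow>\<^sub>0 complex) set \<Rightarrow> 'g \<Rightarrow> ('g word \<Rightarrow>\<^sub>0 complex) set" where
  "presented_gen R g = star_ideal_gen free_star_algebra R +>\<^bsub>free_star_algebra\<^esub> free_gen g"

text \<open>The unital *-homomorphism from the free *-algebra to \<open>B\<close> with \<open>g \<mapsto> f g\<close>, and the map it
  induces on the *-algebra presented by \<open>R\<close> (well defined if it kills \<open>R\<close>).\<close>

definition word_eval :: "('b, 'x) star_algebra_scheme \<Rightarrow> ('g \<Rightarrow> 'b) \<Rightarrow> 'g word \<Rightarrow> 'b" where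
  "word_eval B f w =
     foldr (\<lambda>(g, s) b. (if s then (f g)\<^sup>\<star>\<^bsub>B\<^esub> else f g) \<otimes>\<^bsub>B\<^esub> b) w \<one>\<^bsub>B\<^esub>"

definition free_eval ::
    "('b, 'x) star_algebra_scheme \<Rightarrow> ('g \<Rightarrow> 'b) \<Rightarrow> ('g word \<Rightarrow>\<^sub>0 complex) \<Rightarrow> 'b" where
  "free_eval B f p =
     (\<Oplus>\<^bsub>B\<^esub>w\<in>Poly_Mapping.keys p. Poly_Mapping.lookup p w \<odot>\<^bsub>B\<^esub> word_eval B f w)"

definition presented_eval ::
    "('b, 'x) star_algebra_scheme \<Rightarrow> ('g \<Rightarrow> 'b) \<Rightarrow> ('g word \<Rightarrow>\<^sub>0 complex) set \<Rightarrow> 'b" where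
  "presented_eval B f X = the_elem (free_eval B f ` X)"

section \<open>Algebraic tensor products\<close>

text \<open>Formal linear combinations of pairs modulo bilinearity. The linear span of
  \<open>bilinear_relators\<close> is already a *-ideal of the *-algebra of formal combinations of pairs,
  so it coincides with the *-ideal generated by them.\<close>

abbreviation pair_algebra ::
    "('a, 'x) star_algebra_scheme \<Rightarrow> ('b, 'y) star_algebra_scheme \<Rightarrow>
     (('a \<times> 'b) \<Rightarrow>\<^sub>0 complex) star_algebra" where
  "pair_algebra A B \<equiv> monoid_algebra (A \<times>\<times> B) (map_prod (star A) (star B))"

definition bilinear_relators ::
    "('a, 'x) star_algebra_scheme \<Rightarrow> ('b, 'y) star_algebra_scheme \<Rightarrow>
     (('a \<times> 'b) \<Rightarrow>\<^sub>0 complex) set" where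
  "bilinear_relators A B =
     {Poly_Mapping.single (a \<oplus>\<^bsub>A\<^esub> a', b) 1 - Poly_Mapping.single (a, b) 1
        - Poly_Mapping.single (a', b) 1 | a a' b. a \<in> carrier A \<and> a' \<in> carrier A \<and> b \<in> carrier B} \<union>
     {Poly_Mapping.single (a, b \<oplus>\<^bsub>B\<^esub> b') 1 - Poly_Mapping.single (a, b) 1
        - Poly_Mapping.single (a, b') 1 | a b b'. a \<in> carrier A \<and> b \<in> carrier B \<and> b' \<in> carrier B} \<union>
     {Poly_Mapping.single (c \<odot>\<^bsub>A\<^esub> a, b) 1 - Poly_Mapping.single (a, b) c
        | a b c. a \<in> carrier A \<and> b \<in> carrier B} \<union>
     {Poly_Mapping.single (a, c \<odot>\<^bsub>B\<^esub> b) 1 - Poly_Mapping.single (a, b) c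
        | a b c. a \<in> carrier A \<and> b \<in> carrier B}"

definition tensor_null ::
    "('a, 'x) star_algebra_scheme \<Rightarrow> ('b, 'y) star_algebra_scheme \<Rightarrow>
     (('a \<times> 'b) \<Rightarrow>\<^sub>0 complex) set" where
  "tensor_null A B = star_ideal_gen (pair_algebra A B) (bilinear_relators A B)"

definition tensor_algebra ::
    "('a, 'x) star_algebra_scheme \<Rightarrow> ('b, 'y) star_algebra_scheme \<Rightarrow>
     (('a \<times> 'b) \<Rightarrow>\<^sub>0 complex) set star_algebra" where
  "tensor_algebra A B = star_quotient (pair_algebra A B) (tensor_null A B)"

definition pure_tensor ::
    "('a, 'x) star_algebra_scheme \<Rightarrow> ('b, 'y) star_algebra_scheme \<Rightarrow> 'a \<Rightarrow> 'b \<Rightarrow>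
     (('a \<times> 'b) \<Rightarrow>\<^sub>0 complex) set" where
  "pure_tensor A B a b = tensor_null A B +>\<^bsub>pair_algebra A B\<^esub> Poly_Mapping.single (a, b) 1"

section \<open>C*-norms\<close>

definition algebra_norm :: "('a, 'x) star_algebra_scheme \<Rightarrow> ('a \<Rightarrow> real) \<Rightarrow> bool" where
  "algebra_norm A N \<longleftrightarrow>
     (\<forall>x\<in>carrier A. 0 \<le> N x \<and> (N x = 0 \<longleftrightarrow> x = \<zero>\<^bsub>A\<^esub>)) \<and>
     (\<forall>c. \<forall>x\<in>carrier A. N (c \<odot>\<^bsub>A\<^esub> x) = cmod c * N x) \<and>
     (\<forall>x\<in>carrier A. \<forall>y\<in>carrier A. N (x \<oplus>\<^bsub>A\<^esub> y) \<le> N x + N y)"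

definition cauchy_seqs :: "('a, 'x) star_algebra_scheme \<Rightarrow> ('a \<Rightarrow> real) \<Rightarrow> (nat \<Rightarrow> 'a) set" where
  "cauchy_seqs A N =
     {s. range s \<subseteq> carrier A \<and>
         (\<forall>e>0. \<exists>n0. \<forall>m\<ge>n0. \<forall>n\<ge>n0. N (s m \<ominus>\<^bsub>A\<^esub> s n) < e)}"

definition c_star_algebra :: "('a, 'x) star_algebra_scheme \<Rightarrow> ('a \<Rightarrow> real) \<Rightarrow> bool" where
  "c_star_algebra A N \<longleftrightarrow>
     star_algebra A \<and> algebra_norm A N \<and>
     (\<forall>x\<in>carrier A. \<forall>y\<in>carrier A. N (x \<otimes>\<^bsub>A\<^esub> y) \<le> N x * N y) \<and>
     (\<forall>x\<in>carrier A. N (x\<^sup>\<star>\<^bsub>A\<^esub> \<otimes>\<^bsub>A\<^esub> x) = (N x)\<^sup>2) \<and>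
     (\<forall>s\<in>cauchy_seqs A N. \<exists>x\<in>carrier A. (\<lambda>n. N (s n \<ominus>\<^bsub>A\<^esub> x)) \<longlonglongrightarrow> 0)"

definition cauchy_equiv ::
    "('a, 'x) star_algebra_scheme \<Rightarrow> ('a \<Rightarrow> real) \<Rightarrow> ((nat \<Rightarrow> 'a) \<times> (nat \<Rightarrow> 'a)) set" where
  "cauchy_equiv A N =
     {(s, t). s \<in> cauchy_seqs A N \<and> t \<in> cauchy_seqs A N \<and>
              (\<lambda>n. N (s n \<ominus>\<^bsub>A\<^esub> t n)) \<longlonglongrightarrow> 0}"

text \<open>The completion, with all operations defined termwise on representing sequences. If these
  operations do not pass to the completion, its carrier is not closed under them or they disagree
  with those of \<open>A\<close>, and it is not a C*-algebra.\<close>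

definition completion ::
    "('a, 'x) star_algebra_scheme \<Rightarrow> ('a \<Rightarrow> real) \<Rightarrow> (nat \<Rightarrow> 'a) set star_algebra" where
  "completion A N =
    \<lparr>carrier = cauchy_seqs A N // cauchy_equiv A N,
     monoid.mult = (\<lambda>X Y. \<Union>s\<in>X. \<Union>t\<in>Y. cauchy_equiv A N `` {\<lambda>n. s n \<otimes>\<^bsub>A\<^esub> t n}),
     one = cauchy_equiv A N `` {\<lambda>n. \<one>\<^bsub>A\<^esub>},
     zero = cauchy_equiv A N `` {\<lambda>n. \<zero>\<^bsub>A\<^esub>},
     add = (\<lambda>X Y. \<Union>s\<in>X. \<Union>t\<in>Y. cauchy_equiv A N `` {\<lambda>n. s n \<oplus>\<^bsub>A\<^esub> t n}),
     smult = (\<lambda>c X. \<Union>s\<in>X. cauchy_equiv A N `` {\<lambda>n. c \<odot>\<^bsub>A\<^esub> s n}),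
     star = (\<lambda>X. \<Union>s\<in>X. cauchy_equiv A N `` {\<lambda>n. (s n)\<^sup>\<star>\<^bsub>A\<^esub>})\<rparr>"

definition completion_norm :: "('a \<Rightarrow> real) \<Rightarrow> (nat \<Rightarrow> 'a) set \<Rightarrow> real" where
  "completion_norm N X = the_elem ((\<lambda>s. lim (\<lambda>n. N (s n))) ` X)"

definition pre_c_star_norm :: "('a, 'x) star_algebra_scheme \<Rightarrow> ('a \<Rightarrow> real) \<Rightarrow> bool" where
  "pre_c_star_norm A N \<longleftrightarrow>
     algebra_norm A N \<and> c_star_algebra (completion A N) (completion_norm N)"

section \<open>Compact quantum groups and their discrete duals\<close>

text \<open>A compact quantum group \<open>\<G>\<close> is represented by the Hopf *-algebra \<open>Pol(\<G>)\<close>, its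
  discrete dual by the same data, since \<open>\<complex>[\<Gamma>] = Pol(\<G>)\<close>. Counit and antipode are determined by the
  comultiplication and are not recorded.\<close>

record 'a quantum_group = "'a star_algebra" +
  comult :: "'a \<Rightarrow> (('a \<times> 'a) \<Rightarrow>\<^sub>0 complex) set"

definition c_star_unique :: "('a, 'x) quantum_group_scheme \<Rightarrow> bool" where
  "c_star_unique G \<longleftrightarrow>
     (\<exists>N. pre_c_star_norm G N \<and>
          (\<forall>N'. pre_c_star_norm G N' \<longrightarrow> (\<forall>x\<in>carrier G. N' x = N x)))"

subsection \<open>Finite-dimensional representations\<close>

text \<open>An \<open>n\<close>-dimensional representation is an \<open>n \<times> n\<close> matrix over \<open>Pol(\<G>)\<close>.\<close>

definition unitary_rep :: "('a, 'x) quantum_group_scheme \<Rightarrow> 'a mat \<Rightarrow> bool" where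
  "unitary_rep G U \<longleftrightarrow>
     (\<exists>n>0. U \<in> carrier_mat n n \<and> (\<forall>i<n. \<forall>j<n.
        U $$ (i, j) \<in> carrier G \<and>
        comult G (U $$ (i, j)) =
          (\<Oplus>\<^bsub>tensor_algebra G G\<^esub>k\<in>{..<n}. pure_tensor G G (U $$ (i, k)) (U $$ (k, j))) \<and>
        (\<Oplus>\<^bsub>G\<^esub>k\<in>{..<n}. U $$ (i, k) \<otimes>\<^bsub>G\<^esub> (U $$ (j, k))\<^sup>\<star>\<^bsub>G\<^esub>)
          = (if i = j then \<one>\<^bsub>G\<^esub> else \<zero>\<^bsub>G\<^esub>) \<and>
        (\<Oplus>\<^bsub>G\<^esub>k\<in>{..<n}. (U $$ (k, i))\<^sup>\<star>\<^bsub>G\<^esub> \<otimes>\<^bsub>G\<^esub> U $$ (k, j))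
          = (if i = j then \<one>\<^bsub>G\<^esub> else \<zero>\<^bsub>G\<^esub>)))"

text \<open>Intertwiners: scalar matrices \<open>T\<close> with \<open>T U = V T\<close>.\<close>

definition intertwiners ::
    "('a, 'x) quantum_group_scheme \<Rightarrow> 'a mat \<Rightarrow> 'a mat \<Rightarrow> complex mat set" where
  "intertwiners G U V =
     {T \<in> carrier_mat (dim_row V) (dim_row U). \<forall>i<dim_row V. \<forall>j<dim_row U.
        (\<Oplus>\<^bsub>G\<^esub>k\<in>{..<dim_row U}. T $$ (i, k) \<odot>\<^bsub>G\<^esub> U $$ (k, j)) =
        (\<Oplus>\<^bsub>G\<^esub>k\<in>{..<dim_row V}. T $$ (k, j) \<odot>\<^bsub>G\<^esub> V $$ (i, k))}"

definition rep_equiv :: "('a, 'x) quantum_group_scheme \<Rightarrow> 'a mat \<Rightarrow> 'a mat \<Rightarrow> bool" where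
  "rep_equiv G U V \<longleftrightarrow> (\<exists>T\<in>intertwiners G U V. invertible_mat T)"

definition subrep :: "('a, 'x) quantum_group_scheme \<Rightarrow> 'a mat \<Rightarrow> 'a mat \<Rightarrow> bool" where
  "subrep G V U \<longleftrightarrow>
     (\<exists>T\<in>intertwiners G V U. transpose_mat (map_mat cnj T) * T = 1\<^sub>m (dim_row V))"

definition irreducible_rep :: "('a, 'x) quantum_group_scheme \<Rightarrow> 'a mat \<Rightarrow> bool" where
  "irreducible_rep G U \<longleftrightarrow>
     unitary_rep G U \<and> (\<forall>V. unitary_rep G V \<and> subrep G V U \<longrightarrow> dim_row V = dim_row U)"

definition trivial_rep :: "('a, 'x) quantum_group_scheme \<Rightarrow> 'a mat" where
  "trivial_rep G = mat 1 1 (\<lambda>_. \<one>\<^bsub>G\<^esub>)"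

text \<open>The entrywise adjoint need not be unitary, but is equivalent to a unitary representation.\<close>

definition conj_rep :: "('a, 'x) quantum_group_scheme \<Rightarrow> 'a mat \<Rightarrow> 'a mat" where
  "conj_rep G U = map_mat (star G) U"

definition tensor_rep :: "('a, 'x) quantum_group_scheme \<Rightarrow> 'a mat \<Rightarrow> 'a mat \<Rightarrow> 'a mat" where
  "tensor_rep G U V =
     mat (dim_row U * dim_row V) (dim_row U * dim_row V)
       (\<lambda>(i, j). U $$ (i div dim_row V, j div dim_row V) \<otimes>\<^bsub>G\<^esub>
                 V $$ (i mod dim_row V, j mod dim_row V))"

subsection \<open>Local finiteness\<close>

definition irr_equiv :: "('a, 'x) quantum_group_scheme \<Rightarrow> ('a mat \<times> 'a mat) set" where
  "irr_equiv G = {(U, V). irreducible_rep G U \<and> irreducible_rep G V \<and> rep_equiv G U V}"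

definition Irr :: "('a, 'x) quantum_group_scheme \<Rightarrow> 'a mat set set" where
  "Irr G = {U. irreducible_rep G U} // irr_equiv G"

definition fusion_closed :: "('a, 'x) quantum_group_scheme \<Rightarrow> 'a mat set set \<Rightarrow> bool" where
  "fusion_closed G S \<longleftrightarrow>
     irr_equiv G `` {trivial_rep G} \<in> S \<and>
     (\<forall>x\<in>S. \<forall>U\<in>x. \<forall>V. irreducible_rep G V \<and> rep_equiv G V (conj_rep G U) \<longrightarrow>
        irr_equiv G `` {V} \<in> S) \<and>
     (\<forall>x\<in>S. \<forall>y\<in>S. \<forall>U\<in>x. \<forall>V\<in>y. \<forall>W. irreducible_rep G W \<and> subrep G W (tensor_rep G U V) \<longrightarrow>
        irr_equiv G `` {W} \<in> S)"

definition fusion_generated ::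
    "('a, 'x) quantum_group_scheme \<Rightarrow> 'a mat set set \<Rightarrow> 'a mat set set" where
  "fusion_generated G I = \<Inter>{S. S \<subseteq> Irr G \<and> I \<subseteq> S \<and> fusion_closed G S}"

definition locally_finite :: "('a, 'x) quantum_group_scheme \<Rightarrow> bool" where
  "locally_finite G \<longleftrightarrow> (\<forall>I. I \<subseteq> Irr G \<and> finite I \<longrightarrow> finite (fusion_generated G I))"

section \<open>The crossed product of $SU_q(2)$ by an irrational rotation\<close>

datatype generator = Alpha | Gamma | Unitary

definition suq2_relators :: "real \<Rightarrow> (generator word \<Rightarrow>\<^sub>0 complex) set" where
  "suq2_relators q =
    (let F = free_star_algebra; \<alpha> = free_gen Alpha; \<gamma> = free_gen Gamma; q' = complex_of_real q in
     {\<gamma>\<^sup>\<star>\<^bsub>F\<^esub> \<otimes>\<^bsub>F\<^esub> \<gamma> \<ominus>\<^bsub>F\<^esub> \<gamma> \<otimes>\<^bsub>F\<^esub> \<gamma>\<^sup>\<star>\<^bsub>F\<^esub>,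
      q' \<odot>\<^bsub>F\<^esub> (\<gamma>\<^sup>\<star>\<^bsub>F\<^esub> \<otimes>\<^bsub>F\<^esub> \<alpha>) \<ominus>\<^bsub>F\<^esub> \<alpha> \<otimes>\<^bsub>F\<^esub> \<gamma>\<^sup>\<star>\<^bsub>F\<^esub>,
      q' \<odot>\<^bsub>F\<^esub> (\<gamma> \<otimes>\<^bsub>F\<^esub> \<alpha>) \<ominus>\<^bsub>F\<^esub> \<alpha> \<otimes>\<^bsub>F\<^esub> \<gamma>,
      (\<alpha>\<^sup>\<star>\<^bsub>F\<^esub> \<otimes>\<^bsub>F\<^esub> \<alpha> \<oplus>\<^bsub>F\<^esub> \<gamma>\<^sup>\<star>\<^bsub>F\<^esub> \<otimes>\<^bsub>F\<^esub> \<gamma>) \<ominus>\<^bsub>F\<^esub> \<one>\<^bsub>F\<^esub>,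
      (\<alpha> \<otimes>\<^bsub>F\<^esub> \<alpha>\<^sup>\<star>\<^bsub>F\<^esub> \<oplus>\<^bsub>F\<^esub> (q'\<^sup>2) \<odot>\<^bsub>F\<^esub> (\<gamma> \<otimes>\<^bsub>F\<^esub> \<gamma>\<^sup>\<star>\<^bsub>F\<^esub>)) \<ominus>\<^bsub>F\<^esub> \<one>\<^bsub>F\<^esub>})"

definition rotation_relators :: "real \<Rightarrow> (generator word \<Rightarrow>\<^sub>0 complex) set" where
  "rotation_relators \<theta> =
    (let F = free_star_algebra; \<alpha> = free_gen Alpha; \<gamma> = free_gen Gamma; u = free_gen Unitary in
     {u\<^sup>\<star>\<^bsub>F\<^esub> \<otimes>\<^bsub>F\<^esub> u \<ominus>\<^bsub>F\<^esub> \<one>\<^bsub>F\<^esub>,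
      u \<otimes>\<^bsub>F\<^esub> u\<^sup>\<star>\<^bsub>F\<^esub> \<ominus>\<^bsub>F\<^esub> \<one>\<^bsub>F\<^esub>,
      u\<^sup>\<star>\<^bsub>F\<^esub> \<otimes>\<^bsub>F\<^esub> \<gamma> \<otimes>\<^bsub>F\<^esub> u \<ominus>\<^bsub>F\<^esub> exp (2 * pi * \<i> * \<theta>) \<odot>\<^bsub>F\<^esub> \<gamma>,
      u\<^sup>\<star>\<^bsub>F\<^esub> \<otimes>\<^bsub>F\<^esub> \<alpha> \<otimes>\<^bsub>F\<^esub> u \<ominus>\<^bsub>F\<^esub> \<alpha>})"

definition crossed_relators :: "real \<Rightarrow> real \<Rightarrow> (generator word \<Rightarrow>\<^sub>0 complex) set" where
  "crossed_relators q \<theta> = suq2_relators q \<union> rotation_relators \<theta>"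

definition comult_gen :: "real \<Rightarrow> real \<Rightarrow> generator \<Rightarrow>
    (((generator word \<Rightarrow>\<^sub>0 complex) set \<times> (generator word \<Rightarrow>\<^sub>0 complex) set) \<Rightarrow>\<^sub>0 complex) set" where
  "comult_gen q \<theta> g =
    (let A = presented_star_algebra (crossed_relators q \<theta>);
         \<alpha> = presented_gen (crossed_relators q \<theta>) Alpha;
         \<gamma> = presented_gen (crossed_relators q \<theta>) Gamma;
         u = presented_gen (crossed_relators q \<theta>) Unitary;
         T = tensor_algebra A A
     in case g of
       Alpha \<Rightarrow> pure_tensor A A \<alpha> \<alpha> \<ominus>\<^bsub>T\<^esub> complex_of_real q \<odot>\<^bsub>T\<^esub> pure_tensor A A (\<gamma>\<^sup>\<star>\<^bsub>A\<^esub>) \<gamma>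
     | Gamma \<Rightarrow> pure_tensor A A \<gamma> \<alpha> \<oplus>\<^bsub>T\<^esub> pure_tensor A A (\<alpha>\<^sup>\<star>\<^bsub>A\<^esub>) \<gamma>
     | Unitary \<Rightarrow> pure_tensor A A u u)"

definition SUq2_crossed ::
    "real \<Rightarrow> real \<Rightarrow> (generator word \<Rightarrow>\<^sub>0 complex) set quantum_group" where
  "SUq2_crossed q \<theta> =
    (let A = presented_star_algebra (crossed_relators q \<theta>) in
     star_algebra.extend A
       (quantum_group.fields (presented_eval (tensor_algebra A A) (comult_gen q \<theta>))))"

end

theory Submission
  imports Defs "HOL-Analysis.L2_Norm" "HOL-Computational_Algebra.Polynomial"
begin

text \<open>
  Let \<open>A\<close> be the crossed product, \<open>c = \<gamma>*\<gamma>\<close>, \<open>Q = q\<^sup>2\<close> and \<open>\<lambda> = exp(2\<pi>i\<theta>)\<close>.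

  Conceptually, uniqueness of the C*-norm holds because the reduced completion of \<open>A\<close> contains, as an
  essential ideal, the compact operators tensored with the irrational rotation algebra, which is
  simple: a quotient of the completion by a nonzero ideal kills \<open>\<gamma>\<close>, and \<open>A\<close> does not embed into it.
  The proof below extracts from this picture two estimates that need neither ideals nor simplicity,
  only the C*-identity.

  The completion of \<open>A\<close> in a norm is a C*-algebra iff the norm is submultiplicative and satisfies the
  C*-identity (\<open>pre_c_star_norm_iff\<close>), so completions disappear. The algebra acts by
  weighted shifts on finitely supported functions on \<open>\<nat> \<times> \<int> \<times> \<int>\<close> (\<open>suq2_rep\<close>). The normally
  ordered monomials \<open>\<alpha>\<^sup>k \<gamma>\<^sup>l \<gamma>*\<^sup>m u\<^sup>n\<close> with \<open>k, n \<in> \<int>\<close>, negative powers being powers of the adjoint, span \<open>A\<close>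
  (\<open>nf_exhaust\<close>) and act by linearly independent operators (\<open>ev_faithful\<close>). Hence \<open>A\<close> is an algebra of
  bounded operators, and the operator norm is a C*-norm (\<open>opnorm_S\<close>).

  Let \<open>N\<close> be an arbitrary C*-norm. If \<open>y\<close> is self-adjoint, then \<open>N(y\<^sup>n) = N(y)\<^sup>n\<close> for \<open>n = 2\<^sup>k\<close>, while the
  degree of \<open>y\<^sup>n\<close> grows linearly in \<open>n\<close>. Two C*-norms therefore agree once each is dominated by the
  other up to a factor that is polynomial in the degree (\<open>power_growth_le\<close>, \<open>cstar_norm_le\<close>). The
  bridge between two such norms is the largest matrix coefficient of the operator:

  \<^item> Up to a constant, \<open>N\<close> dominates every matrix coefficient (\<open>coeff_bound\<close>). The powers of \<open>c\<close> converge to the projection onto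
    the eigenspace of the largest eigenvalue, on which \<open>\<gamma>\<close> and \<open>u\<close> generate a rotation
    algebra. Averaging over conjugation by words in \<open>u\<close> and \<open>\<gamma>\<close> leaves only the trace of that algebra, since
    the averages of \<open>1, z, z\<^sup>2, \<dots>\<close> tend to \<open>0\<close> if \<open>z = \<lambda>\<^sup>n\<close> with \<open>n \<noteq> 0\<close>. This is the one
    place where irrationality of \<open>\<theta>\<close> enters (\<open>vacuum_limit_mon\<close>).

  \<^item> \<open>N\<close> is at most a polynomial in the degree times the largest matrix coefficient (\<open>upper_bound\<close>). An element of
    degree \<open>D\<close> has at most \<open>(2D+1)\<^sup>3\<close> homogeneous components for the grading by \<open>\<int>\<^sup>3\<close>. For a
    homogeneous \<open>y\<close>, the element \<open>y*y\<close> is a polynomial in \<open>c\<close> (\<open>mon_gram\<close>) whose values at the eigenvalues \<open>Q\<^sup>j\<close>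
    are squared moduli of matrix coefficients of \<open>y\<close>. Lagrange interpolation at these points bounds its norm,
    because the Lagrange basis polynomials in \<open>c\<close> factor through powers of \<open>\<alpha>\<close> and have
    uniformly bounded norm (\<open>lagrange_factor\<close>, \<open>lagrange_bound\<close>).

  The dual is not locally finite because \<open>u\<close> is a one-dimensional unitary representation whose powers are
  pairwise inequivalent. That \<open>u\<close> is group-like requires the comultiplication to be well defined on
  the presented algebra, i.e. to respect the defining relations (\<open>comult_relations\<close>).
\<close>

section \<open>Complex *-algebras and *-homomorphisms\<close>

lemma cring_complex_ring: "cring complex_ring"
proof (rule cringI)
  show "abelian_group complex_ring"
    by (rule abelian_groupI) (auto simp: complex_ring_def algebra_simps intro: exI[of _ "- x" for x])
  show "comm_monoid complex_ring"
    by (rule comm_monoidI) (auto simp: complex_ring_def)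
qed (auto simp: complex_ring_def algebra_simps)

lemma star_algebraI:
  fixes A (structure)
  assumes "ring A"
    and "\<And>c x. x \<in> carrier A \<Longrightarrow> c \<odot> x \<in> carrier A"
    and "\<And>c d x. x \<in> carrier A \<Longrightarrow> (c + d) \<odot> x = c \<odot> x \<oplus> d \<odot> x"
    and "\<And>c x y. x \<in> carrier A \<Longrightarrow> y \<in> carrier A \<Longrightarrow> c \<odot> (x \<oplus> y) = c \<odot> x \<oplus> c \<odot> y"
    and "\<And>c d x. x \<in> carrier A \<Longrightarrow> (c * d) \<odot> x = c \<odot> (d \<odot> x)"
    and "\<And>x. x \<in> carrier A \<Longrightarrow> 1 \<odot> x = x"
    and "\<And>c x y. x \<in> carrier A \<Longrightarrow> y \<in> carrier A \<Longrightarrow> (c \<odot> x) \<otimes> y = c \<odot> (x \<otimes> y)"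
    and "\<And>c x y. x \<in> carrier A \<Longrightarrow> y \<in> carrier A \<Longrightarrow> x \<otimes> (c \<odot> y) = c \<odot> (x \<otimes> y)"
    and "\<And>x. x \<in> carrier A \<Longrightarrow> x\<^sup>\<star> \<in> carrier A"
    and "\<And>x. x \<in> carrier A \<Longrightarrow> (x\<^sup>\<star>)\<^sup>\<star> = x"
    and "\<And>x y. x \<in> carrier A \<Longrightarrow> y \<in> carrier A \<Longrightarrow> (x \<oplus> y)\<^sup>\<star> = x\<^sup>\<star> \<oplus> y\<^sup>\<star>"
    and "\<And>c x. x \<in> carrier A \<Longrightarrow> (c \<odot> x)\<^sup>\<star> = cnj c \<odot> x\<^sup>\<star>"
    and "\<And>x y. x \<in> carrier A \<Longrightarrow> y \<in> carrier A \<Longrightarrow> (x \<otimes> y)\<^sup>\<star> = y\<^sup>\<star> \<otimes> x\<^sup>\<star>"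
  shows "star_algebra A"
proof -
  interpret ring A by fact
  have "module complex_ring A"
    by (rule moduleI[OF cring_complex_ring])
      (use assms in \<open>auto simp: complex_ring_def intro: abelian_group_axioms\<close>)
  with assms show ?thesis
    by (auto intro!: star_algebra.intro star_algebra_axioms.intro)
qed

text \<open>The locale \<open>star_algebra\<close> takes its scalars from the record \<open>complex_ring\<close>, so its module axioms speak
  of the record operations. The variant below has the same models and uses the arithmetic of \<open>complex\<close>
  itself, which is what the simplifier can compute with.\<close>

locale complex_star_algebra = ring A for A (structure) +
  assumes scale_closed [simp, intro]: "x \<in> carrier A \<Longrightarrow> c \<odot> x \<in> carrier A"
    and scale_add_left: "x \<in> carrier A \<Longrightarrow> (c + d) \<odot> x = c \<odot> x \<oplus> d \<odot> x"
    and scale_add_right: "x \<in> carrier A \<Longrightarrow> y \<in> carrier A \<Longrightarrow> c \<odot> (x \<oplus> y) = c \<odot> x \<oplus> c \<odot> y"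
    and scale_scale: "x \<in> carrier A \<Longrightarrow> c \<odot> (d \<odot> x) = (c * d) \<odot> x"
    and scale_one [simp]: "x \<in> carrier A \<Longrightarrow> 1 \<odot> x = x"
    and smult_mult_left: "x \<in> carrier A \<Longrightarrow> y \<in> carrier A \<Longrightarrow> (c \<odot> x) \<otimes> y = c \<odot> (x \<otimes> y)"
    and smult_mult_right: "x \<in> carrier A \<Longrightarrow> y \<in> carrier A \<Longrightarrow> x \<otimes> (c \<odot> y) = c \<odot> (x \<otimes> y)"
    and star_closed [simp, intro]: "x \<in> carrier A \<Longrightarrow> x\<^sup>\<star> \<in> carrier A"
    and star_star [simp]: "x \<in> carrier A \<Longrightarrow> (x\<^sup>\<star>)\<^sup>\<star> = x"
    and star_add: "x \<in> carrier A \<Longrightarrow> y \<in> carrier A \<Longrightarrow> (x \<oplus> y)\<^sup>\<star> = x\<^sup>\<star> \<oplus> y\<^sup>\<star>"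
    and star_smult: "x \<in> carrier A \<Longrightarrow> (c \<odot> x)\<^sup>\<star> = cnj c \<odot> x\<^sup>\<star>"
    and star_mult: "x \<in> carrier A \<Longrightarrow> y \<in> carrier A \<Longrightarrow> (x \<otimes> y)\<^sup>\<star> = y\<^sup>\<star> \<otimes> x\<^sup>\<star>"

lemma star_algebra_iff: "star_algebra A \<longleftrightarrow> complex_star_algebra A"
proof
  assume "star_algebra A"
  then interpret star_algebra A .
  note [simp] = complex_ring_def
  show "complex_star_algebra A"
    apply (rule complex_star_algebra.intro[OF star_algebra.axioms(1)[OF \<open>star_algebra A\<close>]])
    apply unfold_locales
    using smult_closed smult_l_distr smult_r_distr smult_assoc1 smult_one smult_mult_left smult_mult_right
      star_closed star_star star_add star_smult star_mult
    by auto
next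
  assume "complex_star_algebra A"
  then interpret complex_star_algebra A .
  show "star_algebra A"
    by (rule star_algebraI[OF ring_axioms])
      (simp_all add: scale_add_left scale_add_right scale_scale smult_mult_left smult_mult_right
        star_add star_smult star_mult)
qed

context complex_star_algebra
begin

lemma scale_zero_left [simp]: "x \<in> carrier A \<Longrightarrow> 0 \<odot> x = \<zero>"
proof -
  assume x: "x \<in> carrier A"
  have "0 \<odot> x \<oplus> 0 \<odot> x = 0 \<odot> x" using scale_add_left[OF x, of 0 0] by simp
  thus ?thesis using x by (simp add: add.l_cancel_one')
qed

lemma scale_zero_right [simp]: "c \<odot> \<zero> = \<zero>"
  using scale_scale[of \<zero> c 0] by simp

lemma scale_minus_one: "x \<in> carrier A \<Longrightarrow> (-1) \<odot> x = \<ominus> x"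
proof -
  assume x: "x \<in> carrier A"
  have "(-1) \<odot> x \<oplus> x = \<zero>"
    using scale_add_left[OF x, of "-1" 1] x by simp
  thus ?thesis using x minus_equality[of "(-1) \<odot> x"] by simp
qed

lemma minus_eq_scale: "x \<in> carrier A \<Longrightarrow> y \<in> carrier A \<Longrightarrow> x \<ominus> y = x \<oplus> (-1) \<odot> y"
  by (simp add: scale_minus_one a_minus_def)

lemma star_one [simp]: "\<one>\<^sup>\<star> = \<one>"
proof -
  have "\<one>\<^sup>\<star> = \<one>\<^sup>\<star> \<otimes> (\<one>\<^sup>\<star>)\<^sup>\<star>" by (simp add: star_star)
  also have "\<dots> = (\<one>\<^sup>\<star> \<otimes> \<one>)\<^sup>\<star>" by (subst star_mult) (auto simp: star_star)
  also have "\<dots> = \<one>" by (simp add: star_star)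
  finally show ?thesis .
qed

lemma star_zero [simp]: "\<zero>\<^sup>\<star> = \<zero>"
  using star_smult[of \<zero> 0] by simp

lemma star_minus: "x \<in> carrier A \<Longrightarrow> y \<in> carrier A \<Longrightarrow> (x \<ominus> y)\<^sup>\<star> = x\<^sup>\<star> \<ominus> y\<^sup>\<star>"
  by (simp add: minus_eq_scale star_add star_smult)

lemma scale_minus: "x \<in> carrier A \<Longrightarrow> y \<in> carrier A \<Longrightarrow> c \<odot> (x \<ominus> y) = c \<odot> x \<ominus> c \<odot> y"
  by (simp add: minus_eq_scale scale_add_right scale_scale)

lemma scale_via_one: "x \<in> carrier A \<Longrightarrow> c \<odot> x = (c \<odot> \<one>) \<otimes> x"
  using smult_mult_left[of \<one> x c] by simp

end

lemma UN_const_eq: "a \<in> X \<Longrightarrow> (\<And>x. x \<in> X \<Longrightarrow> g x = c) \<Longrightarrow> (\<Union>x\<in>X. g x) = c"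
  by auto

definition star_hom ::
    "('a, 'x) star_algebra_scheme \<Rightarrow> ('b, 'y) star_algebra_scheme \<Rightarrow> ('a \<Rightarrow> 'b) \<Rightarrow> bool" where
  "star_hom A B \<phi> \<longleftrightarrow>
     (\<forall>x\<in>carrier A. \<phi> x \<in> carrier B) \<and> \<phi> \<one>\<^bsub>A\<^esub> = \<one>\<^bsub>B\<^esub> \<and>
     (\<forall>x\<in>carrier A. \<forall>y\<in>carrier A. \<phi> (x \<otimes>\<^bsub>A\<^esub> y) = \<phi> x \<otimes>\<^bsub>B\<^esub> \<phi> y) \<and>
     (\<forall>x\<in>carrier A. \<forall>y\<in>carrier A. \<phi> (x \<oplus>\<^bsub>A\<^esub> y) = \<phi> x \<oplus>\<^bsub>B\<^esub> \<phi> y) \<and>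
     (\<forall>c. \<forall>x\<in>carrier A. \<phi> (c \<odot>\<^bsub>A\<^esub> x) = c \<odot>\<^bsub>B\<^esub> \<phi> x) \<and>
     (\<forall>x\<in>carrier A. \<phi> (x\<^sup>\<star>\<^bsub>A\<^esub>) = (\<phi> x)\<^sup>\<star>\<^bsub>B\<^esub>)"

lemma star_homD:
  assumes "star_hom A B \<phi>"
  shows "x \<in> carrier A \<Longrightarrow> \<phi> x \<in> carrier B" "\<phi> \<one>\<^bsub>A\<^esub> = \<one>\<^bsub>B\<^esub>"
    "x \<in> carrier A \<Longrightarrow> y \<in> carrier A \<Longrightarrow> \<phi> (x \<otimes>\<^bsub>A\<^esub> y) = \<phi> x \<otimes>\<^bsub>B\<^esub> \<phi> y"
    "x \<in> carrier A \<Longrightarrow> y \<in> carrier A \<Longrightarrow> \<phi> (x \<oplus>\<^bsub>A\<^esub> y) = \<phi> x \<oplus>\<^bsub>B\<^esub> \<phi> y"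
    "x \<in> carrier A \<Longrightarrow> \<phi> (c \<odot>\<^bsub>A\<^esub> x) = c \<odot>\<^bsub>B\<^esub> \<phi> x"
    "x \<in> carrier A \<Longrightarrow> \<phi> (x\<^sup>\<star>\<^bsub>A\<^esub>) = (\<phi> x)\<^sup>\<star>\<^bsub>B\<^esub>"
  using assms unfolding star_hom_def by auto

text \<open>All axioms except closure are equations or supply negatives, and both pass to images under
  maps that respect the operations. Thus a quotient or a completion is a *-algebra as soon as the map to classes is known to
  respect the operations, and no axiom has to be checked on classes.\<close>

lemma star_algebra_image:
  assumes A: "star_algebra A" and h: "star_hom A B \<phi>" and z: "\<phi> \<zero>\<^bsub>A\<^esub> = \<zero>\<^bsub>B\<^esub>"
    and surj: "carrier B \<subseteq> \<phi> ` carrier A"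
  shows "star_algebra B"
proof -
  interpret A: complex_star_algebra A using \<open>star_algebra A\<close> by (simp add: star_algebra_iff)
  note h1 = star_homD[OF h]
  have ex: "\<exists>a\<in>carrier A. b = \<phi> a" if "b \<in> carrier B" for b using surj that by auto
  have pre: P if "b \<in> carrier B" "\<And>a. a \<in> carrier A \<Longrightarrow> b = \<phi> a \<Longrightarrow> P" for b P using ex that by blast
  note pull = h1(1) h1(2-6)[symmetric] z[symmetric]
  have ring: "ring B"
  proof (rule ringI)
    show "abelian_group B"
    proof (rule abelian_groupI)
      fix x assume "x \<in> carrier B"
      then obtain a where a: "a \<in> carrier A" "x = \<phi> a" using ex by blast
      show "\<exists>y\<in>carrier B. y \<oplus>\<^bsub>B\<^esub> x = \<zero>\<^bsub>B\<^esub>"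
        by (rule bexI[of _ "\<phi> (\<ominus>\<^bsub>A\<^esub> a)"]) (use a in \<open>simp_all add: pull A.l_neg\<close>)
    qed (auto elim!: pre simp: pull A.a_ac)
    show "monoid B"
      by (rule monoidI) (auto elim!: pre simp: pull A.m_assoc)
  qed (auto elim!: pre simp: pull A.l_distr A.r_distr)
  show ?thesis
    by (rule star_algebraI[OF ring])
      (auto elim!: pre simp: pull A.scale_add_left A.scale_add_right A.scale_scale A.smult_mult_left
        A.smult_mult_right A.star_add A.star_smult A.star_mult)
qed

lemma star_hom_zero:
  assumes "star_algebra A" "star_algebra B" "star_hom A B \<phi>"
  shows "\<phi> \<zero>\<^bsub>A\<^esub> = \<zero>\<^bsub>B\<^esub>"
proof -
  interpret A: complex_star_algebra A using \<open>star_algebra A\<close> by (simp add: star_algebra_iff)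
  interpret B: complex_star_algebra B using \<open>star_algebra B\<close> by (simp add: star_algebra_iff)
  show ?thesis using star_homD(5)[OF assms(3) A.zero_closed, of 0] star_homD(1)[OF assms(3) A.zero_closed] by simp
qed

lemma star_hom_minus:
  assumes "star_algebra A" "star_algebra B" "star_hom A B \<phi>" "x \<in> carrier A" "y \<in> carrier A"
  shows "\<phi> (x \<ominus>\<^bsub>A\<^esub> y) = \<phi> x \<ominus>\<^bsub>B\<^esub> \<phi> y"
proof -
  interpret A: complex_star_algebra A using \<open>star_algebra A\<close> by (simp add: star_algebra_iff)
  interpret B: complex_star_algebra B using \<open>star_algebra B\<close> by (simp add: star_algebra_iff)
  show ?thesis using star_homD[OF assms(3)] assms(4,5)
    by (simp add: A.minus_eq_scale B.minus_eq_scale)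
qed

section \<open>Quotients\<close>

definition star_ideal :: "'a set \<Rightarrow> ('a, 'x) star_algebra_scheme \<Rightarrow> bool" where
  "star_ideal I A \<longleftrightarrow> ideal I A \<and> (\<forall>x\<in>I. x\<^sup>\<star>\<^bsub>A\<^esub> \<in> I)"

context complex_star_algebra
begin

lemma star_ideal_gen:
  assumes "R \<subseteq> carrier A"
  shows "star_ideal (star_ideal_gen A R) A" "R \<subseteq> star_ideal_gen A R"
proof -
  have "ideal (star_ideal_gen A R) A"
    unfolding star_ideal_gen_def
    by (rule i_Intersect) (use assms oneideal in \<open>auto intro!: exI[of _ "carrier A"]\<close>)
  thus "star_ideal (star_ideal_gen A R) A" "R \<subseteq> star_ideal_gen A R"
    by (auto simp: star_ideal_def star_ideal_gen_def)
qed

lemma coset_eq_iff: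
  assumes "ideal I A" "x \<in> carrier A" "y \<in> carrier A"
  shows "I +> x = I +> y \<longleftrightarrow> x \<ominus> y \<in> I"
  using quotient_eq_iff_same_a_r_cos[OF assms] by blast

text \<open>The operations of the quotient are unions over all members of a coset, and the point is that
  these unions are constant. For the scalar action it matters that multiplication by \<open>s\<close> is
  multiplication by the element \<open>s\<close> times the unit, hence preserves ideals.\<close>

lemma star_quotient_hom:
  assumes I: "star_ideal I A"
  shows "star_hom A (star_quotient A I) (\<lambda>x. I +> x)"
proof -
  have id: "ideal I A" using I by (simp add: star_ideal_def)
  interpret ideal I A by fact
  have coset: "(\<Union>x\<in>I +> a. I +> f x) = I +> f a"
    if a: "a \<in> carrier A" and f: "\<And>x. x \<in> carrier A \<Longrightarrow> f x \<in> carrier A"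
      "\<And>x. x \<in> carrier A \<Longrightarrow> x \<ominus> a \<in> I \<Longrightarrow> f x \<ominus> f a \<in> I" for f a
  proof -
    have "I +> f x = I +> f a" if x: "x \<in> I +> a" for x
    proof -
      have xc: "x \<in> carrier A" using x a a_elemrcos_carrier by blast
      have "I +> x = I +> a" using a_repr_independence'[OF x a] by simp
      hence "x \<ominus> a \<in> I" using coset_eq_iff[OF id xc a] by simp
      thus ?thesis using coset_eq_iff[OF id] f xc a by simp
    qed
    thus ?thesis using UN_const_eq[OF a_rcos_self[OF a], of "\<lambda>x. I +> f x"] by simp
  qed
  show ?thesis
    unfolding star_hom_def star_quotient_def
  proof (simp, intro conjI ballI allI)
    fix x assume x: "x \<in> carrier A"
    show "I +> x \<in> carrier (A Quot I)"
      using x by (auto simp: FactRing_def A_RCOSETS_def')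
    show "I +> x\<^sup>\<star> = (\<Union>x\<in>I +> x. I +> x\<^sup>\<star>)"
      by (rule coset[OF x, symmetric]) (use I x in \<open>auto simp: star_minus[symmetric] star_ideal_def\<close>)
    fix y assume y: "y \<in> carrier A"
    show "I +> x \<otimes> y = (I +> x) \<otimes>\<^bsub>A Quot I\<^esub> (I +> y)"
      using x y by (simp add: FactRing_def rcoset_mult_add)
    show "I +> (x \<oplus> y) = (I +> x) \<oplus>\<^bsub>A Quot I\<^esub> (I +> y)"
      using x y by (simp add: FactRing_def a_rcos_sum)
  next
    fix c x assume x: "x \<in> carrier A"
    show "I +> c \<odot> x = (\<Union>x\<in>I +> x. I +> c \<odot> x)"
    proof (rule coset[OF x, symmetric])
      fix z assume z: "z \<in> carrier A" "z \<ominus> x \<in> I"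
      have "(c \<odot> \<one>) \<otimes> (z \<ominus> x) \<in> I" using z by (intro I_l_closed) auto
      thus "c \<odot> z \<ominus> c \<odot> x \<in> I"
        using z x by (simp add: scale_minus[symmetric] flip: scale_via_one)
    qed auto
  next
    show "I +> \<one> = \<one>\<^bsub>A Quot I\<^esub>" by (simp add: FactRing_def)
  qed
qed

lemma star_quotient_zero: "ideal I A \<Longrightarrow> I +> \<zero> = \<zero>\<^bsub>star_quotient A I\<^esub>"
  using a_coset_add_zero[OF additive_subgroup.a_subset[OF ideal.axioms(1)], of I]
  by (simp add: star_quotient_def FactRing_def)

lemma star_quotient_carrier: "carrier (star_quotient A I) = (\<lambda>x. I +> x) ` carrier A"
  by (auto simp: star_quotient_def FactRing_def A_RCOSETS_def')

lemma star_algebra_quotient: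
  assumes I: "star_ideal I A"
  shows "star_algebra (star_quotient A I)"
  by (rule star_algebra_image[OF _ star_quotient_hom[OF I]])
    (use I complex_star_algebra_axioms in \<open>simp_all add: star_algebra_iff star_quotient_zero star_quotient_carrier star_ideal_def\<close>)

end

text \<open>An ideal generated by relators is the least *-ideal containing them, so it is enough to know
  that kernels are *-ideals to see that a homomorphism killing the relators kills the ideal.\<close>

lemma star_ideal_kernel:
  assumes A: "star_algebra A" and B: "star_algebra B" and h: "star_hom A B \<phi>"
  shows "star_ideal {x \<in> carrier A. \<phi> x = \<zero>\<^bsub>B\<^esub>} A"
proof -
  interpret A: complex_star_algebra A using \<open>star_algebra A\<close> by (simp add: star_algebra_iff)
  interpret B: complex_star_algebra B using \<open>star_algebra B\<close> by (simp add: star_algebra_iff)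
  note h1 = star_homD[OF h] and hz = star_hom_zero[OF assms]
  have "ideal {x \<in> carrier A. \<phi> x = \<zero>\<^bsub>B\<^esub>} A"
  proof (rule idealI[OF A.ring_axioms])
    show "subgroup {x \<in> carrier A. \<phi> x = \<zero>\<^bsub>B\<^esub>} (add_monoid A)"
    proof (rule A.add.subgroupI)
      fix a assume "a \<in> {x \<in> carrier A. \<phi> x = \<zero>\<^bsub>B\<^esub>}"
      thus "\<ominus>\<^bsub>A\<^esub> a \<in> {x \<in> carrier A. \<phi> x = \<zero>\<^bsub>B\<^esub>}"
        using h1(5)[of a "-1"] by (auto simp: A.scale_minus_one)
    qed (use hz h1 in auto)
  qed (use h1 in auto)
  thus ?thesis using h1 by (auto simp: star_ideal_def)
qed

section \<open>Monoid algebras\<close>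

lemma poly_mapping_sum_singles: "p = (\<Sum>a\<in>Poly_Mapping.keys p. Poly_Mapping.single a (Poly_Mapping.lookup p a))"
  by (rule poly_mapping_eqI) (auto simp: lookup_sum lookup_single when_def in_keys_iff)

lemma keys_add_subset:
  "Poly_Mapping.keys f \<subseteq> C \<Longrightarrow> Poly_Mapping.keys g \<subseteq> C \<Longrightarrow> Poly_Mapping.keys (f + g) \<subseteq> C"
  using keys_add[of f g] by blast

text \<open>Identities between additive maps need to be checked on single terms only. The condition on the
  keys is carried along because the monoids below have proper carriers.\<close>

lemma poly_mapping_additive_induct [consumes 1, case_names zero single add]:
  assumes "Poly_Mapping.keys p \<subseteq> C" "P 0"
    and s: "\<And>a c. a \<in> C \<Longrightarrow> P (Poly_Mapping.single a c)"
    and a: "\<And>p q. Poly_Mapping.keys p \<subseteq> C \<Longrightarrow> Poly_Mapping.keys q \<subseteq> C \<Longrightarrow> P p \<Longrightarrow> P q \<Longrightarrow> P (p + q)"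
  shows "P (p :: 'a \<Rightarrow>\<^sub>0 'b::comm_monoid_add)"
proof -
  have "P (\<Sum>a\<in>X. Poly_Mapping.single a (f a)) \<and> Poly_Mapping.keys (\<Sum>a\<in>X. Poly_Mapping.single a (f a)) \<subseteq> C"
    if "finite X" "X \<subseteq> C" for X f using that
  proof (induction X)
    case (insert x X)
    have "Poly_Mapping.keys (Poly_Mapping.single x (f x)) \<subseteq> C" using insert by auto
    with insert s[of x "f x"] show ?case using a[of "Poly_Mapping.single x (f x)"]
      by (auto dest!: subsetD[OF keys_add])
  qed (use assms in auto)
  from this[OF finite_keys assms(1), of "Poly_Mapping.lookup p"] show ?thesis
    using poly_mapping_sum_singles[of p] by simp
qed

lemma lookup_map_times: "Poly_Mapping.lookup (Poly_Mapping.map ((*) c) p) a = c * Poly_Mapping.lookup p (a::'a)"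
  for c :: complex
  by (simp add: Poly_Mapping.map.rep_eq when_def)

lemma map_times_zero [simp]: "Poly_Mapping.map ((*) (c::complex)) 0 = 0"
  by (rule poly_mapping_eqI) (simp add: lookup_map_times)

text \<open>A monoid with an involutive anti-automorphism, as needed for its algebra to carry an involution. The
  instances are words, with reversal combined with exchange of generators and adjoints, and pairs of
  elements of two *-algebras.\<close>

locale star_monoid = monoid M for M (structure) +
  fixes \<iota>
  assumes inv_closed: "x \<in> carrier M \<Longrightarrow> \<iota> x \<in> carrier M"
    and inv_inv: "x \<in> carrier M \<Longrightarrow> \<iota> (\<iota> x) = x"
    and inv_mult: "x \<in> carrier M \<Longrightarrow> y \<in> carrier M \<Longrightarrow> \<iota> (x \<otimes> y) = \<iota> y \<otimes> \<iota> x"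
begin

abbreviation "MA \<equiv> monoid_algebra M \<iota>"

lemma MA_sel: "carrier MA = {p. Poly_Mapping.keys p \<subseteq> carrier M}"
  "\<one>\<^bsub>MA\<^esub> = Poly_Mapping.single \<one> 1" "\<zero>\<^bsub>MA\<^esub> = 0" "p \<oplus>\<^bsub>MA\<^esub> r = p + r"
  "c \<odot>\<^bsub>MA\<^esub> p = Poly_Mapping.map ((*) c) p"
  by (simp_all add: monoid_algebra_def)

text \<open>The product sums over the exact supports, which change under addition. Over a fixed
  finite superset of the supports, the summand is visibly bilinear.\<close>

lemma MA_mult_sup:
  assumes "finite X" "finite Y" "Poly_Mapping.keys p \<subseteq> X" "Poly_Mapping.keys r \<subseteq> Y"
  shows "p \<otimes>\<^bsub>MA\<^esub> r = (\<Sum>a\<in>X. \<Sum>b\<in>Y. Poly_Mapping.single (a \<otimes> b)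
            (Poly_Mapping.lookup p a * Poly_Mapping.lookup r b))"
proof -
  have "p \<otimes>\<^bsub>MA\<^esub> r = (\<Sum>a\<in>Poly_Mapping.keys p. \<Sum>b\<in>Poly_Mapping.keys r.
      Poly_Mapping.single (a \<otimes> b) (Poly_Mapping.lookup p a * Poly_Mapping.lookup r b))"
    by (simp add: monoid_algebra_def)
  also have "\<dots> = (\<Sum>a\<in>Poly_Mapping.keys p. \<Sum>b\<in>Y. Poly_Mapping.single (a \<otimes> b)
            (Poly_Mapping.lookup p a * Poly_Mapping.lookup r b))"
    by (intro sum.cong refl sum.mono_neutral_left) (use assms in \<open>auto simp: in_keys_iff\<close>)
  also have "\<dots> = (\<Sum>a\<in>X. \<Sum>b\<in>Y. Poly_Mapping.single (a \<otimes> b)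
            (Poly_Mapping.lookup p a * Poly_Mapping.lookup r b))"
    by (intro sum.mono_neutral_left) (use assms in \<open>auto simp: in_keys_iff\<close>)
  finally show ?thesis .
qed

lemma MA_star_sup:
  assumes "finite X" "Poly_Mapping.keys p \<subseteq> X"
  shows "p\<^sup>\<star>\<^bsub>MA\<^esub> = (\<Sum>a\<in>X. Poly_Mapping.single (\<iota> a) (cnj (Poly_Mapping.lookup p a)))"
  unfolding monoid_algebra_def
  by (simp, intro sum.mono_neutral_left) (use assms in \<open>auto simp: in_keys_iff\<close>)

lemma MA_mult_single:
  "Poly_Mapping.single a c \<otimes>\<^bsub>MA\<^esub> Poly_Mapping.single b d = Poly_Mapping.single (a \<otimes> b) (c * d)"
  by (subst MA_mult_sup[of "{a}" "{b}"]) auto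

lemma MA_star_single: "(Poly_Mapping.single a c)\<^sup>\<star>\<^bsub>MA\<^esub> = Poly_Mapping.single (\<iota> a) (cnj c)"
  by (subst MA_star_sup[of "{a}"]) auto

lemma MA_distr_left: "(p + p') \<otimes>\<^bsub>MA\<^esub> r = p \<otimes>\<^bsub>MA\<^esub> r + p' \<otimes>\<^bsub>MA\<^esub> r"
proof -
  let ?X = "Poly_Mapping.keys p \<union> Poly_Mapping.keys p'" and ?Y = "Poly_Mapping.keys r"
  note * = MA_mult_sup[of ?X ?Y _ r]
  show ?thesis
    by (simp add: * keys_add lookup_add distrib_right single_add sum.distrib)
qed

lemma MA_distr_right: "r \<otimes>\<^bsub>MA\<^esub> (p + p') = r \<otimes>\<^bsub>MA\<^esub> p + r \<otimes>\<^bsub>MA\<^esub> p'"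
proof -
  let ?X = "Poly_Mapping.keys p \<union> Poly_Mapping.keys p'" and ?Y = "Poly_Mapping.keys r"
  note * = MA_mult_sup[of ?Y ?X r]
  show ?thesis
    by (simp add: * keys_add lookup_add distrib_left single_add sum.distrib)
qed

lemma MA_zero [simp]: "0 \<otimes>\<^bsub>MA\<^esub> r = 0" "r \<otimes>\<^bsub>MA\<^esub> 0 = 0" "0\<^sup>\<star>\<^bsub>MA\<^esub> = 0"
  by (simp_all add: monoid_algebra_def)

lemma MA_star_add: "(p + p')\<^sup>\<star>\<^bsub>MA\<^esub> = p\<^sup>\<star>\<^bsub>MA\<^esub> + p'\<^sup>\<star>\<^bsub>MA\<^esub>"
proof -
  let ?X = "Poly_Mapping.keys p \<union> Poly_Mapping.keys p'"
  note * = MA_star_sup[of ?X]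
  show ?thesis
    by (simp add: * keys_add lookup_add single_add sum.distrib)
qed

lemma MA_smult_add: "Poly_Mapping.map ((*) c) (p + p') = Poly_Mapping.map ((*) c) p + Poly_Mapping.map ((*) (c::complex)) p'"
  by (rule poly_mapping_eqI) (simp add: lookup_map_times lookup_add algebra_simps)

lemma MA_smult_single: "Poly_Mapping.map ((*) (c::complex)) (Poly_Mapping.single a d) = Poly_Mapping.single a (c * d)"
  by (rule poly_mapping_eqI) (simp add: lookup_map_times lookup_single when_def)

lemma MA_closed:
  assumes "Poly_Mapping.keys p \<subseteq> carrier M" "Poly_Mapping.keys r \<subseteq> carrier M"
  shows "Poly_Mapping.keys (p \<otimes>\<^bsub>MA\<^esub> r) \<subseteq> carrier M"
  using assms(1)
proof (induction p rule: poly_mapping_additive_induct)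
  case (single a c)
  show ?case using assms(2)
    by (induction r rule: poly_mapping_additive_induct)
      (use single in \<open>simp_all add: MA_mult_single MA_distr_right keys_add_subset\<close>)
qed (simp_all add: MA_distr_left keys_add_subset)

lemma MA_star_closed:
  assumes "Poly_Mapping.keys p \<subseteq> carrier M"
  shows "Poly_Mapping.keys (p\<^sup>\<star>\<^bsub>MA\<^esub>) \<subseteq> carrier M"
  using assms
  by (induction p rule: poly_mapping_additive_induct)
    (simp_all add: MA_star_single MA_star_add inv_closed keys_add_subset)

lemma MA_assoc:
  assumes "Poly_Mapping.keys p \<subseteq> carrier M" "Poly_Mapping.keys r \<subseteq> carrier M" "Poly_Mapping.keys s \<subseteq> carrier M"
  shows "p \<otimes>\<^bsub>MA\<^esub> r \<otimes>\<^bsub>MA\<^esub> s = p \<otimes>\<^bsub>MA\<^esub> (r \<otimes>\<^bsub>MA\<^esub> s)"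
  using assms(1)
proof (induction p rule: poly_mapping_additive_induct)
  case (single a c)
  note a = this
  show ?case using assms(2)
  proof (induction r rule: poly_mapping_additive_induct)
    case (single b d)
    show ?case using assms(3)
      by (induction s rule: poly_mapping_additive_induct) (use a single in \<open>simp_all add: MA_mult_single MA_distr_right m_assoc mult.assoc\<close>)
  qed (simp_all add: MA_distr_right MA_distr_left)
qed (simp_all add: MA_distr_left)

lemma MA_scale_mult:
  assumes "Poly_Mapping.keys p \<subseteq> carrier M" "Poly_Mapping.keys r \<subseteq> carrier M"
  shows "Poly_Mapping.map ((*) c) p \<otimes>\<^bsub>MA\<^esub> r = Poly_Mapping.map ((*) c) (p \<otimes>\<^bsub>MA\<^esub> r)"
    and "p \<otimes>\<^bsub>MA\<^esub> Poly_Mapping.map ((*) c) r = Poly_Mapping.map ((*) c) (p \<otimes>\<^bsub>MA\<^esub> r)"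
proof -
  have "Poly_Mapping.map ((*) c) p \<otimes>\<^bsub>MA\<^esub> r = Poly_Mapping.map ((*) c) (p \<otimes>\<^bsub>MA\<^esub> r) \<and>
    p \<otimes>\<^bsub>MA\<^esub> Poly_Mapping.map ((*) c) r = Poly_Mapping.map ((*) c) (p \<otimes>\<^bsub>MA\<^esub> r)"
    using assms(1)
  proof (induction p rule: poly_mapping_additive_induct)
    case (single a c')
    show ?case using assms(2)
      by (induction r rule: poly_mapping_additive_induct) 
        (use single in \<open>simp_all add: MA_mult_single MA_smult_single MA_distr_right MA_distr_left MA_smult_add
          mult.left_commute mult.assoc\<close>)
  qed (simp_all add: MA_distr_left MA_distr_right MA_smult_add)
  thus "Poly_Mapping.map ((*) c) p \<otimes>\<^bsub>MA\<^esub> r = Poly_Mapping.map ((*) c) (p \<otimes>\<^bsub>MA\<^esub> r)"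
    "p \<otimes>\<^bsub>MA\<^esub> Poly_Mapping.map ((*) c) r = Poly_Mapping.map ((*) c) (p \<otimes>\<^bsub>MA\<^esub> r)"
    by auto
qed

lemma MA_star_mult:
  assumes "Poly_Mapping.keys p \<subseteq> carrier M" "Poly_Mapping.keys r \<subseteq> carrier M"
  shows "(p \<otimes>\<^bsub>MA\<^esub> r)\<^sup>\<star>\<^bsub>MA\<^esub> = r\<^sup>\<star>\<^bsub>MA\<^esub> \<otimes>\<^bsub>MA\<^esub> p\<^sup>\<star>\<^bsub>MA\<^esub>"
  using assms(1)
proof (induction p rule: poly_mapping_additive_induct)
  case (single a c)
  show ?case using assms(2)
    by (induction r rule: poly_mapping_additive_induct) 
      (use single in \<open>simp_all add: MA_mult_single MA_distr_right MA_distr_left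
        MA_star_add MA_star_single inv_mult mult.commute\<close>)
qed (simp_all add: MA_distr_left MA_distr_right MA_star_add)

lemma MA_one:
  assumes "Poly_Mapping.keys p \<subseteq> carrier M"
  shows "Poly_Mapping.single \<one> 1 \<otimes>\<^bsub>MA\<^esub> p = p" "p \<otimes>\<^bsub>MA\<^esub> Poly_Mapping.single \<one> 1 = p"
    "(p\<^sup>\<star>\<^bsub>MA\<^esub>)\<^sup>\<star>\<^bsub>MA\<^esub> = p" "(Poly_Mapping.map ((*) c) p)\<^sup>\<star>\<^bsub>MA\<^esub> = Poly_Mapping.map ((*) (cnj c)) (p\<^sup>\<star>\<^bsub>MA\<^esub>)"
proof -
  have "Poly_Mapping.single \<one> 1 \<otimes>\<^bsub>MA\<^esub> p = p \<and> p \<otimes>\<^bsub>MA\<^esub> Poly_Mapping.single \<one> 1 = p \<and> (p\<^sup>\<star>\<^bsub>MA\<^esub>)\<^sup>\<star>\<^bsub>MA\<^esub> = p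
     \<and> (Poly_Mapping.map ((*) c) p)\<^sup>\<star>\<^bsub>MA\<^esub> = Poly_Mapping.map ((*) (cnj c)) (p\<^sup>\<star>\<^bsub>MA\<^esub>)"
    using assms
    by (induction p rule: poly_mapping_additive_induct)
      (simp_all add: MA_mult_single MA_distr_left MA_distr_right MA_star_single MA_star_add inv_inv MA_smult_add MA_smult_single)
  thus "Poly_Mapping.single \<one> 1 \<otimes>\<^bsub>MA\<^esub> p = p" "p \<otimes>\<^bsub>MA\<^esub> Poly_Mapping.single \<one> 1 = p"
    "(p\<^sup>\<star>\<^bsub>MA\<^esub>)\<^sup>\<star>\<^bsub>MA\<^esub> = p" "(Poly_Mapping.map ((*) c) p)\<^sup>\<star>\<^bsub>MA\<^esub> = Poly_Mapping.map ((*) (cnj c)) (p\<^sup>\<star>\<^bsub>MA\<^esub>)"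
    by auto
qed

lemma star_algebra_MA: "star_algebra MA"
proof (rule star_algebraI)
  have scale_keys: "Poly_Mapping.keys (Poly_Mapping.map ((*) (c::complex)) p) \<subseteq> Poly_Mapping.keys p" for c and p :: "'a \<Rightarrow>\<^sub>0 complex"
    by (auto simp: in_keys_iff lookup_map_times)
  show "ring MA"
  proof (rule ringI)
    show "abelian_group MA"
    proof (rule abelian_groupI)
      fix x assume "x \<in> carrier MA"
      thus "\<exists>y\<in>carrier MA. y \<oplus>\<^bsub>MA\<^esub> x = \<zero>\<^bsub>MA\<^esub>"
        by (intro bexI[of _ "- x"]) (auto simp: MA_sel)
    qed (simp_all add: MA_sel add_ac keys_add_subset)
    show "monoid MA"
      by (rule monoidI) (auto simp: MA_sel MA_assoc MA_one MA_closed[THEN subsetD])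
  qed (auto simp: MA_sel MA_distr_left MA_distr_right)
  show "c \<odot>\<^bsub>MA\<^esub> x \<in> carrier MA" if "x \<in> carrier MA" for c x
    using that scale_keys[of c x] by (auto simp: MA_sel)
  show "(c + d) \<odot>\<^bsub>MA\<^esub> x = c \<odot>\<^bsub>MA\<^esub> x \<oplus>\<^bsub>MA\<^esub> d \<odot>\<^bsub>MA\<^esub> x" for c d x
    by (rule poly_mapping_eqI) (simp add: MA_sel lookup_map_times lookup_add distrib_right)
  show "(c * d) \<odot>\<^bsub>MA\<^esub> x = c \<odot>\<^bsub>MA\<^esub> (d \<odot>\<^bsub>MA\<^esub> x)" for c d x
    by (rule poly_mapping_eqI) (simp add: MA_sel lookup_map_times)
  show "1 \<odot>\<^bsub>MA\<^esub> x = x" for x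
    by (rule poly_mapping_eqI) (simp add: MA_sel lookup_map_times)
qed (auto simp: MA_sel MA_smult_add MA_scale_mult MA_one MA_star_mult MA_star_add dest!: MA_star_closed)

end

lemma map_single_times: "Poly_Mapping.map ((*) (c::complex)) (Poly_Mapping.single a d) = Poly_Mapping.single a (c * d)"
  by (rule poly_mapping_eqI) (simp add: lookup_map_times lookup_single when_def)

section \<open>Presented *-algebras\<close>

lemma image_constant_eq: "(\<And>x. x \<in> X \<Longrightarrow> g x = c) \<Longrightarrow> X \<noteq> {} \<Longrightarrow> g ` X = {c}"
  by auto

lemma (in complex_star_algebra) minus_zero_eq:
  assumes "x \<ominus> y = \<zero>" "x \<in> carrier A" "y \<in> carrier A"
  shows "x = y"
proof -
  have "x = (x \<ominus> y) \<oplus> y" using assms(2,3) by (simp add: a_minus_def a_assoc l_neg)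
  thus ?thesis using assms by simp
qed

lemma (in star_monoid) MA_minus:
  assumes "p \<in> carrier MA" "r \<in> carrier MA"
  shows "p \<ominus>\<^bsub>MA\<^esub> r = p - r"
proof -
  interpret MA: complex_star_algebra MA using star_algebra_MA by (simp add: star_algebra_iff)
  show ?thesis
    using assms by (simp add: MA.minus_eq_scale)
      (rule poly_mapping_eqI, simp add: MA_sel lookup_map_times lookup_add lookup_minus)
qed

abbreviation word_star :: "'g word \<Rightarrow> 'g word" where
  "word_star w \<equiv> rev (map (\<lambda>(g, s). (g, \<not> s)) w)"

interpretation words: star_monoid "\<lparr>carrier = UNIV, monoid.mult = (@), one = []\<rparr>" word_star
  by unfold_locales (auto simp: rev_map comp_def case_prod_unfold)

interpretation free: complex_star_algebra free_star_algebra
  using words.star_algebra_MA by (simp add: star_algebra_iff free_star_algebra_def)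

lemma free_simps [simp]:
  "carrier free_star_algebra = UNIV" "\<one>\<^bsub>free_star_algebra\<^esub> = Poly_Mapping.single [] 1"
  "\<zero>\<^bsub>free_star_algebra\<^esub> = 0" "p \<oplus>\<^bsub>free_star_algebra\<^esub> r = p + r"
  "c \<odot>\<^bsub>free_star_algebra\<^esub> p = Poly_Mapping.map ((*) c) p"
  by (simp_all add: free_star_algebra_def words.MA_sel)

lemma free_minus [simp]: "p \<ominus>\<^bsub>free_star_algebra\<^esub> r = p - r"
  using words.MA_minus[of p r] by (simp add: free_star_algebra_def words.MA_sel)

lemmas free_star_add = free.star_add[simplified] and free_star_zero [simp] = free.star_zero[simplified]

lemma free_mult_single: "Poly_Mapping.single a c \<otimes>\<^bsub>free_star_algebra\<^esub> Poly_Mapping.single b d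
    = Poly_Mapping.single (a @ b) (c * d)"
  using words.MA_mult_single by (simp add: free_star_algebra_def)

lemma free_star_single: "(Poly_Mapping.single a c)\<^sup>\<star>\<^bsub>free_star_algebra\<^esub> = Poly_Mapping.single (word_star a) (cnj c)"
  using words.MA_star_single by (simp add: free_star_algebra_def)

text \<open>The setting of the universal property: a *-algebra with a family of elements to which the
  generators are sent.\<close>

locale star_algebra_gens = complex_star_algebra B for B (structure) +
  fixes f :: "'g \<Rightarrow> _"
  assumes gen_closed [simp, intro]: "f g \<in> carrier B"
begin

abbreviation "letter \<equiv> (\<lambda>(g, s). if s then (f g)\<^sup>\<star> else f g)"

lemma letter_closed [simp, intro]: "letter l \<in> carrier B"
  by (cases l) auto

lemma word_eval_Cons: "word_eval B f (l # w) = letter l \<otimes> word_eval B f w"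
  by (simp add: word_eval_def case_prod_unfold)

lemma word_eval_Nil [simp]: "word_eval B f [] = \<one>"
  by (simp add: word_eval_def)

lemma word_eval_closed [simp, intro]: "word_eval B f w \<in> carrier B"
  by (induction w) (simp_all add: word_eval_Cons del: split_paired_All)

lemma word_eval_append: "word_eval B f (v @ w) = word_eval B f v \<otimes> word_eval B f w"
  by (induction v) (simp_all add: word_eval_Cons m_assoc)

lemma word_eval_star: "word_eval B f (word_star w) = (word_eval B f w)\<^sup>\<star>"
proof (induction w)
  case (Cons l w)
  have "word_eval B f [(case l of (g, s) \<Rightarrow> (g, \<not> s))] = (letter l)\<^sup>\<star>"
    by (cases l) (simp add: word_eval_Cons)
  with Cons show ?case by (simp add: word_eval_append word_eval_Cons star_mult)
qed simp

lemma free_eval_sup: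
  assumes "finite X" "Poly_Mapping.keys p \<subseteq> X"
  shows "free_eval B f p = (\<Oplus>w\<in>X. Poly_Mapping.lookup p w \<odot> word_eval B f w)"
  unfolding free_eval_def
  by (rule add.finprod_mono_neutral_cong_left) (use assms in \<open>auto simp: in_keys_iff\<close>)

lemma free_eval_closed [simp, intro]: "free_eval B f p \<in> carrier B"
  unfolding free_eval_def by (intro finsum_closed) auto

lemma free_eval_add: "free_eval B f (p + r) = free_eval B f p \<oplus> free_eval B f r"
proof -
  let ?X = "Poly_Mapping.keys p \<union> Poly_Mapping.keys r"
  note * = free_eval_sup[of ?X]
  show ?thesis
    by (simp add: * keys_add lookup_add scale_add_left finsum_addf)
qed

lemma free_eval_single [simp]: "free_eval B f (Poly_Mapping.single w c) = c \<odot> word_eval B f w"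
  by (subst free_eval_sup[of "{w}"]) auto

lemma free_eval_zero [simp]: "free_eval B f 0 = \<zero>"
  by (simp add: free_eval_def)

lemma free_eval_hom: "star_hom free_star_algebra B (free_eval B f)"
proof -
  have "free_eval B f (p \<otimes>\<^bsub>free_star_algebra\<^esub> r) = free_eval B f p \<otimes> free_eval B f r" for p r
  proof -
    have "Poly_Mapping.keys p \<subseteq> UNIV" by simp
    thus ?thesis
    proof (induction p rule: poly_mapping_additive_induct)
      case (single a c)
      have "Poly_Mapping.keys r \<subseteq> UNIV" by simp
      thus ?case
      proof (induction r rule: poly_mapping_additive_induct)
        case (single b d)
        show ?case by (simp add: free_mult_single word_eval_append smult_mult_left smult_mult_right scale_scale mult.commute)
      next
        case (add p q)
        thus ?case using free.r_distr[of p q "Poly_Mapping.single a c"]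
          by (simp add: free_eval_add r_distr)
      qed (use free.r_null[of "Poly_Mapping.single a c"] in simp_all)
    next
      case (add p q)
      thus ?case using free.l_distr[of p q r] by (simp add: free_eval_add l_distr)
    qed (use free.l_null[of r] in simp_all)
  qed
  moreover have "free_eval B f (Poly_Mapping.map ((*) c) p) = c \<odot> free_eval B f p" for c p
  proof -
    have "Poly_Mapping.keys p \<subseteq> UNIV" by simp
    thus ?thesis
      by (induction p rule: poly_mapping_additive_induct)
        (simp_all add: free_eval_add map_single_times words.MA_smult_add scale_scale scale_add_right)
  qed
  moreover have "free_eval B f (p\<^sup>\<star>\<^bsub>free_star_algebra\<^esub>) = (free_eval B f p)\<^sup>\<star>" for p
  proof -
    have "Poly_Mapping.keys p \<subseteq> UNIV" by simp
    thus ?thesis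
      by (induction p rule: poly_mapping_additive_induct)
        (simp_all add: free_star_add free_eval_add free_star_single word_eval_star star_smult star_add)
  qed
  ultimately show ?thesis
    by (simp add: star_hom_def free_eval_add)
qed

lemma free_eval_gen: "free_eval B f (free_gen g) = f g"
  by (simp add: free_gen_def word_eval_Cons)

end

abbreviation rel_ideal :: "('g word \<Rightarrow>\<^sub>0 complex) set \<Rightarrow> ('g word \<Rightarrow>\<^sub>0 complex) set" where
  "rel_ideal R \<equiv> star_ideal_gen free_star_algebra R"

definition cls :: "('g word \<Rightarrow>\<^sub>0 complex) set \<Rightarrow> ('g word \<Rightarrow>\<^sub>0 complex) \<Rightarrow> ('g word \<Rightarrow>\<^sub>0 complex) set" where
  "cls R p = rel_ideal R +>\<^bsub>free_star_algebra\<^esub> p"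

lemma presented_gen_cls: "presented_gen R g = cls R (free_gen g)"
  by (simp add: presented_gen_def cls_def)

lemma rel_ideal: "star_ideal (rel_ideal R) free_star_algebra" "R \<subseteq> rel_ideal R"
  using free.star_ideal_gen[of R] by auto

lemma star_algebra_presented: "star_algebra (presented_star_algebra R)"
  unfolding presented_star_algebra_def by (rule free.star_algebra_quotient[OF rel_ideal(1)])

lemma cls_hom: "star_hom free_star_algebra (presented_star_algebra R) (cls R)"
  unfolding presented_star_algebra_def cls_def by (rule free.star_quotient_hom[OF rel_ideal(1)])

lemma presented_carrier: "carrier (presented_star_algebra R) = range (cls R)"
  unfolding presented_star_algebra_def cls_def by (simp add: free.star_quotient_carrier)

lemma cls_eq_iff: "cls R p = cls R r \<longleftrightarrow> p - r \<in> rel_ideal R"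
  using free.coset_eq_iff[of "rel_ideal R" p r] rel_ideal(1)[of R] by (simp add: cls_def star_ideal_def)

lemma cls_rel: "p - r \<in> R \<Longrightarrow> cls R p = cls R r"
  using rel_ideal(2)[of R] by (auto simp: cls_eq_iff)

lemma mem_cls: "x \<in> cls R p \<Longrightarrow> cls R x = cls R p"
proof -
  interpret I: ideal "rel_ideal R" free_star_algebra using rel_ideal(1)[of R] by (simp add: star_ideal_def)
  show "x \<in> cls R p \<Longrightarrow> cls R x = cls R p"
    using I.a_repr_independence'[of x p] by (simp add: cls_def)
qed

lemma cls_self: "p \<in> cls R p"
proof -
  interpret I: ideal "rel_ideal R" free_star_algebra using rel_ideal(1)[of R] by (simp add: star_ideal_def)
  show ?thesis using I.a_rcos_self[of p] by (simp add: cls_def)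
qed

context star_algebra_gens
begin

text \<open>The kernel of the evaluation is a *-ideal containing the relators.\<close>

lemma free_eval_rel_ideal:
  assumes "\<And>r. r \<in> R \<Longrightarrow> free_eval B f r = \<zero>" "p \<in> rel_ideal R"
  shows "free_eval B f p = \<zero>"
proof -
  have B: "star_algebra B" "star_algebra free_star_algebra"
    using complex_star_algebra_axioms free.complex_star_algebra_axioms by (simp_all add: star_algebra_iff)
  have "star_ideal {x \<in> carrier free_star_algebra. free_eval B f x = \<zero>} free_star_algebra"
    by (rule star_ideal_kernel[OF B(2) B(1) free_eval_hom])
  thus ?thesis using assms unfolding star_ideal_gen_def star_ideal_def by auto
qed

lemma free_eval_minus: "free_eval B f (p - r) = free_eval B f p \<ominus> free_eval B f r"
  using star_hom_minus[OF _ _ free_eval_hom, of p r] complex_star_algebra_axioms free.complex_star_algebra_axioms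
  by (simp add: star_algebra_iff)

text \<open>The evaluation of a coset is the unique element of the image of the coset; it exists because the
  evaluation is constant on the coset.\<close>

lemma presented_eval_cls:
  assumes "\<And>r. r \<in> R \<Longrightarrow> free_eval B f r = \<zero>"
  shows "presented_eval B f (cls R p) = free_eval B f p"
proof -
  have "free_eval B f x = free_eval B f p" if "x \<in> cls R p" for x
  proof -
    have "free_eval B f (x - p) = \<zero>"
      using mem_cls[OF that] free_eval_rel_ideal[OF assms] by (simp add: cls_eq_iff)
    thus ?thesis by (simp add: free_eval_minus minus_zero_eq)
  qed
  moreover have "cls R p \<noteq> {}" using cls_self[of p R] by blast
  ultimately have "free_eval B f ` cls R p = {free_eval B f p}" by (rule image_constant_eq)
  thus ?thesis by (simp add: presented_eval_def)
qed

lemma presented_eval_hom: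
  assumes "\<And>r. r \<in> R \<Longrightarrow> free_eval B f r = \<zero>"
  shows "star_hom (presented_star_algebra R) B (presented_eval B f)"
proof -
  note c = star_homD(2-6)[OF cls_hom[of R], symmetric] and e = star_homD[OF free_eval_hom]
    and pe = presented_eval_cls[OF assms]
  show ?thesis
    unfolding star_hom_def presented_carrier
    using c e by (auto simp: pe)
qed

end

section \<open>Tensor products\<close>

locale tensor_pair = A: complex_star_algebra A + B: complex_star_algebra B
  for A :: "('a, 'x) star_algebra_scheme" and B :: "('b, 'y) star_algebra_scheme"
begin

sublocale P: star_monoid "A \<times>\<times> B" "map_prod (star A) (star B)"
proof -
  have "monoid (A \<times>\<times> B)"
    by (rule DirProd_monoid) (auto intro: A.monoid_axioms B.monoid_axioms)
  then interpret monoid "A \<times>\<times> B" .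
  show "star_monoid (A \<times>\<times> B) (map_prod (star A) (star B))"
    by unfold_locales (auto simp: DirProd_def A.star_mult B.star_mult)
qed

sublocale PA: complex_star_algebra "pair_algebra A B"
  using P.star_algebra_MA by (simp add: star_algebra_iff)

abbreviation "T \<equiv> tensor_algebra A B"
abbreviation "pt \<equiv> pure_tensor A B"

lemma PA_carrier: "carrier (pair_algebra A B) = {p. Poly_Mapping.keys p \<subseteq> carrier A \<times> carrier B}"
  unfolding P.MA_sel by (simp add: DirProd_def)

lemma add_closed: "p \<in> carrier (pair_algebra A B) \<Longrightarrow> r \<in> carrier (pair_algebra A B) \<Longrightarrow>
    p + r \<in> carrier (pair_algebra A B)"
  using PA.a_closed[of p r] by (simp add: P.MA_sel(4))

lemma diff_closed: "p \<in> carrier (pair_algebra A B) \<Longrightarrow> r \<in> carrier (pair_algebra A B) \<Longrightarrow>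
    p - r \<in> carrier (pair_algebra A B)"
  using PA.minus_closed[of p r] by (simp add: P.MA_minus)

lemma single_in: "a \<in> carrier A \<Longrightarrow> b \<in> carrier B \<Longrightarrow> Poly_Mapping.single (a, b) c \<in> carrier (pair_algebra A B)"
  by (simp add: PA_carrier)

lemma bilinear_relators_carrier: "bilinear_relators A B \<subseteq> carrier (pair_algebra A B)"
  unfolding bilinear_relators_def
  by (auto intro!: diff_closed single_in)

lemma tensor_null: "star_ideal (tensor_null A B) (pair_algebra A B)" "bilinear_relators A B \<subseteq> tensor_null A B"
  unfolding tensor_null_def using PA.star_ideal_gen[OF bilinear_relators_carrier] by auto

sublocale T: complex_star_algebra "tensor_algebra A B"
  using PA.star_algebra_quotient[OF tensor_null(1)] by (simp add: star_algebra_iff tensor_algebra_def)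

definition tcls where "tcls p = tensor_null A B +>\<^bsub>pair_algebra A B\<^esub> p"

lemma tcls_hom: "star_hom (pair_algebra A B) (tensor_algebra A B) tcls"
  unfolding tcls_def tensor_algebra_def by (rule PA.star_quotient_hom[OF tensor_null(1)])

lemma pure_tensor_tcls: "pt a b = tcls (Poly_Mapping.single (a, b) 1)"
  by (simp add: pure_tensor_def tcls_def)

lemma pt_closed [simp, intro]: "a \<in> carrier A \<Longrightarrow> b \<in> carrier B \<Longrightarrow> pt a b \<in> carrier T"
  by (simp add: pure_tensor_tcls star_homD[OF tcls_hom] single_in)

text \<open>Every computation in the tensor product goes back to this: formal combinations that differ by a
  bilinearity relator have the same class.\<close>

lemma tcls_rel:
  assumes "p \<in> carrier (pair_algebra A B)" "r \<in> carrier (pair_algebra A B)" "p - r \<in> bilinear_relators A B"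
  shows "tcls p = tcls r"
  using PA.coset_eq_iff[of "tensor_null A B" p r] assms tensor_null
  by (auto simp: tcls_def star_ideal_def P.MA_minus)

lemma pt_mult: "a \<in> carrier A \<Longrightarrow> b \<in> carrier B \<Longrightarrow> a' \<in> carrier A \<Longrightarrow> b' \<in> carrier B \<Longrightarrow>
    pt a b \<otimes>\<^bsub>T\<^esub> pt a' b' = pt (a \<otimes>\<^bsub>A\<^esub> a') (b \<otimes>\<^bsub>B\<^esub> b')"
  by (simp add: pure_tensor_tcls star_homD(3)[OF tcls_hom, symmetric] single_in P.MA_mult_single)

lemma pt_star: "a \<in> carrier A \<Longrightarrow> b \<in> carrier B \<Longrightarrow> (pt a b)\<^sup>\<star>\<^bsub>T\<^esub> = pt (a\<^sup>\<star>\<^bsub>A\<^esub>) (b\<^sup>\<star>\<^bsub>B\<^esub>)"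
  by (simp add: pure_tensor_tcls star_homD(6)[OF tcls_hom, symmetric] single_in P.MA_star_single)

lemma pt_one: "pt \<one>\<^bsub>A\<^esub> \<one>\<^bsub>B\<^esub> = \<one>\<^bsub>T\<^esub>"
  using star_homD(2)[OF tcls_hom] unfolding pure_tensor_tcls P.MA_sel by (simp add: DirProd_def)

lemma tcls_add: "p \<in> carrier (pair_algebra A B) \<Longrightarrow> r \<in> carrier (pair_algebra A B) \<Longrightarrow>
   tcls (p + r) = tcls p \<oplus>\<^bsub>T\<^esub> tcls r"
  using star_homD(4)[OF tcls_hom, of p r] by (simp add: P.MA_sel)

lemma pt_add_left:
  assumes "a \<in> carrier A" "a' \<in> carrier A" "b \<in> carrier B"
  shows "pt (a \<oplus>\<^bsub>A\<^esub> a') b = pt a b \<oplus>\<^bsub>T\<^esub> pt a' b"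
proof -
  have "tcls (Poly_Mapping.single (a \<oplus>\<^bsub>A\<^esub> a', b) 1) = tcls (Poly_Mapping.single (a, b) 1 + Poly_Mapping.single (a', b) 1)"
    by (rule tcls_rel)
      (use assms in \<open>auto intro!: single_in add_closed simp: bilinear_relators_def diff_diff_eq[symmetric]
        simp del: PA.a_closed\<close>)
  thus ?thesis using assms by (simp add: pure_tensor_tcls tcls_add single_in)
qed

lemma pt_add_right:
  assumes "a \<in> carrier A" "b \<in> carrier B" "b' \<in> carrier B"
  shows "pt a (b \<oplus>\<^bsub>B\<^esub> b') = pt a b \<oplus>\<^bsub>T\<^esub> pt a b'"
proof -
  have "tcls (Poly_Mapping.single (a, b \<oplus>\<^bsub>B\<^esub> b') 1) = tcls (Poly_Mapping.single (a, b) 1 + Poly_Mapping.single (a, b') 1)"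
    by (rule tcls_rel)
      (use assms in \<open>auto intro!: single_in add_closed simp: bilinear_relators_def diff_diff_eq[symmetric]
        simp del: PA.a_closed\<close>)
  thus ?thesis using assms by (simp add: pure_tensor_tcls tcls_add single_in)
qed

lemma tcls_single:
  assumes "a \<in> carrier A" "b \<in> carrier B"
  shows "tcls (Poly_Mapping.single (a, b) c) = c \<odot>\<^bsub>T\<^esub> pt a b"
  using star_homD(5)[OF tcls_hom single_in[OF assms], of c 1]
    assms by (simp add: pure_tensor_tcls P.MA_sel(5) map_single_times del: P.MA_sel(1))

lemma pt_scale:
  assumes "a \<in> carrier A" "b \<in> carrier B"
  shows "pt (c \<odot>\<^bsub>A\<^esub> a) b = c \<odot>\<^bsub>T\<^esub> pt a b" "pt a (c \<odot>\<^bsub>B\<^esub> b) = c \<odot>\<^bsub>T\<^esub> pt a b"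
proof -
  have "tcls (Poly_Mapping.single (c \<odot>\<^bsub>A\<^esub> a, b) 1) = tcls (Poly_Mapping.single (a, b) c)"
    by (rule tcls_rel) (use assms in \<open>auto intro!: single_in simp del: Un_iff, (unfold bilinear_relators_def, blast)\<close>)
  moreover have "tcls (Poly_Mapping.single (a, c \<odot>\<^bsub>B\<^esub> b) 1) = tcls (Poly_Mapping.single (a, b) c)"
    by (rule tcls_rel) (use assms in \<open>auto intro!: single_in simp del: Un_iff, (unfold bilinear_relators_def, blast)\<close>)
  ultimately show "pt (c \<odot>\<^bsub>A\<^esub> a) b = c \<odot>\<^bsub>T\<^esub> pt a b" "pt a (c \<odot>\<^bsub>B\<^esub> b) = c \<odot>\<^bsub>T\<^esub> pt a b"
    using tcls_single[OF assms, of c] by (simp_all add: pure_tensor_tcls)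
qed

end

lemma (in complex_star_algebra) finsum_one:
  "f 0 \<in> carrier A \<Longrightarrow> (\<Oplus>k\<in>{..<1::nat}. f k) = f 0"
proof -
  assume f: "f 0 \<in> carrier A"
  have "{..<1::nat} = {0}" by auto
  thus ?thesis using f by simp
qed

lemma (in complex_star_algebra) scale_cancel: "x \<in> carrier A \<Longrightarrow> (- s) \<odot> x \<oplus> s \<odot> x = \<zero>"
  by (simp add: scale_add_left[symmetric])

text \<open>The products of two-term tensors that occur for the comultiplication have cross terms which cancel
  in pairs, here \<open>n1\<close> against \<open>m1\<close> and \<open>n2\<close> against \<open>m2\<close>.\<close>

lemma (in complex_star_algebra) sum_cancel:
  assumes "n1 \<oplus> m1 = \<zero>" "n2 \<oplus> m2 = \<zero>"
    "p1 \<in> carrier A" "p2 \<in> carrier A" "r1 \<in> carrier A" "r2 \<in> carrier A"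
    "n1 \<in> carrier A" "n2 \<in> carrier A" "m1 \<in> carrier A" "m2 \<in> carrier A"
  shows "(p1 \<oplus> n1 \<oplus> (n2 \<oplus> p2)) \<oplus> (r1 \<oplus> m1 \<oplus> (m2 \<oplus> r2)) = (p1 \<oplus> r1) \<oplus> (p2 \<oplus> r2)"
proof -
  have "(p1 \<oplus> n1 \<oplus> (n2 \<oplus> p2)) \<oplus> (r1 \<oplus> m1 \<oplus> (m2 \<oplus> r2)) = ((p1 \<oplus> r1) \<oplus> (p2 \<oplus> r2)) \<oplus> ((n1 \<oplus> m1) \<oplus> (n2 \<oplus> m2))"
    using assms(3-) by (simp add: a_ac)
  thus ?thesis using assms by simp
qed

lemma (in tensor_pair) product_of_sums:
  assumes "a \<in> carrier A" "c \<in> carrier A" "a' \<in> carrier A" "c' \<in> carrier A"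
    "b \<in> carrier B" "d \<in> carrier B" "b' \<in> carrier B" "d' \<in> carrier B"
  shows "(pt a b \<oplus>\<^bsub>T\<^esub> pt c d) \<otimes>\<^bsub>T\<^esub> (pt a' b' \<oplus>\<^bsub>T\<^esub> pt c' d') =
    (pt (a \<otimes>\<^bsub>A\<^esub> a') (b \<otimes>\<^bsub>B\<^esub> b') \<oplus>\<^bsub>T\<^esub> pt (a \<otimes>\<^bsub>A\<^esub> c') (b \<otimes>\<^bsub>B\<^esub> d')) \<oplus>\<^bsub>T\<^esub>
    (pt (c \<otimes>\<^bsub>A\<^esub> a') (d \<otimes>\<^bsub>B\<^esub> b') \<oplus>\<^bsub>T\<^esub> pt (c \<otimes>\<^bsub>A\<^esub> c') (d \<otimes>\<^bsub>B\<^esub> d'))"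
  using assms by (simp add: T.l_distr T.r_distr pt_mult T.a_ac)

section \<open>C*-norms and completions\<close>

lemma tendsto_zero_squeeze:
  "g \<longlonglongrightarrow> 0 \<Longrightarrow> (\<And>n. 0 \<le> f n) \<Longrightarrow> (\<And>n. f n \<le> g n) \<Longrightarrow> f \<longlonglongrightarrow> (0::real)"
  by (rule tendsto_sandwich[of "\<lambda>_. 0" f _ g]) (auto intro: always_eventually)

text \<open>The conditions on a norm that survive in the dense subalgebra once completeness is dropped.\<close>

definition cstar_norm :: "('a, 'x) star_algebra_scheme \<Rightarrow> ('a \<Rightarrow> real) \<Rightarrow> bool" where
  "cstar_norm A N \<longleftrightarrow> algebra_norm A N \<and>
     (\<forall>x\<in>carrier A. \<forall>y\<in>carrier A. N (x \<otimes>\<^bsub>A\<^esub> y) \<le> N x * N y) \<and>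
     (\<forall>x\<in>carrier A. N (x\<^sup>\<star>\<^bsub>A\<^esub> \<otimes>\<^bsub>A\<^esub> x) = (N x)\<^sup>2)"

locale normed_star_algebra = complex_star_algebra A for A (structure) +
  fixes N :: "_ \<Rightarrow> real"
  assumes algebra_norm: "algebra_norm A N"
begin

lemma N_nonneg [simp]: "x \<in> carrier A \<Longrightarrow> 0 \<le> N x"
  and N_eq_zero: "x \<in> carrier A \<Longrightarrow> N x = 0 \<longleftrightarrow> x = \<zero>"
  and N_scale: "x \<in> carrier A \<Longrightarrow> N (c \<odot> x) = cmod c * N x"
  and N_add: "x \<in> carrier A \<Longrightarrow> y \<in> carrier A \<Longrightarrow> N (x \<oplus> y) \<le> N x + N y"
  using algebra_norm by (auto simp: algebra_norm_def)

lemma N_zero [simp]: "N \<zero> = 0" using N_eq_zero[of \<zero>] by simp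

lemma N_minus_commute: "x \<in> carrier A \<Longrightarrow> y \<in> carrier A \<Longrightarrow> N (x \<ominus> y) = N (y \<ominus> x)"
proof -
  assume "x \<in> carrier A" "y \<in> carrier A"
  hence "y \<ominus> x = (-1) \<odot> (x \<ominus> y)" by (simp add: minus_eq_scale scale_add_right scale_scale a_comm)
  thus ?thesis using N_scale[of "x \<ominus> y" "-1"] \<open>x \<in> carrier A\<close> \<open>y \<in> carrier A\<close> by simp
qed

lemma N_triangle: 
  assumes "x \<in> carrier A" "y \<in> carrier A" "z \<in> carrier A"
  shows "N (x \<ominus> z) \<le> N (x \<ominus> y) + N (y \<ominus> z)"
proof -
  have "x \<ominus> z = (x \<ominus> y) \<oplus> (y \<ominus> z)" using assms by (simp add: a_minus_def a_assoc r_neg1)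
  thus ?thesis using N_add[of "x \<ominus> y" "y \<ominus> z"] assms by simp
qed

lemma minus_zero_right: "x \<in> carrier A \<Longrightarrow> x \<ominus> \<zero> = x"
  by (simp add: a_minus_def)

lemma N_diff: "x \<in> carrier A \<Longrightarrow> y \<in> carrier A \<Longrightarrow> \<bar>N x - N y\<bar> \<le> N (x \<ominus> y)"
  using N_triangle[of x y \<zero>] N_triangle[of y x \<zero>] N_minus_commute[of x y]
  by (simp add: minus_zero_right)

abbreviation "C \<equiv> cauchy_seqs A N"
abbreviation "E \<equiv> cauchy_equiv A N"

lemma C_closed: "s \<in> C \<Longrightarrow> s n \<in> carrier A"
  by (auto simp: cauchy_seqs_def)

lemma C_cauchy: "s \<in> C \<Longrightarrow> e > 0 \<Longrightarrow> \<exists>n0. \<forall>m\<ge>n0. \<forall>n\<ge>n0. N (s m \<ominus> s n) < e"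
  by (auto simp: cauchy_seqs_def)

lemma CI: "(\<And>n. s n \<in> carrier A) \<Longrightarrow> (\<And>e. e > 0 \<Longrightarrow> \<exists>n0. \<forall>m\<ge>n0. \<forall>n\<ge>n0. N (s m \<ominus> s n) < e) \<Longrightarrow> s \<in> C"
  by (auto simp: cauchy_seqs_def)

lemma C_const [simp]: "x \<in> carrier A \<Longrightarrow> (\<lambda>_. x) \<in> C"
  by (rule CI) (simp_all add: r_neg a_minus_def)

lemma C_norm_convergent: "s \<in> C \<Longrightarrow> convergent (\<lambda>n. N (s n))"
proof -
  assume s: "s \<in> C"
  have "Cauchy (\<lambda>n. N (s n))"
    unfolding Cauchy_def dist_real_def
  proof (intro allI impI)
    fix e :: real assume "e > 0"
    then obtain n0 where "\<forall>m\<ge>n0. \<forall>n\<ge>n0. N (s m \<ominus> s n) < e" using C_cauchy[OF s] by blast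
    thus "\<exists>M. \<forall>m\<ge>M. \<forall>n\<ge>M. \<bar>N (s m) - N (s n)\<bar> < e"
      using N_diff C_closed[OF s] by (meson le_less_trans)
  qed
  thus ?thesis by (rule Cauchy_convergent)
qed

lemma C_norm_lim: "s \<in> C \<Longrightarrow> (\<lambda>n. N (s n)) \<longlonglongrightarrow> lim (\<lambda>n. N (s n))"
  using C_norm_convergent convergent_LIMSEQ_iff by blast

lemma C_bounded: "s \<in> C \<Longrightarrow> \<exists>K>0. \<forall>n. N (s n) \<le> K"
  using Bseq_def[of "\<lambda>n. N (s n)"] C_norm_convergent[THEN convergent_imp_Bseq, of s] C_closed[of s] by auto

lemma E_iff: "(s, t) \<in> E \<longleftrightarrow> s \<in> C \<and> t \<in> C \<and> (\<lambda>n. N (s n \<ominus> t n)) \<longlonglongrightarrow> 0"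
  by (simp add: cauchy_equiv_def)

lemma E_equiv: "equiv C E"
proof (rule equivI)
  show "E \<subseteq> C \<times> C" by (auto simp: E_iff)
  show "refl_on C E" by (rule refl_onI) (auto simp: E_iff C_closed r_neg a_minus_def)
  show "sym E" by (rule symI) (auto simp: E_iff N_minus_commute[OF C_closed C_closed])
  show "trans E"
  proof (rule transI)
    fix r s t assume "(r, s) \<in> E" "(s, t) \<in> E"
    hence c: "r \<in> C" "s \<in> C" "t \<in> C" and l: "(\<lambda>n. N (r n \<ominus> s n)) \<longlonglongrightarrow> 0" "(\<lambda>n. N (s n \<ominus> t n)) \<longlonglongrightarrow> 0"
      by (auto simp: E_iff)
    have "(\<lambda>n. N (r n \<ominus> t n)) \<longlonglongrightarrow> 0"
      by (rule tendsto_zero_squeeze[OF tendsto_add[OF l, simplified]])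
        (use c C_closed N_triangle in auto)
    with c show "(r, t) \<in> E" by (simp add: E_iff)
  qed
qed

definition "seq_cls s = E `` {s}"

lemma seq_cls_eq_iff: "s \<in> C \<Longrightarrow> t \<in> C \<Longrightarrow> seq_cls s = seq_cls t \<longleftrightarrow> (s, t) \<in> E"
  unfolding seq_cls_def by (rule eq_equiv_class_iff[OF E_equiv])

lemma seq_cls_self: "s \<in> C \<Longrightarrow> s \<in> seq_cls s"
  unfolding seq_cls_def by (rule equiv_class_self[OF E_equiv])

lemma seq_cls_mem: "t \<in> seq_cls s \<longleftrightarrow> (s, t) \<in> E"
  by (simp add: seq_cls_def)

lemma completion_carrier: "carrier (completion A N) = seq_cls ` C"
  by (auto simp: completion_def quotient_def seq_cls_def)

lemma completion_norm_seq: "s \<in> C \<Longrightarrow> completion_norm N (seq_cls s) = lim (\<lambda>n. N (s n))"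
proof -
  assume s: "s \<in> C"
  have "lim (\<lambda>n. N (t n)) = lim (\<lambda>n. N (s n))" if "t \<in> seq_cls s" for t
  proof -
    have st: "t \<in> C" "(\<lambda>n. N (s n \<ominus> t n)) \<longlonglongrightarrow> 0" using that by (auto simp: seq_cls_mem E_iff)
    have "(\<lambda>n. \<bar>N (s n) - N (t n)\<bar>) \<longlonglongrightarrow> 0"
      by (rule tendsto_zero_squeeze[OF st(2)]) (use N_diff C_closed s st in auto)
    hence "(\<lambda>n. N (s n) - N (t n)) \<longlonglongrightarrow> 0" by (simp add: tendsto_rabs_zero_iff)
    from tendsto_diff[OF C_norm_lim[OF s] this] have "(\<lambda>n. N (t n)) \<longlonglongrightarrow> lim (\<lambda>n. N (s n))" by simp
    thus ?thesis by (rule limI)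
  qed
  moreover have "seq_cls s \<noteq> {}" using seq_cls_self[OF s] by blast
  ultimately have "(\<lambda>s. lim (\<lambda>n. N (s n))) ` seq_cls s = {lim (\<lambda>n. N (s n))}" by (rule image_constant_eq)
  thus ?thesis by (simp add: completion_norm_def)
qed

text \<open>The operations of the completion are defined as unions of classes. If such a union is known to be a
  single class, then any sequence in it determines it.\<close>

lemma seq_cls_unique: "X \<in> carrier (completion A N) \<Longrightarrow> s \<in> X \<Longrightarrow> X = seq_cls s"
proof -
  assume "X \<in> carrier (completion A N)" and s: "s \<in> X"
  then obtain x where x: "x \<in> C" "X = seq_cls x" by (auto simp: completion_carrier)
  hence "(x, s) \<in> E" "s \<in> C" using s by (auto simp: seq_cls_mem E_iff)
  thus ?thesis using seq_cls_eq_iff x by simp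
qed

text \<open>Elements of \<open>A\<close> sit in the completion as classes of constant sequences, and the termwise operations
  contain the constant sequences of products and adjoints. Since the results of operations in
  a C*-algebra are classes, the embedding is a *-homomorphism, and the C*-identity restricts
  to \<open>A\<close>.\<close>

lemma cstar_norm_of_completion:
  assumes "c_star_algebra (completion A N) (completion_norm N)"
  shows "cstar_norm A N"
proof -
  interpret K: complex_star_algebra "completion A N"
    using assms by (simp add: c_star_algebra_def star_algebra_iff)
  define j where "j x = seq_cls (\<lambda>_. x)" for x
  have jc: "j x \<in> carrier (completion A N)" if "x \<in> carrier A" for x
    using that by (simp add: completion_carrier j_def)
  have jn: "completion_norm N (j x) = N x" if "x \<in> carrier A" for x
    using that by (simp add: completion_norm_seq j_def)
  have jm: "j x \<otimes>\<^bsub>completion A N\<^esub> j y = j (x \<otimes> y)" if "x \<in> carrier A" "y \<in> carrier A" for x y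
    unfolding j_def
  proof (rule seq_cls_unique)
    show "seq_cls (\<lambda>_. x) \<otimes>\<^bsub>completion A N\<^esub> seq_cls (\<lambda>_. y) \<in> carrier (completion A N)"
      using jc that unfolding j_def by blast
    show "(\<lambda>_. x \<otimes> y) \<in> seq_cls (\<lambda>_. x) \<otimes>\<^bsub>completion A N\<^esub> seq_cls (\<lambda>_. y)"
      unfolding completion_def
      using seq_cls_self[of "\<lambda>_. x"] seq_cls_self[of "\<lambda>_. y"] seq_cls_self[of "\<lambda>_. x \<otimes> y"] that
      by (auto simp flip: seq_cls_def)
  qed
  have js: "(j x)\<^sup>\<star>\<^bsub>completion A N\<^esub> = j (x\<^sup>\<star>)" if "x \<in> carrier A" for x
    unfolding j_def
  proof (rule seq_cls_unique)
    show "(seq_cls (\<lambda>_. x))\<^sup>\<star>\<^bsub>completion A N\<^esub> \<in> carrier (completion A N)"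
      using jc that unfolding j_def by blast
    show "(\<lambda>_. x\<^sup>\<star>) \<in> (seq_cls (\<lambda>_. x))\<^sup>\<star>\<^bsub>completion A N\<^esub>"
      unfolding completion_def
      using seq_cls_self[of "\<lambda>_. x"] seq_cls_self[of "\<lambda>_. x\<^sup>\<star>"] that
      by (auto simp flip: seq_cls_def)
  qed
  have "N (x \<otimes> y) \<le> N x * N y" if "x \<in> carrier A" "y \<in> carrier A" for x y
    using assms jc that jm jn unfolding c_star_algebra_def by (metis m_closed)
  moreover have "N (x\<^sup>\<star> \<otimes> x) = (N x)\<^sup>2" if "x \<in> carrier A" for x
    using assms jc that jm jn js unfolding c_star_algebra_def by (metis m_closed star_closed)
  ultimately show ?thesis by (simp add: cstar_norm_def algebra_norm)
qed

end

locale cstar_normed = complex_star_algebra A for A (structure) +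
  fixes N :: "_ \<Rightarrow> real"
  assumes cstar_norm: "cstar_norm A N"

sublocale cstar_normed \<subseteq> normed_star_algebra
  by unfold_locales (use cstar_norm in \<open>simp add: cstar_norm_def\<close>)

context cstar_normed
begin

lemma N_mult: "x \<in> carrier A \<Longrightarrow> y \<in> carrier A \<Longrightarrow> N (x \<otimes> y) \<le> N x * N y"
  and N_cstar: "x \<in> carrier A \<Longrightarrow> N (x\<^sup>\<star> \<otimes> x) = (N x)\<^sup>2"
  using cstar_norm by (auto simp: cstar_norm_def)

text \<open>From \<open>N(y)\<^sup>2 = N(y*y) \<le> N(y*) N(y)\<close>, applied to \<open>x\<close> and to its adjoint.\<close>

lemma N_star [simp]:
  assumes "x \<in> carrier A"
  shows "N (x\<^sup>\<star>) = N x"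
proof -
  have le: "N y \<le> N (y\<^sup>\<star>)" if "y \<in> carrier A" for y
  proof (cases "N y = 0")
    case False
    have "N y * N y \<le> N (y\<^sup>\<star>) * N y"
      using N_cstar[OF that] N_mult[of "y\<^sup>\<star>" y] that by (simp add: power2_eq_square)
    thus ?thesis using False N_nonneg[OF that] by simp
  qed (use that in simp)
  show ?thesis using le[of x] le[of "x\<^sup>\<star>"] assms by simp
qed

lemma mult_diff:
  assumes "x \<in> carrier A" "y \<in> carrier A" "x' \<in> carrier A" "y' \<in> carrier A"
  shows "N (x \<otimes> y \<ominus> x' \<otimes> y') \<le> N x * N (y \<ominus> y') + N (x \<ominus> x') * N y'"
proof -
  have "x \<otimes> (y \<ominus> y') = x \<otimes> y \<ominus> x \<otimes> y'" "(x \<ominus> x') \<otimes> y' = x \<otimes> y' \<ominus> x' \<otimes> y'"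
    using assms by (simp_all add: a_minus_def r_distr l_distr r_minus l_minus)
  moreover have "N (x \<otimes> (y \<ominus> y')) \<le> N x * N (y \<ominus> y')" "N ((x \<ominus> x') \<otimes> y') \<le> N (x \<ominus> x') * N y'"
    using assms by (simp_all add: N_mult)
  ultimately show ?thesis using N_triangle[of "x \<otimes> y" "x \<otimes> y'" "x' \<otimes> y'"] assms by simp
qed

lemma add_diff:
  assumes "x \<in> carrier A" "y \<in> carrier A" "x' \<in> carrier A" "y' \<in> carrier A"
  shows "N ((x \<oplus> y) \<ominus> (x' \<oplus> y')) \<le> N (x \<ominus> x') + N (y \<ominus> y')"
proof -
  have "(x \<oplus> y) \<ominus> (x' \<oplus> y') = (x \<ominus> x') \<oplus> (y \<ominus> y')"
    using assms by (simp add: minus_eq_scale scale_add_right a_ac)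
  thus ?thesis using N_add[of "x \<ominus> x'" "y \<ominus> y'"] assms by simp
qed

lemma scale_diff: "x \<in> carrier A \<Longrightarrow> x' \<in> carrier A \<Longrightarrow> N (c \<odot> x \<ominus> c \<odot> x') = cmod c * N (x \<ominus> x')"
  by (simp add: scale_minus[symmetric] N_scale)

lemma star_diff: "x \<in> carrier A \<Longrightarrow> x' \<in> carrier A \<Longrightarrow> N (x\<^sup>\<star> \<ominus> x'\<^sup>\<star>) = N (x \<ominus> x')"
  by (simp add: star_minus[symmetric])

lemma C_add:
  assumes "s \<in> C" "t \<in> C"
  shows "(\<lambda>n. s n \<oplus> t n) \<in> C"
proof (rule CI)
  fix e :: real assume "e > 0"
  hence "e / 2 > 0" by simp
  then obtain n0 n1 where n: "\<forall>m\<ge>n0. \<forall>n\<ge>n0. N (s m \<ominus> s n) < e / 2" "\<forall>m\<ge>n1. \<forall>n\<ge>n1. N (t m \<ominus> t n) < e / 2"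
    using C_cauchy assms by meson
  have "N ((s m \<oplus> t m) \<ominus> (s n \<oplus> t n)) < e" if "m \<ge> max n0 n1" "n \<ge> max n0 n1" for m n
  proof -
    have "N (s m \<ominus> s n) < e / 2" "N (t m \<ominus> t n) < e / 2" using n that by auto
    thus ?thesis using add_diff[OF C_closed[OF assms(1)] C_closed[OF assms(2)] C_closed[OF assms(1)] C_closed[OF assms(2)], of m m n n] by simp
  qed
  thus "\<exists>n0. \<forall>m\<ge>n0. \<forall>n\<ge>n0. N ((s m \<oplus> t m) \<ominus> (s n \<oplus> t n)) < e" by blast
qed (use assms C_closed in auto)

lemma C_mult:
  assumes "s \<in> C" "t \<in> C"
  shows "(\<lambda>n. s n \<otimes> t n) \<in> C"
proof (rule CI)
  fix e :: real assume e: "e > 0"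
  obtain K L where K: "K > 0" "\<And>n. N (s n) \<le> K" and L: "L > 0" "\<And>n. N (t n) \<le> L"
    using C_bounded assms by meson
  have "e / (2 * K) > 0" "e / (2 * L) > 0" using e K L by auto
  then obtain n0 n1 where n: "\<forall>m\<ge>n0. \<forall>n\<ge>n0. N (s m \<ominus> s n) < e / (2 * L)" "\<forall>m\<ge>n1. \<forall>n\<ge>n1. N (t m \<ominus> t n) < e / (2 * K)"
    using C_cauchy assms by meson
  have "N (s m \<otimes> t m \<ominus> s n \<otimes> t n) < e" if "m \<ge> max n0 n1" "n \<ge> max n0 n1" for m n
  proof -
    have *: "N (s m \<ominus> s n) < e / (2 * L)" "N (t m \<ominus> t n) < e / (2 * K)" using n that by auto
    have "N (s m) * N (t m \<ominus> t n) \<le> K * N (t m \<ominus> t n)"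
      using K assms C_closed by (intro mult_right_mono) auto
    also have "\<dots> < K * (e / (2 * K))" by (rule mult_strict_left_mono[OF *(2) K(1)])
    also have "\<dots> = e / 2" using K by simp
    finally have 1: "N (s m) * N (t m \<ominus> t n) < e / 2" .
    have "N (s m \<ominus> s n) * N (t n) \<le> N (s m \<ominus> s n) * L"
      using L assms C_closed by (intro mult_left_mono) auto
    also have "\<dots> < (e / (2 * L)) * L" by (rule mult_strict_right_mono[OF *(1) L(1)])
    also have "\<dots> = e / 2" using L by simp
    finally have 2: "N (s m \<ominus> s n) * N (t n) < e / 2" .
    show ?thesis using mult_diff[OF C_closed[OF assms(1)] C_closed[OF assms(2)] C_closed[OF assms(1)] C_closed[OF assms(2)], of m m n n] 1 2 by simp
  qed
  thus "\<exists>n0. \<forall>m\<ge>n0. \<forall>n\<ge>n0. N (s m \<otimes> t m \<ominus> s n \<otimes> t n) < e" by blast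
qed (use assms C_closed in auto)

lemma C_scale: "s \<in> C \<Longrightarrow> (\<lambda>n. c \<odot> s n) \<in> C"
  using C_mult[OF C_const[of "c \<odot> \<one>"], of s] C_closed[of s]
  by (simp add: smult_mult_left)

lemma C_star: "s \<in> C \<Longrightarrow> (\<lambda>n. (s n)\<^sup>\<star>) \<in> C"
  by (rule CI) (use C_cauchy[of s] C_closed[of s] in \<open>auto simp: star_diff\<close>)

text \<open>The *-algebra of Cauchy sequences, of which the completion is a homomorphic image.\<close>

definition seq_algebra :: "(nat \<Rightarrow> 'a) star_algebra" where
  "seq_algebra = \<lparr>carrier = C, monoid.mult = (\<lambda>s t n. s n \<otimes> t n), one = (\<lambda>_. \<one>), zero = (\<lambda>_. \<zero>),
     add = (\<lambda>s t n. s n \<oplus> t n), module.smult = (\<lambda>c s n. c \<odot> s n), star = (\<lambda>s n. (s n)\<^sup>\<star>)\<rparr>"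

lemma star_algebra_seq: "star_algebra seq_algebra"
proof (rule star_algebraI)
  show "ring seq_algebra"
  proof (rule ringI)
    show "abelian_group seq_algebra"
    proof (rule abelian_groupI)
      fix s assume "s \<in> carrier seq_algebra"
      hence s: "s \<in> C" by (simp add: seq_algebra_def)
      hence "(\<lambda>n. (-1) \<odot> s n) \<in> C" by (rule C_scale)
      moreover have "(-1) \<odot> s n \<oplus> s n = \<zero>" for n
        using C_closed[OF s] by (simp add: scale_minus_one l_neg)
      ultimately show "\<exists>t\<in>carrier seq_algebra. t \<oplus>\<^bsub>seq_algebra\<^esub> s = \<zero>\<^bsub>seq_algebra\<^esub>"
        by (intro bexI[of _ "\<lambda>n. (-1) \<odot> s n"]) (auto simp: seq_algebra_def)
    qed (auto simp: seq_algebra_def C_add C_closed a_ac)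
    show "monoid seq_algebra"
      by (rule monoidI) (auto simp: seq_algebra_def C_mult C_closed m_assoc)
  qed (auto simp: seq_algebra_def C_closed l_distr r_distr)
qed (auto simp: seq_algebra_def C_closed C_scale C_star scale_add_left scale_add_right scale_scale
       smult_mult_left smult_mult_right star_add star_smult star_mult)

lemma seq_cls_hom: "star_hom seq_algebra (completion A N) seq_cls"
proof -
  have "seq_cls (\<lambda>n. s n \<otimes> t n) = (\<Union>s\<in>seq_cls s. \<Union>t\<in>seq_cls t. seq_cls (\<lambda>n. s n \<otimes> t n))"
    if st: "s \<in> C" "t \<in> C" for s t
  proof -
    have "seq_cls (\<lambda>n. a n \<otimes> b n) = seq_cls (\<lambda>n. s n \<otimes> t n)" if "a \<in> seq_cls s" "b \<in> seq_cls t" for a b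
    proof -
      have ab: "a \<in> C" "(\<lambda>n. N (s n \<ominus> a n)) \<longlonglongrightarrow> 0" "b \<in> C" "(\<lambda>n. N (t n \<ominus> b n)) \<longlonglongrightarrow> 0"
        using that by (auto simp: seq_cls_mem E_iff)
      have "(\<lambda>n. N (s n) * N (t n \<ominus> b n) + N (s n \<ominus> a n) * N (b n)) \<longlonglongrightarrow>
          lim (\<lambda>n. N (s n)) * 0 + 0 * lim (\<lambda>n. N (b n))"
        by (intro tendsto_intros C_norm_lim ab st)
      hence lim0: "(\<lambda>n. N (s n) * N (t n \<ominus> b n) + N (s n \<ominus> a n) * N (b n)) \<longlonglongrightarrow> 0" by simp
      note cl = C_closed[OF st(1)] C_closed[OF st(2)] C_closed[OF ab(1)] C_closed[OF ab(3)]
      have "(\<lambda>n. N (s n \<otimes> t n \<ominus> a n \<otimes> b n)) \<longlonglongrightarrow> 0"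
        by (rule tendsto_zero_squeeze[OF lim0]) (simp_all add: mult_diff cl)
      hence "seq_cls (\<lambda>n. s n \<otimes> t n) = seq_cls (\<lambda>n. a n \<otimes> b n)"
        using seq_cls_eq_iff C_mult st ab by (simp add: E_iff)
      thus ?thesis by simp
    qed
    hence H: "(\<Union>t\<in>seq_cls t. seq_cls (\<lambda>n. a n \<otimes> t n)) = seq_cls (\<lambda>n. s n \<otimes> t n)" if "a \<in> seq_cls s" for a
      using that by (intro UN_const_eq[OF seq_cls_self[OF st(2)]]) auto
    show ?thesis by (rule sym, rule UN_const_eq[OF seq_cls_self[OF st(1)]], rule H)
  qed
  moreover have "seq_cls (\<lambda>n. s n \<oplus> t n) = (\<Union>s\<in>seq_cls s. \<Union>t\<in>seq_cls t. seq_cls (\<lambda>n. s n \<oplus> t n))"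
    if st: "s \<in> C" "t \<in> C" for s t
  proof -
    have "seq_cls (\<lambda>n. a n \<oplus> b n) = seq_cls (\<lambda>n. s n \<oplus> t n)" if "a \<in> seq_cls s" "b \<in> seq_cls t" for a b
    proof -
      have ab: "a \<in> C" "(\<lambda>n. N (s n \<ominus> a n)) \<longlonglongrightarrow> 0" "b \<in> C" "(\<lambda>n. N (t n \<ominus> b n)) \<longlonglongrightarrow> 0"
        using that by (auto simp: seq_cls_mem E_iff)
      have "(\<lambda>n. N ((s n \<oplus> t n) \<ominus> (a n \<oplus> b n))) \<longlonglongrightarrow> 0"
        by (rule tendsto_zero_squeeze[OF tendsto_add[OF ab(2,4), simplified]])
          (simp_all add: add_diff C_closed[OF st(1)] C_closed[OF st(2)] C_closed[OF ab(1)] C_closed[OF ab(3)])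
      hence "seq_cls (\<lambda>n. s n \<oplus> t n) = seq_cls (\<lambda>n. a n \<oplus> b n)"
        using seq_cls_eq_iff C_add st ab by (simp add: E_iff)
      thus ?thesis by simp
    qed
    hence H: "(\<Union>t\<in>seq_cls t. seq_cls (\<lambda>n. a n \<oplus> t n)) = seq_cls (\<lambda>n. s n \<oplus> t n)" if "a \<in> seq_cls s" for a
      using that by (intro UN_const_eq[OF seq_cls_self[OF st(2)]]) auto
    show ?thesis by (rule sym, rule UN_const_eq[OF seq_cls_self[OF st(1)]], rule H)
  qed
  moreover have "seq_cls (\<lambda>n. c \<odot> s n) = (\<Union>s\<in>seq_cls s. seq_cls (\<lambda>n. c \<odot> s n))" if s: "s \<in> C" for s c
  proof (rule sym, rule UN_const_eq[OF seq_cls_self[OF s]])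
    fix a assume "a \<in> seq_cls s"
    hence a: "a \<in> C" "(\<lambda>n. N (s n \<ominus> a n)) \<longlonglongrightarrow> 0" by (auto simp: seq_cls_mem E_iff)
    have "(\<lambda>n. N (c \<odot> s n \<ominus> c \<odot> a n)) \<longlonglongrightarrow> 0"
      using tendsto_mult_right_zero[OF a(2), of "cmod c"] C_closed s a by (simp add: scale_diff)
    hence "seq_cls (\<lambda>n. c \<odot> s n) = seq_cls (\<lambda>n. c \<odot> a n)"
      using seq_cls_eq_iff C_scale s a by (simp add: E_iff)
    thus "seq_cls (\<lambda>n. c \<odot> a n) = seq_cls (\<lambda>n. c \<odot> s n)" by simp
  qed
  moreover have "seq_cls (\<lambda>n. (s n)\<^sup>\<star>) = (\<Union>s\<in>seq_cls s. seq_cls (\<lambda>n. (s n)\<^sup>\<star>))" if s: "s \<in> C" for s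
  proof (rule sym, rule UN_const_eq[OF seq_cls_self[OF s]])
    fix a assume "a \<in> seq_cls s"
    hence a: "a \<in> C" "(\<lambda>n. N (s n \<ominus> a n)) \<longlonglongrightarrow> 0" by (auto simp: seq_cls_mem E_iff)
    hence "seq_cls (\<lambda>n. (s n)\<^sup>\<star>) = seq_cls (\<lambda>n. (a n)\<^sup>\<star>)"
      using seq_cls_eq_iff C_star s a C_closed by (simp add: E_iff star_diff)
    thus "seq_cls (\<lambda>n. (a n)\<^sup>\<star>) = seq_cls (\<lambda>n. (s n)\<^sup>\<star>)" by simp
  qed
  ultimately show ?thesis
    unfolding star_hom_def by (simp add: completion_carrier)
      (simp add: seq_algebra_def completion_def flip: seq_cls_def)
qed

lemma star_algebra_completion: "star_algebra (completion A N)"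
  by (rule star_algebra_image[OF star_algebra_seq seq_cls_hom])
    (simp_all add: completion_carrier, simp_all add: seq_algebra_def completion_def seq_cls_def)

lemma seq_minus: "s \<in> C \<Longrightarrow> t \<in> C \<Longrightarrow> s \<ominus>\<^bsub>seq_algebra\<^esub> t = (\<lambda>n. s n \<ominus> t n)"
proof -
  interpret S: complex_star_algebra seq_algebra using star_algebra_seq by (simp add: star_algebra_iff)
  assume st: "s \<in> C" "t \<in> C"
  hence "s \<ominus>\<^bsub>seq_algebra\<^esub> t = s \<oplus>\<^bsub>seq_algebra\<^esub> (-1) \<odot>\<^bsub>seq_algebra\<^esub> t"
    by (intro S.minus_eq_scale) (simp_all add: seq_algebra_def)
  thus ?thesis using st C_closed by (simp add: seq_algebra_def minus_eq_scale)
qed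

lemma C_minus: "s \<in> C \<Longrightarrow> t \<in> C \<Longrightarrow> (\<lambda>n. s n \<ominus> t n) \<in> C"
  using C_add[OF _ C_scale[of t "-1"], of s] C_closed by (simp add: minus_eq_scale)

lemma cls_minus: "s \<in> C \<Longrightarrow> t \<in> C \<Longrightarrow> seq_cls s \<ominus>\<^bsub>completion A N\<^esub> seq_cls t = seq_cls (\<lambda>n. s n \<ominus> t n)"
  using star_hom_minus[OF star_algebra_seq star_algebra_completion seq_cls_hom, of s t] seq_minus[of s t]
  by (simp add: seq_algebra_def)

abbreviation "compl_norm \<equiv> completion_norm N"

lemma compl_norm_algebra_norm: "algebra_norm (completion A N) compl_norm"
proof -
  note h = star_homD[OF seq_cls_hom]
  have z: "\<zero>\<^bsub>completion A N\<^esub> = seq_cls (\<lambda>_. \<zero>)" by (simp add: completion_def seq_cls_def)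
  have nn: "0 \<le> lim (\<lambda>n. N (s n))" if "s \<in> C" for s
    by (rule LIMSEQ_le_const[OF C_norm_lim[OF that]]) (use that C_closed in auto)
  have "lim (\<lambda>n. N (s n)) = 0 \<longleftrightarrow> seq_cls s = seq_cls (\<lambda>_. \<zero>)" if s: "s \<in> C" for s
  proof -
    have "lim (\<lambda>n. N (s n)) = 0 \<longleftrightarrow> (\<lambda>n. N (s n)) \<longlonglongrightarrow> 0"
      using C_norm_lim[OF s] LIMSEQ_unique limI by metis
    also have "\<dots> \<longleftrightarrow> seq_cls s = seq_cls (\<lambda>_. \<zero>)"
      using s seq_cls_eq_iff[of s "\<lambda>_. \<zero>"] C_closed[OF s] by (simp add: E_iff minus_zero_right)
    finally show ?thesis .
  qed
  moreover have "lim (\<lambda>n. N (c \<odot> s n)) = cmod c * lim (\<lambda>n. N (s n))" if "s \<in> C" for s c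
    using tendsto_mult_left[OF C_norm_lim[OF that], of "cmod c"] C_closed[OF that] by (intro limI) (simp add: N_scale)
  moreover have "lim (\<lambda>n. N (s n \<oplus> t n)) \<le> lim (\<lambda>n. N (s n)) + lim (\<lambda>n. N (t n))" if "s \<in> C" "t \<in> C" for s t
    by (rule LIMSEQ_le[OF C_norm_lim[OF C_add] tendsto_add[OF C_norm_lim C_norm_lim]])
      (use that C_closed N_add in auto)
  ultimately show ?thesis
    using nn h(4,5) unfolding algebra_norm_def z completion_carrier
    by (simp add: completion_norm_seq seq_algebra_def C_add C_scale del: split_paired_All
        flip: h(4)[unfolded seq_algebra_def, simplified] h(5)[unfolded seq_algebra_def, simplified])
qed

lemma compl_norm_mult: "X \<in> carrier (completion A N) \<Longrightarrow> Y \<in> carrier (completion A N) \<Longrightarrow>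
    compl_norm (X \<otimes>\<^bsub>completion A N\<^esub> Y) \<le> compl_norm X * compl_norm Y"
proof -
  assume "X \<in> carrier (completion A N)" "Y \<in> carrier (completion A N)"
  then obtain s t where st: "s \<in> C" "X = seq_cls s" "t \<in> C" "Y = seq_cls t" by (auto simp: completion_carrier)
  have "X \<otimes>\<^bsub>completion A N\<^esub> Y = seq_cls (\<lambda>n. s n \<otimes> t n)"
    using star_homD(3)[OF seq_cls_hom, of s t] st by (simp add: seq_algebra_def)
  moreover have "lim (\<lambda>n. N (s n \<otimes> t n)) \<le> lim (\<lambda>n. N (s n)) * lim (\<lambda>n. N (t n))"
    by (rule LIMSEQ_le[OF C_norm_lim[OF C_mult] tendsto_mult[OF C_norm_lim C_norm_lim]])
      (use st C_closed N_mult in auto)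
  ultimately show ?thesis using st by (simp add: completion_norm_seq C_mult)
qed

lemma compl_norm_cstar: "X \<in> carrier (completion A N) \<Longrightarrow> compl_norm (X\<^sup>\<star>\<^bsub>completion A N\<^esub> \<otimes>\<^bsub>completion A N\<^esub> X) = (compl_norm X)\<^sup>2"
proof -
  assume "X \<in> carrier (completion A N)"
  then obtain s where s: "s \<in> C" "X = seq_cls s" by (auto simp: completion_carrier)
  have "X\<^sup>\<star>\<^bsub>completion A N\<^esub> = seq_cls (\<lambda>n. (s n)\<^sup>\<star>)"
    using star_homD(6)[OF seq_cls_hom, of s] s by (simp add: seq_algebra_def)
  hence "X\<^sup>\<star>\<^bsub>completion A N\<^esub> \<otimes>\<^bsub>completion A N\<^esub> X = seq_cls (\<lambda>n. (s n)\<^sup>\<star> \<otimes> s n)"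
    using star_homD(3)[OF seq_cls_hom, of "\<lambda>n. (s n)\<^sup>\<star>" s] s C_star[OF s(1)] by (simp add: seq_algebra_def)
  moreover have "lim (\<lambda>n. N ((s n)\<^sup>\<star> \<otimes> s n)) = (lim (\<lambda>n. N (s n)))\<^sup>2"
    using tendsto_power[OF C_norm_lim[OF s(1)], of 2] C_closed[OF s(1)] by (intro limI) (simp add: N_cstar)
  ultimately show ?thesis using s by (simp add: completion_norm_seq C_mult C_star)
qed

text \<open>The class of a Cauchy sequence is approximated by its own terms.\<close>

lemma compl_norm_diff_const:
  assumes "s \<in> C" "\<And>n. n \<ge> m \<Longrightarrow> N (s n \<ominus> x) \<le> e" "x \<in> carrier A"
  shows "compl_norm (seq_cls s \<ominus>\<^bsub>completion A N\<^esub> seq_cls (\<lambda>_. x)) \<le> e"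
proof -
  have c: "(\<lambda>n. s n \<ominus> x) \<in> C" using C_minus[OF assms(1) C_const[OF assms(3)]] .
  have "lim (\<lambda>n. N (s n \<ominus> x)) \<le> e"
    by (rule LIMSEQ_le_const2[OF C_norm_lim[OF c]]) (use assms in auto)
  thus ?thesis using assms c by (simp add: cls_minus completion_norm_seq)
qed

text \<open>Each class \<open>S k\<close> of a Cauchy sequence of classes is within \<open>1/(k+1)\<close> of some element \<open>t k\<close> of \<open>A\<close>. The
  sequence \<open>t\<close> is Cauchy, and its class is the limit.\<close>

lemma completion_complete:
  assumes "S \<in> cauchy_seqs (completion A N) compl_norm"
  shows "\<exists>X\<in>carrier (completion A N). (\<lambda>n. compl_norm (S n \<ominus>\<^bsub>completion A N\<^esub> X)) \<longlonglongrightarrow> 0"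
proof -
  interpret K: normed_star_algebra "completion A N" compl_norm
    using compl_norm_algebra_norm star_algebra_completion
    by (intro normed_star_algebra.intro normed_star_algebra_axioms.intro) (simp_all add: star_algebra_iff)
  have Sc: "S k \<in> carrier (completion A N)" for k using K.C_closed[OF assms] .
  hence "\<exists>s\<in>C. S k = seq_cls s" for k by (auto simp: completion_carrier)
  then obtain s where s: "\<And>k. s k \<in> C" "\<And>k. S k = seq_cls (s k)" by metis
  have "\<exists>m. \<forall>n\<ge>m. N (s k n \<ominus> s k m) < 1 / (real k + 1)" for k
  proof -
    have "1 / (real k + 1) > 0" by simp
    from C_cauchy[OF s(1)[of k] this] show ?thesis by blast
  qed
  then obtain m where m: "\<And>k n. n \<ge> m k \<Longrightarrow> N (s k n \<ominus> s k (m k)) < 1 / (real k + 1)" by metis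
  define t where "t k = s k (m k)" for k
  have tA: "t k \<in> carrier A" for k using C_closed[OF s(1)] by (simp add: t_def)
  define J where "J x = seq_cls (\<lambda>_. x)" for x
  have Jc: "x \<in> carrier A \<Longrightarrow> J x \<in> carrier (completion A N)" for x by (simp add: J_def completion_carrier)
  have d: "compl_norm (S k \<ominus>\<^bsub>completion A N\<^esub> J (t k)) \<le> 1 / (real k + 1)" for k
    unfolding s(2) J_def by (rule compl_norm_diff_const[OF s(1) _ tA, of "m k"]) (use m in \<open>auto simp: t_def less_imp_le\<close>)
  have JJ: "compl_norm (J x \<ominus>\<^bsub>completion A N\<^esub> J y) = N (x \<ominus> y)" if "x \<in> carrier A" "y \<in> carrier A" for x y
    using that by (simp add: J_def cls_minus completion_norm_seq)
  have inv0: "(\<lambda>k. 1 / (real k + 1)) \<longlonglongrightarrow> 0"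
    using LIMSEQ_inverse_real_of_nat by (simp add: inverse_eq_divide add.commute)
  have tC: "t \<in> C"
  proof (rule CI[OF tA])
    fix e :: real assume e: "e > 0"
    hence e3: "e / 3 > 0" by simp
    obtain n0 where n0: "\<And>k. k \<ge> n0 \<Longrightarrow> 1 / (real k + 1) < e / 3"
      using order_tendstoD(2)[OF inv0 e3] by (auto simp: eventually_sequentially)
    obtain n1 where n1: "\<And>k l. k \<ge> n1 \<Longrightarrow> l \<ge> n1 \<Longrightarrow> compl_norm (S k \<ominus>\<^bsub>completion A N\<^esub> S l) < e / 3"
      using K.C_cauchy[OF assms e3] by blast
    have "N (t k \<ominus> t l) < e" if "k \<ge> max n0 n1" "l \<ge> max n0 n1" for k l
    proof -
      have "N (t k \<ominus> t l) = compl_norm (J (t k) \<ominus>\<^bsub>completion A N\<^esub> J (t l))" using JJ tA by simp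
      also have "\<dots> \<le> compl_norm (J (t k) \<ominus>\<^bsub>completion A N\<^esub> S k) + compl_norm (S k \<ominus>\<^bsub>completion A N\<^esub> J (t l))"
        by (rule K.N_triangle) (use Jc tA Sc in auto)
      also have "compl_norm (S k \<ominus>\<^bsub>completion A N\<^esub> J (t l)) \<le> compl_norm (S k \<ominus>\<^bsub>completion A N\<^esub> S l) + compl_norm (S l \<ominus>\<^bsub>completion A N\<^esub> J (t l))"
        by (rule K.N_triangle) (use Jc tA Sc in auto)
      also have "compl_norm (J (t k) \<ominus>\<^bsub>completion A N\<^esub> S k) = compl_norm (S k \<ominus>\<^bsub>completion A N\<^esub> J (t k))"
        by (rule K.N_minus_commute) (use Jc tA Sc in auto)
      finally show ?thesis using d[of k] d[of l] n0[of k] n0[of l] n1[of k l] that by auto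
    qed
    thus "\<exists>n0. \<forall>m\<ge>n0. \<forall>n\<ge>n0. N (t m \<ominus> t n) < e" by blast
  qed
  have Xc: "seq_cls t \<in> carrier (completion A N)" using tC by (simp add: completion_carrier)
  have "(\<lambda>k. compl_norm (seq_cls t \<ominus>\<^bsub>completion A N\<^esub> J (t k))) \<longlonglongrightarrow> 0"
  proof (rule LIMSEQ_I)
    fix e :: real assume e: "e > 0"
    then obtain n0 where n0: "\<forall>m\<ge>n0. \<forall>n\<ge>n0. N (t m \<ominus> t n) < e / 2" using C_cauchy[OF tC, of "e / 2"] by auto
    have "compl_norm (seq_cls t \<ominus>\<^bsub>completion A N\<^esub> J (t k)) \<le> e / 2" if "k \<ge> n0" for k
      unfolding J_def by (rule compl_norm_diff_const[OF tC _ tA, of n0]) (use n0 that in \<open>auto simp: less_imp_le\<close>)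
    thus "\<exists>no. \<forall>n\<ge>no. norm (compl_norm (seq_cls t \<ominus>\<^bsub>completion A N\<^esub> J (t n)) - 0) < e"
      using e K.N_nonneg[OF K.minus_closed[OF Xc Jc[OF tA]]] by (intro exI[of _ n0]) fastforce
  qed
  from tendsto_add[OF inv0 this]
  have lim: "(\<lambda>k. 1 / (real k + 1) + compl_norm (seq_cls t \<ominus>\<^bsub>completion A N\<^esub> J (t k))) \<longlonglongrightarrow> 0" by simp
  have "(\<lambda>k. compl_norm (S k \<ominus>\<^bsub>completion A N\<^esub> seq_cls t)) \<longlonglongrightarrow> 0"
  proof (rule tendsto_zero_squeeze[OF lim])
    fix k
    show "0 \<le> compl_norm (S k \<ominus>\<^bsub>completion A N\<^esub> seq_cls t)" using Sc Xc by simp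
    have "compl_norm (S k \<ominus>\<^bsub>completion A N\<^esub> seq_cls t) \<le> compl_norm (S k \<ominus>\<^bsub>completion A N\<^esub> J (t k)) + compl_norm (J (t k) \<ominus>\<^bsub>completion A N\<^esub> seq_cls t)"
      by (rule K.N_triangle) (use Sc Xc Jc tA in auto)
    also have "compl_norm (J (t k) \<ominus>\<^bsub>completion A N\<^esub> seq_cls t) = compl_norm (seq_cls t \<ominus>\<^bsub>completion A N\<^esub> J (t k))"
      by (rule K.N_minus_commute) (use Xc Jc tA in auto)
    finally show "compl_norm (S k \<ominus>\<^bsub>completion A N\<^esub> seq_cls t) \<le> 1 / (real k + 1) + compl_norm (seq_cls t \<ominus>\<^bsub>completion A N\<^esub> J (t k))"
      using d[of k] by simp
  qed
  thus ?thesis using Xc by blast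
qed

end

text \<open>In a C*-norm the operations are continuous on bounded sets, so they pass to classes of Cauchy sequences; in the other
  direction, the embedding by constant sequences is isometric. Everything below is therefore about norms on \<open>A\<close> itself.\<close>

theorem pre_c_star_norm_iff:
  assumes "star_algebra A"
  shows "pre_c_star_norm A N \<longleftrightarrow> cstar_norm A N"
proof
  assume p: "pre_c_star_norm A N"
  then interpret normed_star_algebra A N
    using assms by (intro normed_star_algebra.intro normed_star_algebra_axioms.intro)
      (simp_all add: star_algebra_iff pre_c_star_norm_def)
  show "cstar_norm A N" using cstar_norm_of_completion p by (simp add: pre_c_star_norm_def)
next
  assume p: "cstar_norm A N"
  then interpret cstar_normed A N
    using assms by (intro cstar_normed.intro cstar_normed_axioms.intro)
      (simp_all add: star_algebra_iff)
  show "pre_c_star_norm A N"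
    unfolding pre_c_star_norm_def c_star_algebra_def
    using algebra_norm star_algebra_completion compl_norm_algebra_norm compl_norm_mult compl_norm_cstar completion_complete by blast
qed

section \<open>Adjointable operators on finitely supported vectors\<close>

definition cinner :: "('i \<Rightarrow>\<^sub>0 complex) \<Rightarrow> ('i \<Rightarrow>\<^sub>0 complex) \<Rightarrow> complex" where
  "cinner v w = (\<Sum>i\<in>Poly_Mapping.keys v. Poly_Mapping.lookup v i * cnj (Poly_Mapping.lookup w i))"

lemma cinner_sup: "finite X \<Longrightarrow> Poly_Mapping.keys v \<inter> Poly_Mapping.keys w \<subseteq> X \<Longrightarrow>
    cinner v w = (\<Sum>i\<in>X. Poly_Mapping.lookup v i * cnj (Poly_Mapping.lookup w i))"
  unfolding cinner_def
  by (rule sum.mono_neutral_cong) (auto simp: in_keys_iff)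

lemma cinner_commute: "cinner w v = cnj (cinner v w)"
proof -
  let ?X = "Poly_Mapping.keys v \<union> Poly_Mapping.keys w"
  have "cinner v w = (\<Sum>i\<in>?X. Poly_Mapping.lookup v i * cnj (Poly_Mapping.lookup w i))"
    "cinner w v = (\<Sum>i\<in>?X. Poly_Mapping.lookup w i * cnj (Poly_Mapping.lookup v i))"
    by (intro cinner_sup; auto)+
  thus ?thesis by (simp add: mult.commute)
qed

lemma cinner_add_left: "cinner (v + v') w = cinner v w + cinner v' w"
proof -
  note * = cinner_sup[of "Poly_Mapping.keys w" _ w]
  show ?thesis by (simp add: * lookup_add distrib_right sum.distrib)
qed

lemma cinner_add_right: "cinner w (v + v') = cinner w v + cinner w v'"
  by (metis cinner_add_left cinner_commute complex_cnj_add)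

abbreviation vscale :: "complex \<Rightarrow> ('i \<Rightarrow>\<^sub>0 complex) \<Rightarrow> ('i \<Rightarrow>\<^sub>0 complex)" where
  "vscale c \<equiv> Poly_Mapping.map ((*) c)"

lemma cinner_scale_left: "cinner (vscale c v) w = c * cinner v w"
proof -
  note * = cinner_sup[of "Poly_Mapping.keys w" _ w]
  show ?thesis by (simp add: * lookup_map_times sum_distrib_left mult.assoc)
qed

lemma cinner_scale_right: "cinner w (vscale c v) = cnj c * cinner w v"
  by (metis cinner_scale_left cinner_commute complex_cnj_mult)

lemma cinner_single_right: "cinner v (Poly_Mapping.single i c) = Poly_Mapping.lookup v i * cnj c"
  by (subst cinner_sup[of "{i}"]) auto

lemma cinner_ext: "(\<And>w. cinner v w = cinner v' w) \<Longrightarrow> v = v'"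
  by (rule poly_mapping_eqI) (metis cinner_single_right complex_cnj_one mult.right_neutral)

lemma cinner_ext_right: "(\<And>w. cinner w v = cinner w v') \<Longrightarrow> v = v'"
  by (rule cinner_ext) (metis cinner_commute)

definition vnorm :: "('i \<Rightarrow>\<^sub>0 complex) \<Rightarrow> real" where
  "vnorm v = L2_set (\<lambda>i. cmod (Poly_Mapping.lookup v i)) (Poly_Mapping.keys v)"

lemma vnorm_sup: "finite X \<Longrightarrow> Poly_Mapping.keys v \<subseteq> X \<Longrightarrow> vnorm v = L2_set (\<lambda>i. cmod (Poly_Mapping.lookup v i)) X"
  unfolding vnorm_def L2_set_def
  by (intro arg_cong[of _ _ sqrt] sum.mono_neutral_left) (auto simp: in_keys_iff)

lemma vnorm_nonneg [simp]: "0 \<le> vnorm v" by (simp add: vnorm_def)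

lemma vnorm_zero [simp]: "vnorm 0 = 0" by (simp add: vnorm_def)

lemma vnorm_sq: "complex_of_real ((vnorm v)\<^sup>2) = cinner v v"
  by (simp add: vnorm_def L2_set_def cinner_def sum_nonneg of_real_sum complex_norm_square del: of_real_power)

lemma vnorm_add: "vnorm (v + w) \<le> vnorm v + vnorm w"
proof -
  let ?X = "Poly_Mapping.keys v \<union> Poly_Mapping.keys w"
  note * = vnorm_sup[of ?X]
  have "L2_set (\<lambda>i. cmod (Poly_Mapping.lookup (v + w) i)) ?X
      \<le> L2_set (\<lambda>i. cmod (Poly_Mapping.lookup v i) + cmod (Poly_Mapping.lookup w i)) ?X"
    by (rule L2_set_mono) (auto simp: lookup_add norm_triangle_ineq)
  also have "\<dots> \<le> L2_set (\<lambda>i. cmod (Poly_Mapping.lookup v i)) ?X + L2_set (\<lambda>i. cmod (Poly_Mapping.lookup w i)) ?X"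
    by (rule L2_set_triangle_ineq)
  finally show ?thesis using keys_add[of v w] by (simp add: *)
qed

lemma vnorm_scale: "vnorm (vscale c v) = cmod c * vnorm v"
proof -
  have "Poly_Mapping.keys (vscale c v) \<subseteq> Poly_Mapping.keys v" by (auto simp: in_keys_iff lookup_map_times)
  hence "vnorm (vscale c v) = L2_set (\<lambda>i. cmod (Poly_Mapping.lookup (vscale c v) i)) (Poly_Mapping.keys v)"
    by (intro vnorm_sup) auto
  also have "\<dots> = cmod c * vnorm v"
    by (simp add: vnorm_def lookup_map_times norm_mult L2_set_right_distrib)
  finally show ?thesis .
qed

lemma cauchy_schwarz: "cmod (cinner v w) \<le> vnorm v * vnorm w"
proof -
  let ?X = "Poly_Mapping.keys v \<union> Poly_Mapping.keys w"
  have "cmod (cinner v w) \<le> (\<Sum>i\<in>?X. \<bar>cmod (Poly_Mapping.lookup v i)\<bar> * \<bar>cmod (Poly_Mapping.lookup w i)\<bar>)"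
    by (subst cinner_sup[of ?X]) (auto intro!: sum_norm_le simp: norm_mult)
  also have "\<dots> \<le> vnorm v * vnorm w"
    using L2_set_mult_ineq[of "\<lambda>i. cmod (Poly_Mapping.lookup v i)" "\<lambda>i. cmod (Poly_Mapping.lookup w i)" ?X]
    by (simp add: vnorm_sup[of ?X])
  finally show ?thesis .
qed

lemma vnorm_eq_zero: "vnorm v = 0 \<longleftrightarrow> v = 0"
proof
  assume "vnorm v = 0"
  hence "cinner v w = 0" for w using cauchy_schwarz[of v w] by simp
  thus "v = 0" by (intro cinner_ext) (simp add: cinner_def)
qed simp

text \<open>An operator is stored together with its adjoint with respect to the inner product, so that the
  involution is a swap of components. Linearity is automatic, as every map with an adjoint is linear.\<close>

typedef 'i op = "{TT :: (('i \<Rightarrow>\<^sub>0 complex) \<Rightarrow> ('i \<Rightarrow>\<^sub>0 complex)) \<times> (('i \<Rightarrow>\<^sub>0 complex) \<Rightarrow> ('i \<Rightarrow>\<^sub>0 complex)).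
    \<forall>v w. cinner (fst TT v) w = cinner v (snd TT w)}"
  by (rule exI[of _ "(\<lambda>v. v, \<lambda>v. v)"]) simp

lifting_forget poly_mapping.lifting
setup_lifting type_definition_op

lift_definition app :: "'i op \<Rightarrow> ('i \<Rightarrow>\<^sub>0 complex) \<Rightarrow> ('i \<Rightarrow>\<^sub>0 complex)" is fst .

lift_definition adj :: "'i op \<Rightarrow> 'i op" is "\<lambda>(T, T'). (T', T)"
  by (auto, metis cinner_commute)

lift_definition oscale :: "complex \<Rightarrow> 'i op \<Rightarrow> 'i op" is
  "\<lambda>c (T, T'). (\<lambda>v. vscale c (T v), \<lambda>v. vscale (cnj c) (T' v))"
  by (auto simp: cinner_scale_left cinner_scale_right)

lemma app_adj: "cinner (app T v) w = cinner v (app (adj T) w)"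
  by transfer auto

text \<open>The adjoint is determined by the operator because the inner product is nondegenerate.\<close>

lemma op_eqI: "(\<And>v. app S v = app T v) \<Longrightarrow> S = T"
proof -
  assume a: "\<And>v. app S v = app T v"
  hence "app (adj S) w = app (adj T) w" for w
    by (intro cinner_ext_right) (simp add: app_adj[symmetric])
  with a show "S = T" by transfer (auto simp: fun_eq_iff prod_eq_iff)
qed

lemma vscale_minus_one: "vscale (-1) v + v = 0"
  by (rule poly_mapping_eqI) (simp add: lookup_map_times lookup_add)

lemma app_add [simp]: "app T (v + w) = app T v + app T w"
  by (rule cinner_ext) (simp add: app_adj cinner_add_left)

text \<open>Stated for pairs of functions, since it is needed before the ring structure exists.\<close>

lemma op_pair_additive:
  "\<forall>v w. cinner (T v) w = cinner v (T' w) \<Longrightarrow> T (v + w) = T v + T w"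
  "\<forall>v w. cinner (T v) w = cinner v (T' w) \<Longrightarrow> T' (v + w) = T' v + T' w"
  by (rule cinner_ext, simp add: cinner_add_left)
    (rule cinner_ext_right, metis cinner_add_right)

instantiation op :: (type) ring_1
begin
lift_definition zero_op :: "'a op" is "(\<lambda>v. 0, \<lambda>v. 0)" by (auto simp: cinner_def)
lift_definition one_op :: "'a op" is "(\<lambda>v. v, \<lambda>v. v)" by auto
lift_definition plus_op :: "'a op \<Rightarrow> 'a op \<Rightarrow> 'a op" is "\<lambda>(S, S') (T, T'). (\<lambda>v. S v + T v, \<lambda>v. S' v + T' v)"
  by (auto simp: cinner_add_left cinner_add_right)
lift_definition times_op :: "'a op \<Rightarrow> 'a op \<Rightarrow> 'a op" is "\<lambda>(S, S') (T, T'). (\<lambda>v. S (T v), \<lambda>v. T' (S' v))"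
  by auto
definition uminus_op :: "'a op \<Rightarrow> 'a op" where "uminus_op T = oscale (-1) T"
definition minus_op :: "'a op \<Rightarrow> 'a op \<Rightarrow> 'a op" where "minus_op S T = S + oscale (-1) T"

instance
proof
  fix a b c :: "'a op"
  show "a * b * c = a * (b * c)" by transfer auto
  show "a + b + c = a + (b + c)" by transfer (auto simp: add.assoc)
  show "a + b = b + a" by transfer (auto simp: add.commute)
  show "0 + a = a" by transfer auto
  show "- a + a = 0" unfolding uminus_op_def by transfer (auto simp: vscale_minus_one)
  show "a - b = a + - b" by (simp add: minus_op_def uminus_op_def)
  show "1 * a = a" "a * 1 = a" by (transfer, auto)+
  show "(a + b) * c = a * c + b * c" by transfer (auto simp: op_pair_additive fun_eq_iff)
  show "a * (b + c) = a * b + a * c"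
    by transfer (clarsimp simp: fun_eq_iff, rule op_pair_additive(1), assumption)
  show "(0 :: 'a op) \<noteq> 1"
  proof transfer
    have "(\<lambda>v::'a \<Rightarrow>\<^sub>0 complex. 0 :: 'a \<Rightarrow>\<^sub>0 complex) (Poly_Mapping.single undefined 1) \<noteq> (\<lambda>v. v) (Poly_Mapping.single undefined 1)"
      by (simp add: poly_mapping_eq_iff fun_eq_iff lookup_single)
    thus "(\<lambda>v::'a \<Rightarrow>\<^sub>0 complex. 0 :: 'a \<Rightarrow>\<^sub>0 complex, \<lambda>v::'a \<Rightarrow>\<^sub>0 complex. 0 :: 'a \<Rightarrow>\<^sub>0 complex) \<noteq> (\<lambda>v. v, \<lambda>v. v)" by (metis prod.inject)
  qed
qed
end

lemma app_simps [simp]: "app 0 v = 0" "app 1 v = v" "app (S + T) v = app S v + app T v"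
  "app (S * T) v = app S (app T v)" "app (oscale c T) v = vscale c (app T v)"
  by (transfer, auto)+

lemma app_vscale [simp]: "app T (vscale c v) = vscale c (app T v)"
  by (rule cinner_ext) (simp add: app_adj cinner_scale_left)

lemma app_vzero [simp]: "app T 0 = 0"
  using app_vscale[of T 0 0] by (simp add: poly_mapping_eq_iff fun_eq_iff lookup_map_times)

lemma lookup_app_minus: "Poly_Mapping.lookup (app (S - T) v) i = Poly_Mapping.lookup (app S v) i - Poly_Mapping.lookup (app T v) i"
  by (simp add: minus_op_def lookup_add lookup_map_times)

lemma lookup_app_sum: "Poly_Mapping.lookup (app (sum f X) v) i = (\<Sum>x\<in>X. Poly_Mapping.lookup (app (f x) v) i)"
  by (induction X rule: infinite_finite_induct) (auto simp: lookup_add)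

lemma op_eq_iff_lookup: "S = T \<longleftrightarrow> (\<forall>v i. Poly_Mapping.lookup (app S v) i = Poly_Mapping.lookup (app T v) i)"
  by (auto intro: op_eqI poly_mapping_eqI)

lemma adj_adj [simp]: "adj (adj T) = T" by transfer auto
lemma adj_add: "adj (S + T) = adj S + adj T" by transfer auto
lemma adj_mult: "adj (S * T) = adj T * adj S" by transfer auto
lemma adj_scale: "adj (oscale c T) = oscale (cnj c) (adj T)" by transfer auto
lemma adj_one [simp]: "adj 1 = 1" by transfer auto
lemma adj_zero [simp]: "adj 0 = 0" by transfer auto
lemma adj_sum: "adj (sum f X) = (\<Sum>x\<in>X. adj (f x))"
  by (induction X rule: infinite_finite_induct) (auto simp: adj_add)
lemma adj_power: "adj (T ^ n) = adj T ^ n" by (induction n) (auto simp: adj_mult power_commutes)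

lemma vscale_add_left: "vscale (c + d) v = vscale c v + vscale d v"
  by (rule poly_mapping_eqI) (simp add: lookup_map_times lookup_add distrib_right)
lemma vscale_vscale: "vscale c (vscale d v) = vscale (c * d) v"
  by (rule poly_mapping_eqI) (simp add: lookup_map_times)
lemma vscale_one: "vscale 1 v = v"
  by (rule poly_mapping_eqI) (simp add: lookup_map_times)
lemma vscale_add_right: "vscale c (v + w) = vscale c v + vscale c w"
  by (rule poly_mapping_eqI) (simp add: lookup_map_times lookup_add distrib_left)

lemma oscale_add_left: "oscale (c + d) T = oscale c T + oscale d T"
  by (rule op_eqI) (simp add: vscale_add_left)
lemma oscale_add_right: "oscale c (S + T) = oscale c S + oscale c T"
  by (rule op_eqI) (simp add: vscale_add_right)
lemma oscale_oscale [simp]: "oscale c (oscale d T) = oscale (c * d) T"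
  by (rule op_eqI) (simp add: vscale_vscale)
lemma oscale_one [simp]: "oscale 1 T = T"
  by (rule op_eqI) (simp add: vscale_one)
lemma oscale_mult_left [simp]: "oscale c S * T = oscale c (S * T)"
  by (rule op_eqI) simp
lemma oscale_mult_right [simp]: "S * oscale c T = oscale c (S * T)"
  by (rule op_eqI) simp
lemma oscale_zero_left [simp]: "oscale 0 T = 0"
  by (simp add: op_eq_iff_lookup lookup_map_times)
lemma oscale_zero_right [simp]: "oscale c 0 = 0"
  by (simp add: op_eq_iff_lookup lookup_map_times)
lemma oscale_sum: "oscale c (sum f X) = (\<Sum>x\<in>X. oscale c (f x))"
  by (induction X rule: infinite_finite_induct) (auto simp: oscale_add_right)
lemma oscale_minus: "oscale c (S - T) = oscale c S - oscale c T"
  by (simp add: minus_op_def oscale_add_right mult.commute)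

definition op_algebra :: "'i op set \<Rightarrow> 'i op star_algebra" where
  "op_algebra S = \<lparr>carrier = S, monoid.mult = (*), one = 1, zero = 0, add = (+), module.smult = oscale, star = adj\<rparr>"

lemma op_algebra_simps [simp]:
  "carrier (op_algebra S) = S" "x \<otimes>\<^bsub>op_algebra S\<^esub> y = x * y" "\<one>\<^bsub>op_algebra S\<^esub> = 1" "\<zero>\<^bsub>op_algebra S\<^esub> = 0"
  "x \<oplus>\<^bsub>op_algebra S\<^esub> y = x + y" "c \<odot>\<^bsub>op_algebra S\<^esub> x = oscale c x" "x\<^sup>\<star>\<^bsub>op_algebra S\<^esub> = adj x"
  by (simp_all add: op_algebra_def)

definition op_subalgebra :: "'i op set \<Rightarrow> bool" where
  "op_subalgebra S \<longleftrightarrow> 1 \<in> S \<and> (\<forall>x\<in>S. \<forall>y\<in>S. x + y \<in> S \<and> x * y \<in> S) \<and> (\<forall>c. \<forall>x\<in>S. oscale c x \<in> S) \<and> (\<forall>x\<in>S. adj x \<in> S)"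

lemma star_algebra_op:
  assumes "op_subalgebra S"
  shows "star_algebra (op_algebra S)"
proof (rule star_algebraI)
  have S: "1 \<in> S" "\<And>x y. x \<in> S \<Longrightarrow> y \<in> S \<Longrightarrow> x + y \<in> S" "\<And>x y. x \<in> S \<Longrightarrow> y \<in> S \<Longrightarrow> x * y \<in> S"
    "\<And>c x. x \<in> S \<Longrightarrow> oscale c x \<in> S" "\<And>x. x \<in> S \<Longrightarrow> adj x \<in> S"
    using assms by (auto simp: op_subalgebra_def)
  have z: "0 \<in> S" using S(4)[OF S(1), of 0] by simp
  show "ring (op_algebra S)"
  proof (rule ringI)
    show "abelian_group (op_algebra S)"
    proof (rule abelian_groupI)
      fix x assume "x \<in> carrier (op_algebra S)"
      hence "- x \<in> S" using S(4)[of x "-1"] uminus_op_def[of x] by simp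
      thus "\<exists>y\<in>carrier (op_algebra S). y \<oplus>\<^bsub>op_algebra S\<^esub> x = \<zero>\<^bsub>op_algebra S\<^esub>"
        by (intro bexI[of _ "- x"]) simp_all
    qed (auto simp: S z add_ac)
    show "monoid (op_algebra S)" by (rule monoidI) (auto simp: S mult.assoc)
  qed (auto simp: algebra_simps)
  show "c \<odot>\<^bsub>op_algebra S\<^esub> x \<in> carrier (op_algebra S)" if "x \<in> carrier (op_algebra S)" for c x
    using that S by simp
  show "x\<^sup>\<star>\<^bsub>op_algebra S\<^esub> \<in> carrier (op_algebra S)" if "x \<in> carrier (op_algebra S)" for x
    using that S by simp
qed (simp_all add: oscale_add_left oscale_add_right adj_add adj_scale adj_mult)

subsection \<open>The operator norm\<close>

definition bounded_by :: "'i op \<Rightarrow> real \<Rightarrow> bool" where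
  "bounded_by T K \<longleftrightarrow> 0 \<le> K \<and> (\<forall>v. vnorm (app T v) \<le> K * vnorm v)"

text \<open>An adjointable operator on finitely supported vectors can be unbounded, in which case the infimum is
  over the empty set. The norm is used only on algebras of bounded operators.\<close>

definition opnorm :: "'i op \<Rightarrow> real" where
  "opnorm T = Inf {K. bounded_by T K}"

lemma bounded_byD: "bounded_by T K \<Longrightarrow> vnorm (app T v) \<le> K * vnorm v" "bounded_by T K \<Longrightarrow> 0 \<le> K"
  by (auto simp: bounded_by_def)

lemma bounded_by_add: "bounded_by S K \<Longrightarrow> bounded_by T L \<Longrightarrow> bounded_by (S + T) (K + L)"
  unfolding bounded_by_def
proof (intro conjI allI; elim conjE)
  fix v assume a: "\<forall>v. vnorm (app S v) \<le> K * vnorm v" "\<forall>v. vnorm (app T v) \<le> L * vnorm v"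
  have "vnorm (app (S + T) v) \<le> vnorm (app S v) + vnorm (app T v)" by (simp add: vnorm_add)
  also have "\<dots> \<le> K * vnorm v + L * vnorm v" using a by (intro add_mono) auto
  finally show "vnorm (app (S + T) v) \<le> (K + L) * vnorm v" by (simp add: distrib_right)
qed auto

lemma bounded_by_mult: "bounded_by S K \<Longrightarrow> bounded_by T L \<Longrightarrow> bounded_by (S * T) (K * L)"
  unfolding bounded_by_def
proof (intro conjI allI; elim conjE)
  fix v assume a: "\<forall>v. vnorm (app S v) \<le> K * vnorm v" "\<forall>v. vnorm (app T v) \<le> L * vnorm v" "0 \<le> K" "0 \<le> L"
  have "vnorm (app (S * T) v) \<le> K * vnorm (app T v)" using a by simp
  also have "\<dots> \<le> K * (L * vnorm v)" using a by (intro mult_left_mono) auto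
  finally show "vnorm (app (S * T) v) \<le> (K * L) * vnorm v" by simp
qed auto

lemma bounded_by_scale: "bounded_by T K \<Longrightarrow> bounded_by (oscale c T) (cmod c * K)"
  unfolding bounded_by_def by (auto simp: vnorm_scale mult.assoc intro!: mult_left_mono)

text \<open>The square of the norm of \<open>T v\<close> is the inner product of \<open>v\<close> with \<open>T* T v\<close>; apply Cauchy-Schwarz.\<close>

lemma bounded_by_cstar: "bounded_by (adj T * T) K \<Longrightarrow> bounded_by T (sqrt K)"
  unfolding bounded_by_def
proof (intro conjI allI; elim conjE)
  fix v assume a: "\<forall>v. vnorm (app (adj T * T) v) \<le> K * vnorm v" "0 \<le> K"
  have "complex_of_real ((vnorm (app T v))\<^sup>2) = cinner v (app (adj T * T) v)"
    by (simp add: vnorm_sq app_adj del: of_real_power)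
  hence "(vnorm (app T v))\<^sup>2 = cmod (cinner v (app (adj T * T) v))"
    by (metis norm_of_real abs_power2)
  also have "\<dots> \<le> vnorm v * vnorm (app (adj T * T) v)" by (rule cauchy_schwarz)
  also have "\<dots> \<le> vnorm v * (K * vnorm v)" using a by (intro mult_left_mono) auto
  also have "\<dots> = (sqrt K * vnorm v)\<^sup>2" using a by (simp add: power2_eq_square)
  finally show "vnorm (app T v) \<le> sqrt K * vnorm v"
    by (rule power2_le_imp_le) (use a in simp)
qed auto

lemma bounded_by_adj: "bounded_by T K \<Longrightarrow> bounded_by (adj T) K"
  unfolding bounded_by_def
proof (intro conjI allI; elim conjE)
  fix v assume a: "\<forall>v. vnorm (app T v) \<le> K * vnorm v" "0 \<le> K"
  let ?w = "app (adj T) v"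
  have "complex_of_real ((vnorm ?w)\<^sup>2) = cinner (app T ?w) v"
    by (simp add: vnorm_sq app_adj del: of_real_power)
  hence "(vnorm ?w)\<^sup>2 = cmod (cinner (app T ?w) v)"
    by (metis norm_of_real abs_power2)
  also have "\<dots> \<le> vnorm (app T ?w) * vnorm v" by (rule cauchy_schwarz)
  also have "\<dots> \<le> (K * vnorm ?w) * vnorm v" using a by (intro mult_right_mono) auto
  finally have "vnorm ?w * vnorm ?w \<le> (K * vnorm v) * vnorm ?w" by (simp add: power2_eq_square mult_ac)
  thus "vnorm ?w \<le> K * vnorm v"
    using a by (cases "vnorm ?w = 0") (auto simp: mult_le_cancel_right less_le)
qed auto

lemma opnorm_le: "bounded_by T K \<Longrightarrow> opnorm T \<le> K"
  unfolding opnorm_def by (rule cInf_lower) (auto intro!: bdd_belowI[of _ 0] simp: bounded_by_def)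

lemma bounded_by_opnorm:
  assumes "bounded_by T K"
  shows "bounded_by T (opnorm T)"
proof -
  have ne: "{K. bounded_by T K} \<noteq> {}" using assms by auto
  have 0: "0 \<le> opnorm T" unfolding opnorm_def by (rule cInf_greatest[OF ne]) (auto simp: bounded_by_def)
  have "vnorm (app T v) \<le> opnorm T * vnorm v" for v
  proof (cases "vnorm v = 0")
    case True
    thus ?thesis using assms bounded_byD(1)[OF assms, of v] by simp
  next
    case False
    hence p: "vnorm v > 0" by (simp add: less_le)
    have "vnorm (app T v) / vnorm v \<le> opnorm T"
      unfolding opnorm_def by (rule cInf_greatest[OF ne]) (use p in \<open>auto simp: bounded_by_def divide_le_eq\<close>)
    thus ?thesis using p by (simp add: divide_le_eq)
  qed
  with 0 show ?thesis by (simp add: bounded_by_def)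
qed

lemma opnorm_cstar_norm:
  assumes S: "op_subalgebra S" and b: "\<And>x. x \<in> S \<Longrightarrow> \<exists>K. bounded_by x K"
  shows "cstar_norm (op_algebra S) opnorm"
proof -
  have b': "bounded_by x (opnorm x)" if "x \<in> S" for x using b[OF that] bounded_by_opnorm by blast
  have cl: "x + y \<in> S" "x * y \<in> S" "oscale c x \<in> S" "adj x \<in> S" if "x \<in> S" "y \<in> S" for x y c
    using S that by (auto simp: op_subalgebra_def)
  have nn: "0 \<le> opnorm x" if "x \<in> S" for x using bounded_byD(2)[OF b'[OF that]] .
  have zero: "opnorm x = 0 \<longleftrightarrow> x = 0" if "x \<in> S" for x
  proof
    assume "opnorm x = 0"
    hence "vnorm (app x v) = 0" for v using bounded_byD(1)[OF b'[OF that], of v] vnorm_nonneg[of "app x v"] by simp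
    thus "x = 0" by (intro op_eqI) (simp add: vnorm_eq_zero)
  next
    assume "x = 0"
    moreover have "opnorm (0 :: 'a op) \<le> 0" by (rule opnorm_le) (simp add: bounded_by_def)
    ultimately show "opnorm x = 0" using nn[OF that] by simp
  qed
  have scale_le: "opnorm (oscale c x) \<le> cmod c * opnorm x" if "x \<in> S" for c x
    by (rule opnorm_le, rule bounded_by_scale, rule b'[OF that])
  have scale: "opnorm (oscale c x) = cmod c * opnorm x" if "x \<in> S" for c x
  proof (cases "c = 0")
    case True
    have "0 \<in> S" using cl(3)[OF that that, of 0] by simp
    thus ?thesis using True zero by simp
  next
    case False
    have "opnorm (oscale (inverse c) (oscale c x)) \<le> cmod (inverse c) * opnorm (oscale c x)"
      by (rule scale_le) (use cl that in auto)
    hence "cmod c * opnorm x \<le> opnorm (oscale c x)" using False by (simp add: norm_inverse norm_divide field_simps)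
    thus ?thesis using scale_le[OF that, of c] by simp
  qed
  have cs: "opnorm (adj x * x) = (opnorm x)\<^sup>2" if x: "x \<in> S" for x
  proof -
    have m: "adj x * x \<in> S" using cl x by auto
    have "opnorm (adj x * x) \<le> opnorm x * opnorm x"
      by (intro opnorm_le bounded_by_mult bounded_by_adj b' x)
    moreover have "opnorm x \<le> sqrt (opnorm (adj x * x))"
      by (intro opnorm_le bounded_by_cstar b' m)
    hence "(opnorm x)\<^sup>2 \<le> opnorm (adj x * x)" using nn[OF m] nn[OF x] real_le_rsqrt sqrt_le_D
      by (metis real_sqrt_le_iff real_sqrt_abs abs_of_nonneg)
    ultimately show ?thesis by (simp add: power2_eq_square)
  qed
  show ?thesis
    unfolding cstar_norm_def algebra_norm_def
    using nn zero scale cs by (auto intro!: opnorm_le bounded_by_add bounded_by_mult b')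
qed

section \<open>Weighted shifts\<close>

text \<open>The operator is described on functions, by pulling back along \<open>\<sigma>\<close> and multiplying by the weight \<open>w\<close>. It
  thus moves the basis vector at \<open>\<sigma> i\<close> to \<open>w i\<close> times the basis vector at \<open>i\<close>.\<close>

definition wshift :: "('i \<Rightarrow> 'i) \<Rightarrow> ('i \<Rightarrow> complex) \<Rightarrow> ('i \<Rightarrow>\<^sub>0 complex) \<Rightarrow> ('i \<Rightarrow>\<^sub>0 complex)" where
  "wshift \<sigma> w v = Abs_poly_mapping (\<lambda>i. w i * Poly_Mapping.lookup v (\<sigma> i))"

text \<open>A weighted shift has as adjoint the weighted shift along the inverse map with conjugate weights.
  The maps need to be mutually inverse only where the weights do not vanish, so \<open>\<sigma>\<close> may
  be a partial bijection, such as the truncated predecessor on \<open>\<nat>\<close>.\<close>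

definition half_pair :: "('i \<Rightarrow> 'i) \<Rightarrow> ('i \<Rightarrow> complex) \<Rightarrow> ('i \<Rightarrow> 'i) \<Rightarrow> ('i \<Rightarrow> complex) \<Rightarrow> bool" where
  "half_pair \<sigma> w \<sigma>' w' \<longleftrightarrow> (\<forall>i. w i \<noteq> 0 \<longrightarrow> \<sigma>' (\<sigma> i) = i \<and> w' (\<sigma> i) = cnj (w i))"

definition shift_pair where "shift_pair \<sigma> w \<sigma>' w' \<longleftrightarrow> half_pair \<sigma> w \<sigma>' w' \<and> half_pair \<sigma>' w' \<sigma> w"

lemma shift_pair_sym: "shift_pair \<sigma> w \<sigma>' w' \<Longrightarrow> shift_pair \<sigma>' w' \<sigma> w"
  by (auto simp: shift_pair_def)

lemma lookup_wshift:
  assumes "half_pair \<sigma> w \<sigma>' w'"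
  shows "Poly_Mapping.lookup (wshift \<sigma> w v) i = w i * Poly_Mapping.lookup v (\<sigma> i)"
proof -
  have "{i. w i * Poly_Mapping.lookup v (\<sigma> i) \<noteq> 0} \<subseteq> \<sigma>' ` Poly_Mapping.keys v"
  proof
    fix i assume "i \<in> {i. w i * Poly_Mapping.lookup v (\<sigma> i) \<noteq> 0}"
    hence "i = \<sigma>' (\<sigma> i)" "\<sigma> i \<in> Poly_Mapping.keys v" using assms by (auto simp: half_pair_def in_keys_iff)
    thus "i \<in> \<sigma>' ` Poly_Mapping.keys v" by blast
  qed
  hence "finite {i. w i * Poly_Mapping.lookup v (\<sigma> i) \<noteq> 0}" by (rule finite_subset) simp
  thus ?thesis by (simp add: wshift_def lookup_Abs_poly_mapping)
qed

text \<open>Both inner products are sums over the pairs of indices matched by the partial bijection, and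
  reindexing along it turns one into the other.\<close>

lemma wshift_adj:
  assumes "shift_pair \<sigma> w \<sigma>' w'"
  shows "cinner (wshift \<sigma> w v) z = cinner v (wshift \<sigma>' w' z)"
proof -
  have h: "half_pair \<sigma> w \<sigma>' w'" "half_pair \<sigma>' w' \<sigma> w" using assms by (auto simp: shift_pair_def)
  let ?X = "{i \<in> Poly_Mapping.keys z. w i \<noteq> 0}" and ?Y = "{j \<in> \<sigma> ` Poly_Mapping.keys z. w' j \<noteq> 0 \<and> \<sigma>' j \<in> Poly_Mapping.keys z}"
  have "cinner (wshift \<sigma> w v) z = (\<Sum>i\<in>?X. w i * Poly_Mapping.lookup v (\<sigma> i) * cnj (Poly_Mapping.lookup z i))"
    by (subst cinner_sup[of ?X]) (auto simp: lookup_wshift[OF h(1)] in_keys_iff)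
  also have "\<dots> = (\<Sum>j\<in>?Y. Poly_Mapping.lookup v j * cnj (w' j * Poly_Mapping.lookup z (\<sigma>' j)))"
    by (rule sum.reindex_bij_witness[of _ \<sigma>' \<sigma>])
      (use h in \<open>auto simp: half_pair_def\<close>)
  also have "\<dots> = cinner v (wshift \<sigma>' w' z)"
  proof (rule cinner_sup[symmetric, where v = v and w = "wshift \<sigma>' w' z" and X = ?Y, unfolded lookup_wshift[OF h(2)]])
    show "Poly_Mapping.keys v \<inter> Poly_Mapping.keys (wshift \<sigma>' w' z) \<subseteq> ?Y"
    proof
      fix j assume "j \<in> Poly_Mapping.keys v \<inter> Poly_Mapping.keys (wshift \<sigma>' w' z)"
      hence "w' j \<noteq> 0" "\<sigma>' j \<in> Poly_Mapping.keys z" by (auto simp: in_keys_iff lookup_wshift[OF h(2)])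
      moreover from this have "j = \<sigma> (\<sigma>' j)" using h(2) by (auto simp: half_pair_def)
      ultimately show "j \<in> ?Y" by blast
    qed
  qed auto
  finally show ?thesis .
qed

definition wop :: "('i \<Rightarrow> 'i) \<Rightarrow> ('i \<Rightarrow> complex) \<Rightarrow> ('i \<Rightarrow> 'i) \<Rightarrow> ('i \<Rightarrow> complex) \<Rightarrow> 'i op" where
  "wop \<sigma> w \<sigma>' w' = Abs_op (wshift \<sigma> w, wshift \<sigma>' w')"

lemma app_wop: "shift_pair \<sigma> w \<sigma>' w' \<Longrightarrow> app (wop \<sigma> w \<sigma>' w') v = wshift \<sigma> w v"
  by (simp add: wop_def app.rep_eq Abs_op_inverse wshift_adj)

lemma lookup_wop: "shift_pair \<sigma> w \<sigma>' w' \<Longrightarrow>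
    Poly_Mapping.lookup (app (wop \<sigma> w \<sigma>' w') v) i = w i * Poly_Mapping.lookup v (\<sigma> i)"
  by (simp only: app_wop, rule lookup_wshift[of \<sigma> w \<sigma>' w']) (simp add: shift_pair_def)

lemma adj_wop: "shift_pair \<sigma> w \<sigma>' w' \<Longrightarrow> adj (wop \<sigma> w \<sigma>' w') = wop \<sigma>' w' \<sigma> w"
  by (rule op_eqI) (simp add: wop_def app.rep_eq adj.rep_eq Abs_op_inverse wshift_adj shift_pair_sym)

type_synonym idx = "nat \<times> int \<times> int"

text \<open>The representation. On the basis vectors \<open>e(j,a,b)\<close> with \<open>j \<in> \<nat>\<close> and \<open>a, b \<in> \<int>\<close> the generators act by
  \<open>\<alpha> e(j,a,b) = sqrt(1 - Q\<^sup>j) e(j-1,a,b)\<close>, \<open>\<gamma> e(j,a,b) = q\<^sup>j e(j,a+1,b)\<close> and \<open>u e(j,a,b) = \<mu>\<^sup>-\<^sup>a e(j,a,b+1)\<close>.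
  It is the standard faithful representation of \<open>SU\<^sub>q(2)\<close> on the first two coordinates, made covariant
  for the automorphism by the third.\<close>

locale suq2_rep =
  fixes q :: real and \<mu> :: complex
  assumes q: "-1 < q" "q < 1" "q \<noteq> 0" and lam: "cmod \<mu> = 1"
begin

definition Q :: real where "Q = q\<^sup>2"

lemma Q: "0 < Q" "Q < 1"
  using q by (auto simp: Q_def power2_less_1_iff abs_square_less_1)

lemma Qpow: "Q ^ n \<le> 1" "0 < Q ^ n" "n > 0 \<Longrightarrow> Q ^ n < 1"
  using Q by (auto simp: power_le_one power_less_one_iff)

text \<open>The weight vanishes at \<open>0\<close>, so \<open>\<alpha>\<close> kills the vectors with \<open>j = 0\<close> and the value of \<open>j - 1\<close>
  at \<open>j = 0\<close> does not matter.\<close>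

definition r :: "nat \<Rightarrow> complex" where "r j = complex_of_real (sqrt (1 - Q ^ j))"

lemma r_cnj [simp]: "cnj (r j) = r j" by (simp add: r_def)
lemma r_0 [simp]: "r 0 = 0" by (simp add: r_def)
lemma r_sq: "r j * r j = 1 - complex_of_real Q ^ j"
  using Qpow[of j] by (simp add: r_def flip: of_real_mult)
lemma r_nz: "j > 0 \<Longrightarrow> r j \<noteq> 0" using Qpow(3)[of j] by (simp add: r_def)

lemma lam_nz [simp]: "\<mu> \<noteq> 0" using lam by auto
lemma lam_cnj: "cnj \<mu> = inverse \<mu>"
  using lam complex_norm_square[of \<mu>] by (simp add: field_simps)
lemma cnj_powi: "cnj (z powi n) = cnj z powi n"
  by (cases n rule: int_cases4) (auto simp: power_int_minus)
definition opA :: "idx op" where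
  "opA = wop (\<lambda>(j,a,b). (Suc j, a, b)) (\<lambda>(j,a,b). r (Suc j)) (\<lambda>(j,a,b). (j - 1, a, b)) (\<lambda>(j,a,b). r j)"
definition opG :: "idx op" where
  "opG = wop (\<lambda>(j,a,b). (j, a - 1, b)) (\<lambda>(j,a,b). complex_of_real q ^ j) (\<lambda>(j,a,b). (j, a + 1, b)) (\<lambda>(j,a,b). complex_of_real q ^ j)"
definition opU :: "idx op" where
  "opU = wop (\<lambda>(j,a,b). (j, a, b - 1)) (\<lambda>(j,a,b). \<mu> powi (- a)) (\<lambda>(j,a,b). (j, a, b + 1)) (\<lambda>(j,a,b). \<mu> powi a)"
text \<open>Functions of the first coordinate. They contain all polynomials in \<open>c\<close>, and their
  calculus is pointwise.\<close>

definition diag :: "(nat \<Rightarrow> complex) \<Rightarrow> idx op" where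
  "diag f = wop id (\<lambda>(j,a,b). f j) id (\<lambda>(j,a,b). cnj (f j))"

lemma shift_pair_A: "shift_pair (\<lambda>(j,a,b). (Suc j, a, b)) (\<lambda>(j,a::int,b::int). r (Suc j)) (\<lambda>(j,a,b). (j - 1, a, b)) (\<lambda>(j,a,b). r j)"
  by (auto simp: shift_pair_def half_pair_def elim!: r_nz) (metis Suc_pred gr0I r_0)+

lemma shift_pair_G: "shift_pair (\<lambda>(j,a,b). (j, a - 1, b)) (\<lambda>(j,a::int,b::int). complex_of_real q ^ j) (\<lambda>(j,a,b). (j, a + 1, b)) (\<lambda>(j,a,b). complex_of_real q ^ j)"
  by (auto simp: shift_pair_def half_pair_def)

lemma shift_pair_U: "shift_pair (\<lambda>(j::nat,a,b::int). (j, a, b - 1)) (\<lambda>(j,a,b). \<mu> powi (- a)) (\<lambda>(j,a,b). (j, a, b + 1)) (\<lambda>(j,a,b). \<mu> powi a)"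
  by (auto simp: shift_pair_def half_pair_def lam_cnj power_int_inverse power_int_minus)

lemma shift_pair_diag: "shift_pair id (\<lambda>(j::nat,a::int,b::int). f j) id (\<lambda>(j,a,b). cnj (f j))"
  by (auto simp: shift_pair_def half_pair_def)

lemma op_lookups [simp]:
  "Poly_Mapping.lookup (app opA v) (j,a,b) = r (Suc j) * Poly_Mapping.lookup v (Suc j, a, b)"
  "Poly_Mapping.lookup (app (adj opA) v) (j,a,b) = r j * Poly_Mapping.lookup v (j - 1, a, b)"
  "Poly_Mapping.lookup (app opG v) (j,a,b) = q ^ j * Poly_Mapping.lookup v (j, a - 1, b)"
  "Poly_Mapping.lookup (app (adj opG) v) (j,a,b) = q ^ j * Poly_Mapping.lookup v (j, a + 1, b)"
  "Poly_Mapping.lookup (app opU v) (j,a,b) = \<mu> powi (- a) * Poly_Mapping.lookup v (j, a, b - 1)"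
  "Poly_Mapping.lookup (app (adj opU) v) (j,a,b) = \<mu> powi a * Poly_Mapping.lookup v (j, a, b + 1)"
  "Poly_Mapping.lookup (app (diag f) v) (j,a,b) = f j * Poly_Mapping.lookup v (j, a, b)"
  using lookup_wop[OF shift_pair_A, of v "(j,a,b)"] lookup_wop[OF shift_pair_sym[OF shift_pair_A], of v "(j,a,b)"]
    lookup_wop[OF shift_pair_G, of v "(j,a,b)"] lookup_wop[OF shift_pair_sym[OF shift_pair_G], of v "(j,a,b)"]
    lookup_wop[OF shift_pair_U, of v "(j,a,b)"] lookup_wop[OF shift_pair_sym[OF shift_pair_U], of v "(j,a,b)"]
    lookup_wop[OF shift_pair_diag[of f], of v "(j,a,b)"]
  unfolding opA_def opG_def opU_def diag_def adj_wop[OF shift_pair_A] adj_wop[OF shift_pair_G] adj_wop[OF shift_pair_U]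
  by simp_all

lemma adj_diag: "adj (diag f) = diag (\<lambda>j. cnj (f j))"
  using shift_pair_diag[of f] by (simp add: diag_def adj_wop)

lemmas op_ext = op_eq_iff_lookup split_paired_All lookup_app_minus lookup_add lookup_map_times

lemma op_eqI3: "(\<And>v j a b. Poly_Mapping.lookup (app X v) (j,a,b) = Poly_Mapping.lookup (app Y v) (j,a,b)) \<Longrightarrow> X = Y"
  for X Y :: "idx op"
  by (auto simp: op_eq_iff_lookup)

lemma diag_mult: "diag f * diag g = diag (\<lambda>j. f j * g j)" by (simp add: op_ext)
lemma diag_add: "diag f + diag g = diag (\<lambda>j. f j + g j)" by (simp add: op_ext distrib_right)
lemma diag_minus: "diag f - diag g = diag (\<lambda>j. f j - g j)" by (simp add: op_ext left_diff_distrib)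
lemma diag_scale: "oscale c (diag f) = diag (\<lambda>j. c * f j)" by (simp add: op_ext)
lemma diag_one: "diag (\<lambda>_. 1) = 1" by (simp add: op_ext)
lemma diag_power: "diag f ^ n = diag (\<lambda>j. f j ^ n)"
  by (induction n) (simp_all add: diag_one diag_mult)
lemma diag_sum: "finite X \<Longrightarrow> (\<Sum>x\<in>X. diag (f x)) = diag (\<lambda>j. \<Sum>x\<in>X. f x j)"
  by (induction X rule: finite_induct) (auto simp: diag_add, simp add: op_ext)

lemma q_sq: "complex_of_real q ^ j * (complex_of_real q ^ j * z) = complex_of_real Q ^ j * z"
  by (simp add: Q_def power_mult_distrib power2_eq_square mult_ac)

lemma r_r: "r j * (r j * z) = (1 - complex_of_real Q ^ j) * z"
  by (simp add: r_sq flip: mult.assoc)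

text \<open>The element \<open>c = \<gamma>*\<gamma>\<close>, whose eigenvalues are the powers of \<open>Q\<close>.\<close>

definition opC :: "idx op" where "opC = diag (\<lambda>j. complex_of_real Q ^ j)"

lemma GG: "adj opG * opG = opC" "opG * adj opG = opC"
  by (simp_all add: op_ext opC_def q_sq)
lemma AA: "adj opA * opA = diag (\<lambda>j. 1 - complex_of_real Q ^ j)"
   "opA * adj opA = diag (\<lambda>j. 1 - complex_of_real Q ^ Suc j)"
proof -
  have "Poly_Mapping.lookup (app (adj opA * opA) v) (j,a,b) = Poly_Mapping.lookup (app (diag (\<lambda>j. 1 - complex_of_real Q ^ j)) v) (j,a,b)" for v j a b
    by (cases j) (simp_all add: r_r del: power_Suc)
  thus "adj opA * opA = diag (\<lambda>j. 1 - complex_of_real Q ^ j)" by (rule op_eqI3)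
qed (simp add: op_ext r_r del: power_Suc)
lemma AG: "opA * opG = oscale q (opG * opA)" "opA * adj opG = oscale q (adj opG * opA)"
  by (simp_all add: op_ext)
lemma UU: "adj opU * opU = 1" "opU * adj opU = 1"
  by (simp_all add: op_ext power_int_minus)
lemma UA: "opA * opU = opU * opA" "opA * adj opU = adj opU * opA"
  by (simp_all add: op_ext)
lemma GU: "opG * opU = oscale \<mu> (opU * opG)"
  by (simp add: op_ext power_int_diff power_int_minus field_simps)
fun gen :: "generator \<Rightarrow> idx op" where
  "gen Alpha = opA" | "gen Gamma = opG" | "gen Unitary = opU"

lemma op_subalgebra_UNIV: "op_subalgebra UNIV" by (simp add: op_subalgebra_def)

sublocale opr: star_algebra_gens "op_algebra UNIV" gen
  using star_algebra_op[OF op_subalgebra_UNIV]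
  by (intro star_algebra_gens.intro star_algebra_gens_axioms.intro) (simp_all add: star_algebra_iff)

abbreviation "ev \<equiv> free_eval (op_algebra UNIV) gen"

lemmas ev_simps = star_homD(2-6)[OF opr.free_eval_hom, simplified] opr.free_eval_gen

lemma ev_minus: "ev (p - p') = ev p - ev p'"
proof -
  have "p - p' = p + Poly_Mapping.map ((*) (-1)) p'"
    by (rule poly_mapping_eqI) (simp add: lookup_map_times lookup_add lookup_minus)
  thus ?thesis by (simp only: ev_simps minus_op_def)
qed

text \<open>The image of the crossed product. Most of the work takes place in this concrete algebra, where
  identities are checked on basis vectors.\<close>

definition S :: "idx op set" where "S = range ev"

lemma S_subalgebra: "op_subalgebra S"
  unfolding op_subalgebra_def S_def
proof (safe)
  show "1 \<in> range ev" by (rule range_eqI[of _ _ "Poly_Mapping.single [] 1"]) simp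
  fix p p' c show "ev p + ev p' \<in> range ev" "ev p * ev p' \<in> range ev" "oscale c (ev p) \<in> range ev" "adj (ev p) \<in> range ev"
    by (metis ev_simps rangeI)+
qed

lemma S_closed: "1 \<in> S" "x \<in> S \<Longrightarrow> y \<in> S \<Longrightarrow> x + y \<in> S" "x \<in> S \<Longrightarrow> y \<in> S \<Longrightarrow> x * y \<in> S"
  "x \<in> S \<Longrightarrow> oscale c x \<in> S" "x \<in> S \<Longrightarrow> adj x \<in> S"
  using S_subalgebra by (auto simp: op_subalgebra_def)

lemma S_minus: "x \<in> S \<Longrightarrow> y \<in> S \<Longrightarrow> x - y \<in> S"
  by (simp add: minus_op_def S_closed)
lemma S_zero: "0 \<in> S" using S_closed(4)[OF S_closed(1), of 0] by simp
lemma S_power: "x \<in> S \<Longrightarrow> x ^ n \<in> S" by (induction n) (auto intro: S_closed)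
lemma S_sum: "(\<And>i. i \<in> X \<Longrightarrow> f i \<in> S) \<Longrightarrow> sum f X \<in> S"
  by (induction X rule: infinite_finite_induct) (auto intro: S_closed S_zero)
lemma S_gen: "opA \<in> S" "opG \<in> S" "opU \<in> S"
  unfolding S_def by (metis gen.simps opr.free_eval_gen rangeI)+
lemma S_C: "opC \<in> S" using S_gen(2) by (auto simp: GG(1)[symmetric] intro: S_closed)

text \<open>For each generator \<open>T\<close>, the operator \<open>T*T\<close> is diagonal with entries in \<open>[0,1]\<close>.\<close>

lemma generators_bounded: "bounded_by (gen g) 1"
proof -
  have b: "bounded_by T 1" if "adj T * T = diag f" "\<And>j. f j = complex_of_real (h j)" "\<And>j. 0 \<le> h j" "\<And>j. h j \<le> 1" for T f h
  proof -
    have "vnorm (app (diag f) v) \<le> 1 * vnorm v" for v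
    proof -
      have "Poly_Mapping.keys (app (diag f) v) \<subseteq> Poly_Mapping.keys v"
      proof
        fix i assume "i \<in> Poly_Mapping.keys (app (diag f) v)"
        thus "i \<in> Poly_Mapping.keys v" by (cases i) (auto simp: in_keys_iff)
      qed
      hence "vnorm (app (diag f) v) = L2_set (\<lambda>i. cmod (Poly_Mapping.lookup (app (diag f) v) i)) (Poly_Mapping.keys v)"
        by (intro vnorm_sup) auto
      also have "\<dots> \<le> L2_set (\<lambda>i. cmod (Poly_Mapping.lookup v i)) (Poly_Mapping.keys v)"
        by (rule L2_set_mono) (use that(3,4) in \<open>auto simp: norm_mult that(2) mult_left_le_one_le\<close>)
      finally show ?thesis by (simp add: vnorm_def)
    qed
    hence "bounded_by (adj T * T) 1" unfolding bounded_by_def that(1) by simp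
    thus ?thesis using bounded_by_cstar by fastforce
  qed
  show ?thesis
  proof (cases g)
    case Alpha
    show ?thesis unfolding Alpha gen.simps
      by (rule b[OF AA(1), of "\<lambda>j. 1 - Q ^ j"]) (use Qpow in \<open>auto simp: less_imp_le\<close>)
  next
    case Gamma
    show ?thesis unfolding Gamma gen.simps
      by (rule b[OF GG(1)[unfolded opC_def], of "\<lambda>j. Q ^ j"]) (use Qpow in \<open>auto simp: less_imp_le\<close>)
  next
    case Unitary
    show ?thesis unfolding Unitary gen.simps
      by (rule b[OF UU(1)[folded diag_one], of "\<lambda>j. 1"]) auto
  qed
qed

lemma words_bounded: "bounded_by (word_eval (op_algebra UNIV) gen w) 1"
proof (induction w)
  case Nil
  show ?case by (simp add: bounded_by_def)
next
  case (Cons l w)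
  have "bounded_by (opr.letter l) 1" by (cases l) (auto simp: generators_bounded bounded_by_adj)
  from bounded_by_mult[OF this Cons] show ?case by (simp add: opr.word_eval_Cons)
qed

lemma ev_bounded: "\<exists>K. bounded_by (ev p) K"
proof -
  have "Poly_Mapping.keys p \<subseteq> UNIV" by simp
  thus ?thesis
  proof (induction p rule: poly_mapping_additive_induct)
    case zero
    show ?case by (auto simp: opr.free_eval_zero[simplified] bounded_by_def intro!: exI[of _ 0])
  next
    case (single w c)
    show ?case using bounded_by_scale[OF words_bounded, of c w] by (auto simp: opr.free_eval_single[simplified])
  next
    case (add p q)
    thus ?case using bounded_by_add by (fastforce simp: ev_simps)
  qed
qed

lemma opnorm_S: "cstar_norm (op_algebra S) opnorm"
  by (rule opnorm_cstar_norm[OF S_subalgebra]) (auto simp: S_def ev_bounded)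

end

section \<open>Normal form\<close>

definition letter_pow :: "'g \<Rightarrow> int \<Rightarrow> 'g word" where
  "letter_pow g k = (if k \<ge> 0 then replicate (nat k) (g, False) else replicate (nat (- k)) (g, True))"

type_synonym exps = "int \<times> nat \<times> nat \<times> int"

definition nword :: "exps \<Rightarrow> generator word" where
  "nword = (\<lambda>(k, l, m, n). letter_pow Alpha k @ replicate l (Gamma, False) @ replicate m (Gamma, True) @ letter_pow Unitary n)"

definition expdeg :: "exps \<Rightarrow> nat" where
  "expdeg = (\<lambda>(k, l, m, n). nat \<bar>k\<bar> + l + m + nat \<bar>n\<bar>)"

lemma length_nword: "length (nword i) = expdeg i"
  by (cases i) (auto simp: nword_def expdeg_def letter_pow_def)

context complex_star_algebra
begin

text \<open>Commutation up to a scalar. The value of the scalar is irrelevant for the span of the normally ordered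
  monomials, and forgetting it makes the relation compatible with products.\<close>

definition qcomm :: "'a \<Rightarrow> 'a \<Rightarrow> bool" where
  "qcomm x y \<longleftrightarrow> (\<exists>s. x \<otimes> y = s \<odot> (y \<otimes> x))"

lemma qcomm_one: "x \<in> carrier A \<Longrightarrow> qcomm x \<one>"
  unfolding qcomm_def by (rule exI[of _ 1]) simp

lemma qcomm_mult:
  assumes "qcomm x y" "qcomm x z" "x \<in> carrier A" "y \<in> carrier A" "z \<in> carrier A"
  shows "qcomm x (y \<otimes> z)"
proof -
  obtain s t where s: "x \<otimes> y = s \<odot> (y \<otimes> x)" and t: "x \<otimes> z = t \<odot> (z \<otimes> x)" using assms by (auto simp: qcomm_def)
  have "x \<otimes> (y \<otimes> z) = (s * t) \<odot> (y \<otimes> z \<otimes> x)"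
    using assms(3-5) by (simp add: m_assoc[symmetric] s smult_mult_left) (simp add: m_assoc t smult_mult_right scale_scale)
  thus ?thesis by (auto simp: qcomm_def)
qed

lemma qcomm_pow: "qcomm x y \<Longrightarrow> x \<in> carrier A \<Longrightarrow> y \<in> carrier A \<Longrightarrow> qcomm x (y [^] (n::nat))"
  by (induction n) (auto intro: qcomm_one qcomm_mult)

end

context star_algebra_gens
begin

lemma word_eval_replicate: "word_eval B f (replicate n l) = letter l [^] n"
proof (induction n)
  case (Suc n)
  thus ?case using nat_pow_Suc2[of "letter l" n] letter_closed[of l]
    by (simp add: word_eval_Cons del: nat_pow_Suc letter_closed)
qed simp

end

locale crossed =
  fixes q \<theta> :: real
  assumes q0: "-1 < q" "q < 1" "q \<noteq> 0"
begin

definition phase :: complex where "phase = exp (2 * pi * \<i> * \<theta>)"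

lemma phase_norm: "cmod phase = 1"
  by (simp add: phase_def norm_exp_eq_Re)

sublocale suq2_rep q phase
  using q0 phase_norm by unfold_locales auto

abbreviation "R \<equiv> crossed_relators q \<theta>"
abbreviation "A \<equiv> presented_star_algebra R"
abbreviation A_mult (infixl \<open>\<cdot>\<close> 70) where "x \<cdot> y \<equiv> x \<otimes>\<^bsub>A\<^esub> y"

definition "gA g = cls R (free_gen g)"

lemma gA_presented: "presented_gen R g = gA g" by (simp add: gA_def presented_gen_cls)

lemma cls_closed [simp]: "cls R p \<in> carrier A" by (simp add: presented_carrier)

sublocale A: star_algebra_gens A gA
  using star_algebra_presented[of R]
  by (intro star_algebra_gens.intro star_algebra_gens_axioms.intro) (simp_all add: star_algebra_iff gA_def)

lemmas cls_simps = star_homD(2-6)[OF cls_hom[of R], simplified]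

lemma cls_single: "cls R (Poly_Mapping.single w c) = c \<odot>\<^bsub>A\<^esub> word_eval A gA w"
proof -
  have "cls R (Poly_Mapping.single w 1) = word_eval A gA w"
  proof (induction w)
    case Nil
    show ?case by (simp add: cls_simps)
  next
    case (Cons l w)
    have "cls R (Poly_Mapping.single [l] 1) = A.letter l"
    proof (cases l)
      case (Pair g s)
      have "cls R (Poly_Mapping.single [(g, True)] 1) = (gA g)\<^sup>\<star>\<^bsub>A\<^esub>"
        unfolding gA_def cls_simps(5)[symmetric] by (simp add: free_gen_def free_star_single)
      thus ?thesis by (cases s) (auto simp: Pair gA_def free_gen_def)
    qed
    moreover have "Poly_Mapping.single (l # w) (1::complex) = Poly_Mapping.single [l] 1 \<otimes>\<^bsub>free_star_algebra\<^esub> Poly_Mapping.single w 1"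
      by (simp add: free_mult_single)
    ultimately show ?case using Cons by (simp add: cls_simps A.word_eval_Cons)
  qed
  moreover have "Poly_Mapping.single w c = Poly_Mapping.map ((*) c) (Poly_Mapping.single w 1)"
    by (simp add: map_single_times)
  ultimately show ?thesis by (simp only: cls_simps)
qed

abbreviation al where "al \<equiv> gA Alpha"
abbreviation ga where "ga \<equiv> gA Gamma"
abbreviation un where "un \<equiv> gA Unitary"
abbreviation als where "als \<equiv> (gA Alpha)\<^sup>\<star>\<^bsub>A\<^esub>"
abbreviation gas where "gas \<equiv> (gA Gamma)\<^sup>\<star>\<^bsub>A\<^esub>"
abbreviation uns where "uns \<equiv> (gA Unitary)\<^sup>\<star>\<^bsub>A\<^esub>"

lemma relations:
  "gas \<cdot> ga = ga \<cdot> gas"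
  "complex_of_real q \<odot>\<^bsub>A\<^esub> (gas \<cdot> al) = al \<cdot> gas"
  "complex_of_real q \<odot>\<^bsub>A\<^esub> (ga \<cdot> al) = al \<cdot> ga"
  "als \<cdot> al \<oplus>\<^bsub>A\<^esub> gas \<cdot> ga = \<one>\<^bsub>A\<^esub>"
  "al \<cdot> als \<oplus>\<^bsub>A\<^esub> (complex_of_real q)\<^sup>2 \<odot>\<^bsub>A\<^esub> (ga \<cdot> gas) = \<one>\<^bsub>A\<^esub>"
  "uns \<cdot> un = \<one>\<^bsub>A\<^esub>"
  "un \<cdot> uns = \<one>\<^bsub>A\<^esub>"
  "uns \<cdot> ga \<cdot> un = phase \<odot>\<^bsub>A\<^esub> ga"
  "uns \<cdot> al \<cdot> un = al"
  unfolding gA_def phase_def cls_simps(1-5)[symmetric]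
  by (rule cls_rel, simp add: crossed_relators_def suq2_relators_def rotation_relators_def Let_def)+

lemma op_relations:
  "adj opA * opA + adj opG * opG = 1"
  "opA * adj opA + oscale ((complex_of_real q)\<^sup>2) (opG * adj opG) = 1"
  "adj opU * opG * opU = oscale phase opG"
  "adj opU * opA * opU = opA"
proof -
  show "adj opA * opA + adj opG * opG = 1"
    by (simp add: AA GG opC_def diag_add diag_one)
  show "opA * adj opA + oscale ((complex_of_real q)\<^sup>2) (opG * adj opG) = 1"
    by (simp add: AA GG opC_def diag_add diag_one diag_scale Q_def)
  have "adj opU * (opU * x) = x" for x by (simp add: UU flip: mult.assoc)
  thus "adj opU * opG * opU = oscale phase opG" "adj opU * opA * opU = opA"
    by (simp_all add: GU UA mult.assoc)
qed

lemma ev_relations: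
  assumes "p \<in> R"
  shows "ev p = 0"
proof -
  consider "p \<in> suq2_relators q" | "p \<in> rotation_relators \<theta>"
    using assms by (auto simp: crossed_relators_def)
  thus ?thesis
  proof cases
    case 1
    hence "ev p \<in> {adj opG * opG - opG * adj opG, oscale q (adj opG * opA) - opA * adj opG,
      oscale q (opG * opA) - opA * opG, adj opA * opA + adj opG * opG - 1,
      opA * adj opA + oscale ((complex_of_real q)\<^sup>2) (opG * adj opG) - 1}"
      unfolding suq2_relators_def Let_def
      by (elim insertE; simp add: ev_minus ev_simps)
    thus ?thesis using AG GG op_relations by auto
  next
    case 2
    hence "ev p \<in> {adj opU * opU - 1, opU * adj opU - 1, adj opU * opG * opU - oscale phase opG,
      adj opU * opA * opU - opA}"
      unfolding rotation_relators_def Let_def phase_def[symmetric]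
      by (elim insertE; simp add: ev_minus ev_simps)
    thus ?thesis using UU op_relations by auto
  qed
qed

subsection \<open>The normal form spans\<close>

text \<open>Normal ordering a product by a new letter on the left moves \<open>\<gamma>\<close> and its adjoint past powers of \<open>\<alpha>\<close> and
  past each other, and \<open>u\<close> and its adjoint past everything else. The pair \<open>\<alpha>, \<alpha>*\<close>, absent here, is the only
  one that needs a genuine reduction. The defining relations give one member of each family;
  the rest follow by taking adjoints and by conjugating with the unitary \<open>u\<close>.\<close>

lemma generator_commutation:
  "A.qcomm ga al" "A.qcomm ga als" "A.qcomm gas al" "A.qcomm gas als" "A.qcomm gas ga" "A.qcomm ga gas"
  "A.qcomm un al" "A.qcomm un als" "A.qcomm un ga" "A.qcomm un gas"
  "A.qcomm uns al" "A.qcomm uns als" "A.qcomm uns ga" "A.qcomm uns gas"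
proof -
  have q1: "complex_of_real q \<noteq> 0" using q by simp
  have flip: "A.qcomm y x" if "s \<odot>\<^bsub>A\<^esub> (y \<cdot> x) = x \<cdot> y" "s \<noteq> 0" "x \<in> carrier A" "y \<in> carrier A" for s x y
  proof -
    have "y \<cdot> x = inverse s \<odot>\<^bsub>A\<^esub> (x \<cdot> y)"
      using that(2-4) by (simp add: that(1)[symmetric] A.scale_scale)
    thus ?thesis unfolding A.qcomm_def by blast
  qed
  have star: "A.qcomm (y\<^sup>\<star>\<^bsub>A\<^esub>) (x\<^sup>\<star>\<^bsub>A\<^esub>)" if xy: "A.qcomm x y" "x \<in> carrier A" "y \<in> carrier A" for x y
  proof -
    obtain s where s: "x \<cdot> y = s \<odot>\<^bsub>A\<^esub> (y \<cdot> x)" using xy by (auto simp: A.qcomm_def)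
    hence "(x \<cdot> y)\<^sup>\<star>\<^bsub>A\<^esub> = (s \<odot>\<^bsub>A\<^esub> (y \<cdot> x))\<^sup>\<star>\<^bsub>A\<^esub>" by simp
    thus ?thesis unfolding A.qcomm_def using xy by (auto simp: A.star_mult A.star_smult)
  qed
  note c = A.gen_closed A.star_closed
  show "A.qcomm ga al" by (rule flip[OF relations(3) q1]) (auto intro: c)
  show "A.qcomm gas al" by (rule flip[OF relations(2) q1]) (auto intro: c)
  have "A.qcomm al gas" "A.qcomm al ga"
    unfolding A.qcomm_def using relations(2,3) by (metis, metis)
  from star[OF this(1)] star[OF this(2)] show "A.qcomm ga als" "A.qcomm gas als" by (auto intro: c)
  show "A.qcomm gas ga" "A.qcomm ga gas"
    unfolding A.qcomm_def using relations(1) A.scale_one[of "ga \<cdot> gas"] by (metis A.m_closed c)+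
  have uu: "un \<cdot> (uns \<cdot> x) = x" "uns \<cdot> (un \<cdot> x) = x" if "x \<in> carrier A" for x
    using that relations(6,7) by (simp_all add: A.m_assoc[symmetric])
  have conj: "x \<cdot> un = s \<odot>\<^bsub>A\<^esub> (un \<cdot> x)" if "uns \<cdot> x \<cdot> un = s \<odot>\<^bsub>A\<^esub> x" "x \<in> carrier A" for x s
  proof -
    have "un \<cdot> (uns \<cdot> x \<cdot> un) = un \<cdot> (s \<odot>\<^bsub>A\<^esub> x)" using that by simp
    thus ?thesis using that(2) by (simp add: A.m_assoc uu A.smult_mult_right)
  qed
  have a: "al \<cdot> un = 1 \<odot>\<^bsub>A\<^esub> (un \<cdot> al)" and g: "ga \<cdot> un = phase \<odot>\<^bsub>A\<^esub> (un \<cdot> ga)"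
    by (rule conj, use relations(8,9) in simp_all)+
  show ua: "A.qcomm un al" by (rule flip[OF a[symmetric]]) auto
  show ug: "A.qcomm un ga" by (rule flip[OF g[symmetric]]) auto
  have "A.qcomm al un" "A.qcomm ga un" unfolding A.qcomm_def using a g by blast+
  from star[OF this(1)] star[OF this(2)] show "A.qcomm uns als" "A.qcomm uns gas" by auto
  have inv: "uns \<cdot> x = s \<odot>\<^bsub>A\<^esub> (x \<cdot> uns)" if "x \<cdot> un = s \<odot>\<^bsub>A\<^esub> (un \<cdot> x)" "x \<in> carrier A" for x s
  proof -
    have "uns \<cdot> (x \<cdot> un) \<cdot> uns = uns \<cdot> (s \<odot>\<^bsub>A\<^esub> (un \<cdot> x)) \<cdot> uns" using that by simp
    moreover have "uns \<cdot> (x \<cdot> un) \<cdot> uns = uns \<cdot> x"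
      using that(2) relations(7) by (simp add: A.m_assoc)
    ultimately show ?thesis using that(2) by (simp add: A.m_assoc uu A.smult_mult_left A.smult_mult_right)
  qed
  show "A.qcomm uns al" "A.qcomm uns ga" unfolding A.qcomm_def by (rule exI, rule inv[OF a], simp) (rule exI, rule inv[OF g], simp)
  from star[OF this(1)] star[OF this(2)]
  have "A.qcomm als un" "A.qcomm gas un" by auto
  then obtain s t where s: "als \<cdot> un = s \<odot>\<^bsub>A\<^esub> (un \<cdot> als)" and t: "gas \<cdot> un = t \<odot>\<^bsub>A\<^esub> (un \<cdot> gas)"
    by (auto simp: A.qcomm_def)
  \<comment> \<open>The scalar comes from an adjoint relation and is not known to be nonzero; but if it is zero, both products vanish.\<close>
  have nz: "A.qcomm un x" if e: "x \<cdot> un = s \<odot>\<^bsub>A\<^esub> (un \<cdot> x)" and x: "x \<in> carrier A" for x s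
  proof (cases "s = 0")
    case True
    have "un \<cdot> x = un \<cdot> (x \<cdot> un \<cdot> uns)" using x relations(7) by (simp add: A.m_assoc)
    also have "\<dots> = \<zero>\<^bsub>A\<^esub>" using True e x by simp
    finally have "un \<cdot> x = 0 \<odot>\<^bsub>A\<^esub> (x \<cdot> un)" using x by simp
    thus ?thesis unfolding A.qcomm_def by blast
  next
    case False
    show ?thesis by (rule flip[OF e[symmetric] False]) (use x in auto)
  qed
  show "A.qcomm un als" "A.qcomm un gas" using nz[OF s] nz[OF t] by auto
qed

definition nf :: "nat \<Rightarrow> (generator word \<Rightarrow>\<^sub>0 complex) set set" where
  "nf D = cls R ` {p. Poly_Mapping.keys p \<subseteq> nword ` {i. expdeg i \<le> D}}"

lemma nf_mono: "D \<le> E \<Longrightarrow> nf D \<subseteq> nf E"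
  unfolding nf_def by (intro image_mono Collect_mono impI) (auto dest: order_trans)

lemma nf_carrier: "X \<in> nf D \<Longrightarrow> X \<in> carrier A" by (auto simp: nf_def)

lemma nf_add: "X \<in> nf D \<Longrightarrow> Y \<in> nf D \<Longrightarrow> X \<oplus>\<^bsub>A\<^esub> Y \<in> nf D"
proof -
  assume "X \<in> nf D" "Y \<in> nf D"
  then obtain p p' where p: "X = cls R p" "Y = cls R p'"
    "Poly_Mapping.keys p \<subseteq> nword ` {i. expdeg i \<le> D}" "Poly_Mapping.keys p' \<subseteq> nword ` {i. expdeg i \<le> D}"
    unfolding nf_def by blast
  have "X \<oplus>\<^bsub>A\<^esub> Y = cls R (p + p')" using p by (simp add: cls_simps(3))
  thus ?thesis unfolding nf_def using keys_add_subset[OF p(3,4)] by blast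
qed

lemma nf_scale: "X \<in> nf D \<Longrightarrow> c \<odot>\<^bsub>A\<^esub> X \<in> nf D"
proof -
  assume "X \<in> nf D"
  then obtain p where p: "X = cls R p" "Poly_Mapping.keys p \<subseteq> nword ` {i. expdeg i \<le> D}"
    unfolding nf_def by blast
  have "Poly_Mapping.keys (vscale c p) \<subseteq> Poly_Mapping.keys p"
    by (auto simp: in_keys_iff lookup_map_times)
  moreover have "c \<odot>\<^bsub>A\<^esub> X = cls R (vscale c p)" using p by (simp add: cls_simps(4))
  ultimately show ?thesis unfolding nf_def using p by blast
qed

lemma nf_minus: "X \<in> nf D \<Longrightarrow> Y \<in> nf D \<Longrightarrow> X \<ominus>\<^bsub>A\<^esub> Y \<in> nf D"
  using A.minus_eq_scale nf_add nf_scale nf_carrier by simp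

lemma nf_zero: "\<zero>\<^bsub>A\<^esub> \<in> nf D"
proof -
  have "cls R 0 = \<zero>\<^bsub>A\<^esub>"
    using star_hom_zero[OF _ _ cls_hom[of R]] free.complex_star_algebra_axioms A.complex_star_algebra_axioms
    by (simp add: star_algebra_iff)
  thus ?thesis unfolding nf_def by (metis (mono_tags, lifting) imageI empty_subsetI keys_zero mem_Collect_eq)
qed

abbreviation nmono :: "exps \<Rightarrow> (generator word \<Rightarrow>\<^sub>0 complex) set" where
  "nmono i \<equiv> word_eval A gA (nword i)"

lemma nmono_nf: "expdeg i \<le> D \<Longrightarrow> nmono i \<in> nf D"
  unfolding nf_def by (rule image_eqI[of _ _ "Poly_Mapping.single (nword i) 1"]) (auto simp: cls_single)

lemma nf_induct [consumes 1, case_names zero nmono add]: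
  assumes "X \<in> nf D" "P \<zero>\<^bsub>A\<^esub>" and m: "\<And>i c. expdeg i \<le> D \<Longrightarrow> P (c \<odot>\<^bsub>A\<^esub> nmono i)"
    and a: "\<And>X Y. X \<in> nf D \<Longrightarrow> Y \<in> nf D \<Longrightarrow> P X \<Longrightarrow> P Y \<Longrightarrow> P (X \<oplus>\<^bsub>A\<^esub> Y)"
  shows "P X"
proof -
  obtain p where p: "Poly_Mapping.keys p \<subseteq> nword ` {i. expdeg i \<le> D}" "X = cls R p" using assms(1) by (auto simp: nf_def)
  have z: "cls R 0 = \<zero>\<^bsub>A\<^esub>"
    using star_hom_zero[OF _ _ cls_hom[of R]] free.complex_star_algebra_axioms A.complex_star_algebra_axioms
    by (simp add: star_algebra_iff)
  show ?thesis unfolding p(2) using p(1)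
  proof (induction p rule: poly_mapping_additive_induct)
    case (single w c)
    thus ?case using m by (auto simp: cls_single)
  next
    case (add p q)
    thus ?case using a[of "cls R p" "cls R q"] by (auto simp: cls_simps(3) nf_def)
  qed (simp add: z assms(2))
qed

definition ipow :: "generator \<Rightarrow> int \<Rightarrow> (generator word \<Rightarrow>\<^sub>0 complex) set" where
  "ipow g k = word_eval A gA (letter_pow g k)"

lemma ipow_closed [simp]: "ipow g k \<in> carrier A" by (simp add: ipow_def)

lemma ipow_simps: "ipow g (int n) = gA g [^]\<^bsub>A\<^esub> n" "ipow g (- int n) = (gA g)\<^sup>\<star>\<^bsub>A\<^esub> [^]\<^bsub>A\<^esub> n"
  by (auto simp: ipow_def letter_pow_def A.word_eval_replicate)

lemma ipow_qcomm: "A.qcomm x (gA g) \<Longrightarrow> A.qcomm x ((gA g)\<^sup>\<star>\<^bsub>A\<^esub>) \<Longrightarrow> x \<in> carrier A \<Longrightarrow> A.qcomm x (ipow g k)"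
  by (cases k rule: int_cases2) (auto simp: ipow_simps intro!: A.qcomm_pow)

lemma nmono_eq: "nmono (k, l, m, n) = ipow Alpha k \<cdot> (ga [^]\<^bsub>A\<^esub> l \<cdot> (gas [^]\<^bsub>A\<^esub> m \<cdot> ipow Unitary n))"
  by (simp add: nword_def A.word_eval_append A.word_eval_replicate ipow_def)

lemma qcomm_swap:
  assumes "A.qcomm x y" "x \<in> carrier A" "y \<in> carrier A" "z \<in> carrier A"
  shows "\<exists>s. x \<cdot> (y \<cdot> z) = s \<odot>\<^bsub>A\<^esub> (y \<cdot> (x \<cdot> z))"
proof -
  obtain s where "x \<cdot> y = s \<odot>\<^bsub>A\<^esub> (y \<cdot> x)" using assms by (auto simp: A.qcomm_def)
  hence "x \<cdot> (y \<cdot> z) = s \<odot>\<^bsub>A\<^esub> (y \<cdot> (x \<cdot> z))"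
    using assms by (simp add: A.m_assoc[symmetric] A.smult_mult_left)
  thus ?thesis by blast
qed

lemma un_ipow: "un \<cdot> ipow Unitary n = ipow Unitary (n + 1)" "uns \<cdot> ipow Unitary n = ipow Unitary (n - 1)"
proof -
  have pos: "x \<cdot> x [^]\<^bsub>A\<^esub> (k::nat) = x [^]\<^bsub>A\<^esub> Suc k" if "x \<in> carrier A" for x k
    using A.nat_pow_Suc2[OF that, of k] by simp
  have neg: "y \<cdot> x [^]\<^bsub>A\<^esub> Suc k = x [^]\<^bsub>A\<^esub> (k::nat)" if "x \<in> carrier A" "y \<in> carrier A" "y \<cdot> x = \<one>\<^bsub>A\<^esub>" for x y k
    using A.nat_pow_Suc2[OF that(1), of k] that by (simp add: A.m_assoc[symmetric] del: A.nat_pow_Suc)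
  show "un \<cdot> ipow Unitary n = ipow Unitary (n + 1)"
  proof (cases "n \<ge> 0")
    case True
    then obtain k where k: "n = int k" "n + 1 = int (Suc k)" by (metis nonneg_int_cases of_nat_Suc add.commute)
    show ?thesis unfolding k(2) unfolding k(1) ipow_simps using pos[of un k] by simp
  next
    case False
    define k where "k = nat (- n - 1)"
    have k: "n = - int (Suc k)" "n + 1 = - int k" using False by (auto simp: k_def)
    show ?thesis unfolding k(2) unfolding k(1) ipow_simps using neg[of uns un k] relations by simp
  qed
  show "uns \<cdot> ipow Unitary n = ipow Unitary (n - 1)"
  proof (cases "n \<le> 0")
    case True
    define k where "k = nat (- n)"
    have k: "n = - int k" "n - 1 = - int (Suc k)" using True by (auto simp: k_def)
    show ?thesis unfolding k(2) unfolding k(1) ipow_simps using pos[of uns k] by simp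
  next
    case False
    define k where "k = nat (n - 1)"
    have k: "n = int (Suc k)" "n - 1 = int k" using False by (auto simp: k_def)
    show ?thesis unfolding k(2) unfolding k(1) ipow_simps using neg[of un uns k] relations by simp
  qed
qed

lemma nf_left_mult:
  assumes m: "\<And>i. expdeg i \<le> D \<Longrightarrow> x \<cdot> nmono i \<in> nf E" and x: "x \<in> carrier A" and X: "X \<in> nf D"
  shows "x \<cdot> X \<in> nf E"
  using X
proof (induction X rule: nf_induct)
  case (nmono i c)
  thus ?case using nf_scale[OF m] x by (simp add: A.smult_mult_right)
next
  case (add X Y)
  thus ?case using x by (simp add: nf_carrier A.r_distr nf_add)
qed (use x in \<open>simp add: nf_zero\<close>)

lemma pow_left: "x \<in> carrier A \<Longrightarrow> x \<cdot> x [^]\<^bsub>A\<^esub> (k::nat) = x [^]\<^bsub>A\<^esub> Suc k"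
  using A.nat_pow_Suc2[of x k] by simp

lemma pow_left2: "x \<in> carrier A \<Longrightarrow> z \<in> carrier A \<Longrightarrow>
    x \<cdot> (x [^]\<^bsub>A\<^esub> (k::nat) \<cdot> z) = x [^]\<^bsub>A\<^esub> Suc k \<cdot> z"
  using A.m_assoc[of x "x [^]\<^bsub>A\<^esub> k" z] pow_left[of x k] by (simp del: A.nat_pow_Suc nat_pow_Suc)

lemma nf_scaled: "\<exists>s. z = s \<odot>\<^bsub>A\<^esub> y \<Longrightarrow> y \<in> nf E \<Longrightarrow> z \<in> nf E"
  using nf_scale by blast

lemma gamma_nmono:
  assumes "expdeg (k, l, m, n) \<le> D"
  shows "ga \<cdot> nmono (k, l, m, n) \<in> nf (Suc D)" "gas \<cdot> nmono (k, l, m, n) \<in> nf (Suc D)"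
    "un \<cdot> nmono (k, l, m, n) \<in> nf (Suc D)" "uns \<cdot> nmono (k, l, m, n) \<in> nf (Suc D)"
proof -
  let ?a = "ipow Alpha k" and ?u = "ipow Unitary n" and ?g = "ga [^]\<^bsub>A\<^esub> l" and ?h = "gas [^]\<^bsub>A\<^esub> m"
  note c = generator_commutation and deg = assms[unfolded expdeg_def, simplified]
  show "ga \<cdot> nmono (k, l, m, n) \<in> nf (Suc D)"
  proof (rule nf_scaled)
    show "\<exists>s. ga \<cdot> nmono (k, l, m, n) = s \<odot>\<^bsub>A\<^esub> nmono (k, Suc l, m, n)"
      using qcomm_swap[OF ipow_qcomm[OF c(1,2), of k], of "?g \<cdot> (?h \<cdot> ?u)"]
      by (simp add: nmono_eq A.m_assoc[symmetric] pow_left del: A.nat_pow_Suc)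
    show "nmono (k, Suc l, m, n) \<in> nf (Suc D)" by (rule nmono_nf) (use deg in \<open>simp add: expdeg_def\<close>)
  qed
  show "gas \<cdot> nmono (k, l, m, n) \<in> nf (Suc D)"
  proof (rule nf_scaled)
    have "A.qcomm gas (?a \<cdot> ?g)"
      by (intro A.qcomm_mult ipow_qcomm A.qcomm_pow c) auto
    from qcomm_swap[OF this, of "?h \<cdot> ?u"]
    show "\<exists>s. gas \<cdot> nmono (k, l, m, n) = s \<odot>\<^bsub>A\<^esub> nmono (k, l, Suc m, n)"
      by (simp add: nmono_eq A.m_assoc pow_left2 del: A.nat_pow_Suc)
    show "nmono (k, l, Suc m, n) \<in> nf (Suc D)" by (rule nmono_nf) (use deg in \<open>simp add: expdeg_def\<close>)
  qed
  show "un \<cdot> nmono (k, l, m, n) \<in> nf (Suc D)"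
  proof (rule nf_scaled)
    have "A.qcomm un (?a \<cdot> (?g \<cdot> ?h))"
      by (intro A.qcomm_mult ipow_qcomm A.qcomm_pow c) auto
    from qcomm_swap[OF this, of ?u]
    show "\<exists>s. un \<cdot> nmono (k, l, m, n) = s \<odot>\<^bsub>A\<^esub> nmono (k, l, m, n + 1)"
      by (simp add: nmono_eq A.m_assoc un_ipow)
    show "nmono (k, l, m, n + 1) \<in> nf (Suc D)" by (rule nmono_nf) (use deg in \<open>simp add: expdeg_def\<close>)
  qed
  show "uns \<cdot> nmono (k, l, m, n) \<in> nf (Suc D)"
  proof (rule nf_scaled)
    have "A.qcomm uns (?a \<cdot> (?g \<cdot> ?h))"
      by (intro A.qcomm_mult ipow_qcomm A.qcomm_pow c) auto
    from qcomm_swap[OF this, of ?u]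
    show "\<exists>s. uns \<cdot> nmono (k, l, m, n) = s \<odot>\<^bsub>A\<^esub> nmono (k, l, m, n - 1)"
      by (simp add: nmono_eq A.m_assoc un_ipow)
    show "nmono (k, l, m, n - 1) \<in> nf (Suc D)" by (rule nmono_nf) (use deg in \<open>simp add: expdeg_def\<close>)
  qed
qed

lemma gamma_nf:
  assumes "X \<in> nf D"
  shows "ga \<cdot> X \<in> nf (Suc D)" "gas \<cdot> X \<in> nf (Suc D)"
    "un \<cdot> X \<in> nf (Suc D)" "uns \<cdot> X \<in> nf (Suc D)"
  by (rule nf_left_mult[OF _ _ assms]; use gamma_nmono in \<open>auto simp del: expdeg_def\<close>)+

text \<open>If a letter \<open>\<alpha>\<close> meets its adjoint, the relation for their product replaces the pair by \<open>1\<close> minus a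
  multiple of \<open>c\<close>, which raises the degree by two, just as the pair does. The two cases,
  with the letters in either order, are instances.\<close>

lemma alpha_reduce:
  assumes "W \<in> nf E" and e: "x \<cdot> y \<oplus>\<^bsub>A\<^esub> s \<odot>\<^bsub>A\<^esub> (v \<cdot> w) = \<one>\<^bsub>A\<^esub>"
    and c: "x \<in> carrier A" "y \<in> carrier A" and vw: "v \<cdot> (w \<cdot> W) \<in> nf (Suc (Suc E))" "v \<in> carrier A" "w \<in> carrier A"
  shows "x \<cdot> (y \<cdot> W) \<in> nf (Suc (Suc E))"
proof -
  have W: "W \<in> carrier A" using nf_carrier assms by blast
  let ?z = "s \<odot>\<^bsub>A\<^esub> (v \<cdot> (w \<cdot> W))"
  have "(x \<cdot> y \<oplus>\<^bsub>A\<^esub> s \<odot>\<^bsub>A\<^esub> (v \<cdot> w)) \<cdot> W = W" using e W by simp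
  hence "x \<cdot> (y \<cdot> W) \<oplus>\<^bsub>A\<^esub> ?z = W"
    using W c vw by (simp add: A.l_distr A.m_assoc A.smult_mult_left)
  hence "W \<ominus>\<^bsub>A\<^esub> ?z = x \<cdot> (y \<cdot> W) \<oplus>\<^bsub>A\<^esub> ?z \<ominus>\<^bsub>A\<^esub> ?z" by simp
  also have "\<dots> = x \<cdot> (y \<cdot> W)"
    using W c vw by (simp add: a_minus_def A.a_assoc A.r_neg)
  finally show ?thesis using nf_minus[OF subsetD[OF nf_mono assms(1)] nf_scale[OF vw(1)]] by (metis le_SucI order_refl)
qed

lemma alpha_nmono:
  assumes "expdeg (k, l, m, n) \<le> D"
  shows "al \<cdot> nmono (k, l, m, n) \<in> nf (Suc D)" "als \<cdot> nmono (k, l, m, n) \<in> nf (Suc D)"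
proof -
  let ?z = "ga [^]\<^bsub>A\<^esub> l \<cdot> (gas [^]\<^bsub>A\<^esub> m \<cdot> ipow Unitary n)"
  note deg = assms[unfolded expdeg_def, simplified]
  have pos: "x \<cdot> (x [^]\<^bsub>A\<^esub> j \<cdot> ?z) = x [^]\<^bsub>A\<^esub> Suc j \<cdot> ?z" if "x \<in> carrier A" for x and j :: nat
    by (rule pow_left2) (use that in auto)
  show "al \<cdot> nmono (k, l, m, n) \<in> nf (Suc D)"
  proof (cases "k \<ge> 0")
    case True
    then obtain j where j: "k = int j" by (metis nonneg_int_cases)
    have "al \<cdot> nmono (k, l, m, n) = nmono (int (Suc j), l, m, n)"
      unfolding j nmono_eq ipow_simps by (rule pos) simp
    moreover have "nmono (int (Suc j), l, m, n) \<in> nf (Suc D)" by (rule nmono_nf) (use deg j in \<open>simp add: expdeg_def\<close>)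
    ultimately show ?thesis by simp
  next
    case False
    define j where "j = nat (- k - 1)"
    have j: "k = - int (Suc j)" using False by (simp add: j_def)
    obtain E where E: "D = Suc E" using deg False by (cases D) auto
    have W: "nmono (- int j, l, m, n) \<in> nf E" by (rule nmono_nf) (use deg j E in \<open>simp add: expdeg_def\<close>)
    have "nmono (k, l, m, n) = als \<cdot> nmono (- int j, l, m, n)"
      unfolding j nmono_eq ipow_simps by (rule pos[symmetric]) simp
    thus ?thesis using alpha_reduce[OF W relations(5)] gamma_nf(1)[OF gamma_nf(2)[OF W]] by (simp add: E)
  qed
  show "als \<cdot> nmono (k, l, m, n) \<in> nf (Suc D)"
  proof (cases "k \<le> 0")
    case True
    define j where "j = nat (- k)"
    have j: "k = - int j" using True by (simp add: j_def)
    have "als \<cdot> nmono (k, l, m, n) = nmono (- int (Suc j), l, m, n)"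
      unfolding j nmono_eq ipow_simps by (rule pos) simp
    moreover have "nmono (- int (Suc j), l, m, n) \<in> nf (Suc D)" by (rule nmono_nf) (use deg j in \<open>simp add: expdeg_def\<close>)
    ultimately show ?thesis by simp
  next
    case False
    define j where "j = nat (k - 1)"
    have j: "k = int (Suc j)" using False by (simp add: j_def)
    obtain E where E: "D = Suc E" using deg False by (cases D) auto
    have W: "nmono (int j, l, m, n) \<in> nf E" by (rule nmono_nf) (use deg j E in \<open>simp add: expdeg_def\<close>)
    have "nmono (k, l, m, n) = al \<cdot> nmono (int j, l, m, n)"
      unfolding j nmono_eq ipow_simps by (rule pos[symmetric]) simp
    moreover have rel: "als \<cdot> al \<oplus>\<^bsub>A\<^esub> 1 \<odot>\<^bsub>A\<^esub> (gas \<cdot> ga) = \<one>\<^bsub>A\<^esub>" using relations(4) by simp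
    ultimately show ?thesis using alpha_reduce[OF W rel] gamma_nf(2)[OF gamma_nf(1)[OF W]] by (simp add: E)
  qed
qed

text \<open>One letter raises the degree by at most one. Hence words, and therefore all elements, lie in the span of
  the normally ordered monomials, and degrees add up under multiplication.\<close>

lemma letter_nf:
  assumes "X \<in> nf D"
  shows "A.letter x \<cdot> X \<in> nf (Suc D)"
proof -
  have "al \<cdot> X \<in> nf (Suc D)" "als \<cdot> X \<in> nf (Suc D)"
    by (rule nf_left_mult[OF _ _ assms]; use alpha_nmono in auto)+
  thus ?thesis using gamma_nf[OF assms] by (cases x; cases "fst x") auto
qed

lemma word_nf: "X \<in> nf D \<Longrightarrow> word_eval A gA w \<cdot> X \<in> nf (length w + D)"
proof (induction w)
  case Nil
  thus ?case using nf_carrier by simp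
next
  case (Cons l w)
  thus ?case using letter_nf[OF Cons.IH] nf_carrier by (simp add: A.word_eval_Cons A.m_assoc del: A.letter_closed add: A.letter_closed[of l])
qed

lemma one_nf: "\<one>\<^bsub>A\<^esub> \<in> nf D"
  using nmono_nf[of "(0, 0, 0, 0)" D] by (simp add: expdeg_def nword_def letter_pow_def)

lemma nf_mult: "X \<in> nf D \<Longrightarrow> Y \<in> nf E \<Longrightarrow> X \<cdot> Y \<in> nf (D + E)"
proof (induction X rule: nf_induct)
  case zero
  thus ?case using nf_carrier nf_zero by simp
next
  case (nmono i c)
  have "nmono i \<cdot> Y \<in> nf (D + E)"
    using word_nf[OF nmono(2), of "nword i"] nmono(1) nf_mono[of "length (nword i) + E" "D + E"] by (auto simp: length_nword)
  thus ?case using nf_scale nmono nf_carrier by (simp add: A.smult_mult_left)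
next
  case (add X X')
  thus ?case using nf_carrier nf_add by (simp add: A.l_distr)
qed

lemma nf_exhaust: "X \<in> carrier A \<Longrightarrow> \<exists>D. X \<in> nf D"
proof -
  assume "X \<in> carrier A"
  then obtain p where p: "X = cls R p" by (auto simp: presented_carrier)
  have "Poly_Mapping.keys p \<subseteq> UNIV" by simp
  thus ?thesis unfolding p
  proof (induction p rule: poly_mapping_additive_induct)
    case zero
    have "cls R 0 \<in> nf 0" unfolding nf_def by auto
    thus ?case by blast
  next
    case (single w c)
    show ?case using nf_scale[OF word_nf[OF one_nf, of w 0], of c] by (auto simp: cls_single)
  next
    case (add p p')
    then obtain D E where "cls R p \<in> nf D" "cls R p' \<in> nf E" by blast
    hence "cls R p \<in> nf (max D E)" "cls R p' \<in> nf (max D E)" using nf_mono by (meson subsetD max.cobounded1 max.cobounded2)+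
    thus ?case using nf_add by (auto simp: cls_simps(3))
  qed
qed

section \<open>Faithfulness\<close>

definition opow :: "idx op \<Rightarrow> int \<Rightarrow> idx op" where
  "opow T k = (if k \<ge> 0 then T ^ nat k else adj T ^ nat (- k))"

definition mon :: "exps \<Rightarrow> idx op" where
  "mon = (\<lambda>(k, l, m, n). opow opA k * (opG ^ l * (adj opG ^ m * opow opU n)))"

lemma op_pow: "x [^]\<^bsub>op_algebra UNIV\<^esub> (n::nat) = x ^ n"
  by (induction n) (simp_all add: power_Suc2 del: power_Suc)

lemma eval_nword: "word_eval (op_algebra UNIV) gen (nword i) = mon i"
  by (cases i) (auto simp: nword_def mon_def opow_def letter_pow_def opr.word_eval_append[simplified]
      opr.word_eval_replicate op_pow)

text \<open>The weight of \<open>\<alpha>\<^sup>k\<close> as a weighted shift: the coefficient with which it moves the basis vector at \<open>j + k\<close>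
  to the one at \<open>j\<close>. It vanishes when \<open>j + k\<close> is negative.\<close>

definition wA :: "int \<Rightarrow> nat \<Rightarrow> complex" where
  "wA k j = (if k \<ge> 0 then \<Prod>i<nat k. r (Suc j + i) else \<Prod>i<nat (- k). r (j - i))"

lemma lookup_A_pow: "Poly_Mapping.lookup (app (opA ^ n) v) (j,a,b) = (\<Prod>i<n. r (Suc j + i)) * Poly_Mapping.lookup v (j + n, a, b)"
  by (induction n arbitrary: v) (simp_all add: power_Suc2 mult.assoc del: power_Suc)

lemma lookup_As_pow: "Poly_Mapping.lookup (app (adj opA ^ n) v) (j,a,b) = (\<Prod>i<n. r (j - i)) * Poly_Mapping.lookup v (j - n, a, b)"
  by (induction n arbitrary: v) (simp_all add: power_Suc2 mult.assoc del: power_Suc)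

lemma lookup_G_pow: "Poly_Mapping.lookup (app (opG ^ n) v) (j,a,b) = (q ^ j) ^ n * Poly_Mapping.lookup v (j, a - int n, b)"
  by (induction n arbitrary: v) (simp_all add: power_Suc2 mult.assoc diff_diff_eq add.commute del: power_Suc)

lemma lookup_Gs_pow: "Poly_Mapping.lookup (app (adj opG ^ n) v) (j,a,b) = (q ^ j) ^ n * Poly_Mapping.lookup v (j, a + int n, b)"
  by (induction n arbitrary: v) (simp_all add: power_Suc2 mult.assoc add.assoc add.commute add.left_commute del: power_Suc)

lemma lookup_U_pow: "Poly_Mapping.lookup (app (opU ^ n) v) (j,a,b) = (phase powi (- a)) ^ n * Poly_Mapping.lookup v (j, a, b - int n)"
  by (induction n arbitrary: v) (simp_all add: power_Suc2 mult.assoc diff_diff_eq add.commute del: power_Suc)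

lemma lookup_Us_pow: "Poly_Mapping.lookup (app (adj opU ^ n) v) (j,a,b) = (phase powi a) ^ n * Poly_Mapping.lookup v (j, a, b + int n)"
  by (induction n arbitrary: v) (simp_all add: power_Suc2 mult.assoc add.assoc add.commute add.left_commute del: power_Suc)

lemma lookup_opow_A: "Poly_Mapping.lookup (app (opow opA k) v) (j,a,b) = wA k j * Poly_Mapping.lookup v (nat (int j + k), a, b)"
proof (cases "k \<ge> 0")
  case True
  hence "j + nat k = nat (int j + k)" by simp
  thus ?thesis using True by (simp add: opow_def wA_def lookup_A_pow)
next
  case False
  hence "j - nat (- k) = nat (int j + k)" by simp
  thus ?thesis using False by (simp add: opow_def wA_def lookup_As_pow)
qed

lemma lookup_opow_U: "Poly_Mapping.lookup (app (opow opU n) v) (j,a,b) = phase powi (- a * n) * Poly_Mapping.lookup v (j, a, b - n)"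
proof (cases "n \<ge> 0")
  case True
  then obtain m where "n = int m" by (metis nonneg_int_cases)
  thus ?thesis by (simp add: opow_def lookup_U_pow power_int_power')
next
  case False
  define m where "m = nat (- n)"
  have m: "n = - int m" using False by (simp add: m_def)
  show ?thesis using False by (simp add: m opow_def lookup_Us_pow power_int_power')
qed

text \<open>Each monomial is a weighted shift along a translation; the factor \<open>q\<^sup>j\<close> for \<open>\<gamma>\<close> is evaluated at the
  position before \<open>\<alpha>\<close> acts.\<close>

lemma lookup_mon:
  "Poly_Mapping.lookup (app (mon (k,l,m,n)) v) (j,a,b) =
    wA k j * (q ^ nat (int j + k)) ^ (l + m) * phase powi (- (a - int l + int m) * n) *
    Poly_Mapping.lookup v (nat (int j + k), a - int l + int m, b - n)"
  by (simp add: mon_def lookup_opow_A lookup_opow_U lookup_G_pow lookup_Gs_pow power_add mult.assoc)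

lemma wA_nz: "int j + k \<ge> 0 \<Longrightarrow> wA k j \<noteq> 0"
  by (auto simp: wA_def intro!: r_nz)

text \<open>A product of weights that would leave \<open>\<nat>\<close> contains the factor \<open>r 0\<close>.\<close>

lemma wA_zero: "int j + k < 0 \<Longrightarrow> wA k j = 0"
proof -
  assume "int j + k < 0"
  hence "j < nat (- k)" "\<not> k \<ge> 0" by auto
  moreover from this have "(\<Prod>i<nat (- k). r (j - i)) = 0" by (intro prod_zero bexI[of _ j]) auto
  ultimately show ?thesis by (simp add: wA_def)
qed

text \<open>Choosing exponents for each normally ordered word makes a formal combination of words a sum of
  operators without proving first that the exponents are unique.\<close>

definition ix :: "generator word \<Rightarrow> exps" where "ix w = (SOME i. nword i = w)"

lemma nword_ix: "w \<in> range nword \<Longrightarrow> nword (ix w) = w"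
  unfolding ix_def by (rule someI_ex) auto

lemma nword_ix_deg: "w \<in> nword ` {i. expdeg i \<le> D} \<Longrightarrow> nword (ix w) = w \<and> expdeg (ix w) \<le> D"
  using nword_ix[of w] by (metis (no_types, lifting) imageE length_nword mem_Collect_eq rangeI)

lemma ev_sum: "ev (sum f X) = (\<Sum>x\<in>X. ev (f x))"
  by (induction X rule: infinite_finite_induct) (simp_all add: ev_simps opr.free_eval_zero[simplified])

lemma ev_nf_sum:
  assumes "Poly_Mapping.keys p \<subseteq> range nword"
  shows "ev p = (\<Sum>w\<in>Poly_Mapping.keys p. oscale (Poly_Mapping.lookup p w) (mon (ix w)))"
proof -
  have "ev p = (\<Sum>w\<in>Poly_Mapping.keys p. ev (Poly_Mapping.single w (Poly_Mapping.lookup p w)))"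
    by (subst poly_mapping_sum_singles[of p]) (simp add: ev_sum)
  also have "\<dots> = (\<Sum>w\<in>Poly_Mapping.keys p. oscale (Poly_Mapping.lookup p w) (mon (ix w)))"
  proof (rule sum.cong[OF refl])
    fix w assume "w \<in> Poly_Mapping.keys p"
    hence "nword (ix w) = w" using nword_ix assms by blast
    thus "ev (Poly_Mapping.single w (Poly_Mapping.lookup p w)) = oscale (Poly_Mapping.lookup p w) (mon (ix w))"
      by (metis eval_nword opr.free_eval_single op_algebra_simps(6))
  qed
  finally show ?thesis .
qed

lemma q_pow_inj: "inj (\<lambda>n. complex_of_real q ^ (N + n))"
proof (rule injI)
  fix m n assume "complex_of_real q ^ (N + m) = complex_of_real q ^ (N + n)"
  hence "cmod (complex_of_real q ^ (N + m)) = cmod (complex_of_real q ^ (N + n))" by simp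
  hence e: "\<bar>q\<bar> ^ (N + m) = \<bar>q\<bar> ^ (N + n)" by (simp add: norm_power)
  have q': "0 < \<bar>q\<bar>" "\<bar>q\<bar> < 1" using q by auto
  have "\<bar>q\<bar> ^ b < \<bar>q\<bar> ^ a" if "a < b" for a b by (rule power_strict_decreasing[OF that q'])
  with e show "m = n" by (metis nat_neq_iff less_irrefl add_left_cancel)
qed

text \<open>The monomials \<open>\<alpha>\<^sup>k \<gamma>\<^sup>l \<gamma>*\<^sup>m u\<^sup>n\<close> that shift all three coordinates in the same way differ only in \<open>l + m\<close>.
  A matrix coefficient of a combination is therefore, up to a nonzero factor, a polynomial in
  \<open>q\<^sup>j\<close> whose coefficients are those of the combination. It vanishes at infinitely many points.\<close>

lemma ev_faithful:
  assumes p: "Poly_Mapping.keys p \<subseteq> range nword" and z: "ev p = 0"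
  shows "p = 0"
proof (rule ccontr)
  assume "p \<noteq> 0"
  then obtain w0 where w0: "w0 \<in> Poly_Mapping.keys p" by fastforce
  obtain k0 l0 m0 n0 where i0: "ix w0 = (k0, l0, m0, n0)" by (cases "ix w0")
  \<comment> \<open>the monomials that shift the coordinates by the same amounts as the one of \<open>w0\<close>\<close>
  define fam where "fam = (\<lambda>(k::int, l::nat, m::nat, n::int). k = k0 \<and> int l - int m = int l0 - int m0 \<and> n = n0)"
  \<comment> \<open>within such a family, the exponent of \<open>q\<^sup>j\<close> tells the monomials apart\<close>
  define dg where "dg = (\<lambda>(k::int, l::nat, m::nat, n::int). l + m)"
  define W where "W = {w \<in> Poly_Mapping.keys p. fam (ix w)}"
  define P where "P = (\<Sum>w\<in>W. Polynomial.monom (Poly_Mapping.lookup p w) (dg (ix w)))"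
  have finW: "finite W" by (simp add: W_def)
  have root: "poly P (complex_of_real q ^ (nat (2 * \<bar>k0\<bar>) + t)) = 0" for t
  proof -
    \<comment> \<open>a position for which both \<open>J\<close> and \<open>J + k0\<close> are natural numbers, for every \<open>t\<close>\<close>
    define J where "J = nat (2 * \<bar>k0\<bar> - k0) + t"
    have J: "int J + k0 \<ge> 0" "nat (int J + k0) = nat (2 * \<bar>k0\<bar>) + t" by (auto simp: J_def)
    define v :: "idx \<Rightarrow>\<^sub>0 complex" where "v = Poly_Mapping.single (nat (int J + k0), - (int l0 - int m0), - n0) 1"
    define c where "c = wA k0 J * phase powi ((int l0 - int m0) * n0)"
    have c: "c \<noteq> 0" using wA_nz[OF J(1)] by (simp add: c_def)
    have trm: "Poly_Mapping.lookup (app (mon i) v) (J,0,0) = (if fam i then c * (complex_of_real q ^ nat (int J + k0)) ^ dg i else 0)" for i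
    proof -
      obtain k l m n where i: "i = (k, l, m, n)" by (cases i)
      show ?thesis
      proof (cases "int J + k \<ge> 0")
        case True
        hence "nat (int J + k) = nat (int J + k0) \<longleftrightarrow> k = k0" using J(1) by auto
        thus ?thesis by (auto simp: i lookup_mon v_def lookup_single fam_def dg_def c_def when_def)
      next
        case False
        hence "k \<noteq> k0" using J by auto
        thus ?thesis using False wA_zero[of J k] by (auto simp: i lookup_mon fam_def)
      qed
    qed
    have "0 = Poly_Mapping.lookup (app (ev p) v) (J,0,0)" by (simp add: z)
    also have "\<dots> = (\<Sum>w\<in>Poly_Mapping.keys p. Poly_Mapping.lookup p w * Poly_Mapping.lookup (app (mon (ix w)) v) (J,0,0))"
      by (simp add: ev_nf_sum[OF p] lookup_app_sum lookup_map_times)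
    also have "\<dots> = (\<Sum>w\<in>Poly_Mapping.keys p. if fam (ix w) then Poly_Mapping.lookup p w * (c * (complex_of_real q ^ nat (int J + k0)) ^ dg (ix w)) else 0)"
      by (intro sum.cong) (simp_all add: trm of_real_power)
    also have "\<dots> = (\<Sum>w\<in>W. Poly_Mapping.lookup p w * (c * (complex_of_real q ^ nat (int J + k0)) ^ dg (ix w)))"
      by (simp add: W_def sum.inter_filter)
    also have "\<dots> = c * poly P (complex_of_real q ^ nat (int J + k0))"
      by (simp add: P_def poly_sum poly_monom sum_distrib_left mult_ac)
    finally show ?thesis using c J(2) by simp
  qed
  have "P = 0"
  proof (rule ccontr)
    assume "P \<noteq> 0"
    hence "finite {x. poly P x = 0}" by (rule poly_roots_finite)
    moreover have "range (\<lambda>t. complex_of_real q ^ (nat (2 * \<bar>k0\<bar>) + t)) \<subseteq> {x. poly P x = 0}" using root by auto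
    ultimately have "finite (range (\<lambda>t. complex_of_real q ^ (nat (2 * \<bar>k0\<bar>) + t)))" by (rule finite_subset[rotated])
    thus False using range_inj_infinite[OF q_pow_inj] by blast
  qed
  have "0 = coeff P (l0 + m0)" using \<open>P = 0\<close> by simp
  also have "\<dots> = (\<Sum>w\<in>W. if w = w0 then Poly_Mapping.lookup p w else 0)"
    unfolding P_def coeff_sum
  proof (rule sum.cong[OF refl])
    fix w assume w: "w \<in> W"
    obtain k l m n where i: "ix w = (k, l, m, n)" by (cases "ix w")
    have f: "k = k0" "int l - int m = int l0 - int m0" "n = n0" using w by (auto simp: W_def fam_def i)
    have "l + m = l0 + m0 \<longleftrightarrow> w = w0"
    proof
      assume "l + m = l0 + m0"
      hence "l = l0" "m = m0" using f by auto
      hence "ix w = ix w0" using f i i0 by simp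
      thus "w = w0" using nword_ix p w w0 W_def by (metis (no_types, lifting) mem_Collect_eq subsetD)
    next
      assume "w = w0"
      thus "l + m = l0 + m0" using i i0 by simp
    qed
    thus "coeff (Polynomial.monom (Poly_Mapping.lookup p w) (dg (ix w))) (l0 + m0) = (if w = w0 then Poly_Mapping.lookup p w else 0)"
      by (auto simp: i dg_def coeff_monom)
  qed
  also have "\<dots> = Poly_Mapping.lookup p w0"
    using finW w0 by (simp add: W_def fam_def i0)
  finally show False using w0 by (simp add: in_keys_iff)
qed

definition rep :: "(generator word \<Rightarrow>\<^sub>0 complex) set \<Rightarrow> idx op" where
  "rep = presented_eval (op_algebra UNIV) gen"

lemma rep_cls: "rep (cls R p) = ev p"
  unfolding rep_def by (rule opr.presented_eval_cls) (simp add: ev_relations)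

lemma rep_hom: "star_hom A (op_algebra UNIV) rep"
  unfolding rep_def by (rule opr.presented_eval_hom) (simp add: ev_relations)

lemmas rep_simps = star_homD(2-6)[OF rep_hom, simplified]

lemma rep_zero_iff: "X \<in> carrier A \<Longrightarrow> rep X = 0 \<longleftrightarrow> X = \<zero>\<^bsub>A\<^esub>"
proof -
  assume "X \<in> carrier A"
  then obtain D where "X \<in> nf D" using nf_exhaust by blast
  then obtain p where p: "X = cls R p" "Poly_Mapping.keys p \<subseteq> range nword" unfolding nf_def by blast
  have z: "cls R 0 = \<zero>\<^bsub>A\<^esub>"
    using star_hom_zero[OF _ _ cls_hom[of R]] free.complex_star_algebra_axioms A.complex_star_algebra_axioms
    by (simp add: star_algebra_iff)
  show ?thesis
  proof
    assume "rep X = 0"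
    thus "X = \<zero>\<^bsub>A\<^esub>" using ev_faithful[OF p(2)] p(1) z by (simp add: rep_cls)
  next
    assume "X = \<zero>\<^bsub>A\<^esub>"
    hence "rep X = ev 0" by (simp add: rep_cls flip: z)
    thus "rep X = 0" by (simp add: opr.free_eval_zero[simplified])
  qed
qed

lemma rep_inj: "inj_on rep (carrier A)"
proof (rule inj_onI)
  fix X Y assume XY: "X \<in> carrier A" "Y \<in> carrier A" "rep X = rep Y"
  hence "rep (X \<ominus>\<^bsub>A\<^esub> Y) = 0"
    by (simp add: A.minus_eq_scale rep_simps) (simp add: op_ext lookup_map_times lookup_add)
  hence "X \<ominus>\<^bsub>A\<^esub> Y = \<zero>\<^bsub>A\<^esub>" using rep_zero_iff XY by simp
  thus "X = Y" using A.minus_zero_eq XY by blast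
qed

lemma rep_image: "rep ` carrier A = S"
  unfolding presented_carrier S_def image_image rep_cls ..

definition S_deg :: "nat \<Rightarrow> idx op set" where
  "S_deg D = rep ` nf D"

lemma S_deg_repr: "x \<in> S_deg D \<Longrightarrow> \<exists>p. Poly_Mapping.keys p \<subseteq> nword ` {i. expdeg i \<le> D} \<and> x = ev p"
  by (auto simp: S_deg_def nf_def rep_cls)

lemma S_deg_S: "x \<in> S_deg D \<Longrightarrow> x \<in> S"
  using rep_image nf_carrier by (auto simp: S_deg_def)

lemma S_deg_exhaust: "x \<in> S \<Longrightarrow> \<exists>D. x \<in> S_deg D"
  unfolding rep_image[symmetric] S_deg_def using nf_exhaust by blast

lemma S_deg_mult: "x \<in> S_deg D \<Longrightarrow> y \<in> S_deg E \<Longrightarrow> x * y \<in> S_deg (D + E)"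
  unfolding S_deg_def using nf_mult nf_carrier by (auto simp: rep_simps(2)[symmetric] intro!: imageI)

lemma S_deg_power: "x \<in> S_deg D \<Longrightarrow> x ^ n \<in> S_deg (n * D)"
proof (induction n)
  case 0
  have "rep \<one>\<^bsub>A\<^esub> \<in> S_deg 0" unfolding S_deg_def using one_nf by blast
  thus ?case by (simp add: rep_simps)
next
  case (Suc n)
  thus ?case using S_deg_mult[of x D "x ^ n" "n * D"] by simp
qed

end

section \<open>Real analysis\<close>

lemma poly_times_geometric_null:
  fixes t :: real
  assumes "0 \<le> t" "t < 1"
  shows "(\<lambda>n. (real n + 1) ^ p * t ^ n) \<longlonglongrightarrow> 0"
proof -
  have *: "(\<lambda>n. (real n + 1) ^ Suc p * t ^ n) \<longlonglongrightarrow> 0"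
  proof -
    \<comment> \<open>then the sequence is a power of \<open>(n + 1) s\<^sup>n\<close>\<close>
    define s where "s = root (Suc p) t"
    have s: "0 \<le> s" "s < 1" "s ^ Suc p = t" using assms by (auto simp: s_def real_root_lt_1_iff simp del: power_Suc)
    have "(\<lambda>n. real n * s ^ n + s ^ n) \<longlonglongrightarrow> 0 + 0"
      by (intro tendsto_add powser_times_n_limit_0 LIMSEQ_realpow_zero) (use s in auto)
    hence "(\<lambda>n. ((real n + 1) * s ^ n) ^ Suc p) \<longlonglongrightarrow> 0 ^ Suc p"
      by (intro tendsto_power) (simp add: distrib_right)
    moreover have "((real n + 1) * s ^ n) ^ Suc p = (real n + 1) ^ Suc p * t ^ n" for n
      by (simp only: power_mult_distrib s(3)[symmetric] power_mult[symmetric] mult.commute)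
    ultimately show ?thesis by (simp only: power_0_Suc mult_zero_left)
  qed
  show ?thesis
  proof (rule tendsto_sandwich[OF _ _ tendsto_const *])
    show "\<forall>\<^sub>F n in sequentially. (real n + 1) ^ p * t ^ n \<le> (real n + 1) ^ Suc p * t ^ n"
      using assms by (intro always_eventually allI mult_right_mono power_increasing) auto
  qed (use assms in auto)
qed

text \<open>If \<open>b < a\<close>, then \<open>(a/b)\<^sup>n\<close> outgrows every polynomial. Powers of two suffice as exponents, and
  they are the ones for which the C*-identity evaluates the norm of a power.\<close>

lemma power_growth_le:
  fixes a b K :: real
  assumes a: "0 \<le> a" and b: "0 \<le> b" and h: "\<And>k. a ^ (2 ^ k) \<le> K * (real (2 ^ k) + 1) ^ p * b ^ (2 ^ k)"
  shows "a \<le> b"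
proof (rule ccontr)
  assume "\<not> a \<le> b"
  hence ab: "b < a" "0 < a" using b by auto
  define t where "t = b / a"
  have t: "0 \<le> t" "t < 1" using ab b by (auto simp: t_def)
  have sm: "strict_mono (\<lambda>k::nat. 2 ^ k :: nat)" by (rule strict_monoI) simp
  have "((\<lambda>n. K * ((real n + 1) ^ p * t ^ n)) \<circ> (\<lambda>k. 2 ^ k)) \<longlonglongrightarrow> K * 0"
    by (rule LIMSEQ_subseq_LIMSEQ[OF tendsto_mult[OF tendsto_const poly_times_geometric_null[OF t]] sm])
  moreover have "1 \<le> ((\<lambda>n. K * ((real n + 1) ^ p * t ^ n)) \<circ> (\<lambda>k. 2 ^ k)) k" for k
  proof -
    have "a ^ (2 ^ k) * 1 \<le> a ^ (2 ^ k) * (K * ((real (2 ^ k) + 1) ^ p * t ^ (2 ^ k)))"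
      using h[of k] ab by (simp add: t_def power_divide mult_ac)
    thus ?thesis using ab by (simp only: mult_le_cancel_left_pos zero_less_power) simp
  qed
  ultimately have "1 \<le> K * 0" by (intro LIMSEQ_le_const) auto
  thus False by simp
qed

text \<open>A geometric sum is bounded independently of its length if \<open>z \<noteq> 1\<close> has modulus one.\<close>

lemma geometric_average_null:
  fixes z :: complex
  assumes "cmod z = 1" "z \<noteq> 1"
  shows "(\<lambda>M. cmod (\<Sum>s<M. z ^ s) / real M) \<longlonglongrightarrow> 0"
proof (rule tendsto_sandwich[of "\<lambda>_. 0" _ _ "\<lambda>M. (2 / cmod (z - 1)) / real M"])
  show "\<forall>\<^sub>F M in sequentially. cmod (\<Sum>s<M. z ^ s) / real M \<le> (2 / cmod (z - 1)) / real M"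
  proof (intro always_eventually allI divide_right_mono)
    fix M
    have "cmod (z ^ M - 1) \<le> 2" using norm_triangle_ineq4[of "z ^ M" 1] assms by (simp add: norm_power)
    hence "cmod (z ^ M - 1) / cmod (z - 1) \<le> 2 / cmod (z - 1)" by (rule divide_right_mono) simp
    moreover have "(\<Sum>s<M. z ^ s) = (z ^ M - 1) / (z - 1)" using assms(2) by (rule geometric_sum)
    ultimately show "cmod (\<Sum>s<M. z ^ s) \<le> 2 / cmod (z - 1)" by (simp add: norm_divide)
  qed simp
  show "(\<lambda>M. 2 / cmod (z - 1) / real M) \<longlonglongrightarrow> 0"
    by (rule tendsto_divide_0[OF tendsto_const]) (simp add: filterlim_real_sequentially filterlim_at_top_imp_at_infinity)
qed auto

context suq2_rep
begin

text \<open>A positive lower bound for all partial products of \<open>(1 - Q)(1 - Q\<^sup>2)(1 - Q\<^sup>3)\<dots>\<close>.\<close>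

definition euler :: real where "euler = exp (- 1 / (1 - Q)\<^sup>2)"

lemma sum_Q_le: "finite X \<Longrightarrow> (\<Sum>i\<in>X. Q ^ i) \<le> 1 / (1 - Q)"
proof -
  assume f: "finite X"
  have "(\<Sum>i\<in>X. Q ^ i) \<le> suminf (\<lambda>i. Q ^ i)"
    by (rule sum_le_suminf) (use Q f in \<open>auto intro: summable_geometric\<close>)
  thus ?thesis using Q by (simp add: suminf_geometric)
qed

lemma euler_pos: "0 < euler" by (simp add: euler_def)

text \<open>Factor by factor, \<open>1 - x \<ge> exp(-x/(1-x))\<close>, and \<open>x/(1-x) \<le> x/(1-Q)\<close> for \<open>x = Q\<^sup>i\<close>; then sum a geometric
  series.\<close>

lemma prod_minus_Q: "finite X \<Longrightarrow> 0 \<notin> X \<Longrightarrow> euler \<le> (\<Prod>i\<in>X. 1 - Q ^ i)"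
proof -
  assume f: "finite X" "0 \<notin> X"
  have "exp (- (Q ^ i / (1 - Q))) \<le> 1 - Q ^ i" if "i > 0" for i
  proof -
    have Qi: "Q ^ i \<le> Q" using Q that power_decreasing[of 1 i Q] by simp
    have p: "0 < 1 - Q ^ i" using Qpow(3)[OF that] by simp
    have "1 / (1 - Q ^ i) = 1 + Q ^ i / (1 - Q ^ i)" using p by (simp add: field_simps)
    also have "\<dots> \<le> 1 + Q ^ i / (1 - Q)"
      using Q Qi by (intro add_left_mono divide_left_mono) auto
    also have "\<dots> \<le> exp (Q ^ i / (1 - Q))" by (rule exp_ge_add_one_self)
    finally have "inverse (exp (Q ^ i / (1 - Q))) \<le> 1 - Q ^ i" using p by (simp add: field_simps)
    thus ?thesis by (simp add: exp_minus)
  qed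
  hence "(\<Prod>i\<in>X. exp (- (Q ^ i / (1 - Q)))) \<le> (\<Prod>i\<in>X. 1 - Q ^ i)"
    using f by (intro prod_mono) (auto, metis gr0I)
  moreover have "(\<Prod>i\<in>X. exp (- (Q ^ i / (1 - Q)))) = exp (- ((\<Sum>i\<in>X. Q ^ i) / (1 - Q)))"
    using f by (simp add: exp_sum[symmetric] sum_negf sum_divide_distrib)
  moreover have "(\<Sum>i\<in>X. Q ^ i) / (1 - Q) \<le> 1 / (1 - Q)\<^sup>2"
    using divide_right_mono[OF sum_Q_le[OF f(1)], of "1 - Q"] Q by (simp add: power2_eq_square)
  hence "euler \<le> exp (- ((\<Sum>i\<in>X. Q ^ i) / (1 - Q)))" by (simp add: euler_def)
  ultimately show ?thesis by linarith
qed

lemma prod_plus_Q: "finite X \<Longrightarrow> (\<Prod>i\<in>X. 1 + Q ^ i) \<le> exp (1 / (1 - Q))"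
proof -
  assume f: "finite X"
  have "(\<Prod>i\<in>X. 1 + Q ^ i) \<le> (\<Prod>i\<in>X. exp (Q ^ i))"
    using Q by (intro prod_mono) (auto simp: less_imp_le add_nonneg_nonneg)
  also have "\<dots> = exp (\<Sum>i\<in>X. Q ^ i)" using f by (simp add: exp_sum)
  also have "\<dots> \<le> exp (1 / (1 - Q))" using sum_Q_le[OF f] by simp
  finally show ?thesis .
qed

end

section \<open>C*-norms on the concrete algebra\<close>

locale crossed_norm = crossed +
  fixes N :: "idx op \<Rightarrow> real"
  assumes theta: "\<theta> \<notin> \<rat>" and cstar: "cstar_norm (op_algebra S) N"
begin

sublocale nn: cstar_normed "op_algebra S" N
  using star_algebra_op[OF S_subalgebra] cstar
  by (intro cstar_normed.intro cstar_normed_axioms.intro) (simp_all add: star_algebra_iff)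

lemma N_nonneg: "x \<in> S \<Longrightarrow> 0 \<le> N x" using nn.N_nonneg[of x] by simp
lemma N_eq_zero: "x \<in> S \<Longrightarrow> N x = 0 \<longleftrightarrow> x = 0" using nn.N_eq_zero[of x] by simp
lemma N_oscale: "x \<in> S \<Longrightarrow> N (oscale c x) = cmod c * N x" using nn.N_scale[of x c] by simp
lemma N_add: "x \<in> S \<Longrightarrow> y \<in> S \<Longrightarrow> N (x + y) \<le> N x + N y" using nn.N_add[of x y] by simp
lemma N_mult: "x \<in> S \<Longrightarrow> y \<in> S \<Longrightarrow> N (x * y) \<le> N x * N y" using nn.N_mult[of x y] by simp
lemma N_cstar: "x \<in> S \<Longrightarrow> N (adj x * x) = (N x)\<^sup>2" using nn.N_cstar[of x] by simp
lemma N_adj: "x \<in> S \<Longrightarrow> N (adj x) = N x" using nn.N_star[of x] by simp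
lemma N_zero [simp]: "N 0 = 0" using N_eq_zero[OF S_zero] by simp

lemma N_minus: "x \<in> S \<Longrightarrow> y \<in> S \<Longrightarrow> N (x - y) \<le> N x + N y"
  using N_add[of x "oscale (-1) y"] by (simp add: minus_op_def S_closed N_oscale)

lemma N_minus_commute: "x \<in> S \<Longrightarrow> y \<in> S \<Longrightarrow> N (x - y) = N (y - x)"
proof -
  assume "x \<in> S" "y \<in> S"
  hence "N (oscale (-1) (x - y)) = N (x - y)" using N_oscale[of "x - y" "-1"] S_minus by simp
  moreover have "oscale (-1) (x - y) = y - x" by (metis minus_diff_eq uminus_op_def)
  ultimately show ?thesis by simp
qed

lemma N_sum: "finite X \<Longrightarrow> (\<And>i. i \<in> X \<Longrightarrow> f i \<in> S) \<Longrightarrow> N (sum f X) \<le> (\<Sum>i\<in>X. N (f i))"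
proof (induction X rule: finite_induct)
  case (insert i X)
  have "N (f i + sum f X) \<le> N (f i) + N (sum f X)" by (rule N_add) (use insert in \<open>auto intro: S_sum\<close>)
  thus ?case using insert by fastforce
qed simp

lemma N_one: "N 1 = 1"
proof -
  have "N 1 = (N 1)\<^sup>2" using N_cstar[OF S_closed(1)] by simp
  moreover have "N 1 \<noteq> 0" using N_eq_zero[OF S_closed(1)] by simp
  ultimately show ?thesis by (simp add: power2_eq_square)
qed

lemma contr_mult: "x \<in> S \<Longrightarrow> y \<in> S \<Longrightarrow> N x \<le> 1 \<Longrightarrow> N y \<le> 1 \<Longrightarrow> N (x * y) \<le> 1"
  using N_mult[of x y] mult_mono[of "N x" 1 "N y" 1] N_nonneg by fastforce

lemma contr_left: "x \<in> S \<Longrightarrow> y \<in> S \<Longrightarrow> N x \<le> 1 \<Longrightarrow> N (x * y) \<le> N y"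
  using N_mult[of x y] mult_right_mono[of "N x" 1 "N y"] N_nonneg by fastforce

lemma contr_right: "x \<in> S \<Longrightarrow> y \<in> S \<Longrightarrow> N y \<le> 1 \<Longrightarrow> N (x * y) \<le> N x"
  using N_mult[of x y] mult_left_mono[of "N y" 1 "N x"] N_nonneg by fastforce

lemma contr_power: "x \<in> S \<Longrightarrow> N x \<le> 1 \<Longrightarrow> N (x ^ n) \<le> 1"
  by (induction n) (auto simp: N_one intro!: contr_mult S_power)

text \<open>The C*-identity, iterated.\<close>

lemma selfadj_power: "x \<in> S \<Longrightarrow> adj x = x \<Longrightarrow> N (x ^ (2 ^ k)) = N x ^ (2 ^ k)"
proof (induction k)
  case (Suc k)
  have "x ^ (2 ^ Suc k) = adj (x ^ (2 ^ k)) * x ^ (2 ^ k)"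
    using Suc.prems by (simp add: adj_power power_add[symmetric] mult_2)
  thus ?case using Suc N_cstar[OF S_power[OF Suc.prems(1)]] by (simp add: power_mult[symmetric] mult.commute)
qed simp

text \<open>Since \<open>\<alpha>\<alpha>* = (1 - Q) + Q \<alpha>*\<alpha>\<close>, the square \<open>t\<close> of the norm of \<open>\<alpha>\<close> satisfies \<open>t \<le> (1 - Q) + Q t\<close>.\<close>

lemma contr_A: "N opA \<le> 1" "N (adj opA) \<le> 1"
proof -
  let ?y = "adj opA * opA"
  have y: "?y \<in> S" using S_gen by (intro S_closed)
  have e: "opA * adj opA = oscale (1 - complex_of_real Q) 1 + oscale Q ?y"
    by (simp add: AA diag_one[symmetric] diag_scale diag_add algebra_simps)
  have "(N opA)\<^sup>2 = N (adj (adj opA) * adj opA)" using N_cstar[of "adj opA"] S_gen by (simp add: N_adj S_closed)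
  also have "\<dots> \<le> N (oscale (1 - complex_of_real Q) 1) + N (oscale Q ?y)"
    unfolding adj_adj e by (rule N_add) (use y in \<open>auto intro: S_closed\<close>)
  also have "\<dots> = (1 - Q) + Q * (N opA)\<^sup>2"
  proof -
    have "cmod (1 - complex_of_real Q) = 1 - Q" using Q norm_of_real[of "1 - Q", where 'a = complex] by simp
    moreover have "cmod (complex_of_real Q) = Q" using Q by simp
    moreover have "N ?y = (N opA)\<^sup>2" using N_cstar S_gen by blast
    ultimately show ?thesis using N_oscale[OF S_closed(1)] N_oscale[OF y] N_one by simp
  qed
  finally have "(1 - Q) * (N opA)\<^sup>2 \<le> (1 - Q) * 1" by (simp add: algebra_simps)
  hence "(N opA)\<^sup>2 \<le> 1" using Q by (simp only: mult_le_cancel_left_pos)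
  thus "N opA \<le> 1" using N_nonneg[OF S_gen(1)] by (simp add: power_le_one_iff)
  thus "N (adj opA) \<le> 1" using S_gen by (simp add: N_adj)
qed

lemma contr_U: "N opU \<le> 1" "N (adj opU) \<le> 1"
proof -
  have "(N opU)\<^sup>2 = 1" using N_cstar[OF S_gen(3)] by (simp add: UU N_one)
  thus "N opU \<le> 1" using N_nonneg[OF S_gen(3)] by (simp add: power2_eq_1_iff)
  thus "N (adj opU) \<le> 1" using S_gen by (simp add: N_adj)
qed

lemma As_diag_A: "adj opA * diag f * opA = diag (\<lambda>j. (1 - complex_of_real Q ^ j) * f (j - 1))"
proof (rule op_eqI3)
  fix v j a b
  show "Poly_Mapping.lookup (app (adj opA * diag f * opA) v) (j,a,b) =
      Poly_Mapping.lookup (app (diag (\<lambda>j. (1 - complex_of_real Q ^ j) * f (j - 1))) v) (j,a,b)"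
    using r_r[of j "f (j - 1) * Poly_Mapping.lookup v (j,a,b)"]
    by (cases j) (simp_all add: mult_ac del: power_Suc)
qed

lemma opC_power: "opC ^ m = diag (\<lambda>j. (complex_of_real Q ^ j) ^ m)"
  by (simp add: opC_def diag_power)

text \<open>From \<open>1 - c = \<alpha>*\<alpha>\<close> and \<open>\<alpha> c = Q c \<alpha>\<close>. Successive powers of \<open>c\<close> thus differ by little, which makes
  them approximate a projection.\<close>

lemma opC_step: "opC ^ m - opC ^ Suc m = oscale (Q ^ m) (adj opA * opC ^ m * opA)"
proof -
  have "(1 - complex_of_real Q ^ j) * (complex_of_real Q ^ j) ^ m
     = complex_of_real Q ^ m * ((1 - complex_of_real Q ^ j) * (complex_of_real Q ^ (j - 1)) ^ m)" for j
    by (cases j) (simp_all add: power_mult_distrib)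
  moreover have "opC ^ m - opC ^ Suc m = diag (\<lambda>j. (1 - complex_of_real Q ^ j) * (complex_of_real Q ^ j) ^ m)"
    by (simp only: opC_power diag_minus) (simp add: algebra_simps)
  ultimately show ?thesis
    by (simp only: opC_power As_diag_A diag_scale of_real_power)
qed

lemma opC_diff: "N (opC ^ m - opC ^ Suc m) \<le> Q ^ m * N (opC ^ m)"
proof -
  have "N (adj opA * opC ^ m * opA) \<le> N (adj opA * opC ^ m)"
    by (rule contr_right) (auto intro!: S_closed S_power S_C S_gen contr_A)
  also have "\<dots> \<le> N (opC ^ m)"
    by (rule contr_left) (auto intro!: S_closed S_power S_C S_gen contr_A)
  finally have "N (adj opA * opC ^ m * opA) \<le> N (opC ^ m)" .
  moreover have "adj opA * opC ^ m * opA \<in> S" by (auto intro!: S_closed S_power S_C S_gen)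
  ultimately show ?thesis using Q by (simp add: opC_step N_oscale norm_power del: power_Suc)
qed

lemma opC_S: "opC ^ m \<in> S" by (intro S_power S_C)

lemma opC_pos: "0 < N (opC ^ m)"
proof -
  have "opC ^ m \<noteq> 0"
  proof
    assume "opC ^ m = 0"
    hence "Poly_Mapping.lookup (app (opC ^ m) (Poly_Mapping.single (0,0,0) 1)) (0,0,0) = 0" by simp
    thus False by (simp add: opC_power)
  qed
  thus ?thesis using N_eq_zero[OF opC_S] N_nonneg[OF opC_S, of m] by (simp add: less_le)
qed

text \<open>The estimate for successive powers keeps the norms of all powers of \<open>c\<close> bounded, and the norms of the
  powers with exponent \<open>2\<^sup>k\<close> are the corresponding powers of the norm of \<open>c\<close>.\<close>

lemma contr_C: "N opC \<le> 1"
proof (rule power_growth_le[where K = "exp (1 / (1 - Q))" and p = 0])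
  have le: "N (opC ^ m) \<le> (\<Prod>i<m. 1 + Q ^ i)" for m
  proof (induction m)
    case (Suc m)
    have "N (opC ^ Suc m) \<le> N (opC ^ m) + N (opC ^ m - opC ^ Suc m)"
      using N_minus[OF opC_S[of m] S_minus[OF opC_S[of m] opC_S[of "Suc m"]]] by simp
    also have "\<dots> \<le> N (opC ^ m) * (1 + Q ^ m)" using opC_diff[of m] by (simp add: algebra_simps)
    also have "\<dots> \<le> (\<Prod>i<m. 1 + Q ^ i) * (1 + Q ^ m)" using Suc Q by (intro mult_right_mono) (auto intro: add_nonneg_nonneg)
    finally show ?case by simp
  qed (simp add: N_one)
  show "0 \<le> N opC" using N_nonneg S_C by blast
  fix k
  have "adj opC = opC" by (simp add: opC_def adj_diag)
  hence "N opC ^ (2 ^ k) = N (opC ^ (2 ^ k))" using selfadj_power[OF S_C] by simp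
  also have "\<dots> \<le> exp (1 / (1 - Q))" using le prod_plus_Q[of "{..<2 ^ k}"] by (meson finite_lessThan order_trans)
  finally show "N opC ^ (2 ^ k) \<le> exp (1 / (1 - Q)) * (real (2 ^ k) + 1) ^ 0 * 1 ^ (2 ^ k)" by simp
qed simp

lemma contr_G: "N opG \<le> 1" "N (adj opG) \<le> 1"
proof -
  have "(N opG)\<^sup>2 \<le> 1" using N_cstar[OF S_gen(2)] contr_C by (simp add: GG)
  thus "N opG \<le> 1" using N_nonneg[OF S_gen(2)] by (simp add: power_le_one_iff)
  thus "N (adj opG) \<le> 1" using S_gen by (simp add: N_adj)
qed

text \<open>A lower bound for the norms of the powers of \<open>c\<close>. It may depend on \<open>N\<close>; only its positivity matters, as
  constants do not influence the comparison of growth rates.\<close>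

definition \<beta> :: real where "\<beta> = euler * N opC"

lemma beta_pos: "0 < \<beta>" using euler_pos opC_pos[of 1] by (simp add: \<beta>_def)

text \<open>By the estimate for successive powers, the norm loses at most the factor \<open>1 - Q\<^sup>m\<close> in each step.\<close>

lemma opC_power_lower: "\<beta> \<le> N (opC ^ Suc m)"
proof -
  have "N opC * (\<Prod>i\<in>{1..m}. 1 - Q ^ i) \<le> N (opC ^ Suc m)"
  proof (induction m)
    case (Suc m)
    have "N (opC ^ Suc m) \<le> N (opC ^ Suc (Suc m)) + N (opC ^ Suc m - opC ^ Suc (Suc m))"
      using N_add[OF opC_S[of "Suc (Suc m)"] S_minus[OF opC_S[of "Suc m"] opC_S[of "Suc (Suc m)"]]] by (simp del: power_Suc)
    hence "N (opC ^ Suc m) * (1 - Q ^ Suc m) \<le> N (opC ^ Suc (Suc m))"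
      using opC_diff[of "Suc m"] by (simp add: algebra_simps)
    moreover have "N opC * (\<Prod>i\<in>{1..m}. 1 - Q ^ i) * (1 - Q ^ Suc m) \<le> N (opC ^ Suc m) * (1 - Q ^ Suc m)"
      by (rule mult_right_mono[OF Suc]) (use Qpow(1)[of "Suc m"] in simp)
    ultimately show ?case by (simp add: mult.assoc del: power_Suc)
  qed simp
  moreover have "N opC * euler \<le> N opC * (\<Prod>i\<in>{1..m}. 1 - Q ^ i)"
    by (intro mult_left_mono prod_minus_Q) (use N_nonneg S_C in auto)
  ultimately show ?thesis by (simp add: \<beta>_def mult.commute)
qed

lemma opC_diff_many: "N (opC ^ p - opC ^ (p + n)) \<le> real n * Q ^ p"
proof (induction n)
  case (Suc n)
  have "opC ^ p - opC ^ (p + Suc n) = (opC ^ p - opC ^ (p + n)) + (opC ^ (p + n) - opC ^ Suc (p + n))" by (simp del: power_Suc)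
  hence "N (opC ^ p - opC ^ (p + Suc n)) \<le> N (opC ^ p - opC ^ (p + n)) + N (opC ^ (p + n) - opC ^ Suc (p + n))"
    by (metis N_add S_minus opC_S)
  also have "N (opC ^ (p + n) - opC ^ Suc (p + n)) \<le> Q ^ (p + n) * N (opC ^ (p + n))" by (rule opC_diff)
  also have "\<dots> \<le> Q ^ p * 1"
    using Q contr_power[OF S_C contr_C] N_nonneg[OF opC_S] by (intro mult_mono power_decreasing) auto
  finally show ?case using Suc by (simp add: algebra_simps)
qed simp

section \<open>Matrix coefficients are bounded by every C*-norm\<close>

lemma opow_S: "x \<in> S \<Longrightarrow> opow x k \<in> S"
  by (auto simp: opow_def intro: S_power S_closed)

lemma contr_opow: "x \<in> S \<Longrightarrow> N x \<le> 1 \<Longrightarrow> N (opow x k) \<le> 1"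
  by (auto simp: opow_def N_adj intro!: contr_power S_closed)

lemma mon_S: "mon i \<in> S"
  by (cases i) (auto simp: mon_def intro!: S_closed(3) opow_S S_gen S_power S_closed(5))

lemma contr_mon: "N (mon i) \<le> 1"
  by (cases i) (auto simp: mon_def intro!: contr_mult S_closed(3) opow_S S_gen S_power S_closed(5)
      contr_opow contr_power contr_A contr_G contr_U)

text \<open>The average over the conjugates \<open>(u\<^sup>s\<gamma>\<^sup>t)* y u\<^sup>s\<gamma>\<^sup>t\<close>. On the eigenspace of \<open>c\<close> for the eigenvalue \<open>1\<close> both \<open>u\<close> and \<open>\<gamma>\<close>
  are unitary and commute up to a scalar, and the average approximates the projection onto
  the invariant elements.\<close>

definition torus_avg :: "nat \<Rightarrow> idx op \<Rightarrow> idx op" where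
  "torus_avg M y = oscale (1 / (of_nat M * of_nat M))
     (\<Sum>s<M. \<Sum>t<M. adj opG ^ t * (adj opU ^ s * (y * (opU ^ s * opG ^ t))))"

lemma conj_S: "y \<in> S \<Longrightarrow> adj opG ^ t * (adj opU ^ s * (y * (opU ^ s * opG ^ t))) \<in> S"
  by (intro S_closed(3) S_power S_gen S_closed(5))

lemma conj_contr: "y \<in> S \<Longrightarrow> N (adj opG ^ t * (adj opU ^ s * (y * (opU ^ s * opG ^ t)))) \<le> N y"
proof -
  assume y: "y \<in> S"
  note m = S_closed(3) S_power S_gen S_closed(5) y
  have "N (adj opG ^ t * (adj opU ^ s * (y * (opU ^ s * opG ^ t)))) \<le> N (adj opU ^ s * (y * (opU ^ s * opG ^ t)))"
    by (rule contr_left) (auto intro!: m contr_power contr_G)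
  also have "\<dots> \<le> N (y * (opU ^ s * opG ^ t))"
    by (rule contr_left) (auto intro!: m contr_power contr_U)
  also have "\<dots> \<le> N y"
    by (rule contr_right) (auto intro!: m contr_mult contr_power contr_U contr_G)
  finally show ?thesis .
qed

lemma torus_avg_S: "y \<in> S \<Longrightarrow> torus_avg M y \<in> S"
  unfolding torus_avg_def by (intro S_closed(4) S_sum conj_S)

lemma N_average:
  assumes "\<And>s t. f s t \<in> S" "\<And>s t. s < M \<Longrightarrow> t < M \<Longrightarrow> N (f s t) \<le> B" "0 \<le> B"
  shows "N (oscale (1 / (of_nat M * of_nat M)) (\<Sum>s<M. \<Sum>t<M. f s t)) \<le> B"
proof -
  have "N (\<Sum>s<M. \<Sum>t<M. f s t) \<le> (\<Sum>s<M. N (\<Sum>t<M. f s t))" by (intro N_sum) (auto intro: S_sum assms)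
  also have "\<dots> \<le> (\<Sum>s<M. \<Sum>t<M. N (f s t))" by (intro sum_mono N_sum) (auto intro: assms)
  also have "\<dots> \<le> (\<Sum>s<M. \<Sum>t<M. B)" by (intro sum_mono) (use assms in auto)
  also have "\<dots> = real M * real M * B" by simp
  finally have *: "N (\<Sum>s<M. \<Sum>t<M. f s t) \<le> real M * real M * B" .
  have "N (oscale (1 / (of_nat M * of_nat M)) (\<Sum>s<M. \<Sum>t<M. f s t)) = 1 / (real M * real M) * N (\<Sum>s<M. \<Sum>t<M. f s t)"
    by (subst N_oscale) (auto intro!: S_sum assms simp: norm_divide norm_mult)
  also have "\<dots> \<le> 1 / (real M * real M) * (real M * real M * B)" by (rule mult_left_mono[OF *]) simp
  also have "\<dots> \<le> B" using assms(3) by (cases "M = 0") auto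
  finally show ?thesis .
qed

lemma torus_avg_contr: "y \<in> S \<Longrightarrow> N (torus_avg M y) \<le> N y"
  unfolding torus_avg_def by (rule N_average) (auto intro: conj_S conj_contr N_nonneg)

lemma torus_avg_add: "torus_avg M (x + y) = torus_avg M x + torus_avg M y"
  unfolding torus_avg_def by (simp add: distrib_left distrib_right sum.distrib oscale_add_right)

lemma torus_avg_scale: "torus_avg M (oscale c x) = oscale c (torus_avg M x)"
  unfolding torus_avg_def by (simp add: oscale_sum mult.commute)

text \<open>The matrix coefficient at \<open>e(0,0,0)\<close>, called the vacuum here. On the rotation algebra generated
  by \<open>\<gamma>\<close> and \<open>u\<close> on the eigenspace \<open>j = 0\<close> it is the trace.\<close>

definition vacuum_coeff :: "idx op \<Rightarrow> complex" where
  "vacuum_coeff x = Poly_Mapping.lookup (app x (Poly_Mapping.single (0,0,0) 1)) (0,0,0)"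

lemma vacuum_coeff_add: "vacuum_coeff (x + y) = vacuum_coeff x + vacuum_coeff y" by (simp add: vacuum_coeff_def lookup_add)
lemma vacuum_coeff_scale: "vacuum_coeff (oscale c x) = c * vacuum_coeff x" by (simp add: vacuum_coeff_def lookup_map_times)

lemma vacuum_coeff_mon: "vacuum_coeff (mon (k,l,m,n)) = (if k = 0 \<and> l = m \<and> n = 0 then 1 else 0)"
proof (cases "k < 0")
  case True
  thus ?thesis using wA_zero[of 0 k] by (simp add: vacuum_coeff_def lookup_mon)
next
  case False
  thus ?thesis by (auto simp: vacuum_coeff_def lookup_mon lookup_single when_def wA_def)
qed

text \<open>The compression of \<open>x\<close> to the eigenspace of \<open>c\<close> for the eigenvalue \<open>1\<close> is replaced by \<open>c\<^sup>M x c\<^sup>M\<close>, as the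
  projection is not in the algebra. After averaging, only the vacuum coefficient is left in the limit; the power
  \<open>c\<^sup>2\<^sup>M\<close> plays the role of the projection.\<close>

definition vacuum_limit :: "idx op \<Rightarrow> bool" where
  "vacuum_limit x \<longleftrightarrow> (\<lambda>M. N (torus_avg M (opC ^ M * (x * opC ^ M)) - oscale (vacuum_coeff x) (opC ^ (2 * M)))) \<longlonglongrightarrow> 0"

lemma squeeze_S: "x \<in> S \<Longrightarrow> opC ^ M * (x * opC ^ M) \<in> S"
  by (intro S_closed(3) opC_S)

lemma vacuum_limit_in_S: "x \<in> S \<Longrightarrow> torus_avg M (opC ^ M * (x * opC ^ M)) - oscale c (opC ^ (2 * M)) \<in> S"
  by (intro S_minus torus_avg_S squeeze_S S_closed(4) opC_S)

lemma vacuum_limit_add: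
  assumes "x \<in> S" "y \<in> S" "vacuum_limit x" "vacuum_limit y"
  shows "vacuum_limit (x + y)"
  unfolding vacuum_limit_def
proof (rule tendsto_zero_squeeze)
  show "(\<lambda>M. N (torus_avg M (opC ^ M * (x * opC ^ M)) - oscale (vacuum_coeff x) (opC ^ (2 * M))) +
      N (torus_avg M (opC ^ M * (y * opC ^ M)) - oscale (vacuum_coeff y) (opC ^ (2 * M)))) \<longlonglongrightarrow> 0"
    using tendsto_add assms(3,4) unfolding vacuum_limit_def by fastforce
  fix M
  show "0 \<le> N (torus_avg M (opC ^ M * ((x + y) * opC ^ M)) - oscale (vacuum_coeff (x + y)) (opC ^ (2 * M)))"
    by (intro N_nonneg vacuum_limit_in_S S_closed assms)
  have "torus_avg M (opC ^ M * ((x + y) * opC ^ M)) - oscale (vacuum_coeff (x + y)) (opC ^ (2 * M)) =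
    (torus_avg M (opC ^ M * (x * opC ^ M)) - oscale (vacuum_coeff x) (opC ^ (2 * M))) +
      (torus_avg M (opC ^ M * (y * opC ^ M)) - oscale (vacuum_coeff y) (opC ^ (2 * M)))"
    by (simp add: distrib_left distrib_right torus_avg_add vacuum_coeff_add oscale_add_left)
  thus "N (torus_avg M (opC ^ M * ((x + y) * opC ^ M)) - oscale (vacuum_coeff (x + y)) (opC ^ (2 * M))) \<le>
    N (torus_avg M (opC ^ M * (x * opC ^ M)) - oscale (vacuum_coeff x) (opC ^ (2 * M))) +
      N (torus_avg M (opC ^ M * (y * opC ^ M)) - oscale (vacuum_coeff y) (opC ^ (2 * M)))"
    using N_add[OF vacuum_limit_in_S[OF assms(1)] vacuum_limit_in_S[OF assms(2)]] by simp
qed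

lemma vacuum_limit_scale:
  assumes "x \<in> S" "vacuum_limit x"
  shows "vacuum_limit (oscale c x)"
proof -
  have "torus_avg M (opC ^ M * (oscale c x * opC ^ M)) - oscale (vacuum_coeff (oscale c x)) (opC ^ (2 * M)) =
    oscale c (torus_avg M (opC ^ M * (x * opC ^ M)) - oscale (vacuum_coeff x) (opC ^ (2 * M)))" for M
    by (simp add: torus_avg_scale vacuum_coeff_scale oscale_minus)
  hence "N (torus_avg M (opC ^ M * (oscale c x * opC ^ M)) - oscale (vacuum_coeff (oscale c x)) (opC ^ (2 * M))) =
    cmod c * N (torus_avg M (opC ^ M * (x * opC ^ M)) - oscale (vacuum_coeff x) (opC ^ (2 * M)))" for M
    using N_oscale[OF vacuum_limit_in_S[OF assms(1)]] by simp
  thus ?thesis using tendsto_mult_right_zero[OF assms(2)[unfolded vacuum_limit_def], of "cmod c"] by (simp add: vacuum_limit_def)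
qed

lemma phase_power: "(phase powi x) ^ s = phase powi (x * int s)"
  by (simp add: power_int_power')

lemma lookup_C_pow: "Poly_Mapping.lookup (app (opC ^ M) v) (j,a,b) = (complex_of_real Q ^ j) ^ M * Poly_Mapping.lookup v (j,a,b)"
  by (simp add: opC_power)

lemma q_pow_Q: "(complex_of_real q ^ j) ^ t * ((complex_of_real q ^ j) ^ t * z) = (complex_of_real Q ^ j) ^ t * z"
  by (simp add: Q_def power_mult_distrib power2_eq_square mult_ac)

text \<open>Commuting \<open>u\<^sup>s\<gamma>\<^sup>t\<close> past \<open>\<gamma>\<^sup>l\<gamma>*\<^sup>mu\<^sup>n\<close> produces a phase, and the part \<open>\<gamma>*\<^sup>t\<gamma>\<^sup>t\<close> which is left over is \<open>c\<^sup>t\<close>.\<close>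

lemma conj_mon:
  "adj opG ^ t * (adj opU ^ s * (opC ^ M * (mon (0,l,m,n) * opC ^ M) * (opU ^ s * opG ^ t))) =
    oscale (phase powi (int s * (int l - int m)) * phase powi (- n * int t)) (opC ^ (2 * M + t) * mon (0,l,m,n))"
proof (rule op_eqI3)
  fix v j a b
  have ph: "phase powi ((a + int t) * int s) * (phase powi (- (a + int t - int l + int m) * n) *
      phase powi (- (a + int t - int l + int m) * int s)) =
    phase powi (int s * (int l - int m)) * (phase powi (- n * int t) * phase powi (- (a - int l + int m) * n))"
    by (simp only: power_int_add[OF disjI1[OF lam_nz], symmetric]) (simp add: algebra_simps)
  have Qq: "(complex_of_real Q ^ j) ^ M * ((complex_of_real Q ^ j) ^ M * (complex_of_real Q ^ j) ^ t) = (complex_of_real Q ^ j) ^ (2 * M + t)"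
    by (simp add: power_add mult_2)
  have "Poly_Mapping.lookup (app (adj opG ^ t * (adj opU ^ s * (opC ^ M * (mon (0,l,m,n) * opC ^ M) * (opU ^ s * opG ^ t)))) v) (j,a,b) =
     ((complex_of_real Q ^ j) ^ M * ((complex_of_real Q ^ j) ^ M * ((complex_of_real q ^ j) ^ t * ((complex_of_real q ^ j) ^ t * 1)))) *
     (phase powi ((a + int t) * int s) * (phase powi (- (a + int t - int l + int m) * n) *
      phase powi (- (a + int t - int l + int m) * int s))) *
     (wA 0 j * (complex_of_real q ^ j) ^ (l + m)) * Poly_Mapping.lookup v (j, a - int l + int m, b - n)"
    by (simp add: lookup_Gs_pow lookup_Us_pow lookup_C_pow lookup_mon lookup_U_pow lookup_G_pow phase_power mult_ac algebra_simps)
  also have "\<dots> = Poly_Mapping.lookup (app (oscale (phase powi (int s * (int l - int m)) * phase powi (- n * int t)) (opC ^ (2 * M + t) * mon (0,l,m,n))) v) (j,a,b)"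
    unfolding ph q_pow_Q using Qq by (simp add: lookup_map_times lookup_C_pow lookup_mon mult_ac)
  finally show "Poly_Mapping.lookup (app (adj opG ^ t * (adj opU ^ s * (opC ^ M * (mon (0,l,m,n) * opC ^ M) * (opU ^ s * opG ^ t)))) v) (j,a,b) = Poly_Mapping.lookup (app (oscale (phase powi (int s * (int l - int m)) * phase powi (- n * int t)) (opC ^ (2 * M + t) * mon (0,l,m,n))) v) (j,a,b)" .
qed

lemma shift_power: "(z ^ (i + t)) ^ M * (z ^ i) ^ M = z ^ (t * M) * (z ^ i) ^ (2 * M)" for z :: complex
proof -
  have "(i + t) * M + i * M = t * M + i * (2 * M)" by (simp add: distrib_right distrib_left mult_2)
  thus ?thesis by (simp only: power_mult[symmetric] power_add[symmetric])
qed

lemma op_of_nat: "of_nat M * T = oscale (of_nat M) T" for T :: "idx op"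
  by (induction M) (simp_all add: distrib_right oscale_add_left add.commute)

lemma squeeze_mon_pos: "k > 0 \<Longrightarrow> opC ^ M * (mon (k,l,m,n) * opC ^ M) = oscale (Q ^ (nat k * M)) (opC ^ (2 * M) * mon (k,l,m,n))"
proof (rule op_eqI3)
  fix v j a b assume k: "k > 0"
  have "nat (int j + k) = j + nat k" using k by simp
  hence "(complex_of_real Q ^ j) ^ M * (complex_of_real Q ^ nat (int j + k)) ^ M = Q ^ (nat k * M) * (complex_of_real Q ^ j) ^ (2 * M)"
    using shift_power[of "complex_of_real Q" j "nat k" M] by (simp add: mult.commute)
  thus "Poly_Mapping.lookup (app (opC ^ M * (mon (k,l,m,n) * opC ^ M)) v) (j,a,b) =
    Poly_Mapping.lookup (app (oscale (Q ^ (nat k * M)) (opC ^ (2 * M) * mon (k,l,m,n))) v) (j,a,b)"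
    by (simp add: lookup_C_pow lookup_mon lookup_map_times)
qed

lemma squeeze_mon_neg: "k < 0 \<Longrightarrow> opC ^ M * (mon (k,l,m,n) * opC ^ M) = oscale (Q ^ (nat (- k) * M)) (mon (k,l,m,n) * opC ^ (2 * M))"
proof (rule op_eqI3)
  fix v j a b assume k: "k < 0"
  show "Poly_Mapping.lookup (app (opC ^ M * (mon (k,l,m,n) * opC ^ M)) v) (j,a,b) =
    Poly_Mapping.lookup (app (oscale (Q ^ (nat (- k) * M)) (mon (k,l,m,n) * opC ^ (2 * M))) v) (j,a,b)"
  proof (cases "int j + k < 0")
    case True
    thus ?thesis by (simp add: lookup_C_pow lookup_mon lookup_map_times wA_zero)
  next
    case False
    hence j: "nat (int j + k) + nat (- k) = j" using k by simp
    from shift_power[of "complex_of_real Q" "nat (int j + k)" "nat (- k)" M] have "(complex_of_real Q ^ j) ^ M * (complex_of_real Q ^ nat (int j + k)) ^ M =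
       Q ^ (nat (- k) * M) * (complex_of_real Q ^ nat (int j + k)) ^ (2 * M)"
      unfolding j by simp
    thus ?thesis by (simp add: lookup_C_pow lookup_mon lookup_map_times)
  qed
qed

lemma Q_null: "(\<lambda>M. Q ^ M) \<longlonglongrightarrow> 0"
  by (rule LIMSEQ_realpow_zero) (use Q in auto)

text \<open>A monomial with \<open>k \<noteq> 0\<close> moves between different eigenspaces of \<open>c\<close>, so at one of its ends \<open>c\<^sup>M\<close> is
  small: commuting it through leaves a factor \<open>Q\<^sup>M\<close>.\<close>

lemma squeeze_small:
  assumes "k \<noteq> 0"
  shows "N (opC ^ M * (mon (k,l,m,n) * opC ^ M)) \<le> Q ^ M"
proof -
  have c1: "N (opC ^ (2 * M) * mon (k,l,m,n)) \<le> 1" "N (mon (k,l,m,n) * opC ^ (2 * M)) \<le> 1"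
    by (auto intro!: contr_mult opC_S mon_S contr_mon contr_power S_C contr_C)
  have s: "opC ^ (2 * M) * mon (k,l,m,n) \<in> S" "mon (k,l,m,n) * opC ^ (2 * M) \<in> S"
    by (auto intro!: S_closed(3) opC_S mon_S)
  have "N (opC ^ M * (mon (k,l,m,n) * opC ^ M)) \<le> Q ^ (nat \<bar>k\<bar> * M)"
  proof (cases "k > 0")
    case True
    thus ?thesis using c1(1) Q N_oscale[OF s(1), of "Q ^ (nat k * M)"] by (simp add: squeeze_mon_pos norm_power mult_left_le)
  next
    case False
    thus ?thesis using c1(2) Q N_oscale[OF s(2), of "Q ^ (nat (- k) * M)"] assms by (simp add: squeeze_mon_neg norm_power mult_left_le)
  qed
  also have "\<dots> \<le> Q ^ M" using Q assms by (intro power_decreasing) auto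
  finally show ?thesis .
qed

text \<open>If \<open>\<lambda>\<^sup>n = 1\<close> with \<open>n \<noteq> 0\<close>, then \<open>n\<theta>\<close> is an integer.\<close>

lemma phase_powi_neq_1: "n \<noteq> 0 \<Longrightarrow> phase powi n \<noteq> 1"
proof
  assume n: "n \<noteq> 0" and e: "phase powi n = 1"
  have "phase = cis (2 * pi * \<theta>)" by (simp add: phase_def cis_conv_exp mult_ac)
  hence "cis (2 * pi * \<theta> * of_int n) = 1" using e by (simp add: cis_power_int mult_ac)
  hence "cos (2 * pi * \<theta> * of_int n) = 1" by (metis cis.simps(1) one_complex.simps(1))
  then obtain k :: int where "2 * pi * \<theta> * of_int n = of_int k * (2 * pi)" by (auto simp: cos_one_2pi_int)
  hence "\<theta> * of_int n = of_int k" by simp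
  hence "\<theta> = of_int k / of_int n" using n by (simp add: field_simps)
  thus False using theta by (metis Rats_divide Rats_of_int)
qed

lemma average_phase: "n \<noteq> 0 \<Longrightarrow> (\<lambda>M. cmod (\<Sum>s<M. phase powi (n * int s)) / real M) \<longlonglongrightarrow> 0"
proof -
  assume n: "n \<noteq> 0"
  have "phase powi (n * int s) = (phase powi n) ^ s" for s by (simp add: phase_power)
  thus ?thesis
    using geometric_average_null[of "phase powi n"] phase_powi_neq_1[OF n] phase_norm by (simp add: norm_power_int)
qed

text \<open>If \<open>k \<noteq> 0\<close>, the compression tends to zero. If \<open>k = 0\<close> and \<open>l \<noteq> m\<close>, the average over conjugation by \<open>u\<close> does,
  and if \<open>k = 0\<close>, \<open>l = m\<close> and \<open>n \<noteq> 0\<close>, the average over conjugation by \<open>\<gamma>\<close> does. In the remaining case the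
  monomial is a power of \<open>c\<close>, which acts as the identity in the limit.\<close>

lemma vacuum_limit_mon: "vacuum_limit (mon i)"
proof -
  obtain k l m n where i: "i = (k, l, m, n)" by (cases i)
  have nonneg: "0 \<le> N (torus_avg M (opC ^ M * (mon i * opC ^ M)) - oscale c (opC ^ (2 * M)))" for M c
    by (intro N_nonneg vacuum_limit_in_S mon_S)
  consider "k \<noteq> 0" | "k = 0" "l \<noteq> m" | "k = 0" "l = m" by blast
  thus ?thesis
  proof cases
    case 1
    have "vacuum_coeff (mon i) = 0" using 1 by (simp add: i vacuum_coeff_mon)
    moreover have "N (torus_avg M (opC ^ M * (mon i * opC ^ M))) \<le> Q ^ M" for M
      using torus_avg_contr[OF squeeze_S[OF mon_S[of i]], of M] squeeze_small[OF 1, of M l m n] i by (meson order_trans)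
    ultimately show ?thesis
      unfolding vacuum_limit_def using nonneg[of _ 0] by (intro tendsto_zero_squeeze[OF Q_null]) auto
  next
    case 2
    have p: "vacuum_coeff (mon i) = 0" using 2 by (simp add: i vacuum_coeff_mon)
    have d: "int l - int m \<noteq> 0" using 2 by simp
    have "N (torus_avg M (opC ^ M * (mon i * opC ^ M))) \<le> cmod (\<Sum>s<M. phase powi ((int l - int m) * int s)) / real M" for M
    proof (cases "M = 0")
      case True
      thus ?thesis by (simp add: torus_avg_def)
    next
      case False
      let ?Y = "\<Sum>t<M. oscale (phase powi (- n * int t)) (opC ^ (2 * M + t) * mon i)"
      have Y: "?Y \<in> S" by (intro S_sum S_closed opC_S mon_S)
      have "N ?Y \<le> (\<Sum>t<M. N (oscale (phase powi (- n * int t)) (opC ^ (2 * M + t) * mon i)))"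
        by (intro N_sum) (auto intro!: S_closed opC_S mon_S)
      also have "\<dots> \<le> (\<Sum>t<M. 1)"
        by (intro sum_mono, subst N_oscale)
          (auto intro!: S_closed opC_S mon_S contr_mult contr_mon contr_power S_C contr_C simp: norm_power_int phase_norm)
      finally have NY: "N ?Y \<le> real M" by simp
      have "torus_avg M (opC ^ M * (mon i * opC ^ M)) = oscale ((\<Sum>s<M. phase powi ((int l - int m) * int s)) / (of_nat M * of_nat M)) ?Y"
      proof -
        have "(\<Sum>s<M. \<Sum>t<M. oscale (phase powi (int s * (int l - int m)) * phase powi (- n * int t)) (opC ^ (2 * M + t) * mon i))
            = oscale (\<Sum>s<M. phase powi ((int l - int m) * int s)) ?Y"
        proof -
          have sc: "oscale (\<Sum>s\<in>X. f s) T = (\<Sum>s\<in>X. oscale (f s) T)" if "finite X" for X :: "nat set" and f and T :: "idx op"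
            using that by (induction X rule: finite_induct) (auto simp: oscale_add_left)
          have dbl: "(\<Sum>s<M. \<Sum>t<M. oscale (f s) (T t)) = oscale (\<Sum>s<M. f s) (\<Sum>t<M. T t)"
            for f and T :: "nat \<Rightarrow> idx op"
            by (subst sum.swap) (simp add: sc oscale_sum)
          show ?thesis using dbl[of "\<lambda>s. phase powi ((int l - int m) * int s)"
              "\<lambda>t. oscale (phase powi (- n * int t)) (opC ^ (2 * M + t) * mon i)"]
            by (simp add: mult.commute)
        qed
        thus ?thesis unfolding torus_avg_def i 2(1) conj_mon by (simp add: mult.commute divide_inverse)
      qed
      hence "N (torus_avg M (opC ^ M * (mon i * opC ^ M))) = cmod (\<Sum>s<M. phase powi ((int l - int m) * int s)) / (real M * real M) * N ?Y"
        using N_oscale[OF Y] by (simp add: norm_divide norm_mult)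
      also have "\<dots> \<le> cmod (\<Sum>s<M. phase powi ((int l - int m) * int s)) / (real M * real M) * real M"
        by (rule mult_left_mono[OF NY]) simp
      finally show ?thesis using False by simp
    qed
    thus ?thesis unfolding vacuum_limit_def p using nonneg[of _ 0]
      by (intro tendsto_zero_squeeze[OF average_phase[OF d]]) auto
  next
    case 3
    \<comment> \<open>Conjugation by \<open>\<gamma>\<^sup>t\<close> leaves the extra factor \<open>c\<^sup>t\<^sup>+\<^sup>l\<close>. Dropping it for all \<open>t < M\<close> at once costs at most \<open>(M + l) Q\<^sup>M\<close>.\<close>
    have mon_l: "mon i = opC ^ l * opow opU n"
      by (rule op_eqI3) (simp add: i 3 lookup_mon lookup_C_pow lookup_opow_U wA_def power_add q_pow_Q mult_ac)
    let ?u = "opow opU n"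
    have u: "?u \<in> S" "N ?u \<le> 1" by (auto intro!: opow_S S_gen contr_opow contr_U)
    have av: "torus_avg M (opC ^ M * (mon i * opC ^ M)) = oscale (1 / (of_nat M * of_nat M))
        (\<Sum>s<M. \<Sum>t<M. oscale (phase powi (- n * int t)) (opC ^ (2 * M + (t + l)) * ?u))" for M
    proof -
      have "opC ^ (2 * M + t) * mon i = opC ^ (2 * M + (t + l)) * ?u" for t
        by (simp add: mon_l power_add mult.assoc)
      thus ?thesis unfolding torus_avg_def unfolding i 3 conj_mon by (simp add: i 3)
    qed
    define main where "main M = oscale (1 / (of_nat M * of_nat M))
        (\<Sum>s<M. \<Sum>t<M. oscale (phase powi (- n * int t)) (opC ^ (2 * M) * ?u))" for M
    have mainS: "main M \<in> S" for M unfolding main_def by (intro S_closed(4) S_sum S_closed(3) opC_S u)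
    have d1: "N (torus_avg M (opC ^ M * (mon i * opC ^ M)) - main M) \<le> (real M + real l) * Q ^ M" for M
    proof -
      have "torus_avg M (opC ^ M * (mon i * opC ^ M)) - main M = oscale (1 / (of_nat M * of_nat M))
        (\<Sum>s<M. \<Sum>t<M. oscale (phase powi (- n * int t)) ((opC ^ (2 * M + (t + l)) - opC ^ (2 * M)) * ?u))"
        unfolding av main_def oscale_minus[symmetric] sum_subtractf[symmetric] left_diff_distrib ..
      also have "N \<dots> \<le> (real M + real l) * Q ^ M"
      proof (rule N_average)
        fix s t :: nat assume t: "t < M"
        have dS: "opC ^ (2 * M + (t + l)) - opC ^ (2 * M) \<in> S" by (intro S_minus opC_S)
        have "N (oscale (phase powi (- n * int t)) ((opC ^ (2 * M + (t + l)) - opC ^ (2 * M)) * ?u)) = N ((opC ^ (2 * M + (t + l)) - opC ^ (2 * M)) * ?u)"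
          using N_oscale[OF S_closed(3)[OF dS u(1)]] by (simp add: norm_power_int phase_norm)
        also have "\<dots> \<le> N (opC ^ (2 * M + (t + l)) - opC ^ (2 * M))"
          by (rule contr_right[OF dS u])
        also have "\<dots> = N (opC ^ (2 * M) - opC ^ (2 * M + (t + l)))" by (rule N_minus_commute) (intro opC_S)+
        also have "\<dots> \<le> real (t + l) * Q ^ (2 * M)" by (rule opC_diff_many)
        also have "\<dots> \<le> (real M + real l) * Q ^ M"
          using t Q by (intro mult_mono power_decreasing) auto
        finally show "N (oscale (phase powi (- n * int t)) ((opC ^ (2 * M + (t + l)) - opC ^ (2 * M)) * ?u)) \<le> (real M + real l) * Q ^ M" .
      qed (use Q in \<open>auto intro!: S_closed S_minus opC_S u\<close>)
      finally show ?thesis .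
    qed
    have d2: "(\<lambda>M. (real M + real l) * Q ^ M) \<longlonglongrightarrow> 0"
    proof -
      have "(\<lambda>M. real M * Q ^ M + real l * Q ^ M) \<longlonglongrightarrow> 0 + real l * 0"
        by (intro tendsto_add tendsto_mult tendsto_const powser_times_n_limit_0 Q_null) (use Q in auto)
      thus ?thesis by (simp add: distrib_right)
    qed
    have d3: "(\<lambda>M. N (main M - oscale (vacuum_coeff (mon i)) (opC ^ (2 * M)))) \<longlonglongrightarrow> 0"
    proof (cases "n = 0")
      case True
      have "main M - oscale (vacuum_coeff (mon i)) (opC ^ (2 * M)) = 0" if "M > 0" for M
        using that by (simp add: main_def True vacuum_coeff_mon i 3 opow_def op_of_nat)
      hence "\<forall>\<^sub>F M in sequentially. 0 = N (main M - oscale (vacuum_coeff (mon i)) (opC ^ (2 * M)))"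
        by (intro eventually_sequentiallyI[of 1]) auto
      thus ?thesis by (rule Lim_transform_eventually[OF tendsto_const])
    next
      case False
      hence p: "vacuum_coeff (mon i) = 0" by (simp add: i vacuum_coeff_mon)
      have "N (main M) \<le> cmod (\<Sum>t<M. phase powi (- n * int t)) / real M" for M
      proof (cases "M = 0")
        case True
        thus ?thesis by (simp add: main_def)
      next
        case M: False
        have sc: "(\<Sum>t<M. oscale (f t) T) = oscale (\<Sum>t<M. f t) T" for f and T :: "idx op" and M :: nat
          by (induction M) (auto simp: oscale_add_left)
        have sum_const: "(\<Sum>s<M. T) = oscale (of_nat M) T" for T :: "idx op" and M :: nat
          by (simp add: op_of_nat)
        have "main M = oscale ((\<Sum>t<M. phase powi (- n * int t)) / of_nat M) (opC ^ (2 * M) * ?u)"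
          using M unfolding main_def sc sum_const by simp
        hence "N (main M) = cmod (\<Sum>t<M. phase powi (- n * int t)) / real M * N (opC ^ (2 * M) * ?u)"
          using N_oscale[OF S_closed(3)[OF opC_S u(1)]] by (simp add: norm_divide)
        also have "\<dots> \<le> cmod (\<Sum>t<M. phase powi (- n * int t)) / real M * 1"
          by (intro mult_left_mono contr_mult opC_S u contr_power S_C contr_C) simp
        finally show ?thesis by simp
      qed
      thus ?thesis unfolding p using False N_nonneg[OF mainS]
        by (intro tendsto_zero_squeeze[OF average_phase[of "- n"]]) auto
    qed
    show ?thesis
      unfolding vacuum_limit_def
    proof (rule tendsto_zero_squeeze[OF tendsto_add[OF d2 d3, simplified]])
      fix M
      show "0 \<le> N (torus_avg M (opC ^ M * (mon i * opC ^ M)) - oscale (vacuum_coeff (mon i)) (opC ^ (2 * M)))" by (rule nonneg)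
      have "torus_avg M (opC ^ M * (mon i * opC ^ M)) - oscale (vacuum_coeff (mon i)) (opC ^ (2 * M)) =
        (torus_avg M (opC ^ M * (mon i * opC ^ M)) - main M) + (main M - oscale (vacuum_coeff (mon i)) (opC ^ (2 * M)))" by simp
      also have "N \<dots> \<le> N (torus_avg M (opC ^ M * (mon i * opC ^ M)) - main M) + N (main M - oscale (vacuum_coeff (mon i)) (opC ^ (2 * M)))"
        by (intro N_add S_minus torus_avg_S squeeze_S mon_S mainS S_closed(4) opC_S)
      finally show "N (torus_avg M (opC ^ M * (mon i * opC ^ M)) - oscale (vacuum_coeff (mon i)) (opC ^ (2 * M))) \<le>
        (real M + real l) * Q ^ M + N (main M - oscale (vacuum_coeff (mon i)) (opC ^ (2 * M)))" using d1[of M] by simp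
    qed
  qed
qed

lemma vacuum_limit_S: "x \<in> S \<Longrightarrow> vacuum_limit x"
proof -
  assume "x \<in> S"
  then obtain D where "x \<in> S_deg D" using S_deg_exhaust by blast
  then obtain p where p: "Poly_Mapping.keys p \<subseteq> nword ` {i. expdeg i \<le> D}" "x = ev p" using S_deg_repr by blast
  show ?thesis unfolding p(2) using p(1)
  proof (induction p rule: poly_mapping_additive_induct)
    case zero
    have "vacuum_limit (oscale 0 (mon (0,0,0,0)))" by (rule vacuum_limit_scale[OF mon_S vacuum_limit_mon])
    thus ?case by (simp add: opr.free_eval_zero[simplified])
  next
    case (single w c)
    then obtain i where "w = nword i" by blast
    hence "ev (Poly_Mapping.single w c) = oscale c (mon i)" by (simp add: opr.free_eval_single[simplified] eval_nword)
    thus ?case using vacuum_limit_scale[OF mon_S vacuum_limit_mon] by simp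
  next
    case (add p p')
    have "ev p \<in> S" "ev p' \<in> S" by (auto simp: S_def)
    thus ?case using vacuum_limit_add add by (simp add: ev_simps)
  qed
qed

text \<open>Compression and averaging do not increase the norm, and the powers of \<open>c\<close> stay away from zero.\<close>

lemma vacuum_coeff_bound: "x \<in> S \<Longrightarrow> cmod (vacuum_coeff x) * \<beta> \<le> N x"
proof -
  assume x: "x \<in> S"
  let ?e = "\<lambda>M. N (torus_avg M (opC ^ M * (x * opC ^ M)) - oscale (vacuum_coeff x) (opC ^ (2 * M)))"
  have le: "cmod (vacuum_coeff x) * \<beta> \<le> N x + ?e M" if "M \<ge> 1" for M
  proof -
    define k where "k = 2 * M - 1"
    have k: "2 * M = Suc k" using that by (simp add: k_def)
    have "cmod (vacuum_coeff x) * \<beta> \<le> cmod (vacuum_coeff x) * N (opC ^ (2 * M))"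
      unfolding k by (intro mult_left_mono opC_power_lower) simp
    also have "\<dots> = N (oscale (vacuum_coeff x) (opC ^ (2 * M)))" by (rule N_oscale[OF opC_S, symmetric])
    also have "\<dots> = N (torus_avg M (opC ^ M * (x * opC ^ M)) - (torus_avg M (opC ^ M * (x * opC ^ M)) - oscale (vacuum_coeff x) (opC ^ (2 * M))))" by simp
    also have "\<dots> \<le> N (torus_avg M (opC ^ M * (x * opC ^ M))) + ?e M"
      by (intro N_minus torus_avg_S squeeze_S vacuum_limit_in_S x)
    also have "N (torus_avg M (opC ^ M * (x * opC ^ M))) \<le> N (opC ^ M * (x * opC ^ M))" by (intro torus_avg_contr squeeze_S x)
    also have "\<dots> \<le> N (x * opC ^ M)" by (intro contr_left opC_S S_closed(3) x contr_power S_C contr_C)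
    also have "\<dots> \<le> N x" by (intro contr_right opC_S x contr_power S_C contr_C)
    finally show ?thesis by simp
  qed
  have "(\<lambda>M. N x + ?e M) \<longlonglongrightarrow> N x + 0"
    using vacuum_limit_S[OF x] unfolding vacuum_limit_def by (intro tendsto_add tendsto_const)
  hence "cmod (vacuum_coeff x) * \<beta> \<le> N x + 0" by (rule LIMSEQ_le_const) (use le in blast)
  thus ?thesis by simp
qed

abbreviation basis :: "nat \<Rightarrow> int \<Rightarrow> int \<Rightarrow> (idx \<Rightarrow>\<^sub>0 complex)" where
  "basis j a b \<equiv> Poly_Mapping.single (j, a, b) 1"

text \<open>The norm of \<open>\<alpha>*\<^sup>j\<close> applied to the vacuum.\<close>

definition \<rho> :: "nat \<Rightarrow> complex" where "\<rho> j = (\<Prod>i<j. r (j - i))"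

lemma rho_bound: "sqrt euler \<le> cmod (\<rho> j)"
proof -
  have "(cmod (\<rho> j))\<^sup>2 = (\<Prod>i<j. 1 - Q ^ (j - i))"
  proof -
    have "(cmod (r i))\<^sup>2 = 1 - Q ^ i" for i
      using Qpow(1)[of i] by (simp add: r_def)
    thus ?thesis by (simp add: \<rho>_def prod_norm[symmetric] prod_power_distrib)
  qed
  also have "\<dots> = (\<Prod>i\<in>{1..j}. 1 - Q ^ i)"
    by (rule prod.reindex_bij_witness[of _ "\<lambda>i. j - i" "\<lambda>i. j - i"]) auto
  finally have "euler \<le> (cmod (\<rho> j))\<^sup>2" using prod_minus_Q[of "{1..j}"] by simp
  thus ?thesis by (simp add: real_le_lsqrt)
qed

text \<open>The monomial that takes the vacuum to a multiple of \<open>e(j,a,b)\<close>.\<close>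

definition creation :: "nat \<Rightarrow> int \<Rightarrow> int \<Rightarrow> idx op" where
  "creation j a b = mon (- int j, nat a, nat (- a), b)"

lemma creation_vacuum: "app (creation j a b) (basis 0 0 0) = vscale (\<rho> j) (basis j a b)"
proof (rule poly_mapping_eqI)
  fix i :: idx
  obtain J A B where i: "i = (J, A, B)" by (cases i)
  have na: "int (nat a) - int (nat (- a)) = a" by simp
  consider "J < j" | "J = j" | "J > j" by linarith
  thus "Poly_Mapping.lookup (app (creation j a b) (basis 0 0 0)) i = Poly_Mapping.lookup (vscale (\<rho> j) (basis j a b)) i"
  proof cases
    case 1
    thus ?thesis by (simp add: i creation_def lookup_mon wA_zero lookup_map_times lookup_single)
  next
    case 2
    have "wA (- int j) j = \<rho> j" by (cases "j = 0") (auto simp: wA_def \<rho>_def)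
    thus ?thesis using 2 na by (auto simp: i creation_def lookup_mon lookup_map_times lookup_single when_def)
  next
    case 3
    thus ?thesis by (auto simp: i creation_def lookup_mon lookup_map_times lookup_single when_def)
  qed
qed

text \<open>A coefficient of \<open>x\<close> is the vacuum coefficient of \<open>W* x V\<close>, where \<open>V\<close> and \<open>W\<close> create the two basis
  vectors from the vacuum, up to weights that are bounded below. Note that \<open>V\<close> and \<open>W\<close> are contractions for
  every C*-norm.\<close>

lemma coeff_bound:
  assumes x: "x \<in> S"
  shows "cmod (Poly_Mapping.lookup (app x (basis j a b)) (j', a', b')) \<le> N x / (euler * \<beta>)"
proof -
  let ?V = "creation j a b" and ?W = "creation j' a' b'"
  let ?c = "Poly_Mapping.lookup (app x (basis j a b)) (j', a', b')"
  have VW: "?V \<in> S" "?W \<in> S" "N ?V \<le> 1" "N (adj ?W) \<le> 1" "adj ?W \<in> S"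
    by (auto simp: creation_def mon_S contr_mon N_adj intro: S_closed(5) mon_S)
  have "vacuum_coeff (adj ?W * (x * ?V)) = cinner (app (adj ?W * (x * ?V)) (basis 0 0 0)) (basis 0 0 0)"
    by (simp add: vacuum_coeff_def cinner_single_right)
  also have "\<dots> = cinner (app x (app ?V (basis 0 0 0))) (app ?W (basis 0 0 0))"
    by (simp add: app_adj)
  also have "\<dots> = \<rho> j * (cnj (\<rho> j') * ?c)"
    unfolding creation_vacuum app_vscale cinner_scale_left cinner_scale_right cinner_single_right by (simp add: lookup_map_times)
  finally have e: "cmod (vacuum_coeff (adj ?W * (x * ?V))) = (cmod (\<rho> j) * cmod (\<rho> j')) * cmod ?c"
    by (simp add: norm_mult)
  have "euler = sqrt euler * sqrt euler" using euler_pos by simp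
  also have "\<dots> \<le> cmod (\<rho> j) * cmod (\<rho> j')"
    using rho_bound euler_pos by (intro mult_mono) auto
  finally have "euler * cmod ?c * \<beta> \<le> (cmod (\<rho> j) * cmod (\<rho> j')) * cmod ?c * \<beta>"
    using beta_pos by (intro mult_right_mono) auto
  also have "\<dots> = cmod (vacuum_coeff (adj ?W * (x * ?V))) * \<beta>" by (simp add: e)
  also have "\<dots> \<le> N (adj ?W * (x * ?V))" by (intro vacuum_coeff_bound S_closed(3) VW x)
  also have "\<dots> \<le> N (x * ?V)" by (intro contr_left S_closed(3) VW x)
  also have "\<dots> \<le> N x" by (intro contr_right VW x)
  finally show ?thesis using euler_pos beta_pos by (simp add: field_simps)
qed

section \<open>Interpolation at the spectrum\<close>

abbreviation Qc :: complex where "Qc \<equiv> complex_of_real Q"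

lemma Qc_inj: "Qc ^ i = Qc ^ j \<longleftrightarrow> i = j"
proof -
  have "Q ^ i = Q ^ j \<longleftrightarrow> i = j" using power_inject_exp'[of Q] Q by simp
  thus ?thesis by (metis of_real_eq_iff of_real_power)
qed

text \<open>The value at \<open>Q\<^sup>i\<close> of the Lagrange basis polynomial for the nodes \<open>Q\<^sup>0, \<dots>, Q\<^sup>d\<close>, equal to \<open>1\<close> at \<open>Q\<^sup>j\<close>.\<close>

definition lagrange :: "nat \<Rightarrow> nat \<Rightarrow> nat \<Rightarrow> complex" where
  "lagrange d j i = (\<Prod>s\<in>{..d} - {j}. (Qc ^ i - Qc ^ s) / (Qc ^ j - Qc ^ s))"

lemma lagrange_interpolation:
  assumes "degree p \<le> d"
  shows "poly p (Qc ^ i) = (\<Sum>j\<le>d. poly p (Qc ^ j) * lagrange d j i)"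
proof -
  define L where "L j = Polynomial.smult (\<Prod>s\<in>{..d} - {j}. 1 / (Qc ^ j - Qc ^ s)) (\<Prod>s\<in>{..d} - {j}. [:- (Qc ^ s), 1:])" for j
  define p' where "p' = (\<Sum>j\<le>d. Polynomial.smult (poly p (Qc ^ j)) (L j))"
  have L: "poly (L j) (Qc ^ i) = lagrange d j i" for i j
    by (simp add: L_def lagrange_def poly_prod prod.distrib[symmetric] divide_inverse mult.commute)
  have dL: "degree (L j) \<le> d" if "j \<le> d" for j
  proof -
    have "degree (L j) \<le> degree (\<Prod>s\<in>{..d} - {j}. [:- (Qc ^ s), 1:])" by (simp add: L_def degree_smult_le)
    also have "\<dots> \<le> (\<Sum>s\<in>{..d} - {j}. degree [:- (Qc ^ s), 1:])" using degree_prod_sum_le[of "{..d} - {j}" "\<lambda>s. [:- (Qc ^ s), 1:]"] by (simp add: comp_def)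
    also have "\<dots> = d" using that by simp
    finally show ?thesis .
  qed
  have dp': "degree p' \<le> d"
    unfolding p'_def by (rule degree_sum_le, simp, rule order_trans[OF degree_smult_le dL]) simp
  have agree: "poly (p - p') (Qc ^ m) = 0" if "m \<le> d" for m
  proof -
    have lagm: "lagrange d j m = (if j = m then 1 else 0)" if "j \<le> d" for j
    proof (cases "j = m")
      case True
      have "(\<Prod>s\<in>{..d} - {m}. (Qc ^ m - Qc ^ s) / (Qc ^ m - Qc ^ s)) = 1"
        by (rule prod.neutral) (auto simp: Qc_inj)
      thus ?thesis by (simp add: lagrange_def True)
    next
      case False
      hence "m \<in> {..d} - {j}" using \<open>m \<le> d\<close> by auto
      hence "(\<Prod>s\<in>{..d} - {j}. (Qc ^ m - Qc ^ s) / (Qc ^ j - Qc ^ s)) = 0" by (intro prod_zero bexI[of _ m]) auto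
      thus ?thesis using False by (simp add: lagrange_def)
    qed
    have "poly p' (Qc ^ m) = (\<Sum>j\<le>d. poly p (Qc ^ j) * lagrange d j m)" by (simp add: p'_def poly_sum L)
    also have "\<dots> = (\<Sum>j\<le>d. if j = m then poly p (Qc ^ j) else 0)"
      by (rule sum.cong) (auto simp: lagm)
    finally have "poly p' (Qc ^ m) = (\<Sum>j\<le>d. if j = m then poly p (Qc ^ j) else 0)" .
    thus ?thesis using that by simp
  qed
  \<comment> \<open>a difference of degree at most \<open>d\<close> with \<open>d + 1\<close> zeros\<close>
  have "p - p' = 0"
  proof (rule ccontr)
    assume nz: "p - p' \<noteq> 0"
    have "inj_on (\<lambda>m. Qc ^ m) {..d}" by (simp add: inj_on_def Qc_inj)
    hence "Suc d = card ((\<lambda>m. Qc ^ m) ` {..d})" by (simp add: card_image)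
    also have "\<dots> \<le> card {x. poly (p - p') x = 0}"
      by (rule card_mono[OF poly_roots_finite[OF nz]]) (use agree in auto)
    also have "\<dots> \<le> degree (p - p')" by (rule card_poly_roots_bound[OF nz])
    also have "\<dots> \<le> d" using assms dp' by (intro degree_diff_le)
    finally show False by simp
  qed
  hence "poly p (Qc ^ i) = poly p' (Qc ^ i)" by simp
  thus ?thesis by (simp add: p'_def poly_sum L)
qed

lemma diag_As_A_power:
  "adj opA ^ j * diag f * opA ^ j = diag (\<lambda>i. (\<Prod>s<j. 1 - Qc ^ (i - s)) * f (i - j))"
proof (induction j)
  case (Suc j)
  have "adj opA ^ Suc j * diag f * opA ^ Suc j = adj opA * (adj opA ^ j * diag f * opA ^ j) * opA"
    unfolding power_Suc[of "adj opA"] power_Suc2[of opA] by (simp only: mult.assoc)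
  also have "\<dots> = diag (\<lambda>i. (1 - Qc ^ i) * ((\<Prod>s<j. 1 - Qc ^ (i - 1 - s)) * f (i - 1 - j)))"
    unfolding Suc As_diag_A ..
  also have "(\<lambda>i. (1 - Qc ^ i) * ((\<Prod>s<j. 1 - Qc ^ (i - 1 - s)) * f (i - 1 - j))) =
      (\<lambda>i. (\<Prod>s<Suc j. 1 - Qc ^ (i - s)) * f (i - Suc j))"
    by (rule ext) (simp add: prod.lessThan_Suc_shift del: prod.lessThan_Suc)
  finally show ?case .
qed simp

text \<open>The product of \<open>c - Q\<^sup>t\<close> for \<open>t = 1, \<dots>, n\<close>. Its factors have norm at most \<open>1 + Q\<^sup>t\<close>, so the norm of the product is
  bounded independently of \<open>n\<close>.\<close>

definition rprod :: "nat \<Rightarrow> idx op" where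
  "rprod n = diag (\<lambda>i. \<Prod>t\<in>{1..n}. Qc ^ i - Qc ^ t)"

lemma rprod_Suc: "rprod (Suc n) = rprod n * (opC - oscale (Qc ^ Suc n) 1)"
  unfolding rprod_def opC_def diag_one[symmetric] diag_scale diag_minus diag_mult by simp

lemma rprod_S: "rprod n \<in> S" and rprod_bound: "N (rprod n) \<le> exp (1 / (1 - Q))"
proof -
  have f: "opC - oscale c 1 \<in> S" for c by (intro S_minus S_C S_closed)
  show S: "rprod n \<in> S" for n
  proof (induction n)
    case 0
    show ?case by (simp add: rprod_def diag_one S_closed)
  next
    case (Suc n)
    thus ?case unfolding rprod_Suc by (intro S_closed(3) f)
  qed
  have "N (rprod n) \<le> (\<Prod>t\<in>{1..n}. 1 + Q ^ t)"
  proof (induction n)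
    case 0
    show ?case by (simp add: rprod_def diag_one N_one)
  next
    case (Suc n)
    have "N (opC - oscale (Qc ^ Suc n) 1) \<le> N opC + N (oscale (Qc ^ Suc n) 1)" by (intro N_minus S_C S_closed)
    also have "\<dots> \<le> 1 + Q ^ Suc n"
      using contr_C Q N_oscale[OF S_closed(1), of "Qc ^ Suc n"] N_one by (simp add: norm_power norm_mult)
    finally have c: "N (opC - oscale (Qc ^ Suc n) 1) \<le> 1 + Q ^ Suc n" .
    have "N (rprod (Suc n)) \<le> N (rprod n) * N (opC - oscale (Qc ^ Suc n) 1)"
      unfolding rprod_Suc by (intro N_mult S f)
    also have "\<dots> \<le> (\<Prod>t\<in>{1..n}. 1 + Q ^ t) * (1 + Q ^ Suc n)"
      by (rule mult_mono[OF Suc c]) (use Q N_nonneg[OF f] in \<open>auto intro!: prod_nonneg add_nonneg_nonneg\<close>)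
    finally show ?case by simp
  qed
  thus "N (rprod n) \<le> exp (1 / (1 - Q))" using prod_plus_Q[of "{1..n}"] by simp
qed

definition interp_const :: real where "interp_const = exp (1 / (1 - Q)) / (euler * euler)"

lemma interp_const_pos: "0 < interp_const" using euler_pos by (simp add: interp_const_def)

text \<open>The denominators of the basis polynomials are so small that the triangle inequality for their
  coefficients gives no useful bound. But \<open>\<alpha>*\<^sup>j f(c) \<alpha>\<^sup>j\<close> vanishes at the nodes before the \<open>j\<close>th and shifts the
  remaining ones to \<open>1, Q, Q\<^sup>2, \<dots>\<close>; so the zeros at the earlier nodes come for free from contractions, and those
  at the later nodes from \<open>rprod\<close>. The normalising constant is a product of two partial Euler products.\<close>

lemma lagrange_factor:
  assumes "j \<le> d"
  shows "diag (lagrange d j) = oscale (1 / ((\<Prod>s<j. 1 - Qc ^ (j - s)) * (\<Prod>t\<in>{1..d - j}. 1 - Qc ^ t)))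
     (adj opA ^ j * rprod (d - j) * opA ^ j)"
proof -
  have "lagrange d j i = 1 / ((\<Prod>s<j. 1 - Qc ^ (j - s)) * (\<Prod>t\<in>{1..d - j}. 1 - Qc ^ t)) *
      ((\<Prod>s<j. 1 - Qc ^ (i - s)) * (\<Prod>t\<in>{1..d - j}. Qc ^ (i - j) - Qc ^ t))" for i
  proof (cases "i < j")
    case True
    have "lagrange d j i = 0" unfolding lagrange_def using True assms by (intro prod_zero bexI[of _ i]) auto
    moreover have "(\<Prod>s<j. 1 - Qc ^ (i - s)) = 0" using True by (intro prod_zero bexI[of _ i]) auto
    ultimately show ?thesis by simp
  next
    case False
    have split: "{..d} - {j} = {..<j} \<union> {Suc j..d}" using assms by auto
    have "lagrange d j i = (\<Prod>s<j. (Qc ^ i - Qc ^ s) / (Qc ^ j - Qc ^ s)) * (\<Prod>s\<in>{Suc j..d}. (Qc ^ i - Qc ^ s) / (Qc ^ j - Qc ^ s))"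
      unfolding lagrange_def split by (rule prod.union_disjoint) auto
    also have "(\<Prod>s<j. (Qc ^ i - Qc ^ s) / (Qc ^ j - Qc ^ s)) = (\<Prod>s<j. (1 - Qc ^ (i - s)) / (1 - Qc ^ (j - s)))"
    proof (rule prod.cong[OF refl])
      fix s assume s: "s \<in> {..<j}"
      have "Qc ^ i - Qc ^ s = - (Qc ^ s) * (1 - Qc ^ (i - s))" if "s \<le> i" for i
        using that by (simp add: algebra_simps flip: power_add)
      thus "(Qc ^ i - Qc ^ s) / (Qc ^ j - Qc ^ s) = (1 - Qc ^ (i - s)) / (1 - Qc ^ (j - s))"
        using s False Q by simp
    qed
    also have "(\<Prod>s\<in>{Suc j..d}. (Qc ^ i - Qc ^ s) / (Qc ^ j - Qc ^ s)) = (\<Prod>t\<in>{1..d - j}. (Qc ^ (i - j) - Qc ^ t) / (1 - Qc ^ t))"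
    proof (rule prod.reindex_bij_witness[of _ "\<lambda>t. j + t" "\<lambda>s. s - j"])
      fix s assume s: "s \<in> {Suc j..d}"
      have "Qc ^ i = Qc ^ j * Qc ^ (i - j)" "Qc ^ s = Qc ^ j * Qc ^ (s - j)" using False s by (simp_all flip: power_add)
      hence "Qc ^ i - Qc ^ s = Qc ^ j * (Qc ^ (i - j) - Qc ^ (s - j))" "Qc ^ j - Qc ^ s = Qc ^ j * (1 - Qc ^ (s - j))"
        by (simp_all add: right_diff_distrib)
      thus "(Qc ^ (i - j) - Qc ^ (s - j)) / (1 - Qc ^ (s - j)) = (Qc ^ i - Qc ^ s) / (Qc ^ j - Qc ^ s)"
        using Q by simp
    qed (use assms in auto)
    finally show ?thesis by (simp add: prod_dividef)
  qed
  hence "lagrange d j = (\<lambda>i. 1 / ((\<Prod>s<j. 1 - Qc ^ (j - s)) * (\<Prod>t\<in>{1..d - j}. 1 - Qc ^ t)) *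
      ((\<Prod>s<j. 1 - Qc ^ (i - s)) * (\<Prod>t\<in>{1..d - j}. Qc ^ (i - j) - Qc ^ t)))" by (rule ext)
  thus ?thesis unfolding rprod_def diag_As_A_power diag_scale by (rule arg_cong)
qed

lemma lagrange_S: "j \<le> d \<Longrightarrow> diag (lagrange d j) \<in> S"
  unfolding lagrange_factor by (intro S_closed(3-5) S_power S_gen rprod_S)

lemma lagrange_bound:
  assumes "j \<le> d"
  shows "N (diag (lagrange d j)) \<le> interp_const"
proof -
  let ?c1 = "\<Prod>s<j. 1 - Qc ^ (j - s)" and ?c2 = "\<Prod>t\<in>{1..d - j}. 1 - Qc ^ t"
  let ?T = "adj opA ^ j * rprod (d - j) * opA ^ j"
  have S: "?T \<in> S" "adj opA ^ j * rprod (d - j) \<in> S" by (intro S_closed(3-5) S_power S_gen rprod_S)+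
  have "N ?T \<le> N (adj opA ^ j * rprod (d - j))"
    by (intro contr_right S S_power S_gen contr_power contr_A)
  also have "\<dots> \<le> N (rprod (d - j))"
    by (intro contr_left S S_power S_gen contr_power contr_A rprod_S S_closed)
  finally have T: "N ?T \<le> exp (1 / (1 - Q))" using rprod_bound[of "d - j"] by simp
  have c2: "euler \<le> cmod ?c2"
  proof -
    have "?c2 = complex_of_real (\<Prod>t\<in>{1..d - j}. 1 - Q ^ t)" by simp
    hence "cmod ?c2 = \<bar>\<Prod>t\<in>{1..d - j}. 1 - Q ^ t\<bar>" by (metis norm_of_real)
    thus ?thesis using prod_minus_Q[of "{1..d - j}"] by simp
  qed
  have c1: "euler \<le> cmod ?c1"
  proof -
    have "?c1 = complex_of_real (\<Prod>s<j. 1 - Q ^ (j - s))" by simp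
    also have "(\<Prod>s<j. 1 - Q ^ (j - s)) = (\<Prod>i\<in>{1..j}. 1 - Q ^ i)"
      by (rule prod.reindex_bij_witness[of _ "\<lambda>i. j - i" "\<lambda>i. j - i"]) auto
    finally have "cmod ?c1 = \<bar>\<Prod>i\<in>{1..j}. 1 - Q ^ i\<bar>" by (metis norm_of_real)
    thus ?thesis using prod_minus_Q[of "{1..j}"] by simp
  qed
  have c12: "euler * euler \<le> cmod ?c1 * cmod ?c2" using c1 c2 euler_pos by (intro mult_mono) auto
  have "N (diag (lagrange d j)) = 1 / (cmod ?c1 * cmod ?c2) * N ?T"
    unfolding lagrange_factor[OF assms] N_oscale[OF S(1)] by (simp add: norm_divide norm_mult)
  also have "\<dots> \<le> 1 / (euler * euler) * exp (1 / (1 - Q))"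
  proof (rule mult_mono[OF _ T])
    show "1 / (cmod ?c1 * cmod ?c2) \<le> 1 / (euler * euler)"
      using less_le_trans[OF euler_pos c1] less_le_trans[OF euler_pos c2] euler_pos
      by (intro divide_left_mono c12 mult_pos_pos) auto
  qed (use N_nonneg[OF S(1)] euler_pos in auto)
  finally show ?thesis by (simp add: interp_const_def)
qed

text \<open>A polynomial in \<open>c\<close> is bounded in every C*-norm by its values at the eigenvalues of \<open>c\<close>, up to a
  factor linear in the degree.\<close>

lemma diag_poly:
  assumes d: "degree p \<le> d" and B: "\<And>j. cmod (poly p (Qc ^ j)) \<le> B"
  shows "diag (\<lambda>i. poly p (Qc ^ i)) \<in> S" "N (diag (\<lambda>i. poly p (Qc ^ i))) \<le> interp_const * (real d + 1) * B"
proof -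
  have e: "diag (\<lambda>i. poly p (Qc ^ i)) = (\<Sum>j\<le>d. oscale (poly p (Qc ^ j)) (diag (lagrange d j)))"
  proof -
    have "diag (\<lambda>i. poly p (Qc ^ i)) = diag (\<lambda>i. \<Sum>j\<le>d. poly p (Qc ^ j) * lagrange d j i)"
      by (rule arg_cong[of _ _ diag], rule ext, rule lagrange_interpolation[OF d])
    also have "\<dots> = (\<Sum>j\<le>d. diag (\<lambda>i. poly p (Qc ^ j) * lagrange d j i))"
      by (rule diag_sum[symmetric]) simp
    finally show ?thesis by (simp only: diag_scale)
  qed
  show "diag (\<lambda>i. poly p (Qc ^ i)) \<in> S" unfolding e by (intro S_sum S_closed(4) lagrange_S) simp
  have "N (diag (\<lambda>i. poly p (Qc ^ i))) \<le> (\<Sum>j\<le>d. N (oscale (poly p (Qc ^ j)) (diag (lagrange d j))))"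
    unfolding e by (intro N_sum S_closed(4) lagrange_S) auto
  also have "\<dots> \<le> (\<Sum>j\<le>d. B * interp_const)"
  proof (rule sum_mono)
    fix j assume j: "j \<in> {..d}"
    show "N (oscale (poly p (Qc ^ j)) (diag (lagrange d j))) \<le> B * interp_const"
      using j by (subst N_oscale) (auto intro!: lagrange_S mult_mono B lagrange_bound N_nonneg order_trans[OF norm_ge_zero B])
  qed
  also have "\<dots> = interp_const * (real d + 1) * B" by (simp add: algebra_simps)
  finally show "N (diag (\<lambda>i. poly p (Qc ^ i))) \<le> interp_const * (real d + 1) * B" .
qed

section \<open>Homogeneous components\<close>

text \<open>The degree for the grading by \<open>\<int>\<^sup>3\<close>, i.e. minus the translation of the first coordinate and the
  translations of the other two.\<close>

definition hdegree :: "exps \<Rightarrow> int \<times> int \<times> int" where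
  "hdegree = (\<lambda>(k, l, m, n). (k, int l - int m, n))"

text \<open>The polynomial with \<open>\<alpha>\<^sup>k* \<alpha>\<^sup>k = Apoly k (c)\<close>. For \<open>k \<ge> 0\<close> its zeros among the eigenvalues are those where \<open>\<alpha>\<^sup>k\<close>
  vanishes.\<close>

definition Apoly :: "int \<Rightarrow> complex poly" where
  "Apoly k = (if k \<ge> 0 then \<Prod>i<nat k. [:1, - (inverse Qc ^ i):] else \<Prod>i<nat (- k). [:1, - (Qc ^ Suc i):])"

lemma degree_Apoly: "degree (Apoly k) \<le> nat \<bar>k\<bar>"
proof -
  have "degree (\<Prod>i<n. [:1, f i:]) \<le> n" for f :: "nat \<Rightarrow> complex" and n
  proof -
    have "degree (\<Prod>i<n. [:1, f i:]) \<le> (\<Sum>i<n. degree [:1, f i:])"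
      using degree_prod_sum_le[of "{..<n}" "\<lambda>i. [:1, f i:]"] by (simp add: comp_def)
    also have "\<dots> \<le> (\<Sum>i<n. 1)" by (intro sum_mono) simp
    finally show ?thesis by simp
  qed
  from this[of "\<lambda>i. - (inverse Qc ^ i)" "nat k"] this[of "\<lambda>i. - (Qc ^ Suc i)" "nat (- k)"]
  show ?thesis by (auto simp: Apoly_def)
qed

lemma wA_Apoly: "wA (- k) j * wA k (nat (int j - k)) = poly (Apoly k) (Qc ^ j)"
proof (cases "k \<ge> 0")
  case True
  then obtain K where K: "k = int K" by (metis nonneg_int_cases)
  have P: "poly (Apoly k) (Qc ^ j) = (\<Prod>i<K. 1 - inverse Qc ^ i * Qc ^ j)"
    by (simp add: K Apoly_def poly_prod mult.commute)
  show ?thesis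
  proof (cases "j < K")
    case True
    have "inverse Qc ^ j * Qc ^ j = 1" using Q by (simp flip: power_mult_distrib)
    hence "(\<Prod>i<K. 1 - inverse Qc ^ i * Qc ^ j) = 0" using True by (intro prod_zero bexI[of _ j]) auto
    moreover have "wA (- k) j = 0" by (rule wA_zero) (use True K in simp)
    ultimately show ?thesis by (simp add: P)
  next
    case False
    have "wA (- k) j = (\<Prod>i<K. r (j - i))" by (cases "K = 0") (auto simp: wA_def K)
    moreover have "wA k (nat (int j - k)) = (\<Prod>i<K. r (j - i))"
    proof -
      have "wA k (nat (int j - k)) = (\<Prod>i<K. r (j - (K - Suc i)))"
        using False by (auto simp: wA_def K nat_diff_distrib' intro!: prod.cong arg_cong[of _ _ r])
      also have "\<dots> = (\<Prod>i<K. r (j - i))" by (rule prod.nat_diff_reindex)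
      finally show ?thesis .
    qed
    moreover have "r (j - i) * r (j - i) = 1 - inverse Qc ^ i * Qc ^ j" if "i < K" for i
      unfolding r_sq using that False Q by (simp add: power_diff power_inverse field_simps)
    ultimately show ?thesis by (simp add: P flip: prod.distrib)
  qed
next
  case False
  define K where "K = nat (- k)"
  have K: "k = - int K" "K > 0" using False by (auto simp: K_def)
  have "wA (- k) j = (\<Prod>i<K. r (Suc j + i))" by (simp add: wA_def K)
  moreover have "wA k (nat (int j - k)) = (\<Prod>i<K. r (Suc j + i))"
  proof -
    have "nat (int j - k) = j + K" by (simp add: K)
    hence "wA k (nat (int j - k)) = (\<Prod>i<K. r (j + K - i))" using K by (simp add: wA_def)
    also have "\<dots> = (\<Prod>i<K. r (j + K - (K - Suc i)))" by (rule prod.nat_diff_reindex[symmetric])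
    also have "\<dots> = (\<Prod>i<K. r (Suc j + i))" by (intro prod.cong arg_cong[of _ _ r]) auto
    finally show ?thesis .
  qed
  moreover have "poly (Apoly k) (Qc ^ j) = (\<Prod>i<K. 1 - Qc ^ (Suc j + i))"
    using K by (simp add: Apoly_def poly_prod power_add mult_ac)
  ultimately show ?thesis by (simp add: r_sq flip: prod.distrib del: power_Suc)
qed

lemma adj_opow: "adj (opow T k) = opow T (- k)"
  by (auto simp: opow_def adj_power)

text \<open>The polynomial with \<open>(mon i)* mon i' = gram i i' (c)\<close> for monomials of the same degree. As \<open>l - m = l' - m'\<close>,
  the four exponents of \<open>\<gamma>\<close> and \<open>\<gamma>*\<close> add up to \<open>2(m + l')\<close>.\<close>

definition gram :: "exps \<Rightarrow> exps \<Rightarrow> complex poly" where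
  "gram = (\<lambda>(k, l, m, n) (k', l', m', n'). Apoly k * Polynomial.monom 1 (m + l'))"

lemma gram_degree: "expdeg i \<le> D \<Longrightarrow> expdeg i' \<le> D \<Longrightarrow> degree (gram i i') \<le> 2 * D"
proof -
  assume a: "expdeg i \<le> D" "expdeg i' \<le> D"
  obtain k l m n k' l' m' n' where i: "i = (k,l,m,n)" "i' = (k',l',m',n')" by (cases i, cases i') auto
  have "degree (gram i i') \<le> degree (Apoly k) + (m + l')"
    unfolding gram_def i by (auto intro: order_trans[OF degree_mult_le] simp: degree_monom_eq)
  also have "\<dots> \<le> 2 * D" using degree_Apoly[of k] a by (simp add: i expdeg_def)
  finally show ?thesis .
qed

lemma mon_gram:
  assumes "hdegree i = hdegree i'"
  shows "adj (mon i) * mon i' = diag (\<lambda>j. poly (gram i i') (Qc ^ j))"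
proof (rule op_eqI3)
  fix v j a b
  obtain k l m n where i: "i = (k,l,m,n)" by (cases i)
  obtain l' m' where i': "i' = (k,l',m',n)" using assms by (cases i') (auto simp: i hdegree_def)
  have lm: "int l - int m = int l' - int m'" using assms by (simp add: i i' hdegree_def)
  have adjm: "adj (mon (k,l,m,n)) = opow opU (- n) * (opG ^ m * (adj opG ^ l * opow opA (- k)))"
    by (simp add: mon_def adj_mult adj_opow adj_power mult.assoc)
  show "Poly_Mapping.lookup (app (adj (mon i) * mon i') v) (j,a,b) = Poly_Mapping.lookup (app (diag (\<lambda>j. poly (gram i i') (Qc ^ j))) v) (j,a,b)"
  proof (cases "int j < k")
    case True
    hence "wA (- k) j = 0" by (intro wA_zero) simp
    moreover from this have "poly (Apoly k) (Qc ^ j) = 0" using wA_Apoly[of k j] by simp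
    ultimately show ?thesis
      by (simp add: adjm i i' lookup_opow_U lookup_G_pow lookup_Gs_pow lookup_opow_A gram_def)
  next
    case False
    hence j: "nat (int (nat (int j - k)) + k) = j" by simp
    have im: "int m' = int l' - int l + int m" and kj: "k \<le> int j" using lm False by simp_all
    have w: "wA (- k) j * wA k (nat (int j - k)) = poly (Apoly k) (Qc ^ j)" by (rule wA_Apoly)
    have p: "phase powi (a * n) * phase powi (- (a * n)) = 1" by (simp add: power_int_minus)
    have e: "m + l + (l' + m') = (m + l') + (m + l')" using lm by linarith
    have qs: "(complex_of_real q ^ j) ^ m * ((complex_of_real q ^ j) ^ l * (complex_of_real q ^ j) ^ (l' + m')) = (Qc ^ j) ^ (m + l')"
    proof -
      have "z ^ m * (z ^ l * z ^ (l' + m')) = (z * z) ^ (m + l')" for z :: complex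
      proof -
        have "z ^ m * (z ^ l * z ^ (l' + m')) = z ^ (m + l + (l' + m'))" by (simp add: power_add)
        thus ?thesis unfolding e by (simp add: power_add power_mult_distrib)
      qed
      moreover have "complex_of_real q ^ j * complex_of_real q ^ j = Qc ^ j"
        by (simp add: Q_def power2_eq_square power_mult_distrib)
      ultimately show ?thesis by simp
    qed
    have "Poly_Mapping.lookup (app (adj (mon i) * mon i') v) (j,a,b) =
        (phase powi (a * n) * phase powi (- (a * n))) *
        ((complex_of_real q ^ j) ^ m * ((complex_of_real q ^ j) ^ l * (complex_of_real q ^ j) ^ (l' + m'))) *
        (wA (- k) j * wA k (nat (int j - k))) * Poly_Mapping.lookup v (j, a, b)"
      using kj by (simp add: i adjm i' lookup_opow_U lookup_G_pow lookup_Gs_pow lookup_opow_A lookup_mon im mult_ac)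
    also have "\<dots> = Poly_Mapping.lookup (app (diag (\<lambda>j. poly (gram i i') (Qc ^ j))) v) (j,a,b)"
      unfolding p qs w by (simp add: i i' gram_def poly_monom mult_ac)
    finally show ?thesis .
  qed
qed

lemma mon_support:
  assumes "Poly_Mapping.lookup (app (mon i) (basis j 0 0)) (J, a, b) \<noteq> 0"
  shows "hdegree i = (int j - int J, a, b)"
proof -
  obtain k l m n where i: "i = (k,l,m,n)" by (cases i)
  have "wA k J \<noteq> 0" "nat (int J + k) = j" "a - int l + int m = 0" "b - n = 0"
    using assms by (auto simp: i lookup_mon lookup_single when_def split: if_splits)
  moreover from this have "int J + k \<ge> 0" using wA_zero[of J k] by force
  ultimately show ?thesis by (auto simp: i hdegree_def)
qed

lemma vnorm_single_support:
  assumes "\<And>i. Poly_Mapping.lookup v i \<noteq> 0 \<Longrightarrow> i = i0" "\<And>i. cmod (Poly_Mapping.lookup v i) \<le> B"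
  shows "vnorm v \<le> B"
proof -
  have "Poly_Mapping.keys v \<subseteq> {i0}" using assms(1) by (auto simp: in_keys_iff)
  hence "vnorm v = L2_set (\<lambda>i. cmod (Poly_Mapping.lookup v i)) {i0}" by (intro vnorm_sup) auto
  thus ?thesis using assms(2)[of i0] by simp
qed

text \<open>Split \<open>x\<close> into its homogeneous components. Each matrix coefficient of a component \<open>y\<close> is zero or a
  coefficient of \<open>x\<close>, and \<open>y*y\<close> is a polynomial in \<open>c\<close> of degree at most \<open>2D\<close>, bounded on the
  eigenvalues by \<open>B\<^sup>2\<close>. Interpolation costs one factor \<open>2D + 1\<close>, the number of components three more.\<close>

lemma upper_bound:
  assumes x: "x \<in> S_deg D" and B: "\<And>j a b j' a' b'. cmod (Poly_Mapping.lookup (app x (basis j a b)) (j', a', b')) \<le> B"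
  shows "N x \<le> (2 * real D + 1) ^ 4 * ((interp_const + 1) * B)"
proof -
  obtain p where p: "Poly_Mapping.keys p \<subseteq> nword ` {i. expdeg i \<le> D}" "x = ev p" using S_deg_repr[OF x] by blast
  define K where "K = Poly_Mapping.keys p"
  define c where "c = Poly_Mapping.lookup p"
  define h where "h w = hdegree (ix w)" for w
  define comp where "comp y = (\<Sum>w\<in>{w \<in> K. h w = y}. oscale (c w) (mon (ix w)))" for y
  have finK: "finite K" by (simp add: K_def)
  have degK: "expdeg (ix w) \<le> D" if "w \<in> K" for w using that p(1) nword_ix_deg by (auto simp: K_def)
  have xs: "x = (\<Sum>w\<in>K. oscale (c w) (mon (ix w)))"
    unfolding p(2) K_def c_def by (rule ev_nf_sum) (use p(1) in auto)
  also have "\<dots> = (\<Sum>y\<in>h ` K. comp y)"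
    unfolding comp_def by (rule sum.image_gen[OF finK])
  finally have xc: "x = (\<Sum>y\<in>h ` K. comp y)" .
  have compS: "comp y \<in> S" for y unfolding comp_def by (intro S_sum S_closed(4) mon_S)
  have B0: "0 \<le> B" using B[of 0 0 0 0 0 0] norm_ge_zero order_trans by blast
  have cB: "N (comp y) \<le> (interp_const + 1) * (2 * real D + 1) * B" for y
  proof -
    define Ky where "Ky = {w \<in> K. h w = y}"
    define P where "P = (\<Sum>w\<in>Ky. \<Sum>w'\<in>Ky. Polynomial.smult (cnj (c w) * c w') (gram (ix w) (ix w')))"
    have finKy: "finite Ky" using finK by (simp add: Ky_def)
    have dP: "degree P \<le> 2 * D" unfolding P_def
      by (intro degree_sum_le finKy order_trans[OF degree_smult_le gram_degree] degK) (auto simp: Ky_def)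
    have gram: "adj (comp y) * comp y = diag (\<lambda>j. poly P (Qc ^ j))"
    proof -
      have "adj (comp y) * comp y = (\<Sum>w\<in>Ky. \<Sum>w'\<in>Ky. oscale (cnj (c w) * c w') (adj (mon (ix w)) * mon (ix w')))"
        unfolding comp_def Ky_def[symmetric] by (simp add: adj_sum adj_scale sum_product mult.commute[of "c _"])
      also have "\<dots> = (\<Sum>w\<in>Ky. \<Sum>w'\<in>Ky. diag (\<lambda>j. cnj (c w) * c w' * poly (gram (ix w) (ix w')) (Qc ^ j)))"
      proof (intro sum.cong refl)
        fix w w' assume "w \<in> Ky" "w' \<in> Ky"
        hence "hdegree (ix w) = hdegree (ix w')" by (simp add: Ky_def h_def)
        thus "oscale (cnj (c w) * c w') (adj (mon (ix w)) * mon (ix w')) = diag (\<lambda>j. cnj (c w) * c w' * poly (gram (ix w) (ix w')) (Qc ^ j))"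
          by (simp add: mon_gram diag_scale)
      qed
      also have "\<dots> = diag (\<lambda>j. poly P (Qc ^ j))"
        using finKy by (simp add: diag_sum P_def poly_sum)
      finally show ?thesis .
    qed
    obtain k d n where y: "y = (k, d, n)" by (cases y)
    \<comment> \<open>A homogeneous element takes a basis vector to a multiple of a single basis vector, and \<open>P\<close> at \<open>Q\<^sup>j\<close> is the square of the norm of the image.\<close>
    have PB: "cmod (poly P (Qc ^ j)) \<le> B\<^sup>2" for j
    proof -
      let ?v = "app (comp y) (basis j 0 0)"
      have lk: "Poly_Mapping.lookup ?v (J, a, b) = (if y = (int j - int J, a, b) then Poly_Mapping.lookup (app x (basis j 0 0)) (J, a, b) else 0)" for J a b
      proof -
        have t: "Poly_Mapping.lookup (app (oscale (c w) (mon (ix w))) (basis j 0 0)) (J, a, b) = 0" if "h w \<noteq> (int j - int J, a, b)" for w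
          using mon_support[of "ix w" j J a b] that by (auto simp: h_def lookup_map_times)
        show ?thesis
        proof (cases "y = (int j - int J, a, b)")
          case True
          have "Poly_Mapping.lookup (app x (basis j 0 0)) (J, a, b) = (\<Sum>w\<in>K. Poly_Mapping.lookup (app (oscale (c w) (mon (ix w))) (basis j 0 0)) (J, a, b))"
            unfolding xs by (simp only: lookup_app_sum)
          also have "\<dots> = (\<Sum>w\<in>Ky. Poly_Mapping.lookup (app (oscale (c w) (mon (ix w))) (basis j 0 0)) (J, a, b))"
            by (rule sum.mono_neutral_right[OF finK]) (use t True in \<open>auto simp: Ky_def\<close>)
          also have "\<dots> = Poly_Mapping.lookup ?v (J, a, b)"
            by (simp only: comp_def Ky_def[symmetric] lookup_app_sum)
          finally have l: "Poly_Mapping.lookup ?v (J, a, b) = Poly_Mapping.lookup (app x (basis j 0 0)) (J, a, b)" ..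
          show ?thesis unfolding l using True by (rule if_P[symmetric])
        next
          case False
          have "Poly_Mapping.lookup ?v (J, a, b) = (\<Sum>w\<in>Ky. Poly_Mapping.lookup (app (oscale (c w) (mon (ix w))) (basis j 0 0)) (J, a, b))"
            by (simp only: comp_def Ky_def[symmetric] lookup_app_sum)
          also have "\<dots> = 0" by (rule sum.neutral) (use t False in \<open>auto simp: Ky_def\<close>)
          finally show ?thesis using False by simp
        qed
      qed
      have "vnorm ?v \<le> B"
      proof (rule vnorm_single_support)
        fix i assume nz: "Poly_Mapping.lookup ?v i \<noteq> 0"
        obtain J a b where i: "i = (J, a, b)" by (cases i)
        have "y = (int j - int J, a, b)" using nz lk[of J a b] unfolding i by meson
        thus "i = (nat (int j - k), d, n)" by (simp add: y i)
      next
        fix i show "cmod (Poly_Mapping.lookup ?v i) \<le> B" using B B0 by (cases i) (auto simp: lk)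
      qed
      hence vB: "(vnorm ?v)\<^sup>2 \<le> B\<^sup>2" by (intro power_mono) auto
      have "poly P (Qc ^ j) = cinner (app (diag (\<lambda>j. poly P (Qc ^ j))) (basis j 0 0)) (basis j 0 0)"
        by (simp add: cinner_single_right)
      also have "\<dots> = cinner ?v ?v" unfolding gram[symmetric] by (simp add: app_adj)
      finally have "poly P (Qc ^ j) = complex_of_real ((vnorm ?v)\<^sup>2)" by (simp only: vnorm_sq)
      hence "cmod (poly P (Qc ^ j)) = (vnorm ?v)\<^sup>2" by (metis norm_of_real abs_power2)
      thus ?thesis using vB by simp
    qed
    have "(N (comp y))\<^sup>2 = N (diag (\<lambda>j. poly P (Qc ^ j)))" unfolding gram[symmetric] N_cstar[OF compS] ..
    also have "\<dots> \<le> interp_const * (real (2 * D) + 1) * B\<^sup>2" by (rule diag_poly(2)[OF dP PB])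
    also have "\<dots> \<le> ((interp_const + 1) * (2 * real D + 1))\<^sup>2 * B\<^sup>2"
    proof (rule mult_right_mono)
      have "1 \<le> (interp_const + 1) * (2 * real D + 1)" using interp_const_pos mult_mono[of 1 "interp_const + 1" 1 "2 * real D + 1"] by simp
      moreover have "interp_const * (real (2 * D) + 1) \<le> (interp_const + 1) * (2 * real D + 1)" by (simp add: distrib_right)
      moreover have "z \<le> z\<^sup>2" if "1 \<le> z" for z :: real using that by (simp add: power2_eq_square)
      ultimately show "interp_const * (real (2 * D) + 1) \<le> ((interp_const + 1) * (2 * real D + 1))\<^sup>2" by (meson order_trans)
    qed simp
    also have "\<dots> = ((interp_const + 1) * (2 * real D + 1) * B)\<^sup>2" by (simp only: power_mult_distrib)
    finally show ?thesis by (rule power2_le_imp_le) (use interp_const_pos B0 in simp)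
  qed
  have "h ` K \<subseteq> {- int D..int D} \<times> {- int D..int D} \<times> {- int D..int D}"
  proof
    fix y assume "y \<in> h ` K"
    then obtain w where w: "w \<in> K" "y = hdegree (ix w)" by (auto simp: h_def)
    obtain k l m n where i: "ix w = (k,l,m,n)" by (cases "ix w")
    have "nat \<bar>k\<bar> + l + m + nat \<bar>n\<bar> \<le> D" using degK[OF w(1)] by (simp add: i expdeg_def)
    thus "y \<in> {- int D..int D} \<times> {- int D..int D} \<times> {- int D..int D}" by (auto simp: w(2) i hdegree_def)
  qed
  hence "card (h ` K) \<le> card ({- int D..int D} \<times> {- int D..int D} \<times> {- int D..int D})"
    by (intro card_mono) auto
  also have "\<dots> = (2 * D + 1) * ((2 * D + 1) * (2 * D + 1))"
  proof -
    have "nat (int D - (- int D) + 1) = 2 * D + 1" by linarith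
    hence "card {- int D..int D} = 2 * D + 1" by (simp only: card_atLeastAtMost_int)
    thus ?thesis by (simp only: card_cartesian_product)
  qed
  finally have "real (card (h ` K)) \<le> real ((2 * D + 1) * ((2 * D + 1) * (2 * D + 1)))" by (simp only: of_nat_le_iff)
  hence card: "real (card (h ` K)) \<le> (2 * real D + 1) ^ 3" by (simp add: power3_eq_cube algebra_simps)
  have "N x \<le> (\<Sum>y\<in>h ` K. N (comp y))" unfolding xc using finK by (intro N_sum compS) auto
  also have "\<dots> \<le> (\<Sum>y\<in>h ` K. (interp_const + 1) * (2 * real D + 1) * B)" by (intro sum_mono cB)
  also have "\<dots> = real (card (h ` K)) * ((interp_const + 1) * (2 * real D + 1) * B)" by simp
  also have "\<dots> \<le> (2 * real D + 1) ^ 3 * ((interp_const + 1) * (2 * real D + 1) * B)"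
    using interp_const_pos B0 by (intro mult_right_mono card) simp
  finally show ?thesis by (simp add: power_numeral_reduce mult_ac)
qed

end

section \<open>Uniqueness of the C*-norm\<close>

context crossed
begin

text \<open>The two bounds give \<open>N1 z \<le> C (2D + 1)\<^sup>4 N2 z\<close> for \<open>z\<close> of degree \<open>D\<close>. For the powers of \<open>x*x\<close> with exponent
  \<open>2\<^sup>k\<close>, whose degrees grow linearly in the exponent, the polynomial factor disappears
  in the limit.\<close>

lemma cstar_norm_le:
  assumes theta: "\<theta> \<notin> \<rat>" and N1: "cstar_norm (op_algebra S) N1" and N2: "cstar_norm (op_algebra S) N2" and x: "x \<in> S"
  shows "N1 x \<le> N2 x"
proof -
  interpret n1: crossed_norm q \<theta> N1 using theta N1 by unfold_locales
  interpret n2: crossed_norm q \<theta> N2 using theta N2 by unfold_locales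
  define C where "C = (n1.interp_const + 1) / (euler * n2.\<beta>)"
  have C: "0 \<le> C" using n1.interp_const_pos euler_pos n2.beta_pos by (simp add: C_def)
  have le: "N1 z \<le> C * (2 * real D + 1) ^ 4 * N2 z" if z: "z \<in> S_deg D" for z D
    using n1.upper_bound[OF z n2.coeff_bound[OF S_deg_S[OF z]]] by (simp add: C_def field_simps)
  let ?y = "adj x * x"
  have y: "?y \<in> S" "adj ?y = ?y" using x by (auto intro: S_closed simp: adj_mult)
  obtain D where D: "?y \<in> S_deg D" using S_deg_exhaust[OF y(1)] by blast
  have "N1 ?y \<le> N2 ?y"
  proof (rule power_growth_le)
    fix k
    let ?n = "2 ^ k :: nat"
    have "N1 ?y ^ ?n = N1 (?y ^ ?n)" by (rule n1.selfadj_power[OF y, symmetric])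
    also have "\<dots> \<le> C * (2 * real (?n * D) + 1) ^ 4 * N2 (?y ^ ?n)" by (rule le[OF S_deg_power[OF D]])
    also have "N2 (?y ^ ?n) = N2 ?y ^ ?n" by (rule n2.selfadj_power[OF y])
    also have "C * (2 * real (?n * D) + 1) ^ 4 * N2 ?y ^ ?n \<le> (C * (2 * real D + 1) ^ 4) * (real ?n + 1) ^ 4 * N2 ?y ^ ?n"
    proof (rule mult_right_mono)
      have "2 * real (?n * D) + 1 \<le> (2 * real D + 1) * (real ?n + 1)" by (simp add: algebra_simps)
      hence "(2 * real (?n * D) + 1) ^ 4 \<le> ((2 * real D + 1) * (real ?n + 1)) ^ 4" by (intro power_mono) auto
      thus "C * (2 * real (?n * D) + 1) ^ 4 \<le> C * (2 * real D + 1) ^ 4 * (real ?n + 1) ^ 4"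
        using C by (simp add: power_mult_distrib mult_left_mono mult.assoc)
    qed (use n2.N_nonneg[OF y(1)] in simp)
    finally show "N1 ?y ^ ?n \<le> (C * (2 * real D + 1) ^ 4) * (real ?n + 1) ^ 4 * N2 ?y ^ ?n" .
  qed (use n1.N_nonneg[OF y(1)] n2.N_nonneg[OF y(1)] in auto)
  hence "(N1 x)\<^sup>2 \<le> (N2 x)\<^sup>2" using n1.N_cstar[OF x] n2.N_cstar[OF x] by simp
  thus ?thesis by (rule power2_le_imp_le) (rule n2.N_nonneg[OF x])
qed

lemma cstar_norm_pullback:
  assumes "cstar_norm (op_algebra S) N"
  shows "cstar_norm A (\<lambda>X. N (rep X))"
proof -
  have r: "X \<in> carrier A \<Longrightarrow> rep X \<in> S" for X using rep_image by blast
  show ?thesis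
    using assms r unfolding cstar_norm_def algebra_norm_def
    by (simp add: rep_simps rep_zero_iff)
qed

lemma cstar_norm_pushforward:
  assumes "cstar_norm A N"
  shows "cstar_norm (op_algebra S) (\<lambda>x. N (inv_into (carrier A) rep x))"
proof -
  let ?i = "inv_into (carrier A) rep"
  have ic: "?i x \<in> carrier A" "rep (?i x) = x" if "x \<in> S" for x
    using that by (auto simp: rep_image[symmetric] inv_into_into f_inv_into_f)
  have iu: "?i x = X" if "rep X = x" "X \<in> carrier A" for x X
    using that rep_inj inv_into_f_f by fastforce
  have i: "?i (x * y) = ?i x \<cdot> ?i y" "?i (x + y) = ?i x \<oplus>\<^bsub>A\<^esub> ?i y" "?i (oscale c x) = c \<odot>\<^bsub>A\<^esub> ?i x" "?i (adj x) = (?i x)\<^sup>\<star>\<^bsub>A\<^esub>"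
    if "x \<in> S" "y \<in> S" for x y c
    by (rule iu; use ic that in \<open>simp add: rep_simps\<close>)+
  have z: "?i x = \<zero>\<^bsub>A\<^esub> \<longleftrightarrow> x = 0" if "x \<in> S" for x
    using rep_zero_iff[OF ic(1)[OF that]] ic(2)[OF that] by simp
  show ?thesis
    using assms ic i z S_closed unfolding cstar_norm_def algebra_norm_def by simp
qed

theorem unique_cstar_norm:
  assumes "\<theta> \<notin> \<rat>"
  shows "\<exists>N. cstar_norm A N \<and> (\<forall>N'. cstar_norm A N' \<longrightarrow> (\<forall>X\<in>carrier A. N' X = N X))"
proof (intro exI conjI allI impI ballI)
  show "cstar_norm A (\<lambda>X. opnorm (rep X))" by (rule cstar_norm_pullback[OF opnorm_S])
  fix N' X assume N': "cstar_norm A N'" and X: "X \<in> carrier A"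
  have rX: "rep X \<in> S" using rep_image X by blast
  have "N' (inv_into (carrier A) rep (rep X)) = opnorm (rep X)"
    by (rule antisym) (rule cstar_norm_le[OF assms _ _ rX], rule cstar_norm_pushforward[OF N'] opnorm_S, rule opnorm_S cstar_norm_pushforward[OF N'])+
  thus "N' X = opnorm (rep X)" using inv_into_f_f[OF rep_inj X] by simp
qed

end

section \<open>The comultiplication\<close>

context crossed
begin

sublocale TP: tensor_pair A A
  by (intro tensor_pair.intro) (rule A.complex_star_algebra_axioms)+

abbreviation T where "T \<equiv> tensor_algebra A A"
abbreviation pt where "pt \<equiv> pure_tensor A A"
abbreviation qc :: complex where "qc \<equiv> complex_of_real q"
abbreviation gc where "gc \<equiv> ga \<cdot> gas"

lemma gens_closed [simp]: "al \<in> carrier A" "ga \<in> carrier A" "un \<in> carrier A"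
  "als \<in> carrier A" "gas \<in> carrier A" "uns \<in> carrier A"
  by (auto intro: A.gen_closed)

lemma solve_sum: "x \<oplus>\<^bsub>A\<^esub> s \<odot>\<^bsub>A\<^esub> y = z \<Longrightarrow> x \<in> carrier A \<Longrightarrow> y \<in> carrier A \<Longrightarrow> x = z \<oplus>\<^bsub>A\<^esub> (- s) \<odot>\<^bsub>A\<^esub> y"
proof -
  assume e: "x \<oplus>\<^bsub>A\<^esub> s \<odot>\<^bsub>A\<^esub> y = z" and c: "x \<in> carrier A" "y \<in> carrier A"
  have "s \<odot>\<^bsub>A\<^esub> y \<oplus>\<^bsub>A\<^esub> (- s) \<odot>\<^bsub>A\<^esub> y = \<zero>\<^bsub>A\<^esub>" using c by (simp add: A.scale_add_left[symmetric])
  thus ?thesis unfolding e[symmetric] using c by (simp add: A.a_assoc)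
qed

text \<open>The relations oriented towards words with the letters for \<open>\<gamma>\<close> before \<open>\<alpha>\<close> and after \<open>\<alpha>*\<close>.\<close>

lemma rewrite_relations:
  "gas \<cdot> ga = gc"
  "al \<cdot> gas = qc \<odot>\<^bsub>A\<^esub> (gas \<cdot> al)"
  "al \<cdot> ga = qc \<odot>\<^bsub>A\<^esub> (ga \<cdot> al)"
  "als \<cdot> al = \<one>\<^bsub>A\<^esub> \<oplus>\<^bsub>A\<^esub> (- 1) \<odot>\<^bsub>A\<^esub> gc"
  "al \<cdot> als = \<one>\<^bsub>A\<^esub> \<oplus>\<^bsub>A\<^esub> (- (qc * qc)) \<odot>\<^bsub>A\<^esub> gc"
  "gas \<cdot> als = qc \<odot>\<^bsub>A\<^esub> (als \<cdot> gas)"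
  "ga \<cdot> als = qc \<odot>\<^bsub>A\<^esub> (als \<cdot> ga)"
proof -
  note r = relations
  show g: "gas \<cdot> ga = gc" by (rule r(1))
  show a: "al \<cdot> gas = qc \<odot>\<^bsub>A\<^esub> (gas \<cdot> al)" by (rule r(2)[symmetric])
  show b: "al \<cdot> ga = qc \<odot>\<^bsub>A\<^esub> (ga \<cdot> al)" by (rule r(3)[symmetric])
  show "als \<cdot> al = \<one>\<^bsub>A\<^esub> \<oplus>\<^bsub>A\<^esub> (- 1) \<odot>\<^bsub>A\<^esub> gc"
    by (rule solve_sum) (use r(4) in \<open>simp_all add: g\<close>)
  show "al \<cdot> als = \<one>\<^bsub>A\<^esub> \<oplus>\<^bsub>A\<^esub> (- (qc * qc)) \<odot>\<^bsub>A\<^esub> gc"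
    by (rule solve_sum) (use r(5) in \<open>simp_all add: power2_eq_square\<close>)
  have "(al \<cdot> ga)\<^sup>\<star>\<^bsub>A\<^esub> = (qc \<odot>\<^bsub>A\<^esub> (ga \<cdot> al))\<^sup>\<star>\<^bsub>A\<^esub>" unfolding b ..
  thus "gas \<cdot> als = qc \<odot>\<^bsub>A\<^esub> (als \<cdot> gas)" by (simp add: A.star_mult A.star_smult)
  have "(al \<cdot> gas)\<^sup>\<star>\<^bsub>A\<^esub> = (qc \<odot>\<^bsub>A\<^esub> (gas \<cdot> al))\<^sup>\<star>\<^bsub>A\<^esub>" unfolding a ..
  thus "ga \<cdot> als = qc \<odot>\<^bsub>A\<^esub> (als \<cdot> ga)" by (simp add: A.star_mult A.star_smult)
qed

text \<open>The images of the generators. They satisfy the defining relations in the tensor square; this is what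
  the lemmas that follow check, one relation at a time.\<close>

definition "dA = pt al al \<oplus>\<^bsub>T\<^esub> pt ((- qc) \<odot>\<^bsub>A\<^esub> gas) ga"
definition "dG = pt ga al \<oplus>\<^bsub>T\<^esub> pt als ga"
definition "dU = pt un un"

lemma comult_gen_simps: "comult_gen q \<theta> Alpha = dA" "comult_gen q \<theta> Gamma = dG" "comult_gen q \<theta> Unitary = dU"
proof -
  show "comult_gen q \<theta> Alpha = dA"
    by (simp add: comult_gen_def Let_def gA_presented dA_def TP.T.minus_eq_scale TP.pt_scale TP.T.scale_scale)
  show "comult_gen q \<theta> Gamma = dG" "comult_gen q \<theta> Unitary = dU"
    by (simp_all add: comult_gen_def Let_def gA_presented dG_def dU_def)
qed

lemma d_closed [simp]: "dA \<in> carrier T" "dG \<in> carrier T" "dU \<in> carrier T"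
  by (simp_all add: dA_def dG_def dU_def)

lemma d_star: "dA\<^sup>\<star>\<^bsub>T\<^esub> = pt als als \<oplus>\<^bsub>T\<^esub> pt ((- qc) \<odot>\<^bsub>A\<^esub> ga) gas"
  "dG\<^sup>\<star>\<^bsub>T\<^esub> = pt gas als \<oplus>\<^bsub>T\<^esub> pt al gas" "dU\<^sup>\<star>\<^bsub>T\<^esub> = pt uns uns"
  by (simp_all add: dA_def dG_def dU_def TP.T.star_add TP.pt_star A.star_smult)

lemmas tensor_expand = TP.pt_add_left TP.pt_add_right TP.pt_scale TP.T.scale_add_right TP.T.scale_scale
  A.smult_mult_left A.smult_mult_right rewrite_relations A.scale_scale

lemma d_rel1: "dG\<^sup>\<star>\<^bsub>T\<^esub> \<otimes>\<^bsub>T\<^esub> dG = dG \<otimes>\<^bsub>T\<^esub> dG\<^sup>\<star>\<^bsub>T\<^esub>"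
  unfolding d_star unfolding dG_def
  by (simp only: TP.product_of_sums gens_closed) (simp add: tensor_expand TP.T.a_ac)

lemma d_rel2: "qc \<odot>\<^bsub>T\<^esub> (dG\<^sup>\<star>\<^bsub>T\<^esub> \<otimes>\<^bsub>T\<^esub> dA) = dA \<otimes>\<^bsub>T\<^esub> dG\<^sup>\<star>\<^bsub>T\<^esub>"
  unfolding d_star unfolding dA_def
  by (simp only: TP.product_of_sums gens_closed A.scale_closed) (simp add: tensor_expand TP.T.a_ac mult_ac)

lemma d_rel3: "qc \<odot>\<^bsub>T\<^esub> (dG \<otimes>\<^bsub>T\<^esub> dA) = dA \<otimes>\<^bsub>T\<^esub> dG"
  unfolding dG_def dA_def
  by (simp only: TP.product_of_sums gens_closed A.scale_closed) (simp add: tensor_expand TP.T.a_ac mult_ac)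

text \<open>The cross terms cancel because \<open>\<gamma>\<close> and \<open>\<gamma>*\<close> commute with \<open>\<alpha>\<close> and \<open>\<alpha>*\<close> up to the same scalar \<open>q\<close>; the diagonal
  terms collapse by the relation in the first leg and then in the second.\<close>

lemma d_rel4: "dA\<^sup>\<star>\<^bsub>T\<^esub> \<otimes>\<^bsub>T\<^esub> dA \<oplus>\<^bsub>T\<^esub> dG\<^sup>\<star>\<^bsub>T\<^esub> \<otimes>\<^bsub>T\<^esub> dG = \<one>\<^bsub>T\<^esub>"
proof -
  have "dA\<^sup>\<star>\<^bsub>T\<^esub> \<otimes>\<^bsub>T\<^esub> dA \<oplus>\<^bsub>T\<^esub> dG\<^sup>\<star>\<^bsub>T\<^esub> \<otimes>\<^bsub>T\<^esub> dG =
    (pt (als \<cdot> al) (als \<cdot> al) \<oplus>\<^bsub>T\<^esub> pt (als \<cdot> ((- qc) \<odot>\<^bsub>A\<^esub> gas)) (als \<cdot> ga) \<oplus>\<^bsub>T\<^esub>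
      (pt (((- qc) \<odot>\<^bsub>A\<^esub> ga) \<cdot> al) (gas \<cdot> al) \<oplus>\<^bsub>T\<^esub> pt (((- qc) \<odot>\<^bsub>A\<^esub> ga) \<cdot> ((- qc) \<odot>\<^bsub>A\<^esub> gas)) (gas \<cdot> ga))) \<oplus>\<^bsub>T\<^esub>
    (pt (gas \<cdot> ga) (als \<cdot> al) \<oplus>\<^bsub>T\<^esub> pt (gas \<cdot> als) (als \<cdot> ga) \<oplus>\<^bsub>T\<^esub>
      (pt (al \<cdot> ga) (gas \<cdot> al) \<oplus>\<^bsub>T\<^esub> pt (al \<cdot> als) (gas \<cdot> ga)))"
    unfolding d_star unfolding dA_def dG_def by (subst (1 2) TP.product_of_sums) auto
  also have "\<dots> = (pt (als \<cdot> al) (als \<cdot> al) \<oplus>\<^bsub>T\<^esub> pt (gas \<cdot> ga) (als \<cdot> al)) \<oplus>\<^bsub>T\<^esub>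
      (pt (((- qc) \<odot>\<^bsub>A\<^esub> ga) \<cdot> ((- qc) \<odot>\<^bsub>A\<^esub> gas)) (gas \<cdot> ga) \<oplus>\<^bsub>T\<^esub> pt (al \<cdot> als) (gas \<cdot> ga))"
    by (rule TP.T.sum_cancel)
      (simp_all add: A.smult_mult_left A.smult_mult_right rewrite_relations(2,3,6,7) TP.pt_scale TP.T.scale_cancel)
  also have "\<dots> = pt \<one>\<^bsub>A\<^esub> (als \<cdot> al) \<oplus>\<^bsub>T\<^esub> pt \<one>\<^bsub>A\<^esub> (gas \<cdot> ga)"
  proof -
    have "((- qc) \<odot>\<^bsub>A\<^esub> ga) \<cdot> ((- qc) \<odot>\<^bsub>A\<^esub> gas) \<oplus>\<^bsub>A\<^esub> al \<cdot> als = \<one>\<^bsub>A\<^esub>"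
      using relations(5) by (simp add: A.smult_mult_left A.smult_mult_right A.scale_scale A.a_comm power2_eq_square)
    thus ?thesis using relations(4) by (simp add: TP.pt_add_left[symmetric])
  qed
  also have "\<dots> = \<one>\<^bsub>T\<^esub>" using relations(4) by (simp add: TP.pt_add_right[symmetric] TP.pt_one)
  finally show ?thesis .
qed

lemma d_rel5: "dA \<otimes>\<^bsub>T\<^esub> dA\<^sup>\<star>\<^bsub>T\<^esub> \<oplus>\<^bsub>T\<^esub> qc\<^sup>2 \<odot>\<^bsub>T\<^esub> (dG \<otimes>\<^bsub>T\<^esub> dG\<^sup>\<star>\<^bsub>T\<^esub>) = \<one>\<^bsub>T\<^esub>"
proof -
  have "dA \<otimes>\<^bsub>T\<^esub> dA\<^sup>\<star>\<^bsub>T\<^esub> \<oplus>\<^bsub>T\<^esub> qc\<^sup>2 \<odot>\<^bsub>T\<^esub> (dG \<otimes>\<^bsub>T\<^esub> dG\<^sup>\<star>\<^bsub>T\<^esub>) =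
    (pt (al \<cdot> als) (al \<cdot> als) \<oplus>\<^bsub>T\<^esub> pt (al \<cdot> ((- qc) \<odot>\<^bsub>A\<^esub> ga)) (al \<cdot> gas) \<oplus>\<^bsub>T\<^esub>
      (pt (((- qc) \<odot>\<^bsub>A\<^esub> gas) \<cdot> als) (ga \<cdot> als) \<oplus>\<^bsub>T\<^esub> pt (((- qc) \<odot>\<^bsub>A\<^esub> gas) \<cdot> ((- qc) \<odot>\<^bsub>A\<^esub> ga)) (ga \<cdot> gas))) \<oplus>\<^bsub>T\<^esub>
    (qc\<^sup>2 \<odot>\<^bsub>T\<^esub> pt (ga \<cdot> gas) (al \<cdot> als) \<oplus>\<^bsub>T\<^esub> qc\<^sup>2 \<odot>\<^bsub>T\<^esub> pt (ga \<cdot> al) (al \<cdot> gas) \<oplus>\<^bsub>T\<^esub>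
      (qc\<^sup>2 \<odot>\<^bsub>T\<^esub> pt (als \<cdot> gas) (ga \<cdot> als) \<oplus>\<^bsub>T\<^esub> qc\<^sup>2 \<odot>\<^bsub>T\<^esub> pt (als \<cdot> al) (ga \<cdot> gas)))"
    unfolding d_star unfolding dA_def dG_def
    by (subst (1 2) TP.product_of_sums) (auto simp: TP.T.scale_add_right)
  also have "\<dots> = (pt (al \<cdot> als) (al \<cdot> als) \<oplus>\<^bsub>T\<^esub> qc\<^sup>2 \<odot>\<^bsub>T\<^esub> pt (ga \<cdot> gas) (al \<cdot> als)) \<oplus>\<^bsub>T\<^esub>
      (pt (((- qc) \<odot>\<^bsub>A\<^esub> gas) \<cdot> ((- qc) \<odot>\<^bsub>A\<^esub> ga)) (ga \<cdot> gas) \<oplus>\<^bsub>T\<^esub> qc\<^sup>2 \<odot>\<^bsub>T\<^esub> pt (als \<cdot> al) (ga \<cdot> gas))"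
    by (rule TP.T.sum_cancel)
      (simp_all add: A.smult_mult_left A.smult_mult_right rewrite_relations(2,3,6,7) TP.pt_scale A.scale_scale
        TP.T.scale_scale TP.T.scale_cancel power2_eq_square mult.assoc)
  also have "\<dots> = pt \<one>\<^bsub>A\<^esub> (al \<cdot> als) \<oplus>\<^bsub>T\<^esub> pt \<one>\<^bsub>A\<^esub> (qc\<^sup>2 \<odot>\<^bsub>A\<^esub> (ga \<cdot> gas))"
  proof -
    have "pt (al \<cdot> als) (al \<cdot> als) \<oplus>\<^bsub>T\<^esub> qc\<^sup>2 \<odot>\<^bsub>T\<^esub> pt (ga \<cdot> gas) (al \<cdot> als) = pt \<one>\<^bsub>A\<^esub> (al \<cdot> als)"
      using relations(5) by (simp add: TP.pt_add_left[symmetric] TP.pt_scale(1)[symmetric])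
    moreover have "pt (((- qc) \<odot>\<^bsub>A\<^esub> gas) \<cdot> ((- qc) \<odot>\<^bsub>A\<^esub> ga)) (ga \<cdot> gas) \<oplus>\<^bsub>T\<^esub> qc\<^sup>2 \<odot>\<^bsub>T\<^esub> pt (als \<cdot> al) (ga \<cdot> gas)
       = pt \<one>\<^bsub>A\<^esub> (qc\<^sup>2 \<odot>\<^bsub>A\<^esub> (ga \<cdot> gas))"
    proof -
      have "((- qc) \<odot>\<^bsub>A\<^esub> gas) \<cdot> ((- qc) \<odot>\<^bsub>A\<^esub> ga) = qc\<^sup>2 \<odot>\<^bsub>A\<^esub> (gas \<cdot> ga)"
        by (simp add: A.smult_mult_left A.smult_mult_right A.scale_scale power2_eq_square)
      moreover have "gas \<cdot> ga \<oplus>\<^bsub>A\<^esub> als \<cdot> al = \<one>\<^bsub>A\<^esub>" using relations(4) by (simp add: A.a_comm)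
      ultimately show ?thesis
        by (simp add: TP.pt_scale TP.T.scale_add_right[symmetric] TP.pt_add_left[symmetric])
    qed
    ultimately show ?thesis by simp
  qed
  also have "\<dots> = \<one>\<^bsub>T\<^esub>" using relations(5) by (simp add: TP.pt_add_right[symmetric] TP.pt_one)
  finally show ?thesis .
qed

lemma d_rel6: "dU\<^sup>\<star>\<^bsub>T\<^esub> \<otimes>\<^bsub>T\<^esub> dU = \<one>\<^bsub>T\<^esub>" "dU \<otimes>\<^bsub>T\<^esub> dU\<^sup>\<star>\<^bsub>T\<^esub> = \<one>\<^bsub>T\<^esub>"
  unfolding d_star unfolding dU_def by (simp_all add: TP.pt_mult relations TP.pt_one)

lemma conj_star: "uns \<cdot> als \<cdot> un = als" "uns \<cdot> gas \<cdot> un = cnj phase \<odot>\<^bsub>A\<^esub> gas"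
proof -
  have "(uns \<cdot> al \<cdot> un)\<^sup>\<star>\<^bsub>A\<^esub> = als" unfolding relations(9) ..
  thus "uns \<cdot> als \<cdot> un = als" by (simp add: A.star_mult A.m_assoc)
  have "(uns \<cdot> ga \<cdot> un)\<^sup>\<star>\<^bsub>A\<^esub> = (phase \<odot>\<^bsub>A\<^esub> ga)\<^sup>\<star>\<^bsub>A\<^esub>" unfolding relations(8) ..
  thus "uns \<cdot> gas \<cdot> un = cnj phase \<odot>\<^bsub>A\<^esub> gas" by (simp add: A.star_mult A.star_smult A.m_assoc)
qed

lemma d_rel8: "dU\<^sup>\<star>\<^bsub>T\<^esub> \<otimes>\<^bsub>T\<^esub> dG \<otimes>\<^bsub>T\<^esub> dU = phase \<odot>\<^bsub>T\<^esub> dG"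
  unfolding d_star unfolding dU_def dG_def
  by (simp add: TP.T.l_distr TP.T.r_distr TP.pt_mult relations(8,9) conj_star TP.pt_scale TP.T.scale_add_right)

lemma d_rel9: "dU\<^sup>\<star>\<^bsub>T\<^esub> \<otimes>\<^bsub>T\<^esub> dA \<otimes>\<^bsub>T\<^esub> dU = dA"
proof -
  have "phase * cnj phase = 1" using phase_norm complex_norm_square[of phase] by simp
  thus ?thesis
    unfolding d_star unfolding dU_def dA_def
    by (simp add: TP.T.l_distr TP.T.r_distr TP.pt_mult relations(8,9) conj_star TP.pt_scale
      A.smult_mult_left A.smult_mult_right TP.T.smult_mult_left TP.T.smult_mult_right TP.T.scale_scale mult_ac)
qed

sublocale D: star_algebra_gens T "comult_gen q \<theta>"
proof (intro star_algebra_gens.intro star_algebra_gens_axioms.intro TP.T.complex_star_algebra_axioms)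
  show "comult_gen q \<theta> g \<in> carrier T" for g by (cases g) (simp_all add: comult_gen_simps)
qed

text \<open>The comultiplication kills the relators, hence descends to the presented algebra. The universal
  evaluation would otherwise not be determined by the values on the generators, and nothing could be said
  about its value at \<open>u\<close>.\<close>

lemma comult_relations:
  assumes "p \<in> R"
  shows "free_eval T (comult_gen q \<theta>) p = \<zero>\<^bsub>T\<^esub>"
proof -
  note ev = star_homD(2-6)[OF D.free_eval_hom, simplified] D.free_eval_gen comult_gen_simps D.free_eval_minus
  have z: "x \<ominus>\<^bsub>T\<^esub> x = \<zero>\<^bsub>T\<^esub>" if "x \<in> carrier T" for x using that by (simp add: a_minus_def TP.T.r_neg)
  consider "p \<in> suq2_relators q" | "p \<in> rotation_relators \<theta>"
    using assms by (auto simp: crossed_relators_def)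
  thus ?thesis
  proof cases
    case 1
    thus ?thesis
      unfolding suq2_relators_def Let_def
      by (elim insertE; simp add: ev d_rel1 d_rel2 d_rel3 d_rel4[unfolded d_rel1] d_rel5 z)
  next
    case 2
    thus ?thesis
      unfolding rotation_relators_def Let_def phase_def[symmetric]
      by (elim insertE; simp add: ev d_rel6 d_rel8 d_rel9 z)
  qed
qed

definition Delta where "Delta = presented_eval T (comult_gen q \<theta>)"

lemma Delta_hom: "star_hom A T Delta"
  unfolding Delta_def by (rule D.presented_eval_hom) (rule comult_relations)

lemma Delta_un: "Delta un = pt un un"
  unfolding Delta_def gA_def using D.presented_eval_cls[OF comult_relations, of R "free_gen Unitary"]
  by (simp add: D.free_eval_gen comult_gen_simps dU_def gA_def)

section \<open>Powers of the unitary as corepresentations\<close>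

abbreviation "G \<equiv> SUq2_crossed q \<theta>"

lemma G_sel [simp]: "carrier G = carrier A" "monoid.mult G = monoid.mult A" "one G = one A" "zero G = zero A"
  "add G = add A" "module.smult G = module.smult A" "star G = star A" "comult G = Delta"
  by (simp_all add: SUq2_crossed_def Let_def star_algebra.extend_def quantum_group.fields_def Delta_def)

text \<open>The quantum group is the presented algebra with one more record field, so facts about the algebra
  transfer along the identity.\<close>

lemma star_algebra_G: "star_algebra G"
  by (rule star_algebra_image[where A = A and \<phi> = "\<lambda>x. x"])
    (use A.complex_star_algebra_axioms in \<open>simp_all add: star_algebra_iff star_hom_def\<close>)

sublocale G: complex_star_algebra G
  using star_algebra_G by (simp add: star_algebra_iff)

lemma cstar_norm_G: "cstar_norm G N \<longleftrightarrow> cstar_norm A N"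
  by (simp add: cstar_norm_def algebra_norm_def)

lemma c_star_unique_G: "\<theta> \<notin> \<rat> \<Longrightarrow> c_star_unique G"
  unfolding c_star_unique_def pre_c_star_norm_iff[OF star_algebra_G] cstar_norm_G
  using unique_cstar_norm by simp

lemma tensor_G: "tensor_algebra G G = T" "pure_tensor G G = pt"
proof -
  have p: "G \<times>\<times> G = A \<times>\<times> A" by (simp add: DirProd_def)
  have b: "bilinear_relators G G = bilinear_relators A A" by (simp add: bilinear_relators_def)
  show "tensor_algebra G G = T" "pure_tensor G G = pt"
    unfolding tensor_algebra_def tensor_null_def pure_tensor_def p b G_sel by (rule refl)+
qed

definition upow :: "nat \<Rightarrow> (generator word \<Rightarrow>\<^sub>0 complex) set" where
  "upow n = un [^]\<^bsub>A\<^esub> n"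

lemma upow_closed [simp]: "upow n \<in> carrier A" by (simp add: upow_def)
lemma upow_Suc: "upow (Suc n) = upow n \<cdot> un" by (simp add: upow_def)

lemma upow_unitary: "upow n \<cdot> (upow n)\<^sup>\<star>\<^bsub>A\<^esub> = \<one>\<^bsub>A\<^esub> \<and> (upow n)\<^sup>\<star>\<^bsub>A\<^esub> \<cdot> upow n = \<one>\<^bsub>A\<^esub>"
proof (induction n)
  case 0
  show ?case by (simp add: upow_def)
next
  case (Suc n)
  have "upow (Suc n) \<cdot> (upow (Suc n))\<^sup>\<star>\<^bsub>A\<^esub> = upow n \<cdot> (un \<cdot> uns) \<cdot> (upow n)\<^sup>\<star>\<^bsub>A\<^esub>"
    by (simp add: upow_Suc A.star_mult A.m_assoc)
  moreover have "(upow (Suc n))\<^sup>\<star>\<^bsub>A\<^esub> \<cdot> upow (Suc n) = uns \<cdot> ((upow n)\<^sup>\<star>\<^bsub>A\<^esub> \<cdot> upow n) \<cdot> un"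
    by (simp add: upow_Suc A.star_mult A.m_assoc)
  ultimately show ?case using Suc by (simp add: relations)
qed

lemma Delta_upow: "Delta (upow n) = pt (upow n) (upow n)"
proof (induction n)
  case 0
  show ?case using star_homD(2)[OF Delta_hom] by (simp add: upow_def TP.pt_one)
next
  case (Suc n)
  thus ?case using star_homD(3)[OF Delta_hom, of "upow n" un] by (simp add: upow_Suc Delta_un TP.pt_mult)
qed

lemma rep_upow: "rep (upow n) = opU ^ n"
proof (induction n)
  case 0
  show ?case by (simp add: upow_def rep_simps)
next
  case (Suc n)
  have "rep un = opU" by (simp add: gA_def rep_cls opr.free_eval_gen)
  thus ?case using Suc by (simp add: upow_Suc rep_simps power_Suc2 del: power_Suc)
qed

text \<open>In the representation, the powers of \<open>u\<close> translate the third coordinate by different amounts.\<close>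

lemma upow_inj: "upow m = upow n \<Longrightarrow> m = n"
proof -
  assume "upow m = upow n"
  hence "opU ^ m = opU ^ n" by (metis rep_upow)
  hence "Poly_Mapping.lookup (app (opU ^ m) (Poly_Mapping.single (0,0,0) 1)) (0,0,int m) =
    Poly_Mapping.lookup (app (opU ^ n) (Poly_Mapping.single (0,0,0) 1)) (0,0,int m)" by simp
  thus "m = n" by (simp add: lookup_U_pow lookup_single when_def split: if_splits)
qed

definition urep where "urep n = mat 1 1 (\<lambda>_. upow n)"

lemma urep_simps [simp]: "urep n \<in> carrier_mat 1 1" "dim_row (urep n) = 1" "dim_col (urep n) = 1" "urep n $$ (0, 0) = upow n"
  by (simp_all add: urep_def)

lemma G_sum_one [simp]: "f 0 \<in> carrier A \<Longrightarrow> (\<Oplus>\<^bsub>G\<^esub>k\<in>{..<Suc 0}. f k) = f 0"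
  using G.finsum_one[of f] by simp

lemma unitary_urep: "unitary_rep G (urep n)"
  unfolding unitary_rep_def tensor_G
  by (rule exI[of _ 1]) (use upow_unitary[of n] TP.T.finsum_one[of "\<lambda>k. pt (urep n $$ (0, k)) (urep n $$ (k, 0))"] urep_simps(1)[of n] in \<open>simp add: Delta_upow\<close>)

lemma identity_intertwiner: "1\<^sub>m 1 \<in> intertwiners G (urep n) (urep n)"
  unfolding intertwiners_def by simp

text \<open>An intertwiner is a scalar \<open>s\<close> with \<open>s u\<^sup>m = s u\<^sup>n\<close>; if it is invertible, the powers agree.\<close>

lemma rep_equiv_urep: "rep_equiv G (urep m) (urep n) \<longleftrightarrow> m = n"
proof
  assume "rep_equiv G (urep m) (urep n)"
  then obtain M where M: "M \<in> intertwiners G (urep m) (urep n)" "invertible_mat M" by (auto simp: rep_equiv_def)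
  have dM: "M \<in> carrier_mat 1 1" and e: "M $$ (0,0) \<odot>\<^bsub>A\<^esub> upow m = M $$ (0,0) \<odot>\<^bsub>A\<^esub> upow n"
    using M(1) by (simp_all add: intertwiners_def)
  obtain M' where M': "inverts_mat M M'" "inverts_mat M' M" using M(2) by (auto simp: invertible_mat_def)
  have "M $$ (0,0) \<noteq> 0"
  proof
    assume z: "M $$ (0,0) = 0"
    have "M' * M = 1\<^sub>m (dim_row M')" using M'(2) by (simp add: inverts_mat_def)
    hence d: "dim_row M' = 1" "M' * M = 1\<^sub>m 1" using dM by (metis carrier_matD(2) index_mult_mat(3) index_one_mat(3), metis carrier_matD(2) index_mult_mat(3) index_one_mat(3))
    have "M * M' = 1\<^sub>m 1" using M'(1) dM by (simp add: inverts_mat_def)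
    hence c: "dim_col M' = 1" by (metis index_mult_mat(3) index_one_mat(3))
    have "(M * M') $$ (0,0) = M $$ (0,0) * M' $$ (0,0)" using dM d c by (simp add: scalar_prod_def)
    thus False using z \<open>M * M' = 1\<^sub>m 1\<close> by simp
  qed
  hence "upow m = upow n" using arg_cong[OF e, of "\<lambda>x. inverse (M $$ (0,0)) \<odot>\<^bsub>A\<^esub> x"] by (simp add: A.scale_scale)
  thus "m = n" by (rule upow_inj)
next
  assume "m = n"
  moreover have "invertible_mat (1\<^sub>m 1 :: complex mat)"
    unfolding invertible_mat_def inverts_mat_def by (auto intro!: exI[of _ "1\<^sub>m 1"])
  ultimately show "rep_equiv G (urep m) (urep n)" using identity_intertwiner by (auto simp: rep_equiv_def)
qed

text \<open>A subrepresentation of dimension \<open>n\<close> is an isometry from \<open>\<complex>\<^sup>n\<close> to \<open>\<complex>\<close>, which forces \<open>n = 1\<close>.\<close>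

lemma irreducible_urep: "irreducible_rep G (urep n)"
  unfolding irreducible_rep_def
proof (intro conjI allI impI unitary_urep)
  fix V assume V: "unitary_rep G V \<and> subrep G V (urep n)"
  then obtain M where M: "M \<in> carrier_mat 1 (dim_row V)" "transpose_mat (map_mat cnj M) * M = 1\<^sub>m (dim_row V)"
    by (auto simp: subrep_def intertwiners_def)
  have pos: "0 < dim_row V" using V by (auto simp: unitary_rep_def)
  have ent: "cnj (M $$ (0,i)) * M $$ (0,j) = (if i = j then 1 else 0)" if "i < dim_row V" "j < dim_row V" for i j
  proof -
    have "(transpose_mat (map_mat cnj M) * M) $$ (i,j) = cnj (M $$ (0,i)) * M $$ (0,j)"
      using M(1) that by (simp add: scalar_prod_def)
    thus ?thesis unfolding M(2) using that by simp
  qed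
  have "\<not> 1 < dim_row V"
  proof
    assume "1 < dim_row V"
    hence "cnj (M $$ (0,0)) * M $$ (0,0) = 1" "cnj (M $$ (0,1)) * M $$ (0,1) = 1" "cnj (M $$ (0,0)) * M $$ (0,1) = 0"
      using ent[of 0 0] ent[of 1 1] ent[of 0 1] by auto
    thus False by auto
  qed
  thus "dim_row V = dim_row (urep n)" using pos by simp
qed

lemma tensor_urep: "tensor_rep G (urep m) (urep 1) = urep (Suc m)"
  by (rule eq_matI) (auto simp: tensor_rep_def urep_def upow_Suc upow_def)

lemma subrep_refl: "subrep G (urep n) (urep n)"
  unfolding subrep_def
  by (rule bexI[OF _ identity_intertwiner]) (rule eq_matI, auto simp: scalar_prod_def)

definition ucls where "ucls n = irr_equiv G `` {urep n}"

lemma urep_mem_ucls: "urep m \<in> ucls n \<longleftrightarrow> m = n"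
  by (auto simp: ucls_def irr_equiv_def irreducible_urep rep_equiv_urep)

text \<open>The class of \<open>u\<close> generates the classes of all its positive powers, by tensoring with \<open>u\<close>
  repeatedly.\<close>

lemma not_locally_finite_G: "\<not> locally_finite G"
proof
  assume lf: "locally_finite G"
  have "{ucls 1} \<subseteq> Irr G" unfolding Irr_def ucls_def by (auto intro!: quotientI irreducible_urep)
  hence fin: "finite (fusion_generated G {ucls 1})" using lf by (simp add: locally_finite_def)
  have "ucls (Suc n) \<in> F" if F: "{ucls 1} \<subseteq> F" "fusion_closed G F" for n F
  proof (induction n)
    case 0
    show ?case using F by simp
  next
    case (Suc n)
    have sub: "irreducible_rep G (urep (Suc (Suc n))) \<and> subrep G (urep (Suc (Suc n))) (tensor_rep G (urep (Suc n)) (urep 1))"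
      using irreducible_urep subrep_refl by (simp only: tensor_urep)
    have mem: "urep (Suc n) \<in> ucls (Suc n)" "urep 1 \<in> ucls 1" by (simp_all add: urep_mem_ucls)
    have one: "ucls 1 \<in> F" using F(1) by simp
    have closed: "\<forall>x\<in>F. \<forall>y\<in>F. \<forall>U\<in>x. \<forall>V\<in>y. \<forall>W. irreducible_rep G W \<and> subrep G W (tensor_rep G U V) \<longrightarrow>
        irr_equiv G `` {W} \<in> F"
      by (rule F(2)[unfolded fusion_closed_def, THEN conjunct2, THEN conjunct2])
    show ?case
      unfolding ucls_def[of "Suc (Suc n)"] by (rule closed[rule_format, OF Suc one mem sub])
  qed
  hence "range (\<lambda>n. ucls (Suc n)) \<subseteq> fusion_generated G {ucls 1}" unfolding fusion_generated_def by blast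
  moreover have "inj (\<lambda>n. ucls (Suc n))"
    by (rule injI) (metis urep_mem_ucls nat.inject)
  ultimately show False using fin finite_subset range_inj_infinite by blast
qed

end

theorem theorem4p7:
  fixes q \<theta> :: real
  assumes "-1 < q" and "q < 1" and "q \<noteq> 0"
    and "0 < \<theta>" and "\<theta> < 1" and "\<theta> \<notin> \<rat>"
  shows "c_star_unique (SUq2_crossed q \<theta>) \<and> \<not> locally_finite (SUq2_crossed q \<theta>)"
proof -
  interpret crossed q \<theta> using assms by unfold_locales
  show ?thesis using c_star_unique_G[OF assms(6)] not_locally_finite_G by blast
qed

end
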